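(* Suppose that for fixed positive constants $C_1,C_3,C_4,C_5,\sigma_1,\sigma_2$: (a) $C_3\le\lambda_{\min}(\Omega^* )$ and $\lambda_{\max}(\Omega^* )\le C_4$; (b) $Y_0-X_0^{\top}\bar\beta$ is sub-gaussian with sub-gaussian norm bounded by $\sigma_2$, and $\mathbb{E}[(Y_0-X_0^{\top}\bar\beta)^2\mid X_0]\ge C_5$; (c) the entries of $\Omega^*X_0$ are sub-gaussian with sub-gaussian norm bounded by $\sigma_1$; (d) with probability at least $1-\delta_1(n)$, where $\delta_1(n)\to0$ as $n\to\infty$, $\|\hat\beta-\bar\beta\|_1\le C_1s_0\sqrt{\log(p\vee n)/n}$ and $\frac1n\sum_{i=1}^n(X_i^{\top}\hat\beta-X_i^{\top}\bar\beta)^2\le C_1s_0\log(p\vee n)/n$; (e) $\hat\Omega^J$ and $\hat\Omega^{J^c}$ are the cross-fitted two-stage estimators (defined in the context) with $\rho_n=A_0\lambda_n$ and a sufficiently large constant $A_0$. Let $$\widehat{\xi^{\top}\beta}=\xi^{\top}\hat\beta+\xi^{\top}\hat\Omega^{J^c}\frac1n\sum_{i\in J}X_i(Y_i-X_i^{\top}\hat\beta)+\xi^{\top}\hat\Omega^{J}\frac1n\sum_{i\in J^c}X_i(Y_i-X_i^{\top}\hat\beta),$$ $$\hat V=\frac1n\sum_{i\in J}(\xi^{\top}\hat\Omega^{J^c}X_i)^2(Y_i-X_i^{\top}\hat\beta)^2+\frac1n\sum_{i\in J^c}(\xi^{\top}\hat\Omega^{J}X_i)^2(Y_i-X_i^{\top}\hat\beta)^2,$$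 and $V=\mathbb{E}[(\xi^{\top}\Omega^*X_0)^2(Y_0-X_0^{\top}\bar\beta)^2]$. Consider $$\frac{\widehat{\xi^{\top}\beta}-\xi^{\top}\bar\beta}{\sqrt V}=\frac1n\sum_{i=1}^n\frac{(\xi^{\top}\Omega^*X_i)(Y_i-X_i^{\top}\bar\beta)}{\sqrt V}+o_p(n^{-1/2}),\qquad\frac{\hat V}{V}=1+o_p(1).\qquad(\ast)$$ (i) If further the entries of $X_0$ are sub-gaussian with sub-gaussian norm bounded by $\sigma_1$, and $\xi^{\top}\Omega^*X_0$ is sub-gaussian with sub-gaussian norm bounded by $\sigma_1\|\Omega^*\xi\|_2$, then $(\ast)$ holds provided $$\max\Big\{s_0,\ s_1\tfrac{\|\xi\|_1}{\|\xi\|_2},\ \min\{\sqrt{\|s_{1\xi}\|_0s_1},s_1\}\sqrt{s_0}\Big\}\tau_n=o(1).$$ (ii) If further $X_0$ is a sub-gaussian random vector with sub-gaussian norm bounded by $\sigma_1$, then $(\ast)$ holds provided $$\max\Big\{s_0,\ \min\{\sqrt{\|s_{1\xi}\|_0s_1},s_1\}\sqrt{s_0}\Big\}\tau_n=o(1).$$ Here $\tau_n=\log(p\vee n)/\sqrt n$ and $\lambda_n=\sqrt{\log(p\vee n)/n}$.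
   Context: Data: $(X_i,Y_i)$, $i=1,\dots,n$, are i.i.d. copies of $(X_0,Y_0)$ with $X_0\in\mathbb{R}^p$, $Y_0\in\mathbb{R}$. The linear model may be misspecified; the target is $\bar\beta=\arg\min_{\beta\in\mathbb{R}^p}\mathbb{E}[\frac12(Y_0-X_0^{\top}\beta)^2]$. $\Sigma=\mathbb{E}[X_0X_0^{\top}]$ (non-centered), $\Omega^*=\Sigma^{-1}$. $\xi\in\mathbb{R}^p$ is a given nonzero vector (loading), $S_\xi=\mathrm{supp}(\xi)$. $\hat\beta$ is an estimator of $\bar\beta$ computed from all $n$ observations. Cross-fitting: $J$ and $J^c$ are complementary subsets of $\{1,\dots,n\}$ with $|J|>\rho n$ and $|J^c|>\rho n$ for a constant $0<\rho<1$. Sparsity: $s_0=\|\bar\beta\|_0$, $s_{1j}=\|\Omega^*_{\cdot j}\|_0$, $s_1=\max_{1\le j\le p}s_{1j}$, $s_{1\xi}=(s_{1j}:j\in S_\xi)$, a vector (so $\|s_{1\xi}\|_0=|S_\xi|$). Two-stage estimator: let $\hat\Sigma_J=\frac1{|J|}\sum_{i\in J}X_iX_i^{\top}$. Stage 1: $\hat G^J$ is a minimizer over $G\in\mathbb{R}^{p\times p}$ of $\frac12\mathrm{Tr}(G^{\top}\hat\Sigma_JG)-\mathrm{Tr}(G)+\rho_n\|G\|_{L_1}$. Stage 2: $\hat\Omega^J$ is a minimizer of $\|\hat G^J-G\|_1$ over symmetric $G\in\mathbb{R}^{p\times p}$ subject to $\|\hat\Sigma_JG-I_p\|_{\max}\le\rho_n$.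 $\hat\Omega^{J^c}$ is defined in the same way with $J$ replaced by $J^c$. Norms: $\|A\|_{\max}$ is the maximum absolute entry; $\|A\|_{L_1}=\sum_{i,j}|A_{ij}|$; for a matrix $\|A\|_1$ is the maximum absolute column sum. $p\vee n=\max(p,n)$. A random variable $z$ has sub-gaussian norm $\|z\|_{\psi_2}=\inf\{t>0:\mathbb{E}\exp(z^2/t^2)\le2\}$; a random vector $Z$ has sub-gaussian norm $\sup_{s\ne0}\|\langle s,Z\rangle/\|s\|_2\|_{\psi_2}$. Asymptotics: $n\to\infty$, and $p$, $\xi$, $J$, the distribution of $(X_0,Y_0)$ and the sparsity quantities may vary with $n$, while the named constants (and $\rho$) are fixed; "sufficiently large constant" means exceeding a threshold depending only on those fixed constants. $X_k=o_p(a_k)$ means $\mathbb{P}(|X_k|>\epsilon|a_k|)\to0$ for every $\epsilon>0$.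
   Formalization: Part (ii) is proved for s_0 ≥ 1 (for large n): with s_0 = 0 its rate condition is void and the claim fails (Gaussian X_0 independent of Y_0, log p ≫ n). The threshold for A_0 is stated per type of sample space. Where a program has no minimizer, the estimator is arbitrary. *)

theory Defs
  imports
    "HOL-Probability.Probability"
    "HOL-Library.Landau_Symbols"
    "Jordan_Normal_Form.Spectral_Radius"
begin

(* The dimension p varies with n, so vectors and matrices are the carrier-based ones of
   Jordan_Normal_Form; the competing HOL-Analysis syntax is switched off.  Vector and
   matrix indices run over 0..<p. *)
unbundle no vec_syntax
unbundle no inner_syntax
hide_type (open) Finite_Cartesian_Product.vec
hide_const (open) Finite_Cartesian_Product.vec Finite_Cartesian_Product.mat
  Determinants.trace Finite_Cartesian_Product.row Finite_Cartesian_Product.column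

definition supp_vec :: "real vec \<Rightarrow> nat set" where
  "supp_vec v = {j. j < dim_vec v \<and> v $ j \<noteq> 0}"

definition l0_norm :: "real vec \<Rightarrow> nat" where
  "l0_norm v = card (supp_vec v)"

definition l1_norm :: "real vec \<Rightarrow> real" where
  "l1_norm v = (\<Sum>j<dim_vec v. \<bar>v $ j\<bar>)"

definition l2_norm :: "real vec \<Rightarrow> real" where
  "l2_norm v = sqrt (v \<bullet> v)"

definition mat_trace :: "real mat \<Rightarrow> real" where
  "mat_trace A = (\<Sum>i<dim_row A. A $$ (i, i))"

definition mat_max_norm :: "real mat \<Rightarrow> real" where
  "mat_max_norm A = Max (abs ` elements_mat A)"

definition mat_L1_norm :: "real mat \<Rightarrow> real" where
  "mat_L1_norm A = (\<Sum>i<dim_row A. \<Sum>j<dim_col A. \<bar>A $$ (i, j)\<bar>)"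

definition mat_one_norm :: "real mat \<Rightarrow> real" where
  "mat_one_norm A = Max ((\<lambda>j. \<Sum>i<dim_row A. \<bar>A $$ (i, j)\<bar>) ` {..<dim_col A})"

(* Used for symmetric matrices of positive dimension only, whose spectrum is finite and
   nonempty. *)
definition lambda_min :: "real mat \<Rightarrow> real" where
  "lambda_min A = Min (spectrum A)"

definition lambda_max :: "real mat \<Rightarrow> real" where
  "lambda_max A = Max (spectrum A)"

definition vec_borel :: "nat \<Rightarrow> real vec measure" where
  "vec_borel p = vimage_algebra (carrier_vec p) (\<lambda>v. \<lambda>j\<in>{..<p}. v $ j) (PiM {..<p} (\<lambda>_. borel))"

definition mat_borel :: "nat \<Rightarrow> real mat measure" where
  "mat_borel p = vimage_algebra (carrier_mat p p) (\<lambda>A. \<lambda>ij\<in>{..<p} \<times> {..<p}. A $$ ij)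
     (PiM ({..<p} \<times> {..<p}) (\<lambda>_. borel))"

definition obs_space :: "nat \<Rightarrow> (real vec \<times> real) measure" where
  "obs_space p = vec_borel p \<Otimes>\<^sub>M borel"

(* Extended-real valued: infinite when z is not sub-gaussian. *)
definition psi2_norm :: "'a measure \<Rightarrow> ('a \<Rightarrow> real) \<Rightarrow> ennreal" where
  "psi2_norm M z =
     Inf {ennreal t |t. 0 < t \<and> (\<integral>\<^sup>+\<omega>. ennreal (exp ((z \<omega>)\<^sup>2 / t\<^sup>2)) \<partial>M) \<le> 2}"

definition psi2_norm_vec :: "'a measure \<Rightarrow> nat \<Rightarrow> ('a \<Rightarrow> real vec) \<Rightarrow> ennreal" where
  "psi2_norm_vec M p Z =
     (SUP s\<in>{s \<in> carrier_vec p. s \<noteq> 0\<^sub>v p}. psi2_norm M (\<lambda>\<omega>. (s \<bullet> Z \<omega>) / l2_norm s))"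

definition little_o_prob :: "(nat \<Rightarrow> 'a measure) \<Rightarrow> (nat \<Rightarrow> 'a \<Rightarrow> real) \<Rightarrow> (nat \<Rightarrow> real) \<Rightarrow> bool" where
  "little_o_prob M Z a \<longleftrightarrow>
     (\<forall>\<epsilon>>0. (\<lambda>n. measure (M n) {\<omega> \<in> space (M n). \<bar>Z n \<omega>\<bar> > \<epsilon> * \<bar>a n\<bar>}) \<longlonglongrightarrow> 0)"

(* Index 0 is the generic observation; indices 1..n are its i.i.d. copies. *)
definition iid_copies ::
  "'a measure \<Rightarrow> nat \<Rightarrow> nat \<Rightarrow> (nat \<Rightarrow> 'a \<Rightarrow> real vec) \<Rightarrow> (nat \<Rightarrow> 'a \<Rightarrow> real) \<Rightarrow> bool" where
  "iid_copies M p n X Y \<longleftrightarrow>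
     (\<lambda>\<omega>. (X 0 \<omega>, Y 0 \<omega>)) \<in> M \<rightarrow>\<^sub>M obs_space p \<and>
     prob_space.indep_vars M (\<lambda>_. obs_space p) (\<lambda>i \<omega>. (X i \<omega>, Y i \<omega>)) {1..n} \<and>
     (\<forall>i\<in>{1..n}. distr M (obs_space p) (\<lambda>\<omega>. (X i \<omega>, Y i \<omega>)) =
                 distr M (obs_space p) (\<lambda>\<omega>. (X 0 \<omega>, Y 0 \<omega>)))"

definition square_integrable_obs :: "'a measure \<Rightarrow> nat \<Rightarrow> ('a \<Rightarrow> real vec) \<Rightarrow> ('a \<Rightarrow> real) \<Rightarrow> bool" where
  "square_integrable_obs M p X0 Y0 \<longleftrightarrow>
     (\<forall>j<p. integrable M (\<lambda>\<omega>. (X0 \<omega> $ j)\<^sup>2)) \<and> integrable M (\<lambda>\<omega>. (Y0 \<omega>)\<^sup>2)"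

definition second_moment :: "'a measure \<Rightarrow> nat \<Rightarrow> ('a \<Rightarrow> real vec) \<Rightarrow> real mat" where
  "second_moment M p X0 = mat p p (\<lambda>(j, k). integral\<^sup>L M (\<lambda>\<omega>. X0 \<omega> $ j * X0 \<omega> $ k))"

definition is_precision_matrix :: "'a measure \<Rightarrow> nat \<Rightarrow> ('a \<Rightarrow> real vec) \<Rightarrow> real mat \<Rightarrow> bool" where
  "is_precision_matrix M p X0 \<Omega> \<longleftrightarrow>
     \<Omega> \<in> carrier_mat p p \<and> inverts_mat (second_moment M p X0) \<Omega> \<and> inverts_mat \<Omega> (second_moment M p X0)"

definition is_regression_target ::
  "'a measure \<Rightarrow> nat \<Rightarrow> ('a \<Rightarrow> real vec) \<Rightarrow> ('a \<Rightarrow> real) \<Rightarrow> real vec \<Rightarrow> bool" where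
  "is_regression_target M p X0 Y0 \<beta> \<longleftrightarrow>
     is_arg_min (\<lambda>b. integral\<^sup>L M (\<lambda>\<omega>. (1/2) * (Y0 \<omega> - X0 \<omega> \<bullet> b)\<^sup>2)) (\<lambda>b. b \<in> carrier_vec p) \<beta>"

definition oracle_variance ::
  "'a measure \<Rightarrow> ('a \<Rightarrow> real vec) \<Rightarrow> ('a \<Rightarrow> real) \<Rightarrow> real vec \<Rightarrow> real vec \<Rightarrow> real mat \<Rightarrow> real" where
  "oracle_variance M X0 Y0 \<xi> \<beta> \<Omega> =
     integral\<^sup>L M (\<lambda>\<omega>. (\<xi> \<bullet> (\<Omega> *\<^sub>v X0 \<omega>))\<^sup>2 * (Y0 \<omega> - X0 \<omega> \<bullet> \<beta>)\<^sup>2)"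

definition max_col_sparsity :: "real mat \<Rightarrow> nat" where
  "max_col_sparsity \<Omega> = Max ((\<lambda>j. l0_norm (col \<Omega> j)) ` {..<dim_col \<Omega>})"

(* The l0-norm of the vector whose entries, indexed by the support of xi, are the column
   sparsities of Omega. *)
definition loading_sparsity :: "real mat \<Rightarrow> real vec \<Rightarrow> nat" where
  "loading_sparsity \<Omega> \<xi> = card {j \<in> supp_vec \<xi>. l0_norm (col \<Omega> j) \<noteq> 0}"

definition rate_lambda :: "nat \<Rightarrow> nat \<Rightarrow> real" where
  "rate_lambda p n = sqrt (ln (real (max p n)) / real n)"

definition rate_tau :: "nat \<Rightarrow> nat \<Rightarrow> real" where
  "rate_tau p n = ln (real (max p n)) / sqrt (real n)"

(* Z is a measurable function of the observations with index in I. *)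
definition computed_from ::
  "'a measure \<Rightarrow> nat \<Rightarrow> (nat \<Rightarrow> 'a \<Rightarrow> real vec) \<Rightarrow> (nat \<Rightarrow> 'a \<Rightarrow> real) \<Rightarrow> nat set \<Rightarrow>
   'b measure \<Rightarrow> ('a \<Rightarrow> 'b) \<Rightarrow> bool" where
  "computed_from M p X Y I N Z \<longleftrightarrow>
     (\<exists>f \<in> PiM I (\<lambda>_. obs_space p) \<rightarrow>\<^sub>M N. \<forall>\<omega>\<in>space M. Z \<omega> = f (\<lambda>i\<in>I. (X i \<omega>, Y i \<omega>)))"

definition sample_second_moment :: "nat \<Rightarrow> nat set \<Rightarrow> (nat \<Rightarrow> real vec) \<Rightarrow> real mat" where
  "sample_second_moment p I x = mat p p (\<lambda>(j, k). (\<Sum>i\<in>I. x i $ j * x i $ k) / real (card I))"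

definition stage_one :: "nat \<Rightarrow> real \<Rightarrow> real mat \<Rightarrow> real mat \<Rightarrow> bool" where
  "stage_one p r S G \<longleftrightarrow>
     is_arg_min (\<lambda>G. (1/2) * mat_trace (transpose_mat G * S * G) - mat_trace G + r * mat_L1_norm G)
       (\<lambda>G. G \<in> carrier_mat p p) G"

definition stage_two :: "nat \<Rightarrow> real \<Rightarrow> real mat \<Rightarrow> real mat \<Rightarrow> real mat \<Rightarrow> bool" where
  "stage_two p r S G1 G \<longleftrightarrow>
     is_arg_min (\<lambda>G. mat_one_norm (G1 - G))
       (\<lambda>G. G \<in> carrier_mat p p \<and> transpose_mat G = G \<and> mat_max_norm (S * G - 1\<^sub>m p) \<le> r) G"

(* For some realisations of the sample the first objective is unbounded below or the second
   feasible set is empty.  The estimator is required to solve the two programs whenever they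
   have a solution and is an arbitrary measurable function of the subsample otherwise;
   requiring minimizers at every sample point would exclude, e.g., Gaussian designs with
   p > card I. *)
definition two_stage_estimator ::
  "'a measure \<Rightarrow> nat \<Rightarrow> (nat \<Rightarrow> 'a \<Rightarrow> real vec) \<Rightarrow> (nat \<Rightarrow> 'a \<Rightarrow> real) \<Rightarrow> nat set \<Rightarrow> real \<Rightarrow>
   ('a \<Rightarrow> real mat) \<Rightarrow> bool" where
  "two_stage_estimator M p X Y I r \<Omega>h \<longleftrightarrow>
     computed_from M p X Y I (mat_borel p) \<Omega>h \<and>
     (\<exists>Gh. computed_from M p X Y I (mat_borel p) Gh \<and>
       (\<forall>\<omega>\<in>space M. let S = sample_second_moment p I (\<lambda>i. X i \<omega>) in
          (\<exists>G. stage_one p r S G) \<longrightarrow>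
            stage_one p r S (Gh \<omega>) \<and>
            ((\<exists>G. stage_two p r S (Gh \<omega>) G) \<longrightarrow> stage_two p r S (Gh \<omega>) (\<Omega>h \<omega>))))"

(* In the next three definitions x, y are the realised data, b the realised estimate of beta,
   OJ and OJc the realised precision estimates from J and from its complement. *)
definition score_sum ::
  "nat \<Rightarrow> nat \<Rightarrow> nat set \<Rightarrow> (nat \<Rightarrow> real vec) \<Rightarrow> (nat \<Rightarrow> real) \<Rightarrow> real vec \<Rightarrow> real vec" where
  "score_sum p n I x y b = vec p (\<lambda>k. (1 / real n) * (\<Sum>i\<in>I. x i $ k * (y i - x i \<bullet> b)))"

definition debiased_estimate ::
  "nat \<Rightarrow> nat \<Rightarrow> nat set \<Rightarrow> (nat \<Rightarrow> real vec) \<Rightarrow> (nat \<Rightarrow> real) \<Rightarrow> real vec \<Rightarrow> real vec \<Rightarrow>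
   real mat \<Rightarrow> real mat \<Rightarrow> real" where
  "debiased_estimate p n J x y \<xi> b OJ OJc =
     \<xi> \<bullet> b + \<xi> \<bullet> (OJc *\<^sub>v score_sum p n J x y b) + \<xi> \<bullet> (OJ *\<^sub>v score_sum p n ({1..n} - J) x y b)"

definition variance_estimate ::
  "nat \<Rightarrow> nat set \<Rightarrow> (nat \<Rightarrow> real vec) \<Rightarrow> (nat \<Rightarrow> real) \<Rightarrow> real vec \<Rightarrow> real vec \<Rightarrow>
   real mat \<Rightarrow> real mat \<Rightarrow> real" where
  "variance_estimate n J x y \<xi> b OJ OJc =
     (1 / real n) * (\<Sum>i\<in>J. (\<xi> \<bullet> (OJc *\<^sub>v x i))\<^sup>2 * (y i - x i \<bullet> b)\<^sup>2) +
     (1 / real n) * (\<Sum>i\<in>{1..n} - J. (\<xi> \<bullet> (OJ *\<^sub>v x i))\<^sup>2 * (y i - x i \<bullet> b)\<^sup>2)"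

definition expansion_and_consistency ::
  "(nat \<Rightarrow> 'a measure) \<Rightarrow> (nat \<Rightarrow> nat) \<Rightarrow> (nat \<Rightarrow> nat \<Rightarrow> 'a \<Rightarrow> real vec) \<Rightarrow> (nat \<Rightarrow> nat \<Rightarrow> 'a \<Rightarrow> real) \<Rightarrow>
   (nat \<Rightarrow> nat set) \<Rightarrow> (nat \<Rightarrow> real vec) \<Rightarrow> (nat \<Rightarrow> real vec) \<Rightarrow> (nat \<Rightarrow> real mat) \<Rightarrow>
   (nat \<Rightarrow> 'a \<Rightarrow> real vec) \<Rightarrow> (nat \<Rightarrow> 'a \<Rightarrow> real mat) \<Rightarrow> (nat \<Rightarrow> 'a \<Rightarrow> real mat) \<Rightarrow> bool" where
  "expansion_and_consistency M p X Y J \<xi> \<beta> \<Omega> \<beta>h \<Omega>J \<Omega>Jc \<longleftrightarrow>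
     (let V = (\<lambda>n. oracle_variance (M n) (X n 0) (Y n 0) (\<xi> n) (\<beta> n) (\<Omega> n));
          est = (\<lambda>n \<omega>. debiased_estimate (p n) n (J n) (\<lambda>i. X n i \<omega>) (\<lambda>i. Y n i \<omega>)
                         (\<xi> n) (\<beta>h n \<omega>) (\<Omega>J n \<omega>) (\<Omega>Jc n \<omega>));
          Vh = (\<lambda>n \<omega>. variance_estimate n (J n) (\<lambda>i. X n i \<omega>) (\<lambda>i. Y n i \<omega>)
                        (\<xi> n) (\<beta>h n \<omega>) (\<Omega>J n \<omega>) (\<Omega>Jc n \<omega>))
      in little_o_prob M
           (\<lambda>n \<omega>. (est n \<omega> - \<xi> n \<bullet> \<beta> n) / sqrt (V n)
              - (1 / real n) * (\<Sum>i\<in>{1..n}. (\<xi> n \<bullet> (\<Omega> n *\<^sub>v X n i \<omega>)) *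
                                   (Y n i \<omega> - X n i \<omega> \<bullet> \<beta> n) / sqrt (V n)))
           (\<lambda>n. 1 / sqrt (real n)) \<and>
         little_o_prob M (\<lambda>n \<omega>. Vh n \<omega> / V n - 1) (\<lambda>n. 1))"

end

theory Submission
  imports Defs
begin

text \<open>
  Write \<open>u\<close> for the error of the cross-fitted direction \<open>\<Omega>h \<xi>\<close> and \<open>d\<close> for the error of the fitted
  regression values. The remainder of the expansion splits into the gram error of \<open>\<Omega> \<xi>\<close> applied to
  \<open>\<beta>h - \<beta>\<close> (of order \<open>s0 \<lambda>\<^sup>2\<close>), the inner product of \<open>X u\<close> and \<open>d\<close> (Cauchy-Schwarz, of order
  \<open>\<parallel>u\<parallel> sqrt s0 \<lambda>\<close>), and the average of \<open>(X u) \<epsilon>\<close>, which has conditional mean zero because \<open>u\<close> is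
  independent of the fold it is applied to; conditional second and fourth moments then suffice
  everywhere. The error \<open>u\<close> is controlled by a lasso argument for each column of stage one. It needs a
  restricted eigenvalue bound \<open>v' Sh v \<ge> \<kappa> \<parallel>v\<parallel>\<^sup>2 - \<gamma> (l1 v)\<^sup>2\<close> of the sample second moment matrix: in
  (i) the entrywise error gives \<open>\<gamma>\<close> of order \<open>\<lambda>\<close>; in (ii) a Maurey-type sparsification reduces the bound to a
  union bound over sums of few signed unit vectors and gives \<open>\<gamma>\<close> of order \<open>\<lambda>\<^sup>2\<close>.
\<close>

subsection \<open>Subexponential concentration\<close>

text \<open>The estimate \<open>\<beta>h\<close> may depend on every observation, so each sum
  containing it is bounded pathwise, through the two inequalities of (d); averaging is exploited
  only in sums free of it. The two arguments of the minimum in the rate condition are two bounds on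
  the l2 error of the direction: a Schur test, available because stage two returns a symmetric
  matrix, and a Frobenius bound over the columns in the support of \<xi>. Parts (i) and (ii) differ
  in two places. Coordinatewise sub-gaussianity controls the fourth moment of a linear form by the
  l1 norm of its coefficients, whence the ratio of norms of \<xi> in (i); that condition also makes
  \<open>s1 * \<lambda>\<close> small. In (ii) only \<open>s1 * \<lambda>^2\<close> is guaranteed to
  be small, and a curvature error of order \<lambda> would be too large. The two programs may lack
  solutions for some samples, so existence is proved on the same event as the error bounds. All
  errors are measured relative to the l2 norm of \<xi>, a multiple of whose square bounds the
  variance from below. Markov's inequality leaves a free level \<open>L\<close>, which goes to
  infinity only after n.\<close>

lemma exp_le_quadratic:
  fixes s x :: real
  assumes "\<bar>s\<bar> \<le> 1/2"
  shows "exp (s * x) \<le> 1 + s * x + 4 * s\<^sup>2 * exp \<bar>x\<bar>"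
proof -
  obtain t where t: "\<bar>t\<bar> \<le> \<bar>s * x\<bar>"
    and e: "exp (s * x) = (\<Sum>m<2. (s * x) ^ m / fact m) + exp t / fact 2 * (s * x) ^ 2"
    using Maclaurin_exp_le[of "s * x" 2] by blast
  \<comment> \<open>The weight \<open>exp \<bar>x\<bar>\<close> is spent in two halves: one
    dominates the Taylor factor \<open>exp t\<close>, the other dominates x^2.\<close>
  have "\<bar>s * x\<bar> \<le> \<bar>x\<bar> / 2"
    using mult_right_mono[OF assms, of "\<bar>x\<bar>"] by (simp add: abs_mult)
  then have "t \<le> \<bar>x\<bar> / 2"
    using t by linarith
  then have et: "exp t \<le> exp (\<bar>x\<bar> / 2)"
    by simp
  have "(\<bar>x\<bar> / 2) ^ 2 / 2 \<le> exp (\<bar>x\<bar> / 2)"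
    using exp_lower_Taylor_quadratic[of "\<bar>x\<bar> / 2"] by simp
  then have x2: "x\<^sup>2 \<le> 8 * exp (\<bar>x\<bar> / 2)"
    by (simp add: power_divide)
  have "exp t / 2 * (s * x) ^ 2 = s\<^sup>2 / 2 * (exp t * x\<^sup>2)"
    by (simp add: power_mult_distrib)
  also have "\<dots> \<le> s\<^sup>2 / 2 * (exp (\<bar>x\<bar> / 2) * (8 * exp (\<bar>x\<bar> / 2)))"
    by (intro mult_left_mono mult_mono et x2) auto
  also have "\<dots> = 4 * s\<^sup>2 * exp \<bar>x\<bar>"
    by (simp add: mult_exp_exp)
  finally show ?thesis
    using e by (simp add: eval_nat_numeral)
qed

text \<open>Moment bounds are carried as nonnegative integrals, which make sense before
  integrability is known. This lemma and the next one translate between them and Bochner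
  integrals.\<close>

lemma integrable_nn_bound:
  fixes f :: "'a \<Rightarrow> real"
  assumes [measurable]: "f \<in> borel_measurable M" and "\<And>x. x \<in> space M \<Longrightarrow> 0 \<le> f x"
    and b: "(\<integral>\<^sup>+x. ennreal (f x) \<partial>M) \<le> ennreal B" and "0 \<le> B"
  shows "integrable M f" "integral\<^sup>L M f \<le> B"
proof -
  have lt: "(\<integral>\<^sup>+x. ennreal (f x) \<partial>M) < \<infinity>"
    using b by (simp add: order_le_less_trans)
  show i: "integrable M f"
    using lt assms(2) by (intro integrableI_nonneg) (auto intro!: AE_I2)
  have "ennreal (integral\<^sup>L M f) = (\<integral>\<^sup>+x. ennreal (f x) \<partial>M)"
    using assms(2) by (intro nn_integral_eq_integral[symmetric] i AE_I2) auto
  then have "ennreal (integral\<^sup>L M f) \<le> ennreal B"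
    using b by simp
  then show "integral\<^sup>L M f \<le> B"
    using \<open>0 \<le> B\<close> by (simp only: ennreal_le_iff)
qed

lemma nn_integral_le_of_integral:
  fixes f :: "'a \<Rightarrow> real"
  assumes "integrable M f" "\<And>x. x \<in> space M \<Longrightarrow> 0 \<le> f x" "integral\<^sup>L M f \<le> B"
  shows "(\<integral>\<^sup>+x. ennreal (f x) \<partial>M) \<le> ennreal B"
proof -
  have "(\<integral>\<^sup>+x. ennreal (f x) \<partial>M) = ennreal (integral\<^sup>L M f)"
    using assms by (intro nn_integral_eq_integral AE_I2) auto
  then show ?thesis
    using assms(3) by (simp add: ennreal_leI)
qed

text \<open>The expectation of \<open>exp_le_quadratic\<close> is at most 1 + (s \<mu> + 8 s^2), and
  1 + y \<le> exp y turns this into an exponential whose linear part the centring removes.\<close>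

lemma (in prob_space) subexponential_mgf:
  fixes W :: "'a \<Rightarrow> real"
  assumes [measurable]: "W \<in> borel_measurable M"
    and W: "(\<integral>\<^sup>+\<omega>. ennreal (exp \<bar>W \<omega>\<bar>) \<partial>M) \<le> 2" and s: "\<bar>s\<bar> \<le> 1/2"
  shows "integrable M W"
    and "(\<integral>\<^sup>+\<omega>. ennreal (exp (s * (W \<omega> - expectation W))) \<partial>M) \<le> ennreal (exp (8 * s\<^sup>2))"
proof -
  have ie: "integrable M (\<lambda>\<omega>. exp \<bar>W \<omega>\<bar>)" and le: "expectation (\<lambda>\<omega>. exp \<bar>W \<omega>\<bar>) \<le> 2"
    using W by (intro integrable_nn_bound[where B = 2]; simp)+
  show i: "integrable M W"
  proof (rule Bochner_Integration.integrable_bound[OF ie])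
    have "\<bar>W x\<bar> \<le> exp \<bar>W x\<bar>" for x
      using exp_ge_add_one_self[of "\<bar>W x\<bar>"] by linarith
    then show "AE x in M. norm (W x) \<le> norm (exp \<bar>W x\<bar>)"
      by simp
  qed simp
  let ?\<mu> = "expectation W"
  let ?q = "\<lambda>\<omega>. 1 + s * W \<omega> + 4 * s\<^sup>2 * exp \<bar>W \<omega>\<bar>"
  have iq: "integrable M ?q"
    using i ie by (intro Bochner_Integration.integrable_add) auto
  have "expectation ?q = 1 + s * ?\<mu> + 4 * s\<^sup>2 * expectation (\<lambda>\<omega>. exp \<bar>W \<omega>\<bar>)"
    using i ie by (simp add: prob_space)
  also have "\<dots> \<le> 1 + (s * ?\<mu> + 8 * s\<^sup>2)"
    using mult_left_mono[OF le, of "4 * s\<^sup>2"] by simp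
  also have "\<dots> \<le> exp (s * ?\<mu> + 8 * s\<^sup>2)"
    by (rule exp_ge_add_one_self)
  finally have q: "expectation ?q \<le> exp (s * ?\<mu> + 8 * s\<^sup>2)" .
  have ge: "exp (s * W \<omega>) \<le> ?q \<omega>" for \<omega>
    by (rule exp_le_quadratic[OF s])
  have q0: "0 \<le> ?q \<omega>" for \<omega>
    using ge[of \<omega>] exp_gt_zero[of "s * W \<omega>"] by linarith
  have "(\<integral>\<^sup>+\<omega>. ennreal (exp (s * (W \<omega> - ?\<mu>))) \<partial>M)
      \<le> (\<integral>\<^sup>+\<omega>. ennreal (exp (- s * ?\<mu>)) * ennreal (?q \<omega>) \<partial>M)"
  proof (rule nn_integral_mono)
    fix \<omega>
    have "exp (s * (W \<omega> - ?\<mu>)) = exp (- s * ?\<mu>) * exp (s * W \<omega>)"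
      by (simp add: mult_exp_exp algebra_simps)
    also have "\<dots> \<le> exp (- s * ?\<mu>) * ?q \<omega>"
      using ge by (intro mult_left_mono) auto
    finally show "ennreal (exp (s * (W \<omega> - ?\<mu>))) \<le> ennreal (exp (- s * ?\<mu>)) * ennreal (?q \<omega>)"
      using q0[of \<omega>] by (simp add: ennreal_mult'[symmetric] ennreal_leI)
  qed
  also have "\<dots> = ennreal (exp (- s * ?\<mu>)) * (\<integral>\<^sup>+\<omega>. ennreal (?q \<omega>) \<partial>M)"
    by (rule nn_integral_cmult) simp
  also have "(\<integral>\<^sup>+\<omega>. ennreal (?q \<omega>) \<partial>M) \<le> ennreal (exp (s * ?\<mu> + 8 * s\<^sup>2))"
    by (rule nn_integral_le_of_integral[OF iq q0 q])
  also have "ennreal (exp (- s * ?\<mu>)) * ennreal (exp (s * ?\<mu> + 8 * s\<^sup>2)) = ennreal (exp (8 * s\<^sup>2))"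
    by (simp add: ennreal_mult'[symmetric] mult_exp_exp)
  finally show "(\<integral>\<^sup>+\<omega>. ennreal (exp (s * (W \<omega> - ?\<mu>))) \<partial>M) \<le> ennreal (exp (8 * s\<^sup>2))"
    by (simp add: mult_left_mono)
qed

lemma (in prob_space) prob_ge_le_nn_integral:
  fixes f :: "'a \<Rightarrow> real"
  assumes [measurable]: "f \<in> borel_measurable M" and "\<And>x. x \<in> space M \<Longrightarrow> 0 \<le> f x"
    and "(\<integral>\<^sup>+x. ennreal (f x) \<partial>M) \<le> ennreal B" and "0 \<le> B" and "0 < c"
  shows "prob {x \<in> space M. c \<le> f x} \<le> B / c"
proof -
  note i = integrable_nn_bound[OF assms(1-4)]
  have "prob {x \<in> space M. c \<le> f x} \<le> expectation f / c"
    using \<open>0 < c\<close> i(1) assms(2) by (intro integral_Markov_inequality_measure[where A = "{}"]) auto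
  also have "\<dots> \<le> B / c"
    using i(2) \<open>0 < c\<close> by (simp add: divide_right_mono)
  finally show ?thesis .
qed

lemma (in prob_space) bernstein_upper:
  fixes g :: "'b \<Rightarrow> real"
  assumes ind: "indep_vars (\<lambda>_. N) Z I" and fin: "finite I"
    and D: "\<And>i. i \<in> I \<Longrightarrow> distr M N (Z i) = D" and PD: "prob_space D"
    and g[measurable]: "g \<in> borel_measurable N"
    and e: "(\<integral>\<^sup>+z. ennreal (exp \<bar>g z\<bar>) \<partial>D) \<le> 2" and t: "0 \<le> t" "t \<le> 8"
  shows "prob {\<omega> \<in> space M. real (card I) * t \<le> (\<Sum>i\<in>I. g (Z i \<omega>) - integral\<^sup>L D g)}
    \<le> exp (- real (card I) * t\<^sup>2 / 32)"
\<comment> \<open>The hypotheses tie the measure \<open>D\<close> to the sigma-algebra of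
  \<open>N\<close> only through some index in \<open>I\<close>.\<close>
proof (cases "I = {}")
  case True
  then show ?thesis by simp
next
  case False
  interpret D: prob_space D by fact
  have Z[measurable]: "i \<in> I \<Longrightarrow> Z i \<in> M \<rightarrow>\<^sub>M N" for i
    using ind by (auto simp: indep_vars_def)
  have sD: "sets D = sets N"
    using False D by (metis all_not_in_conv sets_distr)
  have gD[measurable]: "g \<in> borel_measurable D"
    using g by (simp add: measurable_cong_sets[OF sD refl])
  \<comment> \<open>This minimises 8 s^2 - s t, with minimum - t^2 / 32. The restriction
    \<open>t \<le> 8\<close> is the range \<open>\<bar>s\<bar> \<le> 1/2\<close> of the moment
    generating function bound.\<close>
  define s where "s = t / 16"
  define \<mu> where "\<mu> = integral\<^sup>L D g"
  have s: "0 \<le> s" "\<bar>s\<bar> \<le> 1/2"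
    using t by (auto simp: s_def)
  let ?h = "\<lambda>z. exp (s * (g z - \<mu>))"
  have one: "(\<integral>\<^sup>+\<omega>. ennreal (?h (Z i \<omega>)) \<partial>M) \<le> ennreal (exp (8 * s\<^sup>2))" if i: "i \<in> I" for i
  proof -
    have "(\<integral>\<^sup>+\<omega>. ennreal (?h (Z i \<omega>)) \<partial>M) = (\<integral>\<^sup>+z. ennreal (?h z) \<partial>distr M N (Z i))"
      using i by (subst nn_integral_distr) auto
    also have "\<dots> \<le> ennreal (exp (8 * s\<^sup>2))"
      unfolding D[OF i] \<mu>_def by (rule D.subexponential_mgf(2)[OF gD e s(2)])
    finally show ?thesis .
  qed
  have ind': "indep_vars (\<lambda>_. borel) (\<lambda>i \<omega>. ennreal (?h (Z i \<omega>))) I"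
    by (rule indep_vars_compose2[OF ind]) auto
  have "(\<integral>\<^sup>+\<omega>. ennreal (exp (s * (\<Sum>i\<in>I. g (Z i \<omega>) - \<mu>))) \<partial>M)
      = (\<integral>\<^sup>+\<omega>. (\<Prod>i\<in>I. ennreal (?h (Z i \<omega>))) \<partial>M)"
    by (intro nn_integral_cong) (simp add: sum_distrib_left exp_sum[OF fin] prod_ennreal)
  also have "\<dots> = (\<Prod>i\<in>I. \<integral>\<^sup>+\<omega>. ennreal (?h (Z i \<omega>)) \<partial>M)"
    by (rule indep_vars_nn_integral[OF fin ind']) auto
  also have "\<dots> \<le> (\<Prod>i\<in>I. ennreal (exp (8 * s\<^sup>2)))"
    using fin one by (induction I rule: finite_induct) (auto intro!: mult_mono)
  also have "\<dots> = ennreal (exp (real (card I) * (8 * s\<^sup>2)))"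
    by (simp add: ennreal_power exp_of_nat_mult)
  finally have mgf: "(\<integral>\<^sup>+\<omega>. ennreal (exp (s * (\<Sum>i\<in>I. g (Z i \<omega>) - \<mu>))) \<partial>M)
      \<le> ennreal (exp (real (card I) * (8 * s\<^sup>2)))" .
  have [measurable]: "(\<lambda>\<omega>. \<Sum>i\<in>I. g (Z i \<omega>) - \<mu>) \<in> borel_measurable M"
    by (intro borel_measurable_sum borel_measurable_diff measurable_compose[OF Z g]) auto
  have "prob {\<omega> \<in> space M. real (card I) * t \<le> (\<Sum>i\<in>I. g (Z i \<omega>) - \<mu>)}
      \<le> prob {\<omega> \<in> space M. exp (s * (real (card I) * t)) \<le> exp (s * (\<Sum>i\<in>I. g (Z i \<omega>) - \<mu>))}"
    using s(1) by (intro finite_measure_mono) (auto intro: mult_left_mono)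
  also have "\<dots> \<le> exp (real (card I) * (8 * s\<^sup>2)) / exp (s * (real (card I) * t))"
    by (intro prob_ge_le_nn_integral mgf) auto
  also have "\<dots> = exp (- real (card I) * t\<^sup>2 / 32)"
    by (simp add: exp_diff[symmetric] s_def power2_eq_square field_simps)
  finally show ?thesis
    by (simp add: \<mu>_def)
qed

lemma (in prob_space) bernstein_two_sided:
  fixes g :: "'b \<Rightarrow> real"
  assumes ind: "indep_vars (\<lambda>_. N) Z I" and fin: "finite I"
    and D: "\<And>i. i \<in> I \<Longrightarrow> distr M N (Z i) = D" and PD: "prob_space D"
    and g[measurable]: "g \<in> borel_measurable N" and K: "0 < K"
    and e: "(\<integral>\<^sup>+z. ennreal (exp (\<bar>g z\<bar> / K)) \<partial>D) \<le> 2" and t: "0 \<le> t" "t \<le> 8"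
  shows "prob {\<omega> \<in> space M. K * real (card I) * t \<le> \<bar>(\<Sum>i\<in>I. g (Z i \<omega>)) - real (card I) * integral\<^sup>L D g\<bar>}
    \<le> 2 * exp (- real (card I) * t\<^sup>2 / 32)"
proof -
  let ?S = "\<lambda>\<sigma> \<omega>. \<Sum>i\<in>I. \<sigma> * (g (Z i \<omega>) / K) - integral\<^sup>L D (\<lambda>z. \<sigma> * (g z / K))"
  let ?A = "\<lambda>\<sigma>. {\<omega> \<in> space M. real (card I) * t \<le> ?S \<sigma> \<omega>}"
  have Z: "i \<in> I \<Longrightarrow> Z i \<in> M \<rightarrow>\<^sub>M N" for i
    using ind by (auto simp: indep_vars_def)
  have b: "prob (?A \<sigma>) \<le> exp (- real (card I) * t\<^sup>2 / 32)" if "\<bar>\<sigma>\<bar> = 1" for \<sigma> :: real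
    using e K that by (intro bernstein_upper[OF ind fin D PD _ _ t]) (auto simp: abs_mult)
  have "(\<lambda>\<omega>. ?S \<sigma> \<omega>) \<in> borel_measurable M" for \<sigma>
    by (intro borel_measurable_sum borel_measurable_diff borel_measurable_times
        borel_measurable_divide measurable_compose[OF Z g]) auto
  then have mA: "?A \<sigma> \<in> events" for \<sigma>
    by (intro borel_measurable_le) auto
  have S: "K * ?S \<sigma> \<omega> = \<sigma> * ((\<Sum>i\<in>I. g (Z i \<omega>)) - real (card I) * integral\<^sup>L D g)" for \<sigma> \<omega>
  proof -
    have "?S \<sigma> \<omega> = \<sigma> * ((\<Sum>i\<in>I. g (Z i \<omega>)) - real (card I) * integral\<^sup>L D g) / K"
      by (simp add: sum_subtractf sum_distrib_left[symmetric] sum_divide_distrib[symmetric]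
          algebra_simps diff_divide_distrib)
    then show ?thesis
      using K by simp
  qed
  have K': "K * real (card I) * t \<le> K * x \<longleftrightarrow> real (card I) * t \<le> x" for x
    using K by (simp add: mult.assoc)
  have "{\<omega> \<in> space M. K * real (card I) * t \<le> \<bar>(\<Sum>i\<in>I. g (Z i \<omega>)) - real (card I) * integral\<^sup>L D g\<bar>}
      \<subseteq> ?A 1 \<union> ?A (-1)"
    unfolding K'[symmetric] S by auto
  then have "prob {\<omega> \<in> space M. K * real (card I) * t \<le> \<bar>(\<Sum>i\<in>I. g (Z i \<omega>)) - real (card I) * integral\<^sup>L D g\<bar>}
      \<le> prob (?A 1 \<union> ?A (-1))"
    by (intro finite_measure_mono sets.Un mA)
  also have "\<dots> \<le> prob (?A 1) + prob (?A (-1))"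
    by (intro measure_Un_le mA)
  also have "\<dots> \<le> exp (- real (card I) * t\<^sup>2 / 32) + exp (- real (card I) * t\<^sup>2 / 32)"
    by (intro add_mono b) auto
  finally show ?thesis by simp
qed

section \<open>Sub-gaussian variables: even moments and products\<close>

definition subgaussian :: "'a measure \<Rightarrow> ('a \<Rightarrow> real) \<Rightarrow> real \<Rightarrow> bool" where
  "subgaussian M f K \<longleftrightarrow> (\<integral>\<^sup>+\<omega>. ennreal (exp ((f \<omega>)\<^sup>2 / K\<^sup>2)) \<partial>M) \<le> 2"

text \<open>Doubling makes the inequality for the infimum strict, so an admissible constant below
  \<open>2 * c\<close> exists and attainment of the infimum is never discussed. All later constants
  \<open>K\<close> carry this factor 2.\<close>

lemma sg_of_psi2_norm:
  assumes "psi2_norm M f \<le> ennreal c" "0 < c"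
  shows "subgaussian M f (2 * c)"
proof -
  have "psi2_norm M f < ennreal (2 * c)"
    using assms by (simp add: order_le_less_trans ennreal_lessI)
  then obtain t where t: "0 < t" "ennreal t < ennreal (2 * c)"
    and e: "(\<integral>\<^sup>+\<omega>. ennreal (exp ((f \<omega>)\<^sup>2 / t\<^sup>2)) \<partial>M) \<le> 2"
    unfolding psi2_norm_def Inf_less_iff by auto
  have tc: "t < 2 * c"
    using t by (simp add: ennreal_less_iff)
  have "(\<integral>\<^sup>+\<omega>. ennreal (exp ((f \<omega>)\<^sup>2 / (2 * c)\<^sup>2)) \<partial>M) \<le> (\<integral>\<^sup>+\<omega>. ennreal (exp ((f \<omega>)\<^sup>2 / t\<^sup>2)) \<partial>M)"
    using t(1) tc power_mono[of t "2 * c" 2]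
    by (intro nn_integral_mono ennreal_leI) (auto intro!: divide_left_mono)
  then show ?thesis
    using e unfolding subgaussian_def by (rule order_trans)
qed

lemma sg_scale:
  assumes "subgaussian M (\<lambda>\<omega>. f \<omega> / c) K" "0 < c"
  shows "subgaussian M f (c * K)"
  using assms by (simp add: subgaussian_def power_divide power_mult_distrib)

lemma power_le_fact_exp:
  fixes x :: real
  assumes "0 \<le> x"
  shows "x ^ k \<le> fact k * exp x"
proof -
  obtain t where "exp x = (\<Sum>m<Suc k. x ^ m / fact m) + exp t / fact (Suc k) * x ^ Suc k"
    using Maclaurin_exp_le[of x "Suc k"] by blast
  moreover have "0 \<le> exp t / fact (Suc k) * x ^ Suc k" "0 \<le> (\<Sum>m<k. x ^ m / fact m)"
    using assms by (auto intro: sum_nonneg)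
  ultimately have "x ^ k / fact k \<le> exp x"
    by simp
  then show ?thesis
    by (simp add: field_simps)
qed

lemma sg_moment:
  assumes "subgaussian M f K" "0 < K" and [measurable]: "f \<in> borel_measurable M"
  shows "(\<integral>\<^sup>+\<omega>. ennreal (f \<omega> ^ (2 * k)) \<partial>M) \<le> ennreal (2 * fact k * K ^ (2 * k))"
proof -
  have "f \<omega> ^ (2 * k) \<le> fact k * K ^ (2 * k) * exp ((f \<omega>)\<^sup>2 / K\<^sup>2)" for \<omega>
    using power_le_fact_exp[of "(f \<omega>)\<^sup>2 / K\<^sup>2" k] \<open>0 < K\<close>
    by (simp add: power_divide power_mult[symmetric] field_simps)
  then have "(\<integral>\<^sup>+\<omega>. ennreal (f \<omega> ^ (2 * k)) \<partial>M)
      \<le> (\<integral>\<^sup>+\<omega>. ennreal (fact k * K ^ (2 * k)) * ennreal (exp ((f \<omega>)\<^sup>2 / K\<^sup>2)) \<partial>M)"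
    using \<open>0 < K\<close> by (intro nn_integral_mono) (simp add: ennreal_mult'[symmetric] ennreal_leI)
  also have "\<dots> = ennreal (fact k * K ^ (2 * k)) * (\<integral>\<^sup>+\<omega>. ennreal (exp ((f \<omega>)\<^sup>2 / K\<^sup>2)) \<partial>M)"
    by (rule nn_integral_cmult) simp
  also have "\<dots> \<le> ennreal (fact k * K ^ (2 * k)) * ennreal 2"
    using assms(1) by (intro mult_left_mono) (auto simp: subgaussian_def)
  also have "\<dots> = ennreal (2 * fact k * K ^ (2 * k))"
    using \<open>0 < K\<close> by (subst ennreal_mult'[symmetric]) (auto simp: mult_ac)
  finally show ?thesis .
qed

lemma sg_even_moment:
  assumes "subgaussian M f K" "0 < K" "f \<in> borel_measurable M"
  shows "integrable M (\<lambda>\<omega>. f \<omega> ^ (2 * k))"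
    and "integral\<^sup>L M (\<lambda>\<omega>. f \<omega> ^ (2 * k)) \<le> 2 * fact k * K ^ (2 * k)"
  using assms by (intro integrable_nn_bound[OF _ _ sg_moment]; simp)+

text \<open>The inequality 2 x y \<le> x^2 + y^2 is applied twice, first in the exponent and then to
  the product of the two exponentials. It puts empirical second moments within reach of
  \<open>bernstein_two_sided\<close>.\<close>

lemma sg_product:
  assumes f: "subgaussian M f K" and g: "subgaussian M g L" and "0 < K" "0 < L"
    and [measurable]: "f \<in> borel_measurable M" "g \<in> borel_measurable M"
  shows "(\<integral>\<^sup>+\<omega>. ennreal (exp (\<bar>f \<omega> * g \<omega>\<bar> / (K * L))) \<partial>M) \<le> 2"
proof -
  let ?F = "\<lambda>\<omega>. exp ((f \<omega>)\<^sup>2 / K\<^sup>2)" and ?G = "\<lambda>\<omega>. exp ((g \<omega>)\<^sup>2 / L\<^sup>2)"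
  have pt: "exp (\<bar>f \<omega> * g \<omega>\<bar> / (K * L)) \<le> (1/2) * ?F \<omega> + (1/2) * ?G \<omega>" for \<omega>
  proof -
    define x y where "x = \<bar>f \<omega>\<bar> / K" and "y = \<bar>g \<omega>\<bar> / L"
    have "\<bar>f \<omega> * g \<omega>\<bar> / (K * L) = x * y" "(f \<omega>)\<^sup>2 / K\<^sup>2 = x\<^sup>2" "(g \<omega>)\<^sup>2 / L\<^sup>2 = y\<^sup>2"
      by (auto simp: x_def y_def abs_mult power_divide)
    moreover have "exp (x * y) \<le> (1/2) * exp (x\<^sup>2) + (1/2) * exp (y\<^sup>2)"
    proof -
      have "x * y \<le> x\<^sup>2 / 2 + y\<^sup>2 / 2"
        using sum_squares_bound[of x y] by simp
      then have "exp (x * y) \<le> exp (x\<^sup>2 / 2) * exp (y\<^sup>2 / 2)"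
        by (simp add: mult_exp_exp)
      also have "\<dots> \<le> (1/2) * (exp (x\<^sup>2 / 2))\<^sup>2 + (1/2) * (exp (y\<^sup>2 / 2))\<^sup>2"
        using sum_squares_bound[of "exp (x\<^sup>2 / 2)" "exp (y\<^sup>2 / 2)"] by simp
      also have "\<dots> = (1/2) * exp (x\<^sup>2) + (1/2) * exp (y\<^sup>2)"
        by (simp add: power2_eq_square[of "exp _"] mult_exp_exp)
      finally show ?thesis .
    qed
    ultimately show ?thesis by simp
  qed
  have "(\<integral>\<^sup>+\<omega>. ennreal (exp (\<bar>f \<omega> * g \<omega>\<bar> / (K * L))) \<partial>M)
      \<le> (\<integral>\<^sup>+\<omega>. ennreal (1/2) * ennreal (?F \<omega>) + ennreal (1/2) * ennreal (?G \<omega>) \<partial>M)"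
  proof (rule nn_integral_mono)
    fix \<omega>
    have "ennreal (1/2) * ennreal (?F \<omega>) + ennreal (1/2) * ennreal (?G \<omega>)
        = ennreal ((1/2) * ?F \<omega> + (1/2) * ?G \<omega>)"
      by (subst (1 2) ennreal_mult'[symmetric]) (auto simp: ennreal_plus[symmetric] simp del: ennreal_plus)
    then show "ennreal (exp (\<bar>f \<omega> * g \<omega>\<bar> / (K * L)))
        \<le> ennreal (1/2) * ennreal (?F \<omega>) + ennreal (1/2) * ennreal (?G \<omega>)"
      using pt[of \<omega>] by (simp only: ennreal_leI)
  qed
  also have "\<dots> = ennreal (1/2) * (\<integral>\<^sup>+\<omega>. ennreal (?F \<omega>) \<partial>M) + ennreal (1/2) * (\<integral>\<^sup>+\<omega>. ennreal (?G \<omega>) \<partial>M)"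
    by (subst nn_integral_add) (auto simp: nn_integral_cmult)
  also have "\<dots> \<le> ennreal (1/2) * ennreal 2 + ennreal (1/2) * ennreal 2"
    using f g by (intro add_mono mult_left_mono) (auto simp: subgaussian_def)
  also have "\<dots> = 2"
    by (subst (1 2) ennreal_mult'[symmetric]) auto
  finally show ?thesis .
qed

subsection \<open>Quadratic forms\<close>

text \<open>Vectors and matrices are represented by functions on the naturals that are read below
  \<open>p\<close> only. Linear combinations then carry no dimension conditions, and minimisation
  can use the product topology.\<close>

definition bil_form :: "nat \<Rightarrow> (nat \<Rightarrow> nat \<Rightarrow> real) \<Rightarrow> (nat \<Rightarrow> real) \<Rightarrow> (nat \<Rightarrow> real) \<Rightarrow> real" where
  "bil_form p A a b = (\<Sum>j<p. \<Sum>k<p. a j * A j k * b k)"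

definition l1_sum :: "nat \<Rightarrow> (nat \<Rightarrow> real) \<Rightarrow> real" where
  "l1_sum p v = (\<Sum>j<p. \<bar>v j\<bar>)"

definition sq_sum :: "nat \<Rightarrow> (nat \<Rightarrow> real) \<Rightarrow> real" where
  "sq_sum p v = (\<Sum>j<p. (v j)\<^sup>2)"

definition mat_app :: "nat \<Rightarrow> (nat \<Rightarrow> nat \<Rightarrow> real) \<Rightarrow> (nat \<Rightarrow> real) \<Rightarrow> nat \<Rightarrow> real" where
  "mat_app p A v j = (\<Sum>k<p. A j k * v k)"

lemma bil_mv: "bil_form p A a b = (\<Sum>j<p. a j * mat_app p A b j)"
  by (simp add: bil_form_def mat_app_def sum_distrib_left mult.assoc)

lemma bil_add_left: "bil_form p A (\<lambda>j. a j + c j) b = bil_form p A a b + bil_form p A c b"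
  by (simp add: bil_form_def sum.distrib distrib_right)

lemma bil_add_right: "bil_form p A a (\<lambda>j. b j + c j) = bil_form p A a b + bil_form p A a c"
  by (simp add: bil_form_def sum.distrib distrib_left)

lemma bil_scale_left: "bil_form p A (\<lambda>j. c * a j) b = c * bil_form p A a b"
  by (simp add: bil_form_def sum_distrib_left mult_ac)

lemma bil_scale_right: "bil_form p A a (\<lambda>j. c * b j) = c * bil_form p A a b"
  by (simp add: bil_form_def sum_distrib_left mult_ac)

lemma bil_zero: "bil_form p A (\<lambda>_. 0) b = 0"
  by (simp add: bil_form_def)

lemma bil_sym:
  assumes "\<And>j k. j < p \<Longrightarrow> k < p \<Longrightarrow> A j k = A k j"
  shows "bil_form p A a b = bil_form p A b a"
proof -
  have "bil_form p A a b = (\<Sum>k<p. \<Sum>j<p. a j * A j k * b k)"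
    unfolding bil_form_def by (rule sum.swap)
  also have "\<dots> = bil_form p A b a"
    unfolding bil_form_def using assms by (intro sum.cong) (auto simp: mult_ac)
  finally show ?thesis .
qed

lemma bil_add_add:
  assumes "\<And>j k. j < p \<Longrightarrow> k < p \<Longrightarrow> A j k = A k j"
  shows "bil_form p A (\<lambda>j. a j + b j) (\<lambda>j. a j + b j) = bil_form p A a a + 2 * bil_form p A a b + bil_form p A b b"
  using bil_sym[of p A a b, OF assms] by (simp add: bil_add_left bil_add_right)

lemma sum_abs_mult_le_l1:
  assumes "\<And>j. j < p \<Longrightarrow> \<bar>b j\<bar> \<le> c"
  shows "\<bar>\<Sum>j<p. a j * b j\<bar> \<le> c * l1_sum p a"
proof -
  have "\<bar>\<Sum>j<p. a j * b j\<bar> \<le> (\<Sum>j<p. \<bar>a j\<bar> * \<bar>b j\<bar>)"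
    by (rule order_trans[OF sum_abs]) (simp add: abs_mult)
  also have "\<dots> \<le> (\<Sum>j<p. \<bar>a j\<bar> * c)"
    using assms by (intro sum_mono mult_left_mono) auto
  finally show ?thesis
    by (simp add: l1_sum_def sum_distrib_left mult.commute)
qed

lemma bil_abs_le:
  assumes "\<And>j k. j < p \<Longrightarrow> k < p \<Longrightarrow> \<bar>A j k\<bar> \<le> c"
  shows "\<bar>bil_form p A v v\<bar> \<le> c * (l1_sum p v)\<^sup>2"
proof -
  have "\<bar>mat_app p A v j\<bar> \<le> c * l1_sum p v" if "j < p" for j
    using sum_abs_mult_le_l1[of p "A j" c v] assms[OF that] by (simp add: mat_app_def mult.commute)
  then have "\<bar>bil_form p A v v\<bar> \<le> c * l1_sum p v * l1_sum p v"
    unfolding bil_mv by (intro sum_abs_mult_le_l1) auto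
  then show ?thesis
    by (simp add: power2_eq_square mult.assoc)
qed

lemma cauchy_sum_sqrt:
  fixes a b :: "'i \<Rightarrow> real"
  shows "\<bar>\<Sum>i\<in>I. a i * b i\<bar> \<le> sqrt (\<Sum>i\<in>I. (a i)\<^sup>2) * sqrt (\<Sum>i\<in>I. (b i)\<^sup>2)"
  using real_sqrt_le_mono[OF Cauchy_Schwarz_ineq_sum[of a b I]] by (simp add: real_sqrt_mult)

lemma l1_nonneg [simp]: "0 \<le> l1_sum p v"
  by (simp add: l1_sum_def sum_nonneg)

lemma sq_nonneg [simp]: "0 \<le> sq_sum p v"
  by (simp add: sq_sum_def sum_nonneg)

subsection \<open>Sparse approximation of quadratic forms\<close>

text \<open>The pairs code the 2p vertices of the l1 unit ball, so sums of m vertices are indexed by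
  lists over a finite alphabet and can be counted.\<close>

definition signed_unit :: "nat \<times> bool \<Rightarrow> nat \<Rightarrow> real" where
  "signed_unit x j = (if j = fst x then (if snd x then 1 else - 1) else 0)"

definition lattice_sum :: "(nat \<times> bool) list \<Rightarrow> nat \<Rightarrow> real" where
  "lattice_sum xs j = (\<Sum>x\<leftarrow>xs. signed_unit x j)"

lemma lattice_sum_simps [simp]:
  "lattice_sum [] = (\<lambda>j. 0)"
  "lattice_sum (x # xs) = (\<lambda>j. signed_unit x j + lattice_sum xs j)"
  by (auto simp: lattice_sum_def)

lemma signed_unit_sum:
  assumes "j < p"
  shows "(\<Sum>k<p. f k * signed_unit (j, b) k) = f j * (if b then 1 else - 1)"
proof -
  have "(\<Sum>k<p. f k * signed_unit (j, b) k) = (\<Sum>k<p. if k = j then f j * (if b then 1 else - 1) else 0)"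
    by (intro sum.cong) (auto simp: signed_unit_def)
  also have "\<dots> = f j * (if b then 1 else - 1)"
    using assms by simp
  finally show ?thesis .
qed

lemma exists_le_weighted_average:
  fixes w f :: "'i \<Rightarrow> real"
  assumes "finite I" "\<And>i. i \<in> I \<Longrightarrow> 0 \<le> w i" "sum w I = 1"
  shows "\<exists>i\<in>I. f i \<le> (\<Sum>i\<in>I. w i * f i)"
proof (rule ccontr)
  define s where "s = (\<Sum>i\<in>I. w i * f i)"
  assume "\<not> ?thesis"
  then have lt: "i \<in> I \<Longrightarrow> s < f i" for i
    by (auto simp: s_def not_le)
  \<comment> \<open>The weights sum to 1, so some weight is positive; this index makes the
    comparison of the two averages strict.\<close>
  obtain i where i: "i \<in> I" "w i \<noteq> 0"
    using assms(3) by (metis sum.neutral zero_neq_one)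
  have "(\<Sum>i\<in>I. w i * s) < (\<Sum>i\<in>I. w i * f i)"
  proof (rule sum_strict_mono_ex1[OF assms(1)])
    show "\<forall>j\<in>I. w j * s \<le> w j * f j"
      by (auto intro!: mult_left_mono less_imp_le[OF lt] assms(2))
    show "\<exists>j\<in>I. w j * s < w j * f j"
      using assms(2)[OF i(1)] i by (intro bexI[of _ i] mult_strict_left_mono lt) auto
  qed
  then show False
    using assms(3) by (simp add: sum_distrib_right[symmetric] s_def)
qed

text \<open>Derandomised form of Maurey's argument: the right-hand side is the expectation of the
  quadratic form at \<open>a\<close> plus \<open>m\<close> independent signed unit vectors of mean \<open>u\<close>.\<close>

lemma maurey_lattice:
  assumes sym: "\<And>j k. j < p \<Longrightarrow> k < p \<Longrightarrow> A j k = A k j" and u: "l1_sum p u = 1"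
  shows "\<exists>xs. length xs = m \<and> set xs \<subseteq> {..<p} \<times> UNIV \<and>
    bil_form p A (\<lambda>j. a j + lattice_sum xs j) (\<lambda>j. a j + lattice_sum xs j)
    \<le> bil_form p A a a + 2 * real m * bil_form p A a u + real m * (real m - 1) * bil_form p A u u
       + real m * (\<Sum>j<p. \<bar>u j\<bar> * A j j)"
proof (induction m arbitrary: a)
  case 0
  then show ?case by simp
next
  case (Suc m)
  define e where "e j = signed_unit (j, 0 \<le> u j)" for j
  define d where "d = (\<Sum>j<p. \<bar>u j\<bar> * A j j)"
  \<comment> \<open>The bound of the induction hypothesis with \<open>e j\<close> moved into the
    starting point. Averaging it with weights \<open>\<bar>u j\<bar>\<close> plays the role of
    drawing the next signed unit vector at random, and some j does no worse than the
    average.\<close>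
  define f where "f j = bil_form p A (\<lambda>k. a k + e j k) (\<lambda>k. a k + e j k)
    + 2 * real m * bil_form p A (\<lambda>k. a k + e j k) u + real m * (real m - 1) * bil_form p A u u + real m * d" for j
  have "\<exists>j\<in>{..<p}. f j \<le> (\<Sum>j<p. \<bar>u j\<bar> * f j)"
    using u by (intro exists_le_weighted_average) (auto simp: l1_sum_def)
  then obtain j where j: "j < p" "f j \<le> (\<Sum>j<p. \<bar>u j\<bar> * f j)"
    by auto
  have w: "\<bar>u j\<bar> * (if 0 \<le> u j then 1 else - 1) = u j" for j
    by auto
  have mve: "mat_app p A (e j) l = A l j * (if 0 \<le> u j then 1 else - 1)" if "j < p" for j l
    using signed_unit_sum[OF that, of "A l"] by (simp add: e_def mat_app_def)
  have ee: "bil_form p A (e j) (e j) = A j j" if "j < p" for j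
  proof -
    have "bil_form p A (e j) (e j) = (\<Sum>l<p. A l j * (if 0 \<le> u j then 1 else - 1) * e j l)"
      unfolding bil_mv using mve[OF that] by (simp add: mult_ac)
    also have "\<dots> = A j j"
      using signed_unit_sum[OF that] by (simp add: e_def)
    finally show ?thesis .
  qed
  \<comment> \<open>The signed unit vectors have mean \<open>u\<close> under the weights, so linear
    terms average to their value at \<open>u\<close>; only the diagonal entries remember the
    individual vectors.\<close>
  have avg: "(\<Sum>j<p. \<bar>u j\<bar> * bil_form p A b (e j)) = bil_form p A b u" for b
  proof -
    have "\<bar>u j\<bar> * bil_form p A b (e j) = (\<Sum>l<p. b l * A l j * u j)" if "j < p" for j
    proof -
      have "\<bar>u j\<bar> * bil_form p A b (e j) = (\<Sum>l<p. b l * A l j * (\<bar>u j\<bar> * (if 0 \<le> u j then 1 else - 1)))"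
        unfolding bil_mv mve[OF that] sum_distrib_left by (simp add: mult_ac)
      then show ?thesis
        by (simp only: w)
    qed
    then have "(\<Sum>j<p. \<bar>u j\<bar> * bil_form p A b (e j)) = (\<Sum>j<p. \<Sum>l<p. b l * A l j * u j)"
      by simp
    also have "\<dots> = bil_form p A b u"
      unfolding bil_form_def by (rule sum.swap)
    finally show ?thesis .
  qed
  have fform: "f j = bil_form p A a a + 2 * bil_form p A a (e j) + A j j + 2 * real m * (bil_form p A a u + bil_form p A u (e j))
      + real m * (real m - 1) * bil_form p A u u + real m * d" if "j < p" for j
  proof -
    have "bil_form p A (\<lambda>k. a k + e j k) (\<lambda>k. a k + e j k) = bil_form p A a a + 2 * bil_form p A a (e j) + A j j"
      using bil_add_add[of p A a "e j", OF sym] ee[OF that] by simp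
    moreover have "bil_form p A (\<lambda>k. a k + e j k) u = bil_form p A a u + bil_form p A u (e j)"
      using bil_sym[of p A "e j" u, OF sym] by (simp add: bil_add_left)
    ultimately show ?thesis
      by (simp add: f_def)
  qed
  have "(\<Sum>j<p. \<bar>u j\<bar> * f j)
      = (\<Sum>j<p. \<bar>u j\<bar> * (bil_form p A a a + 2 * real m * bil_form p A a u
          + real m * (real m - 1) * bil_form p A u u + real m * d)
          + 2 * (\<bar>u j\<bar> * bil_form p A a (e j)) + \<bar>u j\<bar> * A j j + 2 * real m * (\<bar>u j\<bar> * bil_form p A u (e j)))"
    by (intro sum.cong refl) (simp only: lessThan_iff fform, simp add: algebra_simps)
  also have "\<dots> = bil_form p A a a + 2 * real m * bil_form p A a u
          + real m * (real m - 1) * bil_form p A u u + real m * d + 2 * bil_form p A a u + d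
          + 2 * real m * bil_form p A u u"
    using u by (simp add: sum.distrib sum_distrib_left[symmetric] sum_distrib_right[symmetric] avg d_def l1_sum_def)
  \<comment> \<open>The new cross term contributes 2 m to the factor m (m - 1) of the form at
    \<open>u\<close>, which gives (m + 1) m.\<close>
  also have "\<dots> = bil_form p A a a + 2 * real (Suc m) * bil_form p A a u
          + real (Suc m) * (real (Suc m) - 1) * bil_form p A u u + real (Suc m) * d"
    by (simp add: algebra_simps)
  finally have fj: "f j \<le> \<dots>"
    using j by simp
  obtain xs where xs: "length xs = m" "set xs \<subseteq> {..<p} \<times> UNIV"
    "bil_form p A (\<lambda>k. (a k + e j k) + lattice_sum xs k) (\<lambda>k. (a k + e j k) + lattice_sum xs k) \<le> f j"
    using Suc.IH[of "\<lambda>k. a k + e j k"] unfolding f_def d_def by blast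
  show ?case
    using xs j fj
    by (intro exI[of _ "(j, 0 \<le> u j) # xs"]) (auto simp: e_def add.assoc d_def)
qed

text \<open>After normalising \<open>v\<close> to l1 norm 1, some sum of m signed unit vectors has
  form at most m (m - 1) Q(v) + m c. Nonnegativity there gives Q(v) \<ge> - c / (m - 1), and
  homogeneity restores the scale of \<open>v\<close>.\<close>

lemma quadratic_form_lower_bound_of_lattice:
  assumes sym: "\<And>j k. j < p \<Longrightarrow> k < p \<Longrightarrow> A j k = A k j" and m: "2 \<le> m"
    and pos: "\<And>xs. length xs = m \<Longrightarrow> set xs \<subseteq> {..<p} \<times> UNIV \<Longrightarrow>
      0 \<le> bil_form p A (lattice_sum xs) (lattice_sum xs)"
    and d: "\<And>j. j < p \<Longrightarrow> A j j \<le> c" 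
  shows "- (c / (real m - 1)) * (l1_sum p v)\<^sup>2 \<le> bil_form p A v v"
proof (cases "l1_sum p v = 0")
  case True
  then have "\<And>j. j < p \<Longrightarrow> v j = 0"
    by (simp add: l1_sum_def sum_nonneg_eq_0_iff)
  then have "bil_form p A v v = 0"
    by (simp add: bil_form_def)
  then show ?thesis
    using True by simp
next
  case False
  then have r: "0 < l1_sum p v"
    using l1_nonneg[of p v] by linarith
  define u where "u j = (1 / l1_sum p v) * v j" for j
  have u1: "l1_sum p u = 1"
    using r by (simp add: l1_sum_def u_def abs_mult sum_divide_distrib[symmetric])
  obtain xs where xs: "length xs = m" "set xs \<subseteq> {..<p} \<times> UNIV"
    "bil_form p A (lattice_sum xs) (lattice_sum xs)
      \<le> real m * (real m - 1) * bil_form p A u u + real m * (\<Sum>j<p. \<bar>u j\<bar> * A j j)"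
    using maurey_lattice[of p A u m "\<lambda>_. 0", OF sym u1] by (auto simp: bil_zero)
  have "(\<Sum>j<p. \<bar>u j\<bar> * A j j) \<le> (\<Sum>j<p. \<bar>u j\<bar> * c)"
    using d by (intro sum_mono mult_left_mono) auto
  also have "\<dots> = c"
    using u1 by (simp add: sum_distrib_right[symmetric] l1_sum_def)
  finally have "real m * (\<Sum>j<p. \<bar>u j\<bar> * A j j) \<le> real m * c"
    by (intro mult_left_mono) auto
  then have "0 \<le> real m * ((real m - 1) * bil_form p A u u + c)"
    using pos[OF xs(1,2)] xs(3) by (simp add: algebra_simps)
  then have "- c \<le> (real m - 1) * bil_form p A u u"
    using m by (simp add: zero_le_mult_iff)
  then have lb: "- (c / (real m - 1)) \<le> bil_form p A u u"
    using m by (simp add: field_simps)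
  moreover have "bil_form p A v v = (l1_sum p v)\<^sup>2 * bil_form p A u u"
  proof -
    have "bil_form p A v v = bil_form p A (\<lambda>j. l1_sum p v * u j) (\<lambda>j. l1_sum p v * u j)"
      using r by (simp add: u_def)
    then show ?thesis
      by (simp add: bil_scale_left bil_scale_right power2_eq_square)
  qed
  ultimately show ?thesis
    using mult_left_mono[OF lb, of "(l1_sum p v)\<^sup>2"] by (simp add: mult.commute)
qed

subsection \<open>Two-stage estimation, one column at a time\<close>

text \<open>Comparing the objective at \<open>g\<close> and \<open>om\<close> suffices: since the
  residual of \<open>om\<close> is at most half the penalty level, the error outside the support is
  at most three times the error inside it. On that cone the negative term of the curvature bound
  consumes at most half of \<open>\<kappa>\<close>. The final constant is 4 * 6, the 4 from the cone
  and the 6 from the basic inequality.\<close>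

lemma lasso_column_error:
  assumes sym: "\<And>j k. j < p \<Longrightarrow> k < p \<Longrightarrow> S j k = S k j"
    and psd: "\<And>v. 0 \<le> bil_form p S v v"
    and re: "\<And>v. \<kappa> * sq_sum p v - \<gamma> * (l1_sum p v)\<^sup>2 \<le> bil_form p S v v"
    and c: "0 < \<kappa>" "0 \<le> \<gamma>" "0 < r" "32 * \<gamma> * real s \<le> \<kappa>"
    and j: "j < p"
    and om: "\<And>l. l < p \<Longrightarrow> \<bar>mat_app p S om l - (if l = j then 1 else 0)\<bar> \<le> r / 2"
    and s: "card {l. l < p \<and> om l \<noteq> 0} \<le> s"
    and opt: "(1/2) * bil_form p S g g - g j + r * l1_sum p g \<le> (1/2) * bil_form p S om om - om j + r * l1_sum p om"
  shows "l1_sum p (\<lambda>l. g l - om l) \<le> 24 * r * real s / \<kappa>"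
proof -
  define \<Delta> where "\<Delta> l = g l - om l" for l
  define T where "T = {l. l < p \<and> om l \<noteq> 0}"
  define NT NC where "NT = (\<Sum>l\<in>T. \<bar>\<Delta> l\<bar>)" and "NC = (\<Sum>l\<in>{..<p}-T. \<bar>\<Delta> l\<bar>)"
  have T: "T \<subseteq> {..<p}" "finite T"
    by (auto simp: T_def)
  have NN: "0 \<le> NT" "0 \<le> NC"
    by (auto simp: NT_def NC_def sum_nonneg)
  have split: "(\<Sum>l<p. f l) = (\<Sum>l\<in>T. f l) + (\<Sum>l\<in>{..<p}-T. f l)" for f :: "nat \<Rightarrow> real"
    using sum.subset_diff[OF T(1), of f] by simp
  have l1_sum\<Delta>: "l1_sum p \<Delta> = NT + NC"
    by (simp add: l1_sum_def split NT_def NC_def)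
  have g: "g = (\<lambda>l. om l + \<Delta> l)"
    by (auto simp: \<Delta>_def)
  have "l1_sum p om - l1_sum p g \<le> NT - NC"
  proof -
    have "l1_sum p om - l1_sum p g = (\<Sum>l<p. \<bar>om l\<bar> - \<bar>g l\<bar>)"
      by (simp add: l1_sum_def sum_subtractf)
    also have "\<dots> = (\<Sum>l\<in>T. \<bar>om l\<bar> - \<bar>g l\<bar>) + (\<Sum>l\<in>{..<p}-T. \<bar>om l\<bar> - \<bar>g l\<bar>)"
      by (rule split)
    also have "\<dots> \<le> (\<Sum>l\<in>T. \<bar>\<Delta> l\<bar>) + (\<Sum>l\<in>{..<p}-T. - \<bar>\<Delta> l\<bar>)"
      by (intro add_mono sum_mono) (auto simp: \<Delta>_def T_def)
    finally show ?thesis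
      by (simp add: NT_def NC_def sum_negf)
  qed
  then have a: "r * (l1_sum p om - l1_sum p g) \<le> r * (NT - NC)"
    using c by (intro mult_left_mono) auto
  \<comment> \<open>The linear part of the objective at \<open>om\<close>, in direction
    \<open>\<Delta>\<close>, is \<open>\<Delta>\<close> paired with the residual S om - e_j.\<close>
  have "bil_form p S \<Delta> om - \<Delta> j = (\<Sum>l<p. \<Delta> l * (mat_app p S om l - (if l = j then 1 else 0)))"
  proof -
    have "(\<Sum>l<p. \<Delta> l * (if l = j then 1 else 0)) = \<Delta> j"
      using j by (simp add: if_distrib[of "\<lambda>x. _ * x"] cong: if_cong)
    then show ?thesis
      by (simp add: bil_mv right_diff_distrib sum_subtractf)
  qed
  moreover have "\<bar>\<Sum>l<p. \<Delta> l * (mat_app p S om l - (if l = j then 1 else 0))\<bar> \<le> r / 2 * l1_sum p \<Delta>"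
    using om by (intro sum_abs_mult_le_l1) auto
  ultimately have b: "- (r / 2 * (NT + NC)) \<le> bil_form p S \<Delta> om - \<Delta> j"
    unfolding l1_sum\<Delta> by linarith
  have "bil_form p S g g = bil_form p S om om + 2 * bil_form p S \<Delta> om + bil_form p S \<Delta> \<Delta>"
    unfolding g using bil_add_add[of p S om \<Delta>, OF sym] bil_sym[of p S om \<Delta>, OF sym] by simp
  then have "(1/2) * bil_form p S \<Delta> \<Delta> + bil_form p S \<Delta> om - \<Delta> j \<le> r * (l1_sum p om - l1_sum p g)"
    using opt unfolding right_diff_distrib by (simp add: \<Delta>_def add_divide_distrib)
  then have "(1/2) * bil_form p S \<Delta> \<Delta> \<le> r / 2 * (NT + NC) + r * (NT - NC)"
    using a b by linarith
  then have main: "bil_form p S \<Delta> \<Delta> \<le> r * (3 * NT - NC)"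
    by (simp add: algebra_simps add_divide_distrib)
  then have "0 \<le> r * (3 * NT - NC)"
    using psd[of \<Delta>] by linarith
  then have cone: "NC \<le> 3 * NT"
    using c by (simp add: zero_le_mult_iff)
  have "NT\<^sup>2 \<le> (\<Sum>l\<in>T. \<bar>\<Delta> l\<bar>\<^sup>2) * real (card T)"
    unfolding NT_def by (rule sum_squared_le_sum_of_squares)
  also have "\<dots> \<le> sq_sum p \<Delta> * real s"
    using T s by (intro mult_mono) (auto simp: sq_sum_def T_def intro!: sum_mono2 sum_nonneg)
  finally have NT2: "NT\<^sup>2 \<le> real s * sq_sum p \<Delta>"
    by (simp add: mult.commute)
  \<comment> \<open>Squaring gives the factor 16; asking that the term with \<open>\<gamma>\<close>
    use only half of \<open>\<kappa>\<close> doubles it to the 32 of the hypothesis.\<close>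
  have l4: "l1_sum p \<Delta> \<le> 4 * NT"
    using cone l1_sum\<Delta> by simp
  then have "(l1_sum p \<Delta>)\<^sup>2 \<le> (4 * NT)\<^sup>2"
    by (intro power_mono) auto
  then have "\<gamma> * (l1_sum p \<Delta>)\<^sup>2 \<le> \<gamma> * (16 * (real s * sq_sum p \<Delta>))"
    using NT2 c by (intro mult_left_mono) auto
  also have "\<dots> = (32 * \<gamma> * real s) * sq_sum p \<Delta> / 2"
    by simp
  also have "\<dots> \<le> \<kappa> * sq_sum p \<Delta> / 2"
    using c by (intro divide_right_mono mult_right_mono) auto
  finally have "\<kappa> * sq_sum p \<Delta> / 2 \<le> r * (3 * NT - NC)"
    using re[of \<Delta>] main by simp
  also have "\<dots> \<le> r * (3 * NT)"
    using c NN by (intro mult_left_mono) auto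
  finally have k: "\<kappa> * sq_sum p \<Delta> \<le> 6 * r * NT"
    by simp
  have "\<kappa> * (NT * NT) \<le> real s * (\<kappa> * sq_sum p \<Delta>)"
    using mult_left_mono[OF NT2, of \<kappa>] c by (simp add: power2_eq_square mult_ac)
  also have "\<dots> \<le> real s * (6 * r * NT)"
    using k by (intro mult_left_mono) auto
  finally have "NT * (\<kappa> * NT) \<le> NT * (6 * r * real s)"
    by (simp add: mult_ac)
  then have "\<kappa> * NT \<le> 6 * r * real s"
    using NN c by (cases "NT = 0") (auto simp: mult_le_cancel_left)
  then have "\<kappa> * l1_sum p \<Delta> \<le> 24 * r * real s"
    using mult_left_mono[OF l4, of \<kappa>] c(1) by linarith
  then show ?thesis
    using c unfolding \<Delta>_def[abs_def] by (simp add: field_simps)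
qed

text \<open>The stage-two error need not lie in the cone of the lasso error, so its l1 bound takes
  the place of the cone condition. The term with \<open>\<gamma>\<close> and the duality bound of
  the form by sup norm times l1 norm each contribute 72, which makes 144.\<close>

lemma l2_error_of_l1_error:
  fixes \<Delta> :: "nat \<Rightarrow> real"
  assumes re: "\<kappa> * sq_sum p \<Delta> - \<gamma> * (l1_sum p \<Delta>)\<^sup>2 \<le> bil_form p S \<Delta> \<Delta>"
    and c: "0 < \<kappa>" "0 \<le> \<gamma>" "0 < r" "32 * \<gamma> * real s \<le> \<kappa>"
    and e: "\<And>l. l < p \<Longrightarrow> \<bar>mat_app p S \<Delta> l\<bar> \<le> 3 * r / 2"
    and l: "l1_sum p \<Delta> \<le> 48 * r * real s / \<kappa>"
  shows "sq_sum p \<Delta> \<le> 144 * r\<^sup>2 * real s / \<kappa>\<^sup>2"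
proof -
  define L where "L = 48 * r * real s / \<kappa>"
  have "bil_form p S \<Delta> \<Delta> \<le> 3 * r / 2 * l1_sum p \<Delta>"
    using sum_abs_mult_le_l1[of p "mat_app p S \<Delta>" "3 * r / 2" \<Delta>, OF e] by (simp add: bil_mv)
  also have "\<dots> \<le> 3 * r / 2 * L"
    using c l by (intro mult_left_mono) (auto simp: L_def)
  finally have "\<kappa> * sq_sum p \<Delta> \<le> \<gamma> * (l1_sum p \<Delta>)\<^sup>2 + 3 * r / 2 * L"
    using re by simp
  also have "\<gamma> * (l1_sum p \<Delta>)\<^sup>2 \<le> \<gamma> * L\<^sup>2"
    using l c by (intro mult_left_mono power_mono) (auto simp: L_def)
  also have "\<gamma> * L\<^sup>2 = (32 * \<gamma> * real s) * (72 * r\<^sup>2 * real s / \<kappa>\<^sup>2)"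
    by (simp add: L_def power2_eq_square)
  also have "\<dots> \<le> \<kappa> * (72 * r\<^sup>2 * real s / \<kappa>\<^sup>2)"
    using c by (intro mult_right_mono) auto
  also have "\<kappa> * (72 * r\<^sup>2 * real s / \<kappa>\<^sup>2) + 3 * r / 2 * L = \<kappa> * (144 * r\<^sup>2 * real s / \<kappa>\<^sup>2)"
    using c by (simp add: L_def power2_eq_square)
  finally have "\<kappa> * sq_sum p \<Delta> \<le> \<kappa> * (144 * r\<^sup>2 * real s / \<kappa>\<^sup>2)"
    by simp
  then show ?thesis
    using c(1) by (rule mult_left_le_imp_le)
qed

text \<open>Schur's test: by symmetry the column bound is also a row bound, and Cauchy-Schwarz is
  applied with \<bar>E\<bar> split into two square roots. This is one reason for the symmetry
  constraint in stage two.\<close>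

lemma sq_mv_le_schur:
  assumes sym: "\<And>j k. j < p \<Longrightarrow> k < p \<Longrightarrow> E j k = E k j"
    and L: "\<And>k. k < p \<Longrightarrow> l1_sum p (\<lambda>j. E j k) \<le> L"
  shows "sq_sum p (mat_app p E x) \<le> L\<^sup>2 * sq_sum p x"
proof -
  have row: "(\<Sum>k<p. \<bar>E j k\<bar>) \<le> L" if "j < p" for j
  proof -
    have "(\<Sum>k<p. \<bar>E j k\<bar>) = l1_sum p (\<lambda>k. E k j)"
      unfolding l1_sum_def using sym that by (intro sum.cong) auto
    then show ?thesis using L[OF that] by simp
  qed
  have "(mat_app p E x j)\<^sup>2 \<le> L * (\<Sum>k<p. \<bar>E j k\<bar> * (x k)\<^sup>2)" if j: "j < p" for j
  proof -
    have "(mat_app p E x j)\<^sup>2 \<le> (\<Sum>k<p. \<bar>E j k\<bar> * \<bar>x k\<bar>)\<^sup>2"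
      unfolding mat_app_def by (rule power2_le_iff_abs_le[THEN iffD2])
        (auto intro!: sum_nonneg order_trans[OF sum_abs] sum_mono simp: abs_mult)
    also have "\<dots> = (\<Sum>k<p. sqrt \<bar>E j k\<bar> * (sqrt \<bar>E j k\<bar> * \<bar>x k\<bar>))\<^sup>2"
      by (simp add: mult.assoc[symmetric])
    also have "\<dots> \<le> (\<Sum>k<p. (sqrt \<bar>E j k\<bar>)\<^sup>2) * (\<Sum>k<p. (sqrt \<bar>E j k\<bar> * \<bar>x k\<bar>)\<^sup>2)"
      by (rule Cauchy_Schwarz_ineq_sum)
    also have "\<dots> = (\<Sum>k<p. \<bar>E j k\<bar>) * (\<Sum>k<p. \<bar>E j k\<bar> * (x k)\<^sup>2)"
      by (simp add: power_mult_distrib)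
    also have "\<dots> \<le> L * (\<Sum>k<p. \<bar>E j k\<bar> * (x k)\<^sup>2)"
      using row[OF j] by (intro mult_right_mono sum_nonneg) auto
    finally show ?thesis .
  qed
  then have "sq_sum p (mat_app p E x) \<le> (\<Sum>j<p. L * (\<Sum>k<p. \<bar>E j k\<bar> * (x k)\<^sup>2))"
    unfolding sq_sum_def by (intro sum_mono) auto
  also have "\<dots> = L * (\<Sum>k<p. (\<Sum>j<p. \<bar>E j k\<bar> * (x k)\<^sup>2))"
    by (subst sum.swap) (simp add: sum_distrib_left)
  also have "\<dots> \<le> L * (\<Sum>k<p. L * (x k)\<^sup>2)"
  proof (cases "p = 0")
    case False
    then have "0 \<le> L"
      using L[of 0] l1_nonneg[of p "\<lambda>j. E j 0"] by (meson gr0I order_trans)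
    then show ?thesis
      using L by (intro mult_left_mono sum_mono)
        (auto simp: sum_distrib_right[symmetric] l1_sum_def intro!: mult_right_mono)
  qed simp
  also have "\<dots> = L\<^sup>2 * sq_sum p x"
    by (simp add: sq_sum_def sum_distrib_left power2_eq_square mult.assoc)
  finally show ?thesis .
qed

text \<open>Only the columns in the support of \<open>x\<close> act on it, so the Frobenius norm of
  these columns bounds the operator. It improves on \<open>sq_mv_le_schur\<close> when the support
  is small.\<close>

lemma sq_mv_le_support:
  assumes q: "\<And>k. k < p \<Longrightarrow> sq_sum p (\<lambda>j. E j k) \<le> q"
  shows "sq_sum p (mat_app p E x) \<le> real (card {k. k < p \<and> x k \<noteq> 0}) * q * sq_sum p x"
proof -
  define T where "T = {k. k < p \<and> x k \<noteq> 0}"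
  have T: "T \<subseteq> {..<p}" "finite T"
    by (auto simp: T_def)
  have "(mat_app p E x j)\<^sup>2 \<le> (\<Sum>k\<in>T. (E j k)\<^sup>2) * sq_sum p x" for j
  proof -
    have "mat_app p E x j = (\<Sum>k\<in>T. E j k * x k)"
      unfolding mat_app_def by (rule sum.mono_neutral_right) (auto simp: T_def)
    then have "(mat_app p E x j)\<^sup>2 \<le> (\<Sum>k\<in>T. (E j k)\<^sup>2) * (\<Sum>k\<in>T. (x k)\<^sup>2)"
      by (simp add: Cauchy_Schwarz_ineq_sum)
    also have "(\<Sum>k\<in>T. (x k)\<^sup>2) = sq_sum p x"
      unfolding sq_sum_def by (rule sum.mono_neutral_left) (auto simp: T_def)
    finally show ?thesis .
  qed
  then have "sq_sum p (mat_app p E x) \<le> (\<Sum>j<p. (\<Sum>k\<in>T. (E j k)\<^sup>2) * sq_sum p x)"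
    unfolding sq_sum_def by (intro sum_mono) auto
  also have "\<dots> = (\<Sum>k\<in>T. sq_sum p (\<lambda>j. E j k)) * sq_sum p x"
    unfolding sum_distrib_right[symmetric] by (subst sum.swap) (simp add: sq_sum_def)
  also have "\<dots> \<le> (\<Sum>k\<in>T. q) * sq_sum p x"
    using T q by (intro mult_right_mono sum_mono) auto
  finally show ?thesis
    by (simp add: T_def)
qed

lemma l1_mv_le:
  assumes L: "\<And>k. k < p \<Longrightarrow> l1_sum p (\<lambda>j. E j k) \<le> L"
  shows "l1_sum p (mat_app p E x) \<le> L * l1_sum p x"
proof -
  have "l1_sum p (mat_app p E x) \<le> (\<Sum>j<p. \<Sum>k<p. \<bar>E j k\<bar> * \<bar>x k\<bar>)"
    unfolding l1_sum_def mat_app_def by (intro sum_mono order_trans[OF sum_abs]) (simp add: abs_mult)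
  also have "\<dots> = (\<Sum>k<p. l1_sum p (\<lambda>j. E j k) * \<bar>x k\<bar>)"
    by (subst sum.swap) (simp add: l1_sum_def sum_distrib_right)
  also have "\<dots> \<le> (\<Sum>k<p. L * \<bar>x k\<bar>)"
    using L by (intro sum_mono mult_right_mono) auto
  finally show ?thesis
    by (simp add: l1_sum_def sum_distrib_left)
qed

subsection \<open>Extremal eigenvalues\<close>

abbreviation entry :: "real mat \<Rightarrow> nat \<Rightarrow> nat \<Rightarrow> real" where
  "entry A j k \<equiv> A $$ (j, k)"

text \<open>A box in the space of functions is compact by Tychonoff's theorem, so coordinatewise
  bounds replace a norm bound and the dimension does not appear in the type.\<close>

lemma attains_min_on_closed_bounded:
  fixes f :: "('i \<Rightarrow> real) \<Rightarrow> real"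
  assumes cont: "continuous_on UNIV f" and cl: "closed C" and ne: "C \<noteq> {}"
    and bd: "\<And>g i. g \<in> C \<Longrightarrow> \<bar>g i\<bar> \<le> B i"
  shows "\<exists>g\<in>C. \<forall>h\<in>C. f g \<le> f h"
proof -
  let ?K = "PiE UNIV (\<lambda>i. {- B i..B i})"
  have "compactin (product_topology (\<lambda>_::'i. euclidean :: real topology) UNIV) ?K"
    by (subst compactin_PiE) (auto simp: compactin_euclidean_iff)
  then have "compact ?K"
    by (simp add: euclidean_product_topology compactin_euclidean_iff)
  moreover have "C \<subseteq> ?K"
  proof
    fix g assume "g \<in> C"
    then have "\<bar>g i\<bar> \<le> B i" for i by (rule bd)
    then show "g \<in> ?K"
      by (auto simp: abs_le_iff minus_le_iff)
  qed
  ultimately have "compact C"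
    using cl by (metis compact_Int_closed inf.absorb_iff2)
  then show ?thesis
    using continuous_attains_inf[of C f] ne continuous_on_subset[OF cont, of C] by auto
qed

lemma continuous_on_Max:
  fixes f :: "'i \<Rightarrow> 'a::topological_space \<Rightarrow> real"
  assumes "finite I" "I \<noteq> {}" "\<And>i. i \<in> I \<Longrightarrow> continuous_on A (f i)"
  shows "continuous_on A (\<lambda>x. Max ((\<lambda>i. f i x) ` I))"
  using assms
proof (induction I rule: finite_ne_induct)
  case (insert i I)
  then have "continuous_on A (\<lambda>x. max (f i x) (Max ((\<lambda>i. f i x) ` I)))"
    by (intro continuous_on_max) auto
  then show ?case
    using insert by simp
qed auto

text \<open>First-order optimality without derivatives: a quadratic in t that vanishes at 0 and is
  never negative has no linear term. It yields both the eigenvector equation and the normal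
  equations of the regression target.\<close>

lemma linear_coefficient_zero:
  fixes b c :: real
  assumes "\<And>t. 0 \<le> 2 * t * b + t\<^sup>2 * c"
  shows "b = 0"
proof (rule ccontr)
  assume "b \<noteq> 0"
  define d where "d = \<bar>c\<bar> + 1"
  have d: "0 < d" "c \<le> d"
    by (auto simp: d_def)
  define t where "t = - b / d"
  have "t\<^sup>2 * c \<le> t\<^sup>2 * d"
    using d by (intro mult_left_mono) auto
  moreover have "t\<^sup>2 * d = b\<^sup>2 / d" "2 * t * b = - 2 * (b\<^sup>2 / d)"
    using d by (simp_all add: t_def power2_eq_square)
  moreover have "0 < b\<^sup>2 / d"
    using \<open>b \<noteq> 0\<close> d by (intro divide_pos_pos) auto
  ultimately show False
    using assms[of t] by linarith
qed

lemma sq_add: "sq_sum p (\<lambda>j. a j + t * b j) = sq_sum p a + 2 * t * (\<Sum>j<p. a j * b j) + t\<^sup>2 * sq_sum p b"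
  by (simp add: sq_sum_def power2_sum power_mult_distrib sum.distrib sum_distrib_left algebra_simps)

lemma sq_eq_0: "sq_sum p v = 0 \<Longrightarrow> j < p \<Longrightarrow> v j = 0"
  by (simp add: sq_sum_def sum_nonneg_eq_0_iff)

lemma bil_restrict: "bil_form p A (\<lambda>j. if j < p then a j else 0) (\<lambda>j. if j < p then b j else 0) = bil_form p A a b"
  by (simp add: bil_form_def)

lemma sq_restrict: "sq_sum p (\<lambda>j. if j < p then a j else 0) = sq_sum p a"
  by (simp add: sq_sum_def)

lemma sq_scale: "sq_sum p (\<lambda>j. c * v j) = c\<^sup>2 * sq_sum p v"
  by (simp add: sq_sum_def power_mult_distrib sum_distrib_left)

text \<open>A minimiser of the Rayleigh quotient on the sphere is perturbed in the direction of its
  own residual A v - \<mu> v. The linear coefficient is then the squared length of the residual,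
  which therefore vanishes.\<close>

lemma smallest_eigenvector:
  assumes p: "0 < p" and sym: "\<And>j k. j < p \<Longrightarrow> k < p \<Longrightarrow> A j k = A k j"
  shows "\<exists>\<mu> v. sq_sum p v = 1 \<and> (\<forall>j<p. mat_app p A v j = \<mu> * v j) \<and> (\<forall>x. \<mu> * sq_sum p x \<le> bil_form p A x x)"
proof -
  define C where "C = {v::nat \<Rightarrow> real. (\<forall>j. p \<le> j \<longrightarrow> v j = 0) \<and> sq_sum p v = 1}"
  have "closed C"
    unfolding C_def sq_sum_def
    by (intro closed_Collect_conj closed_Collect_all closed_Collect_imp closed_Collect_eq
        open_Collect_const continuous_intros continuous_on_product_coordinates)
  moreover have "(\<lambda>j. if j = 0 then 1 else 0) \<in> C"
    using p by (auto simp: C_def sq_sum_def if_distrib[of "\<lambda>x. x\<^sup>2"] cong: if_cong)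
  moreover have "\<bar>g i\<bar> \<le> 1" if "g \<in> C" for g i
  proof (cases "i < p")
    case True
    then have "(g i)\<^sup>2 \<le> sq_sum p g"
      unfolding sq_sum_def by (intro member_le_sum) auto
    then show ?thesis
      using that by (simp add: C_def abs_square_le_1)
  qed (use that in \<open>auto simp: C_def\<close>)
  moreover have "continuous_on UNIV (\<lambda>v. bil_form p A v v)"
    unfolding bil_form_def by (intro continuous_intros continuous_on_product_coordinates)
  ultimately obtain v where v: "v \<in> C" "\<And>x. x \<in> C \<Longrightarrow> bil_form p A v v \<le> bil_form p A x x"
    using attains_min_on_closed_bounded[of "\<lambda>v. bil_form p A v v" C "\<lambda>_. 1"] by blast
  define \<mu> where "\<mu> = bil_form p A v v"
  have v1: "sq_sum p v = 1"
    using v(1) by (simp add: C_def)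
  have min: "\<mu> * sq_sum p x \<le> bil_form p A x x" for x
  proof (cases "sq_sum p x = 0")
    case True
    then have "bil_form p A x x = 0"
      by (simp add: bil_form_def sq_eq_0)
    then show ?thesis using True by simp
  next
    case False
    then have pos: "0 < sq_sum p x"
      using sq_nonneg[of p x] by linarith
    \<comment> \<open>Truncating beyond \<open>p\<close> puts the normalised vector into
      \<open>C\<close> and leaves both forms unchanged.\<close>
    define y where "y = (\<lambda>j. if j < p then (1 / sqrt (sq_sum p x)) * x j else 0)"
    have "sq_sum p y = (1 / sqrt (sq_sum p x))\<^sup>2 * sq_sum p x"
      by (simp only: y_def sq_restrict sq_scale)
    then have "sq_sum p y = 1"
      using pos by (simp add: power_divide)
    then have "\<mu> \<le> bil_form p A y y"
      unfolding \<mu>_def by (intro v(2)) (auto simp: C_def y_def)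
    also have "\<dots> = bil_form p A x x / sq_sum p x"
      unfolding y_def bil_restrict bil_scale_left bil_scale_right
      using pos by (simp add: real_sqrt_mult_self)
    finally show ?thesis
      using pos by (simp add: field_simps)
  qed
  define x where "x = (\<lambda>j. mat_app p A v j - \<mu> * v j)"
  have "bil_form p A v x - \<mu> * (\<Sum>j<p. v j * x j) = 0"
  proof (rule linear_coefficient_zero)
    fix t
    have "bil_form p A (\<lambda>j. v j + t * x j) (\<lambda>j. v j + t * x j)
        = bil_form p A v v + 2 * (t * bil_form p A v x) + t * (t * bil_form p A x x)"
      using bil_add_add[of p A v "\<lambda>j. t * x j", OF sym] by (simp only: bil_scale_left bil_scale_right)
    then show "0 \<le> 2 * t * (bil_form p A v x - \<mu> * (\<Sum>j<p. v j * x j)) + t\<^sup>2 * (bil_form p A x x - \<mu> * sq_sum p x)"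
      using min[of "\<lambda>j. v j + t * x j"] v1
      by (simp add: sq_add \<mu>_def algebra_simps power2_eq_square)
  qed
  moreover have "bil_form p A v x - \<mu> * (\<Sum>j<p. v j * x j) = sq_sum p x"
  proof -
    have "bil_form p A v x = (\<Sum>j<p. x j * mat_app p A v j)"
      using bil_sym[of p A v x, OF sym] by (simp add: bil_mv)
    then have "bil_form p A v x - \<mu> * (\<Sum>j<p. v j * x j) = (\<Sum>j<p. x j * mat_app p A v j - \<mu> * (v j * x j))"
      by (simp add: sum_subtractf sum_distrib_left)
    also have "\<dots> = sq_sum p x"
      unfolding sq_sum_def by (intro sum.cong) (auto simp: x_def power2_eq_square algebra_simps)
    finally show ?thesis .
  qed
  ultimately have "\<forall>j<p. mat_app p A v j = \<mu> * v j"
    using sq_eq_0[of p x] by (simp add: x_def)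
  then show ?thesis
    using v1 min by blast
qed

lemma eigenvalue_of_mv:
  assumes A: "A \<in> carrier_mat p p" and v: "sq_sum p v = 1" "\<forall>j<p. mat_app p (entry A) v j = \<mu> * v j"
  shows "\<mu> \<in> spectrum A"
proof -
  have "A *\<^sub>v vec p v = \<mu> \<cdot>\<^sub>v vec p v"
    using A v(2) by (intro eq_vecI) (auto simp: scalar_prod_def mat_app_def atLeast0LessThan)
  moreover have "vec p v \<noteq> 0\<^sub>v p"
  proof
    assume "vec p v = 0\<^sub>v p"
    then have "v j = 0" if "j < p" for j
      using that by (metis index_vec index_zero_vec(1))
    then show False
      using v(1) by (simp add: sq_sum_def)
  qed
  ultimately show ?thesis
    using A by (auto simp: spectrum_def eigenvalue_def eigenvector_def intro!: exI[of _ "vec p v"])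
qed

text \<open>The minimum of the Rayleigh quotient is itself an element of the spectrum, hence at
  least the least eigenvalue. The bound by \<open>lambda_max\<close> is the same argument for -
  A.\<close>

lemma lambda_min_le_quadratic_form:
  assumes "A \<in> carrier_mat p p" "0 < p" "\<And>j k. j < p \<Longrightarrow> k < p \<Longrightarrow> entry A j k = entry A k j"
  shows "lambda_min A * sq_sum p x \<le> bil_form p (entry A) x x"
proof -
  obtain \<mu> v where m: "sq_sum p v = 1" "\<forall>j<p. mat_app p (entry A) v j = \<mu> * v j"
    "\<forall>x. \<mu> * sq_sum p x \<le> bil_form p (entry A) x x"
    using smallest_eigenvector[of p "entry A", OF assms(2,3)] by blast
  have "lambda_min A \<le> \<mu>"
    unfolding lambda_min_def
    using eigenvalue_of_mv[OF assms(1) m(1,2)] card_finite_spectrum(1)[OF assms(1)] by simp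
  then have "lambda_min A * sq_sum p x \<le> \<mu> * sq_sum p x"
    by (intro mult_right_mono) auto
  then show ?thesis
    using m(3) by (metis order_trans)
qed

lemma quadratic_form_le_lambda_max:
  assumes "A \<in> carrier_mat p p" "0 < p" "\<And>j k. j < p \<Longrightarrow> k < p \<Longrightarrow> entry A j k = entry A k j"
  shows "bil_form p (entry A) x x \<le> lambda_max A * sq_sum p x"
proof -
  obtain \<mu> v where m: "sq_sum p v = 1" "\<forall>j<p. mat_app p (\<lambda>j k. - entry A j k) v j = \<mu> * v j"
    "\<forall>x. \<mu> * sq_sum p x \<le> bil_form p (\<lambda>j k. - entry A j k) x x"
    using smallest_eigenvector[of p "\<lambda>j k. - entry A j k"] assms(2,3) by auto
  have "mat_app p (entry A) v j = - \<mu> * v j" if "j < p" for j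
  proof -
    have "- mat_app p (entry A) v j = \<mu> * v j"
      using m(2)[rule_format, OF that] by (simp add: mat_app_def sum_negf)
    then show ?thesis by linarith
  qed
  then have "- \<mu> \<le> lambda_max A"
    unfolding lambda_max_def
    using eigenvalue_of_mv[OF assms(1) m(1), of "- \<mu>"] card_finite_spectrum(1)[OF assms(1)] by simp
  then have "- \<mu> * sq_sum p x \<le> lambda_max A * sq_sum p x"
    by (intro mult_right_mono) auto
  moreover have "bil_form p (\<lambda>j k. - entry A j k) x x = - bil_form p (entry A) x x"
    by (simp add: bil_form_def sum_negf)
  ultimately show ?thesis
    using m(3)[rule_format, of x] by simp
qed

subsection \<open>Quadratic forms of mutually inverse matrices\<close>

text \<open>\<open>S\<close> will be the population second moment matrix and \<open>W\<close> the
  precision matrix. Hypothesis (a) speaks of \<open>W\<close>; the bounds on the form of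
  \<open>S\<close> are derived from it through the inverse relation.\<close>

locale inverse_pair =
  fixes p :: nat and S W :: "nat \<Rightarrow> nat \<Rightarrow> real" and c3 c4 :: real
  assumes S_sym: "\<And>j k. j < p \<Longrightarrow> k < p \<Longrightarrow> S j k = S k j"
    and W_sym: "\<And>j k. j < p \<Longrightarrow> k < p \<Longrightarrow> W j k = W k j"
    and S_W: "\<And>j l. j < p \<Longrightarrow> l < p \<Longrightarrow> (\<Sum>k<p. S j k * W k l) = (if j = l then 1 else 0)"
    and W_S: "\<And>j l. j < p \<Longrightarrow> l < p \<Longrightarrow> (\<Sum>k<p. W j k * S k l) = (if j = l then 1 else 0)"
    and c3: "0 < c3" "\<And>v. c3 * sq_sum p v \<le> bil_form p W v v"
    and c4: "0 < c4" "\<And>v. bil_form p W v v \<le> c4 * sq_sum p v"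
begin

lemma mv_mv_id:
  assumes "\<And>j l. j < p \<Longrightarrow> l < p \<Longrightarrow> (\<Sum>k<p. A j k * B k l) = (if j = l then 1 else 0)" "j < p"
  shows "mat_app p A (mat_app p B v) j = v j"
proof -
  have "mat_app p A (mat_app p B v) j = (\<Sum>k<p. \<Sum>l<p. A j k * B k l * v l)"
    by (simp add: mat_app_def sum_distrib_left mult.assoc)
  also have "\<dots> = (\<Sum>l<p. (\<Sum>k<p. A j k * B k l) * v l)"
    by (subst sum.swap) (simp add: sum_distrib_right)
  also have "\<dots> = (\<Sum>l<p. if j = l then v l else 0)"
    using assms by (intro sum.cong) auto
  finally show ?thesis
    using assms(2) by simp
qed

lemma S_W_id: "j < p \<Longrightarrow> mat_app p S (mat_app p W v) j = v j"
  by (rule mv_mv_id) (auto simp: S_W)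

lemma W_S_id: "j < p \<Longrightarrow> mat_app p W (mat_app p S v) j = v j"
  by (rule mv_mv_id) (auto simp: W_S)

lemma S_form: "bil_form p S v v = bil_form p W (mat_app p S v) (mat_app p S v)"
proof -
  have "bil_form p W (mat_app p S v) (mat_app p S v) = (\<Sum>j<p. mat_app p S v j * v j)"
    unfolding bil_mv by (intro sum.cong) (auto simp: W_S_id)
  then show ?thesis
    by (simp add: bil_mv mult.commute)
qed

lemma S_psd: "0 \<le> bil_form p S v v"
proof -
  have "0 \<le> c3 * sq_sum p (mat_app p S v)"
    using c3(1) by simp
  then show ?thesis
    using c3(2)[of "mat_app p S v"] unfolding S_form by linarith
qed

text \<open>With w = S v the form b = v' S v equals w' W w \<ge> c3 \<bar>w\<bar>^2, while
  Cauchy-Schwarz gives b^2 \<le> \<bar>v\<bar>^2 \<bar>w\<bar>^2. Eliminating \<bar>w\<bar> leaves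
  b^2 \<le> b \<bar>v\<bar>^2 / c3.\<close>

lemma S_upper: "bil_form p S v v \<le> sq_sum p v / c3"
proof -
  let ?b = "bil_form p S v v" and ?w = "mat_app p S v"
  have "?b\<^sup>2 \<le> sq_sum p v * sq_sum p ?w"
    unfolding bil_mv sq_sum_def by (rule Cauchy_Schwarz_ineq_sum)
  also have "\<dots> \<le> sq_sum p v * (?b / c3)"
    using c3(2)[of ?w] c3(1) by (intro mult_left_mono) (auto simp: S_form[symmetric] field_simps)
  finally have "?b * ?b \<le> ?b * (sq_sum p v / c3)"
    by (simp add: power2_eq_square mult_ac)
  then show ?thesis
    using S_psd[of v] c3(1) by (cases "?b = 0") (auto simp: mult_le_cancel_left simp del: times_divide_eq_right)
qed

text \<open>Completing the square: the form of \<open>S\<close> is nonnegative at v - W v / c4,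
  whose cross term is exactly \<bar>v\<bar>^2 because S W v = v.\<close>

lemma S_lower: "sq_sum p v / c4 \<le> bil_form p S v v"
proof -
  define w where "w = mat_app p W v"
  have Sw: "j < p \<Longrightarrow> mat_app p S w j = v j" for j
    by (simp add: w_def S_W_id)
  have vw: "bil_form p S v w = sq_sum p v"
    using Sw by (simp add: bil_mv sq_sum_def power2_eq_square)
  have ww: "bil_form p S w w = bil_form p W v v"
    using Sw by (simp add: bil_mv w_def mult.commute)
  have "0 \<le> bil_form p S (\<lambda>j. v j + (- 1 / c4) * w j) (\<lambda>j. v j + (- 1 / c4) * w j)"
    by (rule S_psd)
  also have "\<dots> = bil_form p S v v + 2 * ((- 1 / c4) * sq_sum p v) + (- 1 / c4) * ((- 1 / c4) * bil_form p W v v)"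
    using bil_add_add[of p S v "\<lambda>j. (- 1 / c4) * w j", OF S_sym]
    by (simp only: bil_scale_left bil_scale_right vw ww)
  also have "(- 1 / c4) * ((- 1 / c4) * bil_form p W v v) \<le> (1 / c4 * (1 / c4)) * (c4 * sq_sum p v)"
    using c4(2)[of v] mult_left_mono[OF c4(2)[of v], of "1 / c4 * (1 / c4)"] by simp
  finally have "0 \<le> bil_form p S v v + 2 * ((- 1 / c4) * sq_sum p v) + (1 / c4 * (1 / c4)) * (c4 * sq_sum p v)"
    by simp
  then show ?thesis
    using c4(1) by simp
qed

text \<open>This is \<open>S_lower\<close> at W v, where the form of \<open>S\<close> equals v' W v
  \<le> c4 \<bar>v\<bar>^2.\<close>

lemma W_mv_bound: "sq_sum p (mat_app p W v) \<le> c4\<^sup>2 * sq_sum p v"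
proof -
  have "sq_sum p (mat_app p W v) / c4 \<le> bil_form p S (mat_app p W v) (mat_app p W v)"
    by (rule S_lower)
  also have "\<dots> = bil_form p W v v"
    unfolding bil_mv[of p S] bil_mv[of p W] by (intro sum.cong) (auto simp: S_W_id)
  also have "\<dots> \<le> c4 * sq_sum p v"
    by (rule c4)
  finally show ?thesis
    using c4(1) by (simp add: field_simps power2_eq_square)
qed

end

subsection \<open>The two programs in coordinates\<close>

lemma mat_trace_quadratic:
  assumes "G \<in> carrier_mat p p" "S \<in> carrier_mat p p"
  shows "mat_trace (transpose_mat G * S * G) = (\<Sum>j<p. bil_form p (entry S) (\<lambda>l. entry G l j) (\<lambda>l. entry G l j))"
proof -
  have "(transpose_mat G * S * G) $$ (j, j) = bil_form p (entry S) (\<lambda>l. entry G l j) (\<lambda>l. entry G l j)" if "j < p" for j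
  proof -
    have "(transpose_mat G * S * G) $$ (j, j) = (\<Sum>l<p. entry G l j * (\<Sum>k<p. entry S l k * entry G k j))"
      using assms that by (simp add: scalar_prod_def atLeast0LessThan)
    also have "\<dots> = bil_form p (entry S) (\<lambda>l. entry G l j) (\<lambda>l. entry G l j)"
      by (simp add: bil_mv mat_app_def)
    finally show ?thesis .
  qed
  then show ?thesis
    using assms by (simp add: mat_trace_def)
qed

definition column_obj :: "nat \<Rightarrow> real \<Rightarrow> real mat \<Rightarrow> nat \<Rightarrow> (nat \<Rightarrow> real) \<Rightarrow> real" where
  "column_obj p r S j g = (1/2) * bil_form p (entry S) g g - g j + r * l1_sum p g"

lemma stage_one_objective:
  assumes "G \<in> carrier_mat p p" "S \<in> carrier_mat p p"
  shows "(1/2) * mat_trace (transpose_mat G * S * G) - mat_trace G + r * mat_L1_norm G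
    = (\<Sum>j<p. column_obj p r S j (\<lambda>l. entry G l j))"
proof -
  have "mat_L1_norm G = (\<Sum>j<p. l1_sum p (\<lambda>l. entry G l j))"
    using assms unfolding mat_L1_norm_def l1_sum_def by (subst sum.swap) auto
  moreover have "mat_trace G = (\<Sum>j<p. entry G j j)"
    using assms by (simp add: mat_trace_def)
  ultimately show ?thesis
    by (simp add: mat_trace_quadratic[OF assms] column_obj_def sum.distrib sum_subtractf sum_distrib_left
        sum_divide_distrib)
qed

lemma column_obj_cong:
  assumes "\<And>l. l < p \<Longrightarrow> g l = h l" "j < p"
  shows "column_obj p r S j g = column_obj p r S j h"
  using assms by (simp add: column_obj_def bil_form_def l1_sum_def)

text \<open>The stage-one objective is a sum over columns, so exchanging a single column of the
  minimiser for \<open>h\<close> compares the objectives of that column alone.\<close>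

lemma stage_one_columnwise:
  assumes S: "S \<in> carrier_mat p p" and G: "stage_one p r S G" and j: "j < p"
  shows "column_obj p r S j (\<lambda>l. entry G l j) \<le> column_obj p r S j h"
proof -
  have Gc: "G \<in> carrier_mat p p"
    using G by (auto simp: stage_one_def is_arg_min_def)
  define H where "H = mat p p (\<lambda>(l, k). if k = j then h l else entry G l k)"
  have Hc: "H \<in> carrier_mat p p"
    by (simp add: H_def)
  let ?F = "\<lambda>G k. column_obj p r S k (\<lambda>l. entry G l k)"
  have "(\<Sum>k<p. ?F G k) \<le> (\<Sum>k<p. ?F H k)"
    using G Hc Gc unfolding stage_one_def is_arg_min_def
    by (simp add: stage_one_objective[OF _ S] not_less del: times_divide_eq_left mult_1)
  also have "(\<Sum>k<p. ?F H k) = (\<Sum>k<p. if k = j then column_obj p r S j h else ?F G k)"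
    by (intro sum.cong) (auto simp: H_def intro!: column_obj_cong)
  also have "\<dots> = column_obj p r S j h + (\<Sum>k\<in>{..<p}-{j}. ?F G k)"
    using j by (subst sum.remove[of _ j]) auto
  finally show ?thesis
    using j by (subst (asm) sum.remove[of _ j]) auto
qed

lemma continuous_on_column_obj: "continuous_on UNIV (column_obj p r S j)"
  unfolding column_obj_def[abs_def] bil_form_def l1_sum_def
  by (intro continuous_intros continuous_on_product_coordinates)

text \<open>The bound on \<open>S om - e\<^sub>j\<close> makes the objective coercive even when \<open>S\<close> is singular.\<close>

lemma column_minimizer_exists:
  assumes sym: "\<And>j k. j < p \<Longrightarrow> k < p \<Longrightarrow> entry S j k = entry S k j"
    and psd: "\<And>v. 0 \<le> bil_form p (entry S) v v" and r: "0 < r" and j: "j < p"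
    and om: "\<And>l. l < p \<Longrightarrow> \<bar>mat_app p (entry S) om l - (if l = j then 1 else 0)\<bar> \<le> r / 2"
  shows "\<exists>g. \<forall>h. column_obj p r S j g \<le> column_obj p r S j h"
proof -
  define c where "c = (1/2) * bil_form p (entry S) om om"
  \<comment> \<open>Nonnegativity of the form at g - om absorbs the cross term into half of the
    quadratic term, and the residual of \<open>om\<close> uses up half of the penalty; the other
    half of the penalty makes the objective grow.\<close>
  have coercive: "(r / 2) * l1_sum p g - c \<le> column_obj p r S j g" for g
  proof -
    have "bil_form p (entry S) g om - g j = (\<Sum>l<p. g l * (mat_app p (entry S) om l - (if l = j then 1 else 0)))"
    proof -
      have "(\<Sum>l<p. g l * (if l = j then 1 else 0)) = g j"
        using j by (simp add: if_distrib[of "\<lambda>x. _ * x"] cong: if_cong)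
      then show ?thesis
        by (simp add: bil_mv right_diff_distrib sum_subtractf)
    qed
    moreover have "\<bar>\<Sum>l<p. g l * (mat_app p (entry S) om l - (if l = j then 1 else 0))\<bar> \<le> r / 2 * l1_sum p g"
      using om by (intro sum_abs_mult_le_l1) auto
    ultimately have a: "g j \<le> bil_form p (entry S) g om + r / 2 * l1_sum p g"
      by linarith
    have "0 \<le> bil_form p (entry S) (\<lambda>l. g l + (-1) * om l) (\<lambda>l. g l + (-1) * om l)"
      by (rule psd)
    also have "\<dots> = bil_form p (entry S) g g + 2 * ((-1) * bil_form p (entry S) g om) + (-1) * ((-1) * bil_form p (entry S) om om)"
      using bil_add_add[of p "entry S" g "\<lambda>j. (-1) * om j", OF sym]
      by (simp only: bil_scale_left bil_scale_right)
    finally have "bil_form p (entry S) g om \<le> (1/2) * bil_form p (entry S) g g + c"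
      by (simp add: c_def)
    then show ?thesis
      using a by (simp add: column_obj_def)
  qed
  define b where "b = column_obj p r S j (\<lambda>_. 0)"
  \<comment> \<open>The objective ignores coordinates from \<open>p\<close> on, so they are fixed at
    0 to make the sublevel set bounded.\<close>
  define C where "C = {g. (\<forall>l. p \<le> l \<longrightarrow> g l = 0) \<and> column_obj p r S j g \<le> b}"
  have "closed C"
    unfolding C_def
    by (intro closed_Collect_conj closed_Collect_all closed_Collect_imp closed_Collect_eq closed_Collect_le
        open_Collect_const continuous_intros continuous_on_product_coordinates continuous_on_column_obj)
  moreover have zero: "(\<lambda>_. 0) \<in> C"
    by (simp add: C_def b_def)
  moreover have "\<bar>g i\<bar> \<le> (\<bar>b\<bar> + \<bar>c\<bar>) * 2 / r" if "g \<in> C" for g i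
  proof (cases "i < p")
    case True
    then have "\<bar>g i\<bar> \<le> l1_sum p g"
      unfolding l1_sum_def by (intro member_le_sum) auto
    moreover have "(r / 2) * l1_sum p g \<le> \<bar>b\<bar> + \<bar>c\<bar>"
      using coercive[of g] that by (auto simp: C_def)
    ultimately have "r / 2 * \<bar>g i\<bar> \<le> \<bar>b\<bar> + \<bar>c\<bar>"
      using mult_left_mono[of "\<bar>g i\<bar>" "l1_sum p g" "r / 2"] r by linarith
    then show ?thesis
      using r by (simp add: field_simps)
  qed (use that r in \<open>auto simp: C_def\<close>)
  ultimately obtain g where g: "g \<in> C" "\<And>h. h \<in> C \<Longrightarrow> column_obj p r S j g \<le> column_obj p r S j h"
    using attains_min_on_closed_bounded[OF continuous_on_column_obj[of p r S j], of C
        "\<lambda>_. (\<bar>b\<bar> + \<bar>c\<bar>) * 2 / r"] by blast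
  have "column_obj p r S j g \<le> column_obj p r S j h" for h
  proof (cases "column_obj p r S j h \<le> b")
    case True
    define h' where "h' l = (if l < p then h l else 0)" for l
    have e: "column_obj p r S j h' = column_obj p r S j h"
      using j by (intro column_obj_cong) (auto simp: h'_def)
    then have "h' \<in> C"
      using True by (auto simp: C_def h'_def)
    then show ?thesis
      using g(2) e by metis
  next
    case False
    then show ?thesis
      using g(2)[OF zero] by (simp add: b_def)
  qed
  then show ?thesis by blast
qed

lemma stage_one_exists:
  assumes S: "S \<in> carrier_mat p p" and sym: "\<And>j k. j < p \<Longrightarrow> k < p \<Longrightarrow> entry S j k = entry S k j"
    and psd: "\<And>v. 0 \<le> bil_form p (entry S) v v" and r: "0 < r"
    and om: "\<And>l j. l < p \<Longrightarrow> j < p \<Longrightarrow> \<bar>mat_app p (entry S) (\<lambda>k. om k j) l - (if l = j then 1 else 0)\<bar> \<le> r / 2"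
  shows "\<exists>G. stage_one p r S G"
proof -
  have "\<exists>g. \<forall>h. column_obj p r S j g \<le> column_obj p r S j h" if "j < p" for j
    using that by (intro column_minimizer_exists[where om = "\<lambda>k. om k j"] sym psd r om) auto
  then obtain g where g: "\<And>j h. j < p \<Longrightarrow> column_obj p r S j (g j) \<le> column_obj p r S j h"
    by metis
  define G where "G = mat p p (\<lambda>(l, j). g j l)"
  have G: "G \<in> carrier_mat p p"
    by (simp add: G_def)
  have "(\<Sum>j<p. column_obj p r S j (\<lambda>l. entry G l j)) \<le> (\<Sum>j<p. column_obj p r S j (\<lambda>l. entry H l j))" for H
  proof (rule sum_mono)
    fix j assume "j \<in> {..<p}"
    then have "column_obj p r S j (\<lambda>l. entry G l j) = column_obj p r S j (g j)"
      by (intro column_obj_cong) (auto simp: G_def)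
    then show "column_obj p r S j (\<lambda>l. entry G l j) \<le> column_obj p r S j (\<lambda>l. entry H l j)"
      using g \<open>j \<in> {..<p}\<close> by simp
  qed
  then have "stage_one p r S G"
    using G unfolding stage_one_def is_arg_min_def
    by (auto simp add: stage_one_objective[OF _ S] not_less simp del: times_divide_eq_left mult_1)
  then show ?thesis ..
qed

lemma mat_max_norm_le_iff:
  assumes "A \<in> carrier_mat p p" "0 < p"
  shows "mat_max_norm A \<le> r \<longleftrightarrow> (\<forall>l<p. \<forall>k<p. \<bar>entry A l k\<bar> \<le> r)"
proof -
  have e: "elements_mat A = (\<lambda>(l, k). A $$ (l, k)) ` ({..<p} \<times> {..<p})"
    using assms by (auto simp: elements_mat_def)
  show ?thesis
    using assms(2) unfolding mat_max_norm_def e by (subst Max_le_iff) auto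
qed

lemma mat_one_norm_eq:
  assumes "A \<in> carrier_mat p p"
  shows "mat_one_norm A = Max ((\<lambda>j. l1_sum p (\<lambda>i. entry A i j)) ` {..<p})"
  using assms by (simp add: mat_one_norm_def l1_sum_def)

lemma ment_mult:
  assumes "S \<in> carrier_mat p p" "G \<in> carrier_mat p p" "l < p" "k < p"
  shows "entry (S * G - 1\<^sub>m p) l k = mat_app p (entry S) (\<lambda>j. entry G j k) l - (if l = k then 1 else 0)"
  using assms by (simp add: scalar_prod_def mat_app_def atLeast0LessThan)

lemma stage_two_feasible_iff:
  assumes "S \<in> carrier_mat p p" "G \<in> carrier_mat p p" "0 < p"
  shows "transpose_mat G = G \<and> mat_max_norm (S * G - 1\<^sub>m p) \<le> r \<longleftrightarrow>
    (\<forall>l<p. \<forall>k<p. entry G l k = entry G k l) \<and>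
    (\<forall>l<p. \<forall>k<p. \<bar>mat_app p (entry S) (\<lambda>j. entry G j k) l - (if l = k then 1 else 0)\<bar> \<le> r)"
proof -
  have "transpose_mat G = G \<longleftrightarrow> (\<forall>l<p. \<forall>k<p. entry G l k = entry G k l)"
  proof
    assume "transpose_mat G = G"
    then have t: "transpose_mat G $$ (l, k) = G $$ (l, k)" for l k
      by simp
    show "\<forall>l<p. \<forall>k<p. entry G l k = entry G k l"
      using assms(2) t by (metis carrier_matD index_transpose_mat(1))
  next
    assume "\<forall>l<p. \<forall>k<p. entry G l k = entry G k l"
    then show "transpose_mat G = G"
      using assms(2) by (intro eq_matI) auto
  qed
  moreover have "S * G - 1\<^sub>m p \<in> carrier_mat p p"
    using assms by auto
  ultimately show ?thesis
    using assms by (simp add: mat_max_norm_le_iff ment_mult del: index_minus_mat)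
qed

text \<open>The matrix \<open>\<Omega>\<close> is feasible, so the search may be confined to
  feasible matrices at least as close to \<open>G1\<close> as \<open>\<Omega>\<close>. The
  column-sum distance bounds every entry, which makes this set compact.\<close>

lemma stage_two_exists:
  assumes p: "0 < p" and S: "S \<in> carrier_mat p p" and G1: "G1 \<in> carrier_mat p p"
    and \<Omega>: "\<Omega> \<in> carrier_mat p p" "\<And>l k. l < p \<Longrightarrow> k < p \<Longrightarrow> entry \<Omega> l k = entry \<Omega> k l"
    and fe: "\<And>l k. l < p \<Longrightarrow> k < p \<Longrightarrow>
      \<bar>mat_app p (entry S) (\<lambda>j. entry \<Omega> j k) l - (if l = k then 1 else 0)\<bar> \<le> r"
  shows "\<exists>G. stage_two p r S G1 G"
proof -
  \<comment> \<open>The matrix one-norm of \<open>G1 - g\<close> for matrices coded as functions of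
    index pairs, the setting of the compactness lemma.\<close>
  define F where "F g = Max ((\<lambda>j. \<Sum>i<p. \<bar>entry G1 i j - g (i, j)\<bar>) ` {..<p})" for g :: "nat \<times> nat \<Rightarrow> real"
  have contF: "continuous_on UNIV F"
    unfolding F_def[abs_def] using p
    by (intro continuous_on_Max continuous_intros continuous_on_product_coordinates) auto
  define f\<Omega> where "f\<Omega> = (\<lambda>(i, j). if i < p \<and> j < p then entry \<Omega> i j else 0)"
  define b where "b = F f\<Omega>"
  define C where "C = {g :: nat \<times> nat \<Rightarrow> real. (\<forall>i j. \<not> (i < p \<and> j < p) \<longrightarrow> g (i, j) = 0)
    \<and> (\<forall>l k. g (l, k) = g (k, l))
    \<and> (\<forall>l k. l < p \<and> k < p \<longrightarrow> \<bar>(\<Sum>j<p. entry S l j * g (j, k)) - (if l = k then 1 else 0)\<bar> \<le> r) \<and> F g \<le> b}"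
  have "closed C"
    unfolding C_def
    by (intro closed_Collect_conj closed_Collect_all closed_Collect_imp closed_Collect_eq closed_Collect_le
        open_Collect_const continuous_intros continuous_on_product_coordinates contF)
  moreover have \<Omega>C: "f\<Omega> \<in> C"
    using fe \<Omega>(2) by (auto simp: C_def f\<Omega>_def b_def mat_app_def)
  moreover have "\<bar>g ij\<bar> \<le> \<bar>entry G1 (fst ij) (snd ij)\<bar> + \<bar>b\<bar>" if g: "g \<in> C" for g ij
  proof (cases "fst ij < p \<and> snd ij < p")
    case True
    obtain i j where ij: "ij = (i, j)" by (cases ij)
    have "\<bar>entry G1 i j - g (i, j)\<bar> \<le> (\<Sum>i<p. \<bar>entry G1 i j - g (i, j)\<bar>)"
      using True ij by (intro member_le_sum[where f = "\<lambda>i. \<bar>entry G1 i j - g (i, j)\<bar>"]) auto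
    also have "\<dots> \<le> F g"
      using True ij unfolding F_def by (intro Max_ge) auto
    also have "\<dots> \<le> b"
      using g by (simp add: C_def)
    finally show ?thesis
      using ij by auto
  next
    case False
    then show ?thesis
      using g by (cases ij) (auto simp: C_def)
  qed
  ultimately obtain g where g: "g \<in> C" "\<And>h. h \<in> C \<Longrightarrow> F g \<le> F h"
    using attains_min_on_closed_bounded[OF contF, of C
        "\<lambda>ij. \<bar>entry G1 (fst ij) (snd ij)\<bar> + \<bar>b\<bar>"] by blast
  define G where "G = mat p p g"
  have Gc: "G \<in> carrier_mat p p"
    by (simp add: G_def)
  have norm: "mat_one_norm (G1 - H) = F h"
    if "H \<in> carrier_mat p p" "\<And>i j. i < p \<Longrightarrow> j < p \<Longrightarrow> h (i, j) = entry H i j" for H h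
  proof -
    have "G1 - H \<in> carrier_mat p p"
      using that(1) by auto
    then show ?thesis
      using that G1 by (auto simp: mat_one_norm_eq F_def l1_sum_def intro!: arg_cong[of _ _ Max] image_cong)
  qed
  have nG: "mat_one_norm (G1 - G) = F g"
    by (rule norm[OF Gc]) (simp add: G_def)
  have feas: "transpose_mat G = G \<and> mat_max_norm (S * G - 1\<^sub>m p) \<le> r"
    unfolding stage_two_feasible_iff[OF S Gc p]
  proof (intro conjI allI impI)
    fix l k assume lk: "l < p" "k < p"
    show "entry G l k = entry G k l"
      using g(1) lk by (simp add: C_def G_def)
    have "mat_app p (entry S) (\<lambda>j. entry G j k) l = (\<Sum>j<p. entry S l j * g (j, k))"
      using lk by (simp add: mat_app_def G_def)
    then show "\<bar>mat_app p (entry S) (\<lambda>j. entry G j k) l - (if l = k then 1 else 0)\<bar> \<le> r"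
      using g(1) lk unfolding C_def by (simp only: mem_Collect_eq)
  qed
  have opt: "mat_one_norm (G1 - G) \<le> mat_one_norm (G1 - H)"
    if H: "H \<in> carrier_mat p p" and fH: "transpose_mat H = H \<and> mat_max_norm (S * H - 1\<^sub>m p) \<le> r" for H
  proof -
    define h where "h = (\<lambda>(i, j). if i < p \<and> j < p then entry H i j else 0)"
    have nH: "mat_one_norm (G1 - H) = F h"
      by (rule norm[OF H]) (simp add: h_def)
    show ?thesis
    \<comment> \<open>A feasible competitor outside the sublevel set is farther from
      \<open>G1\<close> than \<open>\<Omega>\<close>, which lies in \<open>C\<close>.\<close>
    proof (cases "F h \<le> b")
      case True
      have "h \<in> C"
        unfolding C_def
      proof (simp only: mem_Collect_eq, intro conjI allI impI True)
        show "h (l, k) = h (k, l)" for l k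
          using fH unfolding stage_two_feasible_iff[OF S H p] by (auto simp: h_def)
        fix l k assume lk: "l < p \<and> k < p"
        then have "(\<Sum>j<p. entry S l j * h (j, k)) = mat_app p (entry S) (\<lambda>j. entry H j k) l"
          by (simp add: mat_app_def h_def)
        then show "\<bar>(\<Sum>j<p. entry S l j * h (j, k)) - (if l = k then 1 else 0)\<bar> \<le> r"
          using fH lk unfolding stage_two_feasible_iff[OF S H p] by simp
      qed (auto simp: h_def)
      then show ?thesis
        using g(2) nG nH by simp
    next
      case False
      then show ?thesis
        using g(2)[OF \<Omega>C] nG nH by (simp add: b_def)
    qed
  qed
  have "stage_two p r S G1 G"
    unfolding stage_two_def is_arg_min_def using Gc feas opt by (auto simp: not_less)
  then show ?thesis ..
qed

text \<open>Since \<open>\<Omega>\<close> is feasible in stage two, \<open>G\<close> is as close to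
  \<open>G1\<close> as \<open>\<Omega>\<close> is, and the triangle inequality doubles the lasso
  constant 24. The residual bounds r for \<open>G\<close> and r / 2 for \<open>\<Omega>\<close>
  control S (G - \<Omega>) by 3 r / 2, which upgrades the l1 bound to l2.\<close>

lemma two_stage_error:
  assumes p: "0 < p" and S: "S \<in> carrier_mat p p"
    and sym: "\<And>j k. j < p \<Longrightarrow> k < p \<Longrightarrow> entry S j k = entry S k j"
    and psd: "\<And>v. 0 \<le> bil_form p (entry S) v v"
    and re: "\<And>v. \<kappa> * sq_sum p v - \<gamma> * (l1_sum p v)\<^sup>2 \<le> bil_form p (entry S) v v"
    and c: "0 < \<kappa>" "0 \<le> \<gamma>" "0 < r" "32 * \<gamma> * real s \<le> \<kappa>"
    and \<Omega>: "\<Omega> \<in> carrier_mat p p" "\<And>l k. l < p \<Longrightarrow> k < p \<Longrightarrow> entry \<Omega> l k = entry \<Omega> k l"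
    and om: "\<And>l k. l < p \<Longrightarrow> k < p \<Longrightarrow>
      \<bar>mat_app p (entry S) (\<lambda>j. entry \<Omega> j k) l - (if l = k then 1 else 0)\<bar> \<le> r / 2"
    and s: "\<And>k. k < p \<Longrightarrow> card {l. l < p \<and> entry \<Omega> l k \<noteq> 0} \<le> s"
    and G1: "stage_one p r S G1" and G2: "stage_two p r S G1 G"
  shows "G \<in> carrier_mat p p" "\<And>l k. l < p \<Longrightarrow> k < p \<Longrightarrow> entry G l k = entry G k l"
    and "\<And>k. k < p \<Longrightarrow> l1_sum p (\<lambda>j. entry G j k - entry \<Omega> j k) \<le> 48 * r * real s / \<kappa>"
    and "\<And>k. k < p \<Longrightarrow> sq_sum p (\<lambda>j. entry G j k - entry \<Omega> j k) \<le> 144 * r\<^sup>2 * real s / \<kappa>\<^sup>2"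
proof -
  have G1c: "G1 \<in> carrier_mat p p"
    using G1 by (auto simp: stage_one_def is_arg_min_def)
  show Gc: "G \<in> carrier_mat p p"
    using G2 by (auto simp: stage_two_def is_arg_min_def)
  have "transpose_mat G = G \<and> mat_max_norm (S * G - 1\<^sub>m p) \<le> r"
    using G2 by (auto simp: stage_two_def is_arg_min_def)
  note feas = this[unfolded stage_two_feasible_iff[OF S Gc p]]
  show "\<And>l k. l < p \<Longrightarrow> k < p \<Longrightarrow> entry G l k = entry G k l"
    using feas by blast
  have e1: "l1_sum p (\<lambda>l. entry G1 l k - entry \<Omega> l k) \<le> 24 * r * real s / \<kappa>" if k: "k < p" for k
  proof (rule lasso_column_error[where S = "entry S" and om = "\<lambda>l. entry \<Omega> l k" and j = k])
    show "(1/2) * bil_form p (entry S) (\<lambda>l. entry G1 l k) (\<lambda>l. entry G1 l k) - entry G1 k k + r * l1_sum p (\<lambda>l. entry G1 l k)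
        \<le> (1/2) * bil_form p (entry S) (\<lambda>l. entry \<Omega> l k) (\<lambda>l. entry \<Omega> l k) - entry \<Omega> k k + r * l1_sum p (\<lambda>l. entry \<Omega> l k)"
      using stage_one_columnwise[OF S G1 k, of "\<lambda>l. entry \<Omega> l k"] by (simp add: column_obj_def)
  qed (use sym psd re c k om s in auto)
  have "\<bar>mat_app p (entry S) (\<lambda>j. entry \<Omega> j k) l - (if l = k then 1 else 0)\<bar> \<le> r" if "l < p" "k < p" for l k
    using om[OF that] c(3) by linarith
  then have f\<Omega>: "transpose_mat \<Omega> = \<Omega> \<and> mat_max_norm (S * \<Omega> - 1\<^sub>m p) \<le> r"
    unfolding stage_two_feasible_iff[OF S \<Omega>(1) p] using \<Omega>(2) by blast
  have "mat_one_norm (G1 - G) \<le> mat_one_norm (G1 - \<Omega>)"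
    using G2 f\<Omega> \<Omega>(1) unfolding stage_two_def is_arg_min_def by (auto simp: not_less)
  also have "\<dots> \<le> 24 * r * real s / \<kappa>"
  proof -
    have "G1 - \<Omega> \<in> carrier_mat p p"
      using \<Omega> by auto
    moreover have "l1_sum p (\<lambda>l. entry (G1 - \<Omega>) l k) \<le> 24 * r * real s / \<kappa>" if "k < p" for k
      using e1[OF that] G1c \<Omega>(1) that by (simp add: l1_sum_def)
    ultimately show ?thesis
      using p by (subst mat_one_norm_eq) (auto intro!: Max.boundedI)
  qed
  finally have m: "mat_one_norm (G1 - G) \<le> 24 * r * real s / \<kappa>" .
  have e2: "l1_sum p (\<lambda>l. entry G1 l k - entry G l k) \<le> 24 * r * real s / \<kappa>" if "k < p" for k
  proof -
    have "G1 - G \<in> carrier_mat p p"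
      using Gc by auto
    then have "l1_sum p (\<lambda>l. entry (G1 - G) l k) \<le> mat_one_norm (G1 - G)"
      using that by (subst mat_one_norm_eq) (auto intro!: Max_ge)
    moreover have "l1_sum p (\<lambda>l. entry (G1 - G) l k) = l1_sum p (\<lambda>l. entry G1 l k - entry G l k)"
      using G1c Gc that by (simp add: l1_sum_def)
    ultimately show ?thesis using m by simp
  qed
  show L: "l1_sum p (\<lambda>j. entry G j k - entry \<Omega> j k) \<le> 48 * r * real s / \<kappa>" if "k < p" for k
  proof -
    have "l1_sum p (\<lambda>j. entry G j k - entry \<Omega> j k)
        \<le> l1_sum p (\<lambda>j. entry G1 j k - entry \<Omega> j k) + l1_sum p (\<lambda>j. entry G1 j k - entry G j k)"
      unfolding l1_sum_def sum.distrib[symmetric] by (intro sum_mono) linarith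
    then show ?thesis
      using e1[OF that] e2[OF that] by simp
  qed
  show "sq_sum p (\<lambda>j. entry G j k - entry \<Omega> j k) \<le> 144 * r\<^sup>2 * real s / \<kappa>\<^sup>2" if k: "k < p" for k
  proof (rule l2_error_of_l1_error[OF re c _ L[OF k]])
    fix l assume l: "l < p"
    have "mat_app p (entry S) (\<lambda>j. entry G j k - entry \<Omega> j k) l
        = (mat_app p (entry S) (\<lambda>j. entry G j k) l - (if l = k then 1 else 0))
          - (mat_app p (entry S) (\<lambda>j. entry \<Omega> j k) l - (if l = k then 1 else 0))"
      by (simp add: mat_app_def right_diff_distrib sum_subtractf)
    moreover have "\<bar>mat_app p (entry S) (\<lambda>j. entry G j k) l - (if l = k then 1 else 0)\<bar> \<le> r"
      using feas l k by blast
    ultimately show "\<bar>mat_app p (entry S) (\<lambda>j. entry G j k - entry \<Omega> j k) l\<bar> \<le> 3 * r / 2"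
      using om[OF l k] by linarith
  qed
qed

subsection \<open>Error decomposition\<close>

lemma scalar_prod_mv:
  assumes "\<xi> \<in> carrier_vec p" "W \<in> carrier_mat p p" "v \<in> carrier_vec p"
  shows "\<xi> \<bullet> (W *\<^sub>v v) = (\<Sum>k<p. (\<Sum>j<p. \<xi> $ j * entry W j k) * v $ k)"
proof -
  have "\<xi> \<bullet> (W *\<^sub>v v) = (\<Sum>j<p. \<Sum>k<p. \<xi> $ j * (entry W j k * v $ k))"
    using assms by (simp add: scalar_prod_def atLeast0LessThan sum_distrib_left)
  also have "\<dots> = (\<Sum>k<p. \<Sum>j<p. \<xi> $ j * (entry W j k * v $ k))"
    by (rule sum.swap)
  finally show ?thesis
    by (simp add: sum_distrib_right mult.assoc)
qed

lemma scalar_prod_score_sum: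
  assumes "\<xi> \<in> carrier_vec p" "W \<in> carrier_mat p p" "\<And>i. i \<in> I \<Longrightarrow> x i \<in> carrier_vec p"
  shows "\<xi> \<bullet> (W *\<^sub>v score_sum p n I x y b) = (1 / real n) * (\<Sum>i\<in>I. (\<xi> \<bullet> (W *\<^sub>v x i)) * (y i - x i \<bullet> b))"
proof -
  define c where "c k = (\<Sum>j<p. \<xi> $ j * entry W j k)" for k
  have "\<xi> \<bullet> (W *\<^sub>v score_sum p n I x y b) = (\<Sum>k<p. c k * ((1 / real n) * (\<Sum>i\<in>I. x i $ k * (y i - x i \<bullet> b))))"
    using assms by (subst scalar_prod_mv[of _ p]) (auto simp: score_sum_def c_def)
  also have "\<dots> = (1 / real n) * (\<Sum>k<p. \<Sum>i\<in>I. c k * x i $ k * (y i - x i \<bullet> b))"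
    by (simp add: sum_distrib_left mult_ac)
  also have "(\<Sum>k<p. \<Sum>i\<in>I. c k * x i $ k * (y i - x i \<bullet> b)) = (\<Sum>i\<in>I. (\<Sum>k<p. c k * x i $ k) * (y i - x i \<bullet> b))"
    by (subst sum.swap) (simp add: sum_distrib_right)
  also have "\<dots> = (\<Sum>i\<in>I. (\<xi> \<bullet> (W *\<^sub>v x i)) * (y i - x i \<bullet> b))"
    using assms by (intro sum.cong) (auto simp: scalar_prod_mv[of _ p] c_def)
  finally show ?thesis .
qed

lemma scalar_prod_minus:
  fixes v b \<beta> :: "real vec"
  assumes "v \<in> carrier_vec p" "b \<in> carrier_vec p" "\<beta> \<in> carrier_vec p"
  shows "v \<bullet> b - v \<bullet> \<beta> = (\<Sum>k<p. v $ k * (b $ k - \<beta> $ k))"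
  using assms by (simp add: scalar_prod_def atLeast0LessThan sum_subtractf right_diff_distrib)

text \<open>With y - x b = e - d and h = a + (h - a), the plug-in error of \<xi> and the average of
  a d combine into the Gram residual of \<Omega> \<xi> paired with b - \<beta>. The two remaining
  sums contain the direction error h - a.\<close>

lemma debiased_estimate_decomposition:
  fixes x :: "nat \<Rightarrow> real vec" and y :: "nat \<Rightarrow> real"
  assumes \<xi>: "\<xi> \<in> carrier_vec p" and J: "J \<subseteq> {1..n}"
    and W: "WJ \<in> carrier_mat p p" "WJc \<in> carrier_mat p p" "\<Omega> \<in> carrier_mat p p"
    and x: "\<And>i. i \<in> {1..n} \<Longrightarrow> x i \<in> carrier_vec p" and b: "b \<in> carrier_vec p" "\<beta> \<in> carrier_vec p"
  defines "h \<equiv> \<lambda>i. \<xi> \<bullet> ((if i \<in> J then WJc else WJ) *\<^sub>v x i)" and "a \<equiv> \<lambda>i. \<xi> \<bullet> (\<Omega> *\<^sub>v x i)"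
    and "d \<equiv> \<lambda>i. x i \<bullet> b - x i \<bullet> \<beta>" and "e \<equiv> \<lambda>i. y i - x i \<bullet> \<beta>"
  shows "debiased_estimate p n J x y \<xi> b WJ WJc - \<xi> \<bullet> \<beta> - (1 / real n) * (\<Sum>i\<in>{1..n}. a i * e i)
    = (\<Sum>k<p. (b $ k - \<beta> $ k) * (\<xi> $ k - (1 / real n) * (\<Sum>i\<in>{1..n}. a i * x i $ k)))
      - (1 / real n) * (\<Sum>i\<in>{1..n}. (h i - a i) * d i) + (1 / real n) * (\<Sum>i\<in>{1..n}. (h i - a i) * e i)"
    and "variance_estimate n J x y \<xi> b WJ WJc = (1 / real n) * (\<Sum>i\<in>{1..n}. (h i)\<^sup>2 * (e i - d i)\<^sup>2)"
proof -
  have split: "(\<Sum>i\<in>{1..n}. f i) = (\<Sum>i\<in>J. f i) + (\<Sum>i\<in>{1..n}-J. f i)" for f :: "nat \<Rightarrow> real"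
    using sum.subset_diff[OF J, of f] by simp
  have yb: "y i - x i \<bullet> b = e i - d i" for i
    by (simp add: e_def d_def)
  have 1: "\<xi> \<bullet> (WJc *\<^sub>v score_sum p n J x y b) = (1 / real n) * (\<Sum>i\<in>J. h i * (e i - d i))"
    using J x by (subst scalar_prod_score_sum[OF \<xi> W(2)]) (auto simp: h_def yb)
  have 2: "\<xi> \<bullet> (WJ *\<^sub>v score_sum p n ({1..n} - J) x y b) = (1 / real n) * (\<Sum>i\<in>{1..n}-J. h i * (e i - d i))"
    using x by (subst scalar_prod_score_sum[OF \<xi> W(1)]) (auto simp: h_def yb)
  have est: "debiased_estimate p n J x y \<xi> b WJ WJc
      = \<xi> \<bullet> b + (1 / real n) * (\<Sum>i\<in>{1..n}. h i * (e i - d i))"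
    by (simp only: debiased_estimate_def 1 2 split distrib_left add.assoc)
  have ad: "(\<Sum>i\<in>{1..n}. a i * d i) = (\<Sum>k<p. (b $ k - \<beta> $ k) * (\<Sum>i\<in>{1..n}. a i * x i $ k))"
  proof -
    have "(\<Sum>i\<in>{1..n}. a i * d i) = (\<Sum>i\<in>{1..n}. \<Sum>k<p. (b $ k - \<beta> $ k) * (a i * x i $ k))"
      using x b by (intro sum.cong) (auto simp: d_def scalar_prod_minus[of _ p] sum_distrib_left mult_ac)
    then show ?thesis
      by (subst (asm) sum.swap) (simp add: sum_distrib_left)
  qed
  have f1: "(\<Sum>k<p. (b $ k - \<beta> $ k) * (\<xi> $ k - (1 / real n) * (\<Sum>i\<in>{1..n}. a i * x i $ k)))
      = \<xi> \<bullet> b - \<xi> \<bullet> \<beta> - (1 / real n) * (\<Sum>i\<in>{1..n}. a i * d i)"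
  proof -
    have "(\<Sum>k<p. (b $ k - \<beta> $ k) * (\<xi> $ k - (1 / real n) * (\<Sum>i\<in>{1..n}. a i * x i $ k)))
        = (\<Sum>k<p. \<xi> $ k * (b $ k - \<beta> $ k)
            - (1 / real n) * ((b $ k - \<beta> $ k) * (\<Sum>i\<in>{1..n}. a i * x i $ k)))"
      by (intro sum.cong) (auto simp: algebra_simps diff_divide_distrib)
    then show ?thesis
      unfolding ad scalar_prod_minus[OF \<xi> b] by (simp only: sum_subtractf sum_distrib_left)
  qed
  have f2: "(\<Sum>i\<in>{1..n}. h i * (e i - d i))
      = (\<Sum>i\<in>{1..n}. a i * e i) - (\<Sum>i\<in>{1..n}. a i * d i)
        - (\<Sum>i\<in>{1..n}. (h i - a i) * d i) + (\<Sum>i\<in>{1..n}. (h i - a i) * e i)"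
  proof -
    have "(\<Sum>i\<in>{1..n}. h i * (e i - d i)) = (\<Sum>i\<in>{1..n}. a i * e i - a i * d i - (h i - a i) * d i + (h i - a i) * e i)"
      by (intro sum.cong) (auto simp: algebra_simps)
    then show ?thesis
      by (simp only: sum_subtractf sum.distrib)
  qed
  show "debiased_estimate p n J x y \<xi> b WJ WJc - \<xi> \<bullet> \<beta> - (1 / real n) * (\<Sum>i\<in>{1..n}. a i * e i)
    = (\<Sum>k<p. (b $ k - \<beta> $ k) * (\<xi> $ k - (1 / real n) * (\<Sum>i\<in>{1..n}. a i * x i $ k)))
      - (1 / real n) * (\<Sum>i\<in>{1..n}. (h i - a i) * d i) + (1 / real n) * (\<Sum>i\<in>{1..n}. (h i - a i) * e i)"
    unfolding est f1 f2 by (simp only: right_diff_distrib distrib_left)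
  have "variance_estimate n J x y \<xi> b WJ WJc
      = (1 / real n) * (\<Sum>i\<in>J. (h i)\<^sup>2 * (e i - d i)\<^sup>2) + (1 / real n) * (\<Sum>i\<in>{1..n}-J. (h i)\<^sup>2 * (e i - d i)\<^sup>2)"
    unfolding variance_estimate_def yb by (intro arg_cong2[of _ _ _ _ "(+)"] arg_cong2[of _ _ _ _ "(*)"] sum.cong)
      (auto simp: h_def)
  then show "variance_estimate n J x y \<xi> b WJ WJc = (1 / real n) * (\<Sum>i\<in>{1..n}. (h i)\<^sup>2 * (e i - d i)\<^sup>2)"
    by (simp only: split distrib_left)
qed

text \<open>The largest (a i)^2 is at most the square root of the sum of fourth powers, so a fourth
  moment does the work of a maximal inequality. The resulting loss of sqrt n is affordable: against
  s0 \<lambda>^2 it gives s0 \<tau>.\<close>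

lemma sum_square_product_le:
  fixes a d :: "'i \<Rightarrow> real"
  assumes "finite I"
  shows "(\<Sum>i\<in>I. (a i)\<^sup>2 * (d i)\<^sup>2) \<le> sqrt (\<Sum>i\<in>I. a i ^ 4) * (\<Sum>i\<in>I. (d i)\<^sup>2)"
proof -
  have "(a i)\<^sup>2 \<le> sqrt (\<Sum>i\<in>I. a i ^ 4)" if "i \<in> I" for i
  proof (rule real_le_rsqrt)
    have "a i ^ 4 \<le> (\<Sum>i\<in>I. a i ^ 4)"
      using assms that by (intro member_le_sum) auto
    then show "((a i)\<^sup>2)\<^sup>2 \<le> (\<Sum>i\<in>I. a i ^ 4)"
      by (simp add: power_mult[symmetric])
  qed
  then show ?thesis
    unfolding sum_distrib_left by (intro sum_mono mult_right_mono) auto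
qed

lemma sum_squares_perturbation:
  fixes f r :: "'i \<Rightarrow> real"
  shows "\<bar>(\<Sum>i\<in>I. (f i + r i)\<^sup>2) - (\<Sum>i\<in>I. (f i)\<^sup>2)\<bar>
    \<le> 2 * (sqrt (\<Sum>i\<in>I. (f i)\<^sup>2) * sqrt (\<Sum>i\<in>I. (r i)\<^sup>2)) + (\<Sum>i\<in>I. (r i)\<^sup>2)"
proof -
  have "(\<Sum>i\<in>I. (f i + r i)\<^sup>2) - (\<Sum>i\<in>I. (f i)\<^sup>2) = 2 * (\<Sum>i\<in>I. f i * r i) + (\<Sum>i\<in>I. (r i)\<^sup>2)"
  proof -
    have "(\<Sum>i\<in>I. (f i + r i)\<^sup>2) = (\<Sum>i\<in>I. (f i)\<^sup>2 + 2 * (f i * r i) + (r i)\<^sup>2)"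
      by (intro sum.cong) (auto simp: power2_sum)
    then show ?thesis
      by (simp add: sum.distrib sum_distrib_left[symmetric])
  qed
  moreover have "\<bar>\<Sum>i\<in>I. f i * r i\<bar> \<le> sqrt (\<Sum>i\<in>I. (f i)\<^sup>2) * sqrt (\<Sum>i\<in>I. (r i)\<^sup>2)"
    by (rule cauchy_sum_sqrt)
  moreover have "0 \<le> (\<Sum>i\<in>I. (r i)\<^sup>2)"
    by (simp add: sum_nonneg)
  ultimately show ?thesis by linarith
qed

definition lin_form :: "nat \<Rightarrow> (nat \<Rightarrow> real) \<Rightarrow> real vec \<Rightarrow> real" where
  "lin_form p c v = (\<Sum>k<p. c k * v $ k)"

subsection \<open>The population model\<close>

lemma space_vec_borel: "space (vec_borel p) = carrier_vec p"
  by (simp add: vec_borel_def)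

lemma space_obs_space: "space (obs_space p) = carrier_vec p \<times> UNIV"
  by (simp add: obs_space_def space_pair_measure space_vec_borel)

lemma measurable_vec_component [measurable]:
  assumes "k < p"
  shows "(\<lambda>v. v $ k) \<in> borel_measurable (vec_borel p)"
proof -
  have "(\<lambda>v. \<lambda>j\<in>{..<p}. v $ j) \<in> vec_borel p \<rightarrow>\<^sub>M PiM {..<p} (\<lambda>_. borel :: real measure)"
    unfolding vec_borel_def by (rule measurable_vimage_algebra1) (auto simp: space_PiM)
  from measurable_compose[OF this measurable_component_singleton[of k]]
  show ?thesis
    using assms by simp
qed

lemma measurable_mat_entry:
  assumes "j < p" "k < p"
  shows "(\<lambda>A. entry A j k) \<in> borel_measurable (mat_borel p)"
proof -
  have "(\<lambda>A. \<lambda>ij\<in>{..<p} \<times> {..<p}. A $$ ij) \<in> mat_borel p \<rightarrow>\<^sub>M PiM ({..<p} \<times> {..<p}) (\<lambda>_. borel :: real measure)"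
    unfolding mat_borel_def by (rule measurable_vimage_algebra1) (auto simp: space_PiM)
  from measurable_compose[OF this measurable_component_singleton[of "(j, k)"]]
  show ?thesis
    using assms by simp
qed

lemma measurable_obs_component [measurable]:
  assumes "k < p"
  shows "(\<lambda>z. fst z $ k) \<in> borel_measurable (obs_space p)"
  unfolding obs_space_def using measurable_vec_component[OF assms] by (rule measurable_compose[OF measurable_fst])

lemma measurable_obs_snd [measurable]: "snd \<in> borel_measurable (obs_space p)"
  unfolding obs_space_def by (rule measurable_snd)

lemma measurable_lin_vec [measurable]: "lin_form p c \<in> borel_measurable (vec_borel p)"
  unfolding lin_form_def[abs_def]
  by (intro borel_measurable_sum borel_measurable_times borel_measurable_const measurable_vec_component) auto

lemma measurable_lin [measurable]: "(\<lambda>z. lin_form p c (fst z)) \<in> borel_measurable (obs_space p)"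
  unfolding obs_space_def by (rule measurable_compose[OF measurable_fst measurable_lin_vec])

lemma scalar_prod_lin:
  assumes "c \<in> carrier_vec p" "v \<in> carrier_vec p"
  shows "v \<bullet> c = lin_form p (($) c) v" "c \<bullet> v = lin_form p (($) c) v"
  using assms by (auto simp: lin_form_def scalar_prod_def atLeast0LessThan mult.commute intro!: sum.cong)

lemma l2_norm_sq:
  assumes "v \<in> carrier_vec p"
  shows "l2_norm v = sqrt (sq_sum p (($) v))"
  using assms by (simp add: l2_norm_def scalar_prod_def atLeast0LessThan sq_sum_def power2_eq_square)

lemma mat_vec_lin:
  assumes "W \<in> carrier_mat p p" "v \<in> carrier_vec p" "j < p"
  shows "(W *\<^sub>v v) $ j = lin_form p (entry W j) v"
  using assms by (simp add: lin_form_def scalar_prod_def atLeast0LessThan)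

text \<open>Jensen's inequality for the fourth power with weights \<open>\<bar>u k\<bar>\<close>,
  obtained from Cauchy-Schwarz used twice. It reduces the fourth moment of a linear form to those of
  single coordinates, at the price of the l1 norm.\<close>

lemma lin_power4_le:
  "(lin_form p u v) ^ 4 \<le> (l1_sum p u) ^ 3 * (\<Sum>k<p. \<bar>u k\<bar> * (v $ k) ^ 4)"
proof -
  have cs: "(\<Sum>k<p. \<bar>u k\<bar> * c k)\<^sup>2 \<le> l1_sum p u * (\<Sum>k<p. \<bar>u k\<bar> * (c k)\<^sup>2)" for c
  proof -
    have "(\<Sum>k<p. \<bar>u k\<bar> * c k)\<^sup>2 = (\<Sum>k<p. sqrt \<bar>u k\<bar> * (sqrt \<bar>u k\<bar> * c k))\<^sup>2"
      by (simp add: mult.assoc[symmetric])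
    also have "\<dots> \<le> (\<Sum>k<p. (sqrt \<bar>u k\<bar>)\<^sup>2) * (\<Sum>k<p. (sqrt \<bar>u k\<bar> * c k)\<^sup>2)"
      by (rule Cauchy_Schwarz_ineq_sum)
    finally show ?thesis
      by (simp add: power_mult_distrib l1_sum_def)
  qed
  have "(lin_form p u v)\<^sup>2 \<le> (\<Sum>k<p. \<bar>u k\<bar> * \<bar>v $ k\<bar>)\<^sup>2"
    unfolding lin_form_def by (rule power2_le_iff_abs_le[THEN iffD2])
      (auto intro!: sum_nonneg order_trans[OF sum_abs] sum_mono simp: abs_mult)
  also have "\<dots> \<le> l1_sum p u * (\<Sum>k<p. \<bar>u k\<bar> * (v $ k)\<^sup>2)"
    using cs[of "\<lambda>k. \<bar>v $ k\<bar>"] by simp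
  finally have "((lin_form p u v)\<^sup>2)\<^sup>2 \<le> (l1_sum p u * (\<Sum>k<p. \<bar>u k\<bar> * (v $ k)\<^sup>2))\<^sup>2"
    by (intro power_mono) auto
  also have "\<dots> = (l1_sum p u)\<^sup>2 * (\<Sum>k<p. \<bar>u k\<bar> * (v $ k)\<^sup>2)\<^sup>2"
    by (simp add: power_mult_distrib)
  also have "\<dots> \<le> (l1_sum p u)\<^sup>2 * (l1_sum p u * (\<Sum>k<p. \<bar>u k\<bar> * ((v $ k)\<^sup>2)\<^sup>2))"
    using cs[of "\<lambda>k. (v $ k)\<^sup>2"] by (intro mult_left_mono) auto
  also have "\<dots> = (l1_sum p u) ^ 3 * (\<Sum>k<p. \<bar>u k\<bar> * (v $ k) ^ 4)"
    by (simp add: power_mult[symmetric] power3_eq_cube power2_eq_square[of "l1_sum p u"] mult.assoc)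
  finally show ?thesis
    by (simp add: power_mult[symmetric])
qed

lemma precision_matrix_symmetric:
  assumes "is_precision_matrix M p X0 \<Omega>"
  shows "transpose_mat \<Omega> = \<Omega>"
proof -
  define S where "S = second_moment M p X0"
  have S: "S \<in> carrier_mat p p" "transpose_mat S = S"
    unfolding S_def second_moment_def by (auto simp: mult.commute intro!: eq_matI)
  have \<Omega>: "\<Omega> \<in> carrier_mat p p" "S * \<Omega> = 1\<^sub>m p"
    using assms S(1) by (auto simp: is_precision_matrix_def S_def inverts_mat_def)
  have t: "transpose_mat \<Omega> * S = 1\<^sub>m p"
    using transpose_mult[OF S(1) \<Omega>(1)] S(2) \<Omega>(2) by simp
  have "transpose_mat \<Omega> = transpose_mat \<Omega> * (S * \<Omega>)"
    using \<Omega> by simp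
  also have "\<dots> = (transpose_mat \<Omega> * S) * \<Omega>"
    using \<Omega>(1) S(1) by (intro assoc_mult_mat[symmetric]) auto
  also have "\<dots> = \<Omega>"
    using t \<Omega>(1) by simp
  finally show ?thesis .
qed

text \<open>The common ground of (i) and (ii) at a fixed n, with sub-gaussian constants in
  exponential-moment form. The bounds \<open>sg_X\<close> and \<open>sg_score\<close> come from the
  extra hypotheses of (i), and in (ii) from sub-gaussianity of the whole vector.\<close>

locale regression_model = prob_space M for M :: "'a measure" +
  fixes p n :: nat and X :: "nat \<Rightarrow> 'a \<Rightarrow> real vec" and Y :: "nat \<Rightarrow> 'a \<Rightarrow> real"
    and \<beta> \<xi> :: "real vec" and \<Omega> :: "real mat" and c3 c4 c5 K K2 :: real
  assumes iid: "iid_copies M p n X Y" and sqint: "square_integrable_obs M p (X 0) (Y 0)"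
    and target: "is_regression_target M p (X 0) (Y 0) \<beta>" and prec: "is_precision_matrix M p (X 0) \<Omega>"
    and \<xi>: "\<xi> \<in> carrier_vec p" "\<xi> \<noteq> 0\<^sub>v p"
    and c: "0 < c3" "c3 \<le> lambda_min \<Omega>" "lambda_max \<Omega> \<le> c4" "0 < c4" "0 < c5" and K: "0 < K" "0 < K2"
    and sg_eps: "subgaussian M (\<lambda>\<omega>. Y 0 \<omega> - X 0 \<omega> \<bullet> \<beta>) K2"
    and cond_var: "AE \<omega> in M. real_cond_exp M (vimage_algebra (space M) (X 0) (vec_borel p))
                        (\<lambda>\<omega>. (Y 0 \<omega> - X 0 \<omega> \<bullet> \<beta>)\<^sup>2) \<omega> \<ge> c5"
    and sg_OX: "\<And>j. j < p \<Longrightarrow> subgaussian M (\<lambda>\<omega>. (\<Omega> *\<^sub>v X 0 \<omega>) $ j) K"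
    and sg_X: "\<And>j. j < p \<Longrightarrow> subgaussian M (\<lambda>\<omega>. X 0 \<omega> $ j) K"
    and sg_score: "subgaussian M (\<lambda>\<omega>. \<xi> \<bullet> (\<Omega> *\<^sub>v X 0 \<omega>)) (K * l2_norm (\<Omega> *\<^sub>v \<xi>))"
begin

definition Z :: "nat \<Rightarrow> 'a \<Rightarrow> real vec \<times> real" where "Z i \<omega> = (X i \<omega>, Y i \<omega>)"
text \<open>Population statements are made under the law of one observation, so that they apply to
  every \<open>Z i\<close> alike.\<close>

definition law :: "(real vec \<times> real) measure" where "law = distr M (obs_space p) (Z 0)"
definition eps :: "real vec \<times> real \<Rightarrow> real" where "eps z = snd z - lin_form p (($) \<beta>) (fst z)"
definition Sig :: "nat \<Rightarrow> nat \<Rightarrow> real" where "Sig j k = entry (second_moment M p (X 0)) j k"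
definition \<alpha> :: "nat \<Rightarrow> real" where "\<alpha> k = (\<Sum>j<p. \<xi> $ j * entry \<Omega> j k)"
definition score :: "real vec \<times> real \<Rightarrow> real" where "score z = lin_form p \<alpha> (fst z)"
definition N :: real where "N = sqrt (sq_sum p (($) \<xi>))"

lemma Z0 [measurable]: "Z 0 \<in> M \<rightarrow>\<^sub>M obs_space p"
  using iid by (simp add: iid_copies_def Z_def[abs_def])

lemma indep_Z: "indep_vars (\<lambda>_. obs_space p) Z {1..n}"
  using iid by (simp add: iid_copies_def Z_def[abs_def])

lemma Zi: "i \<in> {1..n} \<Longrightarrow> Z i \<in> M \<rightarrow>\<^sub>M obs_space p"
  using indep_Z by (auto simp: indep_vars_def)

lemma law_Zi: "i \<in> {1..n} \<Longrightarrow> distr M (obs_space p) (Z i) = law"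
  using iid by (simp add: iid_copies_def Z_def[abs_def] law_def)

lemma sets_law [measurable_cong]: "sets law = sets (obs_space p)"
  by (simp add: law_def)

lemma law_prob: "prob_space law"
  unfolding law_def by (rule prob_space_distr) simp

sublocale L: prob_space law
  by (rule law_prob)

lemma X_carrier: "\<omega> \<in> space M \<Longrightarrow> i = 0 \<or> i \<in> {1..n} \<Longrightarrow> X i \<omega> \<in> carrier_vec p"
  using measurable_space[OF Z0, of \<omega>] measurable_space[OF Zi, of i \<omega>]
  by (auto simp: space_obs_space Z_def)

lemma \<Omega>_carrier: "\<Omega> \<in> carrier_mat p p"
  using prec by (simp add: is_precision_matrix_def)

lemma \<beta>_carrier: "\<beta> \<in> carrier_vec p"
  using target by (simp add: is_regression_target_def is_arg_min_def)

lemma p_pos: "0 < p"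
proof (rule ccontr)
  assume "\<not> 0 < p"
  then have "\<xi> = 0\<^sub>v p"
    using \<xi>(1) by (intro eq_vecI) auto
  then show False
    using \<xi>(2) by simp
qed

lemma eps_measurable [measurable]: "eps \<in> borel_measurable (obs_space p)"
  unfolding eps_def[abs_def] by measurable

lemma score_measurable [measurable]: "score \<in> borel_measurable (obs_space p)"
  unfolding score_def[abs_def] by measurable

lemma eps_eq: "\<omega> \<in> space M \<Longrightarrow> i = 0 \<or> i \<in> {1..n} \<Longrightarrow> eps (Z i \<omega>) = Y i \<omega> - X i \<omega> \<bullet> \<beta>"
  using scalar_prod_lin(1)[OF \<beta>_carrier X_carrier] by (simp add: eps_def Z_def)

lemma score_eq: "\<omega> \<in> space M \<Longrightarrow> i = 0 \<or> i \<in> {1..n} \<Longrightarrow> score (Z i \<omega>) = \<xi> \<bullet> (\<Omega> *\<^sub>v X i \<omega>)"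
  using scalar_prod_mv[OF \<xi>(1) \<Omega>_carrier X_carrier] by (simp add: score_def Z_def lin_form_def \<alpha>_def)

lemma sg_law:
  assumes [measurable]: "f \<in> borel_measurable (obs_space p)"
    and "\<And>\<omega>. \<omega> \<in> space M \<Longrightarrow> f (Z 0 \<omega>) = g \<omega>" and "subgaussian M g k"
  shows "subgaussian law f k"
proof -
  have "(\<integral>\<^sup>+z. ennreal (exp ((f z)\<^sup>2 / k\<^sup>2)) \<partial>law) = (\<integral>\<^sup>+\<omega>. ennreal (exp ((g \<omega>)\<^sup>2 / k\<^sup>2)) \<partial>M)"
    unfolding law_def using assms(2) by (subst nn_integral_distr) (auto intro!: nn_integral_cong)
  then show ?thesis
    using assms(3) by (simp add: subgaussian_def)
qed

lemma integral_law:
  fixes f :: "real vec \<times> real \<Rightarrow> real"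
  assumes [measurable]: "f \<in> borel_measurable (obs_space p)"
  shows "integral\<^sup>L law f = (\<integral>\<omega>. f (Z 0 \<omega>) \<partial>M)" "integrable law f \<longleftrightarrow> integrable M (\<lambda>\<omega>. f (Z 0 \<omega>))"
  unfolding law_def by (auto simp: integral_distr integrable_distr_eq)

lemma law_sg_eps: "subgaussian law eps K2"
  by (rule sg_law[OF _ _ sg_eps]) (auto simp: eps_eq)

lemma law_sg_X: "j < p \<Longrightarrow> subgaussian law (\<lambda>z. fst z $ j) K"
  by (rule sg_law[OF _ _ sg_X]) (auto simp: Z_def)

lemma law_sg_OX: "j < p \<Longrightarrow> subgaussian law (\<lambda>z. lin_form p (entry \<Omega> j) (fst z)) K"
  by (rule sg_law[OF _ _ sg_OX]) (auto simp: Z_def mat_vec_lin[OF \<Omega>_carrier X_carrier])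

lemma Sig_carrier: "second_moment M p (X 0) \<in> carrier_mat p p"
  by (simp add: second_moment_def)

lemma Sig_sym: "j < p \<Longrightarrow> k < p \<Longrightarrow> Sig j k = Sig k j"
  by (simp add: Sig_def second_moment_def mult.commute)

lemma Sig_law: "j < p \<Longrightarrow> k < p \<Longrightarrow> Sig j k = (\<integral>z. fst z $ j * fst z $ k \<partial>law)"
  by (subst integral_law) (auto simp: Sig_def second_moment_def Z_def)

lemma ment_mult_one:
  assumes "A \<in> carrier_mat p p" "B \<in> carrier_mat p p" "A * B = 1\<^sub>m p" "j < p" "l < p"
  shows "(\<Sum>k<p. entry A j k * entry B k l) = (if j = l then 1 else 0)"
proof -
  have "(\<Sum>k<p. entry A j k * entry B k l) = (A * B) $$ (j, l)"
    using assms(1,2,4,5) by (simp add: scalar_prod_def atLeast0LessThan)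
  then show ?thesis
    using assms by simp
qed

lemma Sig_\<Omega>: "j < p \<Longrightarrow> l < p \<Longrightarrow> (\<Sum>k<p. Sig j k * entry \<Omega> k l) = (if j = l then 1 else 0)"
  unfolding Sig_def using prec Sig_carrier
  by (intro ment_mult_one) (auto simp: is_precision_matrix_def inverts_mat_def)

lemma \<Omega>_Sig: "j < p \<Longrightarrow> l < p \<Longrightarrow> (\<Sum>k<p. entry \<Omega> j k * Sig k l) = (if j = l then 1 else 0)"
  unfolding Sig_def using prec Sig_carrier
  by (intro ment_mult_one) (auto simp: is_precision_matrix_def inverts_mat_def)

lemma \<Omega>_sym:
  assumes "j < p" "l < p"
  shows "entry \<Omega> j l = entry \<Omega> l j"
  using assms \<Omega>_carrier precision_matrix_symmetric[OF prec] by (metis carrier_matD index_transpose_mat(1))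

sublocale inverse_pair p Sig "entry \<Omega>" c3 c4
proof
  fix v
  have "c3 * sq_sum p v \<le> lambda_min \<Omega> * sq_sum p v"
    using c by (intro mult_right_mono) auto
  then show "c3 * sq_sum p v \<le> bil_form p (entry \<Omega>) v v"
    using lambda_min_le_quadratic_form[OF \<Omega>_carrier p_pos \<Omega>_sym, of v] by linarith
  have "lambda_max \<Omega> * sq_sum p v \<le> c4 * sq_sum p v"
    using c by (intro mult_right_mono) auto
  then show "bil_form p (entry \<Omega>) v v \<le> c4 * sq_sum p v"
    using quadratic_form_le_lambda_max[OF \<Omega>_carrier p_pos \<Omega>_sym, of v] by linarith
qed (use c Sig_sym \<Omega>_sym Sig_\<Omega> \<Omega>_Sig in auto)

lemma \<alpha>_mv: "k < p \<Longrightarrow> \<alpha> k = mat_app p (entry \<Omega>) (($) \<xi>) k"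
  unfolding \<alpha>_def mat_app_def by (intro sum.cong) (auto simp: \<Omega>_sym mult.commute)

lemma N_sq: "N\<^sup>2 = sq_sum p (($) \<xi>)"
  by (simp add: N_def)

lemma N_pos: "0 < N"
proof -
  have "sq_sum p (($) \<xi>) \<noteq> 0"
  proof
    assume "sq_sum p (($) \<xi>) = 0"
    then have "\<xi> = 0\<^sub>v p"
      using \<xi>(1) sq_eq_0 by (intro eq_vecI) auto
    then show False using \<xi>(2) by simp
  qed
  then have "0 < sq_sum p (($) \<xi>)"
    by (metis less_le sq_nonneg)
  then show ?thesis
    by (simp add: N_def)
qed

lemma sq_\<alpha>: "sq_sum p \<alpha> \<le> c4\<^sup>2 * N\<^sup>2" and \<alpha>_pos: "0 < sq_sum p \<alpha>"
proof -
  have e: "sq_sum p \<alpha> = sq_sum p (mat_app p (entry \<Omega>) (($) \<xi>))"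
    by (simp add: sq_sum_def \<alpha>_mv)
  show "sq_sum p \<alpha> \<le> c4\<^sup>2 * N\<^sup>2"
    unfolding e N_sq by (rule W_mv_bound)
  have "sq_sum p \<alpha> \<noteq> 0"
  proof
    assume "sq_sum p \<alpha> = 0"
    then have "mat_app p (entry \<Omega>) (($) \<xi>) k = 0" if "k < p" for k
      using sq_eq_0[of p \<alpha> k] that by (simp add: \<alpha>_mv)
    then have "bil_form p (entry \<Omega>) (($) \<xi>) (($) \<xi>) = 0"
      by (simp add: bil_mv)
    moreover have "0 < c3 * N\<^sup>2"
      using c N_pos by simp
    ultimately show False
      using c3(2)[of "($) \<xi>"] by (simp add: N_sq)
  qed
  then show "0 < sq_sum p \<alpha>"
    using sq_nonneg[of p \<alpha>] by linarith
qed

text \<open>An upper bound for K times the l2 norm of \<Omega> \<xi>, written as a multiple of the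
  norm of \<xi> so that all later bounds scale with \<open>N\<close>.\<close>

definition K\<alpha> :: real where "K\<alpha> = K * c4 * N"

lemma K\<alpha>_pos: "0 < K\<alpha>"
  using K c N_pos by (simp add: K\<alpha>_def)

lemma sg_mono:
  assumes "subgaussian P f k" "0 < k" "k \<le> l"
  shows "subgaussian P f l"
proof -
  have "(\<integral>\<^sup>+z. ennreal (exp ((f z)\<^sup>2 / l\<^sup>2)) \<partial>P) \<le> (\<integral>\<^sup>+z. ennreal (exp ((f z)\<^sup>2 / k\<^sup>2)) \<partial>P)"
    using assms(2,3) power_mono[of k l 2] by (intro nn_integral_mono ennreal_leI) (auto intro!: divide_left_mono)
  then show ?thesis
    using assms(1) unfolding subgaussian_def by (rule order_trans)
qed

lemma law_sg_score: "subgaussian law score K\<alpha>"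
proof -
  have "\<Omega> *\<^sub>v \<xi> \<in> carrier_vec p"
    using \<Omega>_carrier \<xi> by auto
  moreover have "(\<Omega> *\<^sub>v \<xi>) $ k = \<alpha> k" if "k < p" for k
    using that by (simp only: mat_vec_lin[OF \<Omega>_carrier \<xi>(1) that] \<alpha>_mv lin_form_def mat_app_def)
  ultimately have e: "l2_norm (\<Omega> *\<^sub>v \<xi>) = sqrt (sq_sum p \<alpha>)"
    unfolding l2_norm_sq[OF \<open>\<Omega> *\<^sub>v \<xi> \<in> carrier_vec p\<close>] sq_sum_def by (simp del: index_mult_mat_vec)
  have "sqrt (sq_sum p \<alpha>) \<le> c4 * N"
    using sq_\<alpha> c N_pos by (intro real_le_lsqrt) (auto simp: power_mult_distrib)
  then have le: "K * l2_norm (\<Omega> *\<^sub>v \<xi>) \<le> K\<alpha>"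
    using K unfolding e K\<alpha>_def mult.assoc by (intro mult_left_mono) auto
  have "subgaussian law score (K * l2_norm (\<Omega> *\<^sub>v \<xi>))"
    by (rule sg_law[OF _ _ sg_score]) (auto simp: score_eq)
  then show ?thesis
    using le K \<alpha>_pos by (rule_tac sg_mono) (auto simp: e)
qed

lemma integrable_product_law:
  fixes f g :: "real vec \<times> real \<Rightarrow> real"
  assumes [measurable]: "f \<in> borel_measurable law" "g \<in> borel_measurable law"
    and "integrable law (\<lambda>z. (f z)\<^sup>2)" "integrable law (\<lambda>z. (g z)\<^sup>2)"
  shows "integrable law (\<lambda>z. f z * g z)"
proof (rule Bochner_Integration.integrable_bound[OF Bochner_Integration.integrable_add[OF assms(3,4)]])
  have "\<bar>f z * g z\<bar> \<le> (f z)\<^sup>2 + (g z)\<^sup>2" for z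
  proof -
    have "2 * (\<bar>f z\<bar> * \<bar>g z\<bar>) \<le> (f z)\<^sup>2 + (g z)\<^sup>2"
      using sum_squares_bound[of "\<bar>f z\<bar>" "\<bar>g z\<bar>"] by (simp add: mult.assoc)
    moreover have "0 \<le> \<bar>f z\<bar> * \<bar>g z\<bar>"
      by simp
    ultimately show ?thesis
      unfolding abs_mult by linarith
  qed
  then show "AE z in law. norm (f z * g z) \<le> norm ((f z)\<^sup>2 + (g z)\<^sup>2)"
    by simp
qed simp

lemma integrable_X_sq: "j < p \<Longrightarrow> integrable law (\<lambda>z. (fst z $ j)\<^sup>2)"
  using sg_even_moment(1)[OF law_sg_X K(1), of j 1] by (simp add: sets_law[THEN measurable_cong_sets])

lemma integrable_XX: "j < p \<Longrightarrow> k < p \<Longrightarrow> integrable law (\<lambda>z. fst z $ j * fst z $ k)"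
  by (intro integrable_product_law integrable_X_sq) auto

lemma lin_sq_expand: "(lin_form p u v)\<^sup>2 = (\<Sum>j<p. \<Sum>k<p. u j * u k * (v $ j * v $ k))"
  by (simp add: lin_form_def power2_eq_square sum_product mult_ac)

lemma integrable_lin_sq: "integrable law (\<lambda>z. (lin_form p u (fst z))\<^sup>2)"
  unfolding lin_sq_expand
  by (intro Bochner_Integration.integrable_sum integrable_mult_right integrable_XX) auto

lemma integral_lin_sq: "(\<integral>z. (lin_form p u (fst z))\<^sup>2 \<partial>law) = bil_form p Sig u u"
proof -
  have "(\<integral>z. (lin_form p u (fst z))\<^sup>2 \<partial>law) = (\<Sum>j<p. \<Sum>k<p. u j * u k * (\<integral>z. fst z $ j * fst z $ k \<partial>law))"
    unfolding lin_sq_expand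
  proof (subst Bochner_Integration.integral_sum)
    show "integrable law (\<lambda>z. \<Sum>k<p. u j * u k * (fst z $ j * fst z $ k))" if "j \<in> {..<p}" for j
      using that by (intro Bochner_Integration.integrable_sum integrable_mult_right integrable_XX) auto
    show "(\<Sum>j<p. \<integral>z. (\<Sum>k<p. u j * u k * (fst z $ j * fst z $ k)) \<partial>law)
        = (\<Sum>j<p. \<Sum>k<p. u j * u k * (\<integral>z. fst z $ j * fst z $ k \<partial>law))"
      by (intro sum.cong refl, subst Bochner_Integration.integral_sum)
        (auto intro!: integrable_mult_right integrable_XX)
  qed
  also have "\<dots> = bil_form p Sig u u"
    unfolding bil_form_def by (intro sum.cong refl) (auto simp: Sig_law mult_ac)
  finally show ?thesis .
qed

text \<open>This is \<Sigma> \<Omega> \<xi> = \<xi>, the reason why the Gram residual of the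
  expansion is centred.\<close>

lemma integral_score_X: "k < p \<Longrightarrow> (\<integral>z. score z * fst z $ k \<partial>law) = \<xi> $ k"
proof -
  assume k: "k < p"
  have "(\<integral>z. score z * fst z $ k \<partial>law) = (\<integral>z. (\<Sum>j<p. \<alpha> j * (fst z $ j * fst z $ k)) \<partial>law)"
    by (simp add: score_def lin_form_def sum_distrib_right mult.assoc)
  also have "\<dots> = (\<Sum>j<p. \<alpha> j * Sig j k)"
    using k by (subst Bochner_Integration.integral_sum)
      (auto intro!: integrable_mult_right integrable_XX simp: Sig_law)
  also have "\<dots> = mat_app p Sig (mat_app p (entry \<Omega>) (($) \<xi>)) k"
    unfolding mat_app_def[of p Sig] using k by (intro sum.cong) (auto simp: \<alpha>_mv Sig_sym mult.commute)
  also have "\<dots> = \<xi> $ k"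
    using S_W_id[OF k] by simp
  finally show ?thesis .
qed

lemma integral_OX_X: "j < p \<Longrightarrow> k < p \<Longrightarrow> (\<integral>z. fst z $ j * lin_form p (entry \<Omega> k) (fst z) \<partial>law) = (if j = k then 1 else 0)"
proof -
  assume jk: "j < p" "k < p"
  have "(\<integral>z. fst z $ j * lin_form p (entry \<Omega> k) (fst z) \<partial>law) = (\<integral>z. (\<Sum>l<p. entry \<Omega> k l * (fst z $ j * fst z $ l)) \<partial>law)"
    by (simp add: lin_form_def sum_distrib_left mult_ac)
  also have "\<dots> = (\<Sum>l<p. Sig j l * entry \<Omega> l k)"
    using jk by (subst Bochner_Integration.integral_sum)
      (auto intro!: integrable_mult_right integrable_XX sum.cong simp: Sig_law \<Omega>_sym mult.commute)
  finally show ?thesis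
    using Sig_\<Omega>[OF jk] by simp
qed

lemma integrable_eps_sq: "integrable law (\<lambda>z. (eps z)\<^sup>2)"
  using sg_even_moment(1)[OF law_sg_eps K(2), of 1] by (simp add: sets_law[THEN measurable_cong_sets])

lemma integrable_X_eps: "j < p \<Longrightarrow> integrable law (\<lambda>z. fst z $ j * eps z)"
  by (intro integrable_product_law integrable_X_sq integrable_eps_sq) auto

text \<open>The normal equations. The model may be misspecified, so the error is only uncorrelated
  with the covariates; this follows by moving the target by t in coordinate j and reading off the
  linear coefficient.\<close>

lemma integral_X_eps: "j < p \<Longrightarrow> (\<integral>z. fst z $ j * eps z \<partial>law) = 0"
proof -
  assume j: "j < p"
  let ?E = "\<integral>z. fst z $ j * eps z \<partial>law"
  let ?loss = "\<lambda>b. integral\<^sup>L M (\<lambda>\<omega>. (1/2) * (Y 0 \<omega> - X 0 \<omega> \<bullet> b)\<^sup>2)"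
  have "- ?E = 0"
  proof (rule linear_coefficient_zero)
    fix t :: real
    define b where "b = vec p (\<lambda>k. \<beta> $ k + (if k = j then t else 0))"
    have b: "b \<in> carrier_vec p"
      by (simp add: b_def)
    have "?loss \<beta> \<le> ?loss b"
      using target b by (auto simp: is_regression_target_def is_arg_min_def not_less)
    also have "?loss b = (\<integral>z. (1/2) * (eps z - t * fst z $ j)\<^sup>2 \<partial>law)"
    proof (subst integral_law, measurable, (simp add: j), intro Bochner_Integration.integral_cong refl)
      fix \<omega> assume w: "\<omega> \<in> space M"
      have "X 0 \<omega> \<bullet> b = lin_form p (\<lambda>k. \<beta> $ k + (if k = j then t else 0)) (X 0 \<omega>)"
        using scalar_prod_lin(1)[OF b X_carrier[OF w]] by (simp add: lin_form_def b_def)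
      also have "\<dots> = lin_form p (($) \<beta>) (X 0 \<omega>) + t * X 0 \<omega> $ j"
        using j by (simp add: lin_form_def distrib_right sum.distrib if_distrib[of "\<lambda>x. x * _"] cong: if_cong)
      finally have "Y 0 \<omega> - X 0 \<omega> \<bullet> b = eps (Z 0 \<omega>) - t * fst (Z 0 \<omega>) $ j"
        by (simp add: eps_def Z_def)
      then show "(1/2) * (Y 0 \<omega> - X 0 \<omega> \<bullet> b)\<^sup>2 = (1/2) * (eps (Z 0 \<omega>) - t * fst (Z 0 \<omega>) $ j)\<^sup>2"
        by simp
    qed
    also have "\<dots> = (\<integral>z. (1/2) * (eps z)\<^sup>2 + (- t * (fst z $ j * eps z) + (t\<^sup>2/2) * (fst z $ j)\<^sup>2) \<partial>law)"
      by (intro Bochner_Integration.integral_cong) (auto simp: power2_diff algebra_simps power_mult_distrib)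
    also have "\<dots> = (\<integral>z. (1/2) * (eps z)\<^sup>2 \<partial>law) + (- t * ?E + (t\<^sup>2/2) * (\<integral>z. (fst z $ j)\<^sup>2 \<partial>law))"
      using integrable_eps_sq integrable_X_eps[OF j] integrable_X_sq[OF j] by simp
    also have "(\<integral>z. (1/2) * (eps z)\<^sup>2 \<partial>law) = ?loss \<beta>"
      by (subst integral_law) (auto intro!: Bochner_Integration.integral_cong simp: eps_eq)
    finally show "0 \<le> 2 * t * (- ?E) + t\<^sup>2 * (\<integral>z. (fst z $ j)\<^sup>2 \<partial>law)"
      by simp
  qed
  then show ?thesis by simp
qed

lemma eps_fourth: "(\<integral>\<^sup>+z. ennreal (eps z ^ 4) \<partial>law) \<le> ennreal (4 * K2 ^ 4)"
  using sg_moment[OF law_sg_eps K(2), of 2] by (simp add: sets_law[THEN measurable_cong_sets] eval_nat_numeral)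

lemma score_fourth: "(\<integral>\<^sup>+z. ennreal (score z ^ 4) \<partial>law) \<le> ennreal (4 * K\<alpha> ^ 4)"
  using sg_moment[OF law_sg_score K\<alpha>_pos, of 2] by (simp add: sets_law[THEN measurable_cong_sets] eval_nat_numeral)

definition V :: real where "V = (\<integral>z. (score z)\<^sup>2 * (eps z)\<^sup>2 \<partial>law)"

lemma V_oracle: "V = oracle_variance M (X 0) (Y 0) \<xi> \<beta> \<Omega>"
  unfolding V_def oracle_variance_def
  by (subst integral_law) (auto intro!: Bochner_Integration.integral_cong simp: eps_eq score_eq)

lemma integrable_score_eps_sq: "integrable law (\<lambda>z. (score z)\<^sup>2 * (eps z)\<^sup>2)"
  using sg_even_moment(1)[OF law_sg_eps K(2), of 2] sg_even_moment(1)[OF law_sg_score K\<alpha>_pos, of 2]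
  by (intro integrable_product_law) (simp_all add: sets_law[THEN measurable_cong_sets] power_mult[symmetric])

lemma score_eps_fourth:
  "integrable law (\<lambda>z. ((score z)\<^sup>2 * (eps z)\<^sup>2)\<^sup>2)"
  "(\<integral>z. ((score z)\<^sup>2 * (eps z)\<^sup>2)\<^sup>2 \<partial>law) \<le> 24 * ((K * c4) ^ 8 + K2 ^ 8) * N ^ 4"
proof -
  have i: "integrable law (\<lambda>z. score z ^ 8)" "integrable law (\<lambda>z. eps z ^ 8)"
    and le: "(\<integral>z. score z ^ 8 \<partial>law) \<le> 48 * K\<alpha> ^ 8" "(\<integral>z. eps z ^ 8 \<partial>law) \<le> 48 * K2 ^ 8"
    using sg_even_moment[OF law_sg_eps K(2), of 4] sg_even_moment[OF law_sg_score K\<alpha>_pos, of 4]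
    by (simp_all add: sets_law[THEN measurable_cong_sets] fact_numeral)
  let ?g = "\<lambda>z. (1/2) * (1 / N ^ 4 * score z ^ 8) + (1/2) * (N ^ 4 * eps z ^ 8)"
  have b: "((score z)\<^sup>2 * (eps z)\<^sup>2)\<^sup>2 \<le> ?g z" for z
  proof -
    \<comment> \<open>The score scales with \<open>N\<close> and the error does not; the weights
      balance the two eighth moments so that both contribute multiples of N^4.\<close>
    define x y where "x = score z ^ 4 / N\<^sup>2" and "y = N\<^sup>2 * eps z ^ 4"
    have "x * y \<le> (1/2) * x\<^sup>2 + (1/2) * y\<^sup>2"
      using sum_squares_bound[of x y] by simp
    moreover have "x * y = ((score z)\<^sup>2 * (eps z)\<^sup>2)\<^sup>2"
      using N_pos by (simp add: x_def y_def power_mult_distrib power_mult[symmetric])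
    moreover have "x\<^sup>2 = 1 / N ^ 4 * score z ^ 8" "y\<^sup>2 = N ^ 4 * eps z ^ 8"
      by (simp_all add: x_def y_def power_mult_distrib power_divide power_mult[symmetric])
    ultimately show ?thesis by simp
  qed
  have ig: "integrable law ?g"
    using i by (intro Bochner_Integration.integrable_add integrable_mult_right)
  show int: "integrable law (\<lambda>z. ((score z)\<^sup>2 * (eps z)\<^sup>2)\<^sup>2)"
    using b by (intro Bochner_Integration.integrable_bound[OF ig])
      (auto intro!: AE_I2 simp: sets_law[THEN measurable_cong_sets] intro: order_trans[OF _ abs_ge_self])
  have "(\<integral>z. ((score z)\<^sup>2 * (eps z)\<^sup>2)\<^sup>2 \<partial>law) \<le> integral\<^sup>L law ?g"
    by (intro integral_mono int ig b)
  also have "\<dots> = (1/2) * (1 / N ^ 4 * (\<integral>z. score z ^ 8 \<partial>law)) + (1/2) * (N ^ 4 * (\<integral>z. eps z ^ 8 \<partial>law))"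
    using i by simp
  also have "\<dots> \<le> (1/2) * (1 / N ^ 4 * (48 * K\<alpha> ^ 8)) + (1/2) * (N ^ 4 * (48 * K2 ^ 8))"
    using le N_pos by (intro add_mono mult_left_mono) auto
  also have "1 / N ^ 4 * (48 * K\<alpha> ^ 8) = 48 * ((K * c4) ^ 8 * N ^ 4)"
    using N_pos by (simp add: K\<alpha>_def power_mult_distrib field_simps flip: power_add)
  finally show "(\<integral>z. ((score z)\<^sup>2 * (eps z)\<^sup>2)\<^sup>2 \<partial>law) \<le> 24 * ((K * c4) ^ 8 + K2 ^ 8) * N ^ 4"
    by (simp add: algebra_simps)
qed

text \<open>Conditioning on the covariates replaces the squared error by at least c5. What remains
  is c5 times \<alpha>' \<Sigma> \<alpha> = \<xi>' \<Omega> \<xi>, and (a) bounds that form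
  below.\<close>

lemma V_lower: "c5 * c3 * N\<^sup>2 \<le> V"
proof -
  define F where "F = vimage_algebra (space M) (X 0) (vec_borel p)"
  have X0: "X 0 \<in> M \<rightarrow>\<^sub>M vec_borel p"
    using measurable_compose[OF Z0[unfolded obs_space_def] measurable_fst]
    by (simp add: Z_def)
  have sub: "subalgebra M F"
    unfolding subalgebra_def F_def using X0
    by (auto simp: measurable_iff_sets)
  interpret F: finite_measure_subalgebra M F
    using sub by unfold_locales
  let ?s = "\<lambda>\<omega>. (lin_form p \<alpha> (X 0 \<omega>))\<^sup>2"
  let ?e = "\<lambda>\<omega>. (Y 0 \<omega> - X 0 \<omega> \<bullet> \<beta>)\<^sup>2"
  have X0F: "X 0 \<in> F \<rightarrow>\<^sub>M vec_borel p"
    unfolding F_def using X0 by (intro measurable_vimage_algebra1) (auto dest: measurable_space)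
  have sF: "?s \<in> borel_measurable F"
    using measurable_compose[OF X0F measurable_lin_vec] by simp
  have "(\<lambda>\<omega>. (eps (Z 0 \<omega>))\<^sup>2) \<in> borel_measurable M"
    by simp
  then have eM: "?e \<in> borel_measurable M"
    by (rule measurable_cong[THEN iffD1, rotated]) (simp add: eps_eq)
  have int: "integrable M (\<lambda>\<omega>. ?s \<omega> * ?e \<omega>)"
    using integrable_score_eps_sq
    by (subst (asm) integral_law)
      (auto simp: score_def Z_def eps_eq[of _ 0, unfolded Z_def] cong: Bochner_Integration.integrable_cong)
  note ce = F.real_cond_exp_intg[OF int sF eM]
  have Veq: "V = (\<integral>\<omega>. ?s \<omega> * ?e \<omega> \<partial>M)"
    unfolding V_def
    by (subst integral_law) (auto intro!: Bochner_Integration.integral_cong simp: score_def eps_eq Z_def eps_eq[of _ 0, unfolded Z_def])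
  have isq: "integrable M ?s"
    using integrable_lin_sq[of \<alpha>] by (subst (asm) integral_law) (auto simp: Z_def)
  have "c5 * c3 * N\<^sup>2 \<le> c5 * bil_form p Sig \<alpha> \<alpha>"
  proof -
    have "bil_form p Sig \<alpha> \<alpha> = bil_form p Sig (mat_app p (entry \<Omega>) (($) \<xi>)) (mat_app p (entry \<Omega>) (($) \<xi>))"
      unfolding bil_form_def by (intro sum.cong refl) (auto simp: \<alpha>_mv)
    also have "\<dots> = bil_form p (entry \<Omega>) (($) \<xi>) (($) \<xi>)"
      unfolding bil_mv[of p Sig] bil_mv[of p "entry \<Omega>"] by (intro sum.cong) (auto simp: S_W_id)
    finally have "c3 * N\<^sup>2 \<le> bil_form p Sig \<alpha> \<alpha>"
      using c3(2) by (simp add: N_sq)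
    then show ?thesis
      using c by (simp add: mult.assoc)
  qed
  also have "bil_form p Sig \<alpha> \<alpha> = (\<integral>\<omega>. ?s \<omega> \<partial>M)"
    by (subst integral_lin_sq[symmetric], subst integral_law) (auto simp: Z_def)
  also have "c5 * (\<integral>\<omega>. ?s \<omega> \<partial>M) = (\<integral>\<omega>. ?s \<omega> * c5 \<partial>M)"
    by simp
  also have "\<dots> \<le> (\<integral>\<omega>. ?s \<omega> * real_cond_exp M F ?e \<omega> \<partial>M)"
  proof (rule integral_mono_AE)
    show "AE \<omega> in M. ?s \<omega> * c5 \<le> ?s \<omega> * real_cond_exp M F ?e \<omega>"
      using cond_var unfolding F_def[symmetric] by (rule AE_mp) (auto intro!: AE_I2 mult_left_mono)
  qed (use isq ce(1) in auto)
  also have "\<dots> = V"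
    unfolding Veq by (rule ce(2))
  finally show ?thesis .
qed

end

subsection \<open>Sample second moments\<close>

lemma (in prob_space) second_moment_indep_sum:
  fixes W :: "'i \<Rightarrow> 'a \<Rightarrow> real"
  assumes fin: "finite I" and ind: "indep_vars (\<lambda>_. borel) W I"
    and sqi: "\<And>i. i \<in> I \<Longrightarrow> integrable M (\<lambda>\<omega>. (W i \<omega>)\<^sup>2)"
    and z: "\<And>i. i \<in> I \<Longrightarrow> expectation (W i) = 0"
  shows "integrable M (\<lambda>\<omega>. (\<Sum>i\<in>I. W i \<omega>)\<^sup>2) \<and>
    expectation (\<lambda>\<omega>. (\<Sum>i\<in>I. W i \<omega>)\<^sup>2) = (\<Sum>i\<in>I. expectation (\<lambda>\<omega>. (W i \<omega>)\<^sup>2))"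
  using assms
proof (induction I rule: finite_induct)
  case (insert i I)
  have W: "j \<in> insert i I \<Longrightarrow> W j \<in> borel_measurable M" for j
    using insert.prems(1) by (auto simp: indep_vars_def)
  have int: "j \<in> insert i I \<Longrightarrow> integrable M (W j)" for j
    using square_integrable_imp_integrable[OF W insert.prems(2)] by blast
  have IH: "integrable M (\<lambda>\<omega>. (\<Sum>i\<in>I. W i \<omega>)\<^sup>2)"
    "expectation (\<lambda>\<omega>. (\<Sum>i\<in>I. W i \<omega>)\<^sup>2) = (\<Sum>i\<in>I. expectation (\<lambda>\<omega>. (W i \<omega>)\<^sup>2))"
    using insert.IH[OF indep_vars_subset[OF insert.prems(1)]] insert.prems by auto
  have iv: "indep_var borel (W i) borel (\<lambda>\<omega>. \<Sum>j\<in>I. W j \<omega>)"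
    using insert by (intro indep_vars_sum) auto
  have isum: "integrable M (\<lambda>\<omega>. \<Sum>j\<in>I. W j \<omega>)"
    using int by (intro Bochner_Integration.integrable_sum) auto
  have cross: "integrable M (\<lambda>\<omega>. W i \<omega> * (\<Sum>j\<in>I. W j \<omega>))"
    "expectation (\<lambda>\<omega>. W i \<omega> * (\<Sum>j\<in>I. W j \<omega>)) = 0"
    using indep_var_integrable[OF iv int isum] indep_var_lebesgue_integral[OF iv int isum] insert.prems(3)
    by auto
  have e: "(\<lambda>\<omega>. (\<Sum>j\<in>insert i I. W j \<omega>)\<^sup>2)
      = (\<lambda>\<omega>. (W i \<omega>)\<^sup>2 + 2 * (W i \<omega> * (\<Sum>j\<in>I. W j \<omega>)) + (\<Sum>j\<in>I. W j \<omega>)\<^sup>2)"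
    using insert.hyps by (auto simp: power2_sum)
  show ?case
    unfolding e using cross IH insert.prems(2)[of i] insert.hyps by simp
qed auto

text \<open>The bound on the conditional mean is an event of \<open>U\<close> alone, so Markov's inequality can be applied
  on it after integrating out \<open>R\<close>.\<close>

lemma (in prob_space) conditional_markov:
  fixes F :: "'b \<times> 'b \<Rightarrow> real"
  assumes ind: "indep_var S U T R" and F[measurable]: "F \<in> borel_measurable (S \<Otimes>\<^sub>M T)"
    and pos: "\<And>x. 0 \<le> F x" and b: "0 \<le> b" and c: "0 < c"
  shows "prob {\<omega> \<in> space M. (\<integral>\<^sup>+\<omega>'. ennreal (F (U \<omega>, R \<omega>')) \<partial>M) \<le> ennreal b \<and> c \<le> F (U \<omega>, R \<omega>)} \<le> b / c"
    and "{\<omega> \<in> space M. (\<integral>\<^sup>+\<omega>'. ennreal (F (U \<omega>, R \<omega>')) \<partial>M) \<le> ennreal b \<and> c \<le> F (U \<omega>, R \<omega>)} \<in> events"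
proof -
  have U[measurable]: "U \<in> M \<rightarrow>\<^sub>M S" and R[measurable]: "R \<in> M \<rightarrow>\<^sub>M T"
    and joint: "distr M S U \<Otimes>\<^sub>M distr M T R = distr M (S \<Otimes>\<^sub>M T) (\<lambda>\<omega>. (U \<omega>, R \<omega>))"
    using ind by (auto simp: indep_var_distribution_eq)
  interpret PR: prob_space "distr M T R"
    by (rule prob_space_distr) simp
  interpret PU: prob_space "distr M S U"
    by (rule prob_space_distr) simp
  define h where "h u = (\<integral>\<^sup>+r. ennreal (F (u, r)) \<partial>distr M T R)" for u
  have h[measurable]: "h \<in> borel_measurable S"
    unfolding h_def[abs_def] by (rule PR.borel_measurable_nn_integral) simp
  have hU: "h (U \<omega>) = (\<integral>\<^sup>+\<omega>'. ennreal (F (U \<omega>, R \<omega>')) \<partial>M)" if "\<omega> \<in> space M" for \<omega>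
  proof -
    have [measurable]: "(\<lambda>r. F (U \<omega>, r)) \<in> borel_measurable T"
      using measurable_space[OF U that] by measurable
    show ?thesis
      unfolding h_def by (subst nn_integral_distr) auto
  qed
  \<comment> \<open>Cutting \<open>F\<close> off where its conditional mean exceeds b makes the
    inner integral at most b for every value of \<open>U\<close>, so Fubini bounds the full
    expectation by b.\<close>
  define f where "f x = (if h (fst x) \<le> ennreal b then F x else 0)" for x
  have f[measurable]: "f \<in> borel_measurable (S \<Otimes>\<^sub>M T)"
    unfolding f_def[abs_def] by measurable
  have "(\<integral>\<^sup>+\<omega>. ennreal (f (U \<omega>, R \<omega>)) \<partial>M) = (\<integral>\<^sup>+x. ennreal (f x) \<partial>(distr M S U \<Otimes>\<^sub>M distr M T R))"
    unfolding joint by (subst nn_integral_distr) auto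
  also have "\<dots> = (\<integral>\<^sup>+u. \<integral>\<^sup>+r. ennreal (f (u, r)) \<partial>distr M T R \<partial>distr M S U)"
    by (subst PR.nn_integral_fst[symmetric]) auto
  also have "\<dots> \<le> (\<integral>\<^sup>+u. ennreal b \<partial>distr M S U)"
  proof (rule nn_integral_mono)
    show "(\<integral>\<^sup>+r. ennreal (f (u, r)) \<partial>distr M T R) \<le> ennreal b" for u
      by (cases "h u \<le> ennreal b") (simp_all add: f_def h_def[symmetric])
  qed
  also have "\<dots> = ennreal b"
    using PU.emeasure_space_1 by simp
  finally have le: "(\<integral>\<^sup>+\<omega>. ennreal (f (U \<omega>, R \<omega>)) \<partial>M) \<le> ennreal b" .
  have fm: "(\<lambda>\<omega>. f (U \<omega>, R \<omega>)) \<in> borel_measurable M"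
    by measurable
  have "prob {\<omega> \<in> space M. c \<le> f (U \<omega>, R \<omega>)} \<le> b / c"
    by (rule prob_ge_le_nn_integral[OF fm _ le b c]) (simp add: f_def pos)
  moreover have eq: "{\<omega> \<in> space M. (\<integral>\<^sup>+\<omega>'. ennreal (F (U \<omega>, R \<omega>')) \<partial>M) \<le> ennreal b \<and> c \<le> F (U \<omega>, R \<omega>)}
      = {\<omega> \<in> space M. c \<le> f (U \<omega>, R \<omega>)}"
    using c by (auto simp: f_def hU)
  ultimately show "prob {\<omega> \<in> space M. (\<integral>\<^sup>+\<omega>'. ennreal (F (U \<omega>, R \<omega>')) \<partial>M) \<le> ennreal b \<and> c \<le> F (U \<omega>, R \<omega>)} \<le> b / c"
    by simp
  show "{\<omega> \<in> space M. (\<integral>\<^sup>+\<omega>'. ennreal (F (U \<omega>, R \<omega>')) \<partial>M) \<le> ennreal b \<and> c \<le> F (U \<omega>, R \<omega>)} \<in> events"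
    unfolding eq using fm by measurable
qed

section \<open>Concentration and restricted eigenvalues of the sample second moment matrix\<close>

context regression_model
begin

text \<open>One union bound for all families of products needed below: covariates against rows of
  \<Omega> X, pairs of covariates, squares of lattice forms, and the score against
  covariates.\<close>

lemma bernstein_products:
  fixes f g :: "'t \<Rightarrow> real vec \<times> real \<Rightarrow> real"
  assumes I: "I \<subseteq> {1..n}" and T: "finite T"
    and m: "\<And>\<tau>. \<tau> \<in> T \<Longrightarrow> f \<tau> \<in> borel_measurable (obs_space p)" "\<And>\<tau>. \<tau> \<in> T \<Longrightarrow> g \<tau> \<in> borel_measurable (obs_space p)"
    and s: "\<And>\<tau>. \<tau> \<in> T \<Longrightarrow> subgaussian law (f \<tau>) (k \<tau>)" "\<And>\<tau>. \<tau> \<in> T \<Longrightarrow> subgaussian law (g \<tau>) (l \<tau>)"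
    and kl: "\<And>\<tau>. \<tau> \<in> T \<Longrightarrow> 0 < k \<tau>" "\<And>\<tau>. \<tau> \<in> T \<Longrightarrow> 0 < l \<tau>" and t: "0 \<le> t" "t \<le> 8"
  defines "B \<equiv> {\<omega> \<in> space M. \<exists>\<tau>\<in>T. k \<tau> * l \<tau> * real (card I) * t
      \<le> \<bar>(\<Sum>i\<in>I. f \<tau> (Z i \<omega>) * g \<tau> (Z i \<omega>)) - real (card I) * (\<integral>z. f \<tau> z * g \<tau> z \<partial>law)\<bar>}"
  shows "B \<in> events" "prob B \<le> real (card T) * (2 * exp (- real (card I) * t\<^sup>2 / 32))"
proof -
  let ?A = "\<lambda>\<tau>. {\<omega> \<in> space M. k \<tau> * l \<tau> * real (card I) * t
      \<le> \<bar>(\<Sum>i\<in>I. f \<tau> (Z i \<omega>) * g \<tau> (Z i \<omega>)) - real (card I) * (\<integral>z. f \<tau> z * g \<tau> z \<partial>law)\<bar>}"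
  have B: "B = (\<Union>\<tau>\<in>T. ?A \<tau>)"
    by (auto simp: B_def)
  have fI: "finite I"
    using I finite_subset by auto
  have A: "?A \<tau> \<in> events" if "\<tau> \<in> T" for \<tau>
  proof -
    have "(\<lambda>\<omega>. f \<tau> (Z i \<omega>)) \<in> borel_measurable M" "(\<lambda>\<omega>. g \<tau> (Z i \<omega>)) \<in> borel_measurable M" if "i \<in> I" for i
      using measurable_compose[OF Zi m(1)[OF \<open>\<tau> \<in> T\<close>], of i] measurable_compose[OF Zi m(2)[OF \<open>\<tau> \<in> T\<close>], of i] that I
      by blast+
    then have [measurable]: "(\<lambda>\<omega>. \<Sum>i\<in>I. f \<tau> (Z i \<omega>) * g \<tau> (Z i \<omega>)) \<in> borel_measurable M"
      by (intro borel_measurable_sum borel_measurable_times)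
    show ?thesis
      by measurable
  qed
  show "B \<in> events"
    unfolding B by (intro sets.finite_UN T A)
  have "prob B \<le> (\<Sum>\<tau>\<in>T. prob (?A \<tau>))"
    unfolding B by (intro finite_measure_subadditive_finite T image_subsetI A)
  also have "\<dots> \<le> (\<Sum>\<tau>\<in>T. 2 * exp (- real (card I) * t\<^sup>2 / 32))"
  proof (rule sum_mono)
    fix \<tau> assume \<tau>: "\<tau> \<in> T"
    have ml: "f \<tau> \<in> borel_measurable law" "g \<tau> \<in> borel_measurable law"
      using m[OF \<tau>] by (simp_all add: sets_law[THEN measurable_cong_sets])
    show "prob (?A \<tau>) \<le> 2 * exp (- real (card I) * t\<^sup>2 / 32)"
      using I \<tau> m[OF \<tau>] s[OF \<tau>] kl[OF \<tau>]
      by (intro bernstein_two_sided[OF indep_vars_subset[OF indep_Z I] fI _ law_prob _ _ _ t] sg_product ml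
          borel_measurable_times law_Zi mult_pos_pos) auto
  qed
  finally show "prob B \<le> real (card T) * (2 * exp (- real (card I) * t\<^sup>2 / 32))"
    by simp
qed

definition Shat :: "nat set \<Rightarrow> 'a \<Rightarrow> real mat" where
  "Shat I \<omega> = sample_second_moment p I (\<lambda>i. X i \<omega>)"

lemma Shat_carrier: "Shat I \<omega> \<in> carrier_mat p p"
  by (simp add: Shat_def sample_second_moment_def)

lemma Shat_entry: "j < p \<Longrightarrow> k < p \<Longrightarrow>
    entry (Shat I \<omega>) j k = (\<Sum>i\<in>I. fst (Z i \<omega>) $ j * fst (Z i \<omega>) $ k) / real (card I)"
  by (simp add: Shat_def sample_second_moment_def Z_def)

lemma Shat_sym: "j < p \<Longrightarrow> k < p \<Longrightarrow> entry (Shat I \<omega>) j k = entry (Shat I \<omega>) k j"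
  by (simp add: Shat_entry mult.commute)

lemma Shat_mv: "j < p \<Longrightarrow> mat_app p (entry (Shat I \<omega>)) u j
    = (\<Sum>i\<in>I. fst (Z i \<omega>) $ j * lin_form p u (fst (Z i \<omega>))) / real (card I)"
proof -
  assume j: "j < p"
  have "mat_app p (entry (Shat I \<omega>)) u j = (\<Sum>k<p. (\<Sum>i\<in>I. fst (Z i \<omega>) $ j * (u k * fst (Z i \<omega>) $ k)) / real (card I))"
    unfolding mat_app_def using j by (intro sum.cong) (auto simp: Shat_entry sum_distrib_left mult_ac)
  also have "\<dots> = (\<Sum>k<p. \<Sum>i\<in>I. fst (Z i \<omega>) $ j * (u k * fst (Z i \<omega>) $ k)) / real (card I)"
    by (simp add: sum_divide_distrib)
  also have "\<dots> = (\<Sum>i\<in>I. fst (Z i \<omega>) $ j * lin_form p u (fst (Z i \<omega>))) / real (card I)"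
    by (subst sum.swap) (simp add: lin_form_def sum_distrib_left)
  finally show ?thesis .
qed

lemma Shat_bil: "bil_form p (entry (Shat I \<omega>)) u u = (\<Sum>i\<in>I. (lin_form p u (fst (Z i \<omega>)))\<^sup>2) / real (card I)"
proof -
  have "bil_form p (entry (Shat I \<omega>)) u u
      = (\<Sum>j<p. \<Sum>i\<in>I. u j * fst (Z i \<omega>) $ j * lin_form p u (fst (Z i \<omega>))) / real (card I)"
    unfolding bil_mv sum_divide_distrib by (intro sum.cong) (auto simp: Shat_mv sum_distrib_left sum_divide_distrib mult_ac)
  also have "\<dots> = (\<Sum>i\<in>I. lin_form p u (fst (Z i \<omega>)) * lin_form p u (fst (Z i \<omega>))) / real (card I)"
    by (subst sum.swap) (simp add: lin_form_def[of p u] sum_distrib_right)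
  finally show ?thesis
    by (simp add: power2_eq_square)
qed

lemma Shat_psd: "0 \<le> bil_form p (entry (Shat I \<omega>)) u u"
  by (simp add: Shat_bil sum_nonneg)

text \<open>Off this event every entry of the sample second moment matrix times
  \<open>\<Omega>\<close>, minus the identity, is at most K^2 t. That bound serves three purposes:
  lasso residual, coercivity of stage one, feasibility in stage two.\<close>

definition gram_fail :: "nat set \<Rightarrow> real \<Rightarrow> 'a set" where
  "gram_fail I t = {\<omega> \<in> space M. \<exists>lk\<in>{..<p} \<times> {..<p}. K * K * real (card I) * t
      \<le> \<bar>(\<Sum>i\<in>I. fst (Z i \<omega>) $ fst lk * lin_form p (entry \<Omega> (snd lk)) (fst (Z i \<omega>)))
        - real (card I) * (\<integral>z. fst z $ fst lk * lin_form p (entry \<Omega> (snd lk)) (fst z) \<partial>law)\<bar>}"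

lemma gram_fail_prob:
  assumes "I \<subseteq> {1..n}" "0 \<le> t" "t \<le> 8"
  shows "gram_fail I t \<in> events" "prob (gram_fail I t) \<le> (real p)\<^sup>2 * (2 * exp (- real (card I) * t\<^sup>2 / 32))"
proof -
  note b = bernstein_products[OF assms(1), where T = "{..<p} \<times> {..<p}" and f = "\<lambda>lk z. fst z $ fst lk"
      and g = "\<lambda>lk z. lin_form p (entry \<Omega> (snd lk)) (fst z)" and k = "\<lambda>_. K" and l = "\<lambda>_. K" and t = t]
  show "gram_fail I t \<in> events"
    unfolding gram_fail_def using assms K law_sg_X law_sg_OX by (intro b(1)) auto
  have "prob (gram_fail I t) \<le> real (card ({..<p} \<times> {..<p})) * (2 * exp (- real (card I) * t\<^sup>2 / 32))"
    unfolding gram_fail_def using assms K law_sg_X law_sg_OX by (intro b(2)) auto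
  then show "prob (gram_fail I t) \<le> (real p)\<^sup>2 * (2 * exp (- real (card I) * t\<^sup>2 / 32))"
    by (simp add: power2_eq_square)
qed

lemma gram_ok:
  assumes "I \<subseteq> {1..n}" "I \<noteq> {}" "\<omega> \<in> space M" "\<omega> \<notin> gram_fail I t" "l < p" "k < p"
  shows "\<bar>mat_app p (entry (Shat I \<omega>)) (\<lambda>j. entry \<Omega> j k) l - (if l = k then 1 else 0)\<bar> \<le> K\<^sup>2 * t"
proof -
  have cI: "0 < real (card I)"
    using assms(1,2) finite_subset[OF assms(1)] by (simp add: card_gt_0_iff)
  define s where "s = (\<Sum>i\<in>I. fst (Z i \<omega>) $ l * lin_form p (entry \<Omega> k) (fst (Z i \<omega>)))"
  have "lin_form p (\<lambda>j. entry \<Omega> j k) = lin_form p (entry \<Omega> k)"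
    unfolding lin_form_def using assms(6) by (intro ext sum.cong) (auto simp: \<Omega>_sym)
  then have e: "mat_app p (entry (Shat I \<omega>)) (\<lambda>j. entry \<Omega> j k) l = s / real (card I)"
    by (simp add: Shat_mv[OF assms(5)] s_def)
  have "\<bar>s - real (card I) * (\<integral>z. fst z $ l * lin_form p (entry \<Omega> k) (fst z) \<partial>law)\<bar> < K * K * real (card I) * t"
    using assms(3-6) by (auto simp: gram_fail_def s_def not_le)
  then have "\<bar>s - real (card I) * (if l = k then 1 else 0)\<bar> \<le> K * K * real (card I) * t"
    unfolding integral_OX_X[OF assms(5,6)] by simp
  then have "\<bar>real (card I) * (s / real (card I) - (if l = k then 1 else 0))\<bar> \<le> real (card I) * (K\<^sup>2 * t)"
    using cI by (simp add: right_diff_distrib power2_eq_square mult_ac)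
  then show ?thesis
    unfolding e abs_mult using cI by simp
qed

text \<open>Used with t of order \<lambda> for the restricted eigenvalue in (i), and with t = 1 in
  (ii), where boundedness of the diagonal is all that is asked of it.\<close>

definition cov_fail :: "nat set \<Rightarrow> real \<Rightarrow> 'a set" where
  "cov_fail I t = {\<omega> \<in> space M. \<exists>jk\<in>{..<p} \<times> {..<p}. K * K * real (card I) * t
      \<le> \<bar>(\<Sum>i\<in>I. fst (Z i \<omega>) $ fst jk * fst (Z i \<omega>) $ snd jk)
        - real (card I) * (\<integral>z. fst z $ fst jk * fst z $ snd jk \<partial>law)\<bar>}"

lemma cov_fail_prob:
  assumes "I \<subseteq> {1..n}" "0 \<le> t" "t \<le> 8"
  shows "cov_fail I t \<in> events" "prob (cov_fail I t) \<le> (real p)\<^sup>2 * (2 * exp (- real (card I) * t\<^sup>2 / 32))"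
proof -
  note b = bernstein_products[OF assms(1), where T = "{..<p} \<times> {..<p}" and f = "\<lambda>jk z. fst z $ fst jk"
      and g = "\<lambda>jk z. fst z $ snd jk" and k = "\<lambda>_. K" and l = "\<lambda>_. K" and t = t]
  show "cov_fail I t \<in> events"
    unfolding cov_fail_def using assms K law_sg_X by (intro b(1)) auto
  have "prob (cov_fail I t) \<le> real (card ({..<p} \<times> {..<p})) * (2 * exp (- real (card I) * t\<^sup>2 / 32))"
    unfolding cov_fail_def using assms K law_sg_X by (intro b(2)) auto
  then show "prob (cov_fail I t) \<le> (real p)\<^sup>2 * (2 * exp (- real (card I) * t\<^sup>2 / 32))"
    by (simp add: power2_eq_square)
qed

lemma cov_ok:
  assumes "I \<subseteq> {1..n}" "I \<noteq> {}" "\<omega> \<in> space M" "\<omega> \<notin> cov_fail I t" "j < p" "k < p"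
  shows "\<bar>entry (Shat I \<omega>) j k - Sig j k\<bar> \<le> K\<^sup>2 * t"
proof -
  have cI: "0 < real (card I)"
    using assms(1,2) finite_subset[OF assms(1)] by (simp add: card_gt_0_iff)
  define s where "s = (\<Sum>i\<in>I. fst (Z i \<omega>) $ j * fst (Z i \<omega>) $ k)"
  have "\<bar>s - real (card I) * Sig j k\<bar> \<le> K * K * real (card I) * t"
    using assms(3-6)
    by (auto simp: cov_fail_def s_def Sig_law not_le less_imp_le dest!: bspec[of _ _ "(j, k)"])
  then have "\<bar>real (card I) * (s / real (card I) - Sig j k)\<bar> \<le> real (card I) * (K\<^sup>2 * t)"
    using cI by (simp add: right_diff_distrib power2_eq_square mult_ac)
  then show ?thesis
    unfolding Shat_entry[OF assms(5,6)] s_def[symmetric] abs_mult using cI by simp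
qed

text \<open>The population form is at least \<bar>v\<bar>^2 / c4 and the entrywise error costs K^2 t
  times the squared l1 norm. The leading constant is lowered to 1 / (2 * c4) so that both parts
  share the same \<open>\<kappa>\<close>.\<close>

lemma restricted_eigenvalue_max_norm:
  assumes "I \<subseteq> {1..n}" "I \<noteq> {}" "\<omega> \<in> space M" "\<omega> \<notin> cov_fail I t"
  shows "1 / (2 * c4) * sq_sum p v - K\<^sup>2 * t * (l1_sum p v)\<^sup>2 \<le> bil_form p (entry (Shat I \<omega>)) v v"
proof -
  have "\<bar>bil_form p (\<lambda>j k. entry (Shat I \<omega>) j k - Sig j k) v v\<bar> \<le> K\<^sup>2 * t * (l1_sum p v)\<^sup>2"
    by (intro bil_abs_le cov_ok assms)
  moreover have "bil_form p (\<lambda>j k. entry (Shat I \<omega>) j k - Sig j k) v v = bil_form p (entry (Shat I \<omega>)) v v - bil_form p Sig v v"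
    by (simp add: bil_form_def right_diff_distrib left_diff_distrib sum_subtractf)
  moreover have "1 / (2 * c4) * sq_sum p v \<le> sq_sum p v / c4"
    using c by (simp add: divide_simps mult_right_mono)
  ultimately show ?thesis
    using S_lower[of v] by linarith
qed

text \<open>Lists whose sum cancels to 0 are left out: the sub-gaussian scale of the linear form has
  to be positive in the concentration bound, and the form vanishes at such sums.\<close>

definition lattice_fail :: "nat set \<Rightarrow> nat \<Rightarrow> real \<Rightarrow> 'a set" where
  "lattice_fail I m t = {\<omega> \<in> space M. \<exists>xs\<in>{xs. set xs \<subseteq> {..<p} \<times> UNIV \<and> length xs = m \<and> sq_sum p (lattice_sum xs) \<noteq> 0}.
      (K * sqrt (sq_sum p (lattice_sum xs))) * (K * sqrt (sq_sum p (lattice_sum xs))) * real (card I) * t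
      \<le> \<bar>(\<Sum>i\<in>I. lin_form p (lattice_sum xs) (fst (Z i \<omega>)) * lin_form p (lattice_sum xs) (fst (Z i \<omega>)))
        - real (card I) * (\<integral>z. lin_form p (lattice_sum xs) (fst z) * lin_form p (lattice_sum xs) (fst z) \<partial>law)\<bar>}"

lemma lattice_fail_prob:
  assumes sg_vec: "\<And>u. 0 < sq_sum p u \<Longrightarrow> subgaussian law (\<lambda>z. lin_form p u (fst z)) (K * sqrt (sq_sum p u))"
    and I: "I \<subseteq> {1..n}" and t: "0 \<le> t" "t \<le> 8"
  shows "lattice_fail I m t \<in> events"
    "prob (lattice_fail I m t) \<le> (2 * real p) ^ m * (2 * exp (- real (card I) * t\<^sup>2 / 32))"
proof -
  define T where "T = {xs. set xs \<subseteq> {..<p} \<times> (UNIV :: bool set) \<and> length xs = m \<and> sq_sum p (lattice_sum xs) \<noteq> 0}"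
  have fin: "finite {xs. set xs \<subseteq> {..<p} \<times> (UNIV :: bool set) \<and> length xs = m}"
    by (intro finite_lists_length_eq) auto
  have sub: "T \<subseteq> {xs. set xs \<subseteq> {..<p} \<times> (UNIV :: bool set) \<and> length xs = m}"
    by (auto simp: T_def)
  have T: "finite T"
    by (rule finite_subset[OF sub fin])
  have "card T \<le> card {xs. set xs \<subseteq> {..<p} \<times> (UNIV :: bool set) \<and> length xs = m}"
    by (rule card_mono[OF fin sub])
  also have "\<dots> = (p * 2) ^ m"
    by (subst card_lists_length_eq) auto
  finally have "real (card T) \<le> real ((p * 2) ^ m)"
    by (rule of_nat_mono)
  then have card: "real (card T) \<le> (2 * real p) ^ m"
    by (simp add: mult.commute)
  have pos: "xs \<in> T \<Longrightarrow> 0 < sq_sum p (lattice_sum xs)" for xs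
    using sq_nonneg[of p "lattice_sum xs"] by (simp add: T_def del: sq_nonneg)
  note b = bernstein_products[OF I T, where f = "\<lambda>xs z. lin_form p (lattice_sum xs) (fst z)"
      and g = "\<lambda>xs z. lin_form p (lattice_sum xs) (fst z)" and k = "\<lambda>xs. K * sqrt (sq_sum p (lattice_sum xs))"
      and l = "\<lambda>xs. K * sqrt (sq_sum p (lattice_sum xs))" and t = t]
  show "lattice_fail I m t \<in> events"
    unfolding lattice_fail_def T_def[symmetric] using t K sg_vec[OF pos] pos by (intro b(1)) auto
  have "prob (lattice_fail I m t) \<le> real (card T) * (2 * exp (- real (card I) * t\<^sup>2 / 32))"
    unfolding lattice_fail_def T_def[symmetric] using t K sg_vec[OF pos] pos by (intro b(2)) auto
  also have "\<dots> \<le> (2 * real p) ^ m * (2 * exp (- real (card I) * t\<^sup>2 / 32))"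
    using card by (intro mult_right_mono) auto
  finally show "prob (lattice_fail I m t) \<le> (2 * real p) ^ m * (2 * exp (- real (card I) * t\<^sup>2 / 32))" .
qed

text \<open>The sparsification bound is applied to Q, the sample matrix minus half the population
  matrix. On each lattice sum the deviation K^2 t \<bar>u\<bar>^2 is at most half the population
  form, so Q is nonnegative there; the other half of the population form supplies the
  curvature.\<close>

lemma restricted_eigenvalue_subgaussian:
  assumes I: "I \<subseteq> {1..n}" "I \<noteq> {}" and \<omega>: "\<omega> \<in> space M" "\<omega> \<notin> lattice_fail I m t" "\<omega> \<notin> cov_fail I 1"
    and t: "K\<^sup>2 * t \<le> 1 / (2 * c4)" and m: "2 \<le> m"
  shows "1 / (2 * c4) * sq_sum p v - (1 / c3 + K\<^sup>2) / (real m - 1) * (l1_sum p v)\<^sup>2 \<le> bil_form p (entry (Shat I \<omega>)) v v"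
proof -
  define Q where "Q j k = entry (Shat I \<omega>) j k - (1/2) * Sig j k" for j k
  have cI: "0 < real (card I)"
    using I finite_subset[OF I(1)] by (simp add: card_gt_0_iff)
  have Q: "bil_form p Q u u = bil_form p (entry (Shat I \<omega>)) u u - (1/2) * bil_form p Sig u u" for u
    by (simp add: Q_def bil_form_def right_diff_distrib left_diff_distrib sum_subtractf sum_divide_distrib)
  have "- ((1 / c3 + K\<^sup>2) / (real m - 1)) * (l1_sum p v)\<^sup>2 \<le> bil_form p Q v v"
  proof (rule quadratic_form_lower_bound_of_lattice[OF _ m])
    show "Q j k = Q k j" if "j < p" "k < p" for j k
      using that by (simp add: Q_def Sig_sym Shat_sym)
    fix xs :: "(nat \<times> bool) list" assume xs: "length xs = m" "set xs \<subseteq> {..<p} \<times> UNIV"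
    let ?u = "lattice_sum xs"
    show "0 \<le> bil_form p Q ?u ?u"
    proof (cases "sq_sum p ?u = 0")
      case True
      then show ?thesis
        by (simp add: bil_form_def sq_eq_0)
    next
      case False
      define s where "s = (\<Sum>i\<in>I. lin_form p ?u (fst (Z i \<omega>)) * lin_form p ?u (fst (Z i \<omega>)))"
      have "\<bar>s - real (card I) * (\<integral>z. lin_form p ?u (fst z) * lin_form p ?u (fst z) \<partial>law)\<bar>
          \<le> (K * sqrt (sq_sum p ?u)) * (K * sqrt (sq_sum p ?u)) * real (card I) * t"
        using \<omega>(1,2) xs False unfolding lattice_fail_def s_def by (auto simp: not_le less_imp_le)
      then have "\<bar>s - real (card I) * bil_form p Sig ?u ?u\<bar> \<le> real (card I) * ((K\<^sup>2 * t) * sq_sum p ?u)"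
        by (simp add: integral_lin_sq[symmetric] power2_eq_square mult_ac)
      also have "\<dots> \<le> real (card I) * (1 / (2 * c4) * sq_sum p ?u)"
        using t by (intro mult_left_mono mult_right_mono) auto
      also have "1 / (2 * c4) * sq_sum p ?u = (1/2) * (sq_sum p ?u / c4)"
        by simp
      also have "real (card I) * ((1/2) * (sq_sum p ?u / c4)) \<le> real (card I) * ((1/2) * bil_form p Sig ?u ?u)"
        using S_lower[of ?u] by (intro mult_left_mono) auto
      finally have "real (card I) * ((1/2) * bil_form p Sig ?u ?u) \<le> s"
        by linarith
      then have "(1/2) * bil_form p Sig ?u ?u \<le> s / real (card I)"
        using cI by (simp add: field_simps)
      then show ?thesis
        by (simp add: Q Shat_bil s_def power2_eq_square)
    qed
  next
    fix j assume j: "j < p"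
    \<comment> \<open>A unit vector turns the upper bound on the population form into a bound on its
      diagonal entries.\<close>
    have "bil_form p Sig (signed_unit (j, True)) (signed_unit (j, True)) = Sig j j"
      using j by (simp add: bil_mv mat_app_def signed_unit_sum mult.commute[of "signed_unit _ _"])
    moreover have "sq_sum p (signed_unit (j, True)) = 1"
      using signed_unit_sum[OF j, of "signed_unit (j, True)" True]
      by (simp add: sq_sum_def power2_eq_square signed_unit_def)
    ultimately have "Sig j j \<le> 1 / c3" "0 \<le> Sig j j"
      using S_upper[of "signed_unit (j, True)"] S_psd[of "signed_unit (j, True)"] by auto
    then show "Q j j \<le> 1 / c3 + K\<^sup>2"
      using cov_ok[OF I \<omega>(1,3) j j] by (simp add: Q_def)
  qed
  moreover have "1 / (2 * c4) * sq_sum p v \<le> (1/2) * bil_form p Sig v v"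
    using S_lower[of v] by simp
  ultimately show ?thesis
    unfolding Q by linarith
qed

end

text \<open>Failure is covered by a measurable set of small measure, so \<open>P\<close> itself need
  not define an event. This admits statements quantified over all vectors and events built from
  arbitrary minimisers.\<close>

definition whp :: "'a measure \<Rightarrow> real \<Rightarrow> ('a \<Rightarrow> bool) \<Rightarrow> bool" where
  "whp M q P \<longleftrightarrow> (\<exists>E\<in>sets M. measure M E \<le> q \<and> (\<forall>\<omega>\<in>space M - E. P \<omega>))"

lemma whpI:
  assumes "E \<in> sets M" "measure M E \<le> q" "\<And>\<omega>. \<omega> \<in> space M \<Longrightarrow> \<omega> \<notin> E \<Longrightarrow> P \<omega>"
  shows "whp M q P"
  using assms unfolding whp_def by blast

lemma whp_mono:
  assumes "whp M q P" "q \<le> r" "\<And>\<omega>. \<omega> \<in> space M \<Longrightarrow> P \<omega> \<Longrightarrow> Q \<omega>"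
  shows "whp M r Q"
  using assms unfolding whp_def by (meson DiffD1 order_trans)

lemma (in prob_space) whp_conj:
  assumes "whp M q P" "whp M r Q"
  shows "whp M (q + r) (\<lambda>\<omega>. P \<omega> \<and> Q \<omega>)"
proof -
  obtain E F where EF: "E \<in> events" "prob E \<le> q" "\<forall>\<omega>\<in>space M - E. P \<omega>"
    "F \<in> events" "prob F \<le> r" "\<forall>\<omega>\<in>space M - F. Q \<omega>"
    using assms unfolding whp_def by blast
  have "prob (E \<union> F) \<le> q + r"
    using measure_Un_le[OF EF(1,4)] EF(2,5) by linarith
  then show ?thesis
    using EF by (intro whpI[of "E \<union> F"]) auto
qed

lemma (in prob_space) whp_failure:
  assumes "whp M q P"
  shows "prob {\<omega> \<in> space M. \<not> P \<omega>} \<le> q"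
proof -
  obtain E where E: "E \<in> events" "prob E \<le> q" "\<forall>\<omega>\<in>space M - E. P \<omega>"
    using assms unfolding whp_def by blast
  then have "{\<omega> \<in> space M. \<not> P \<omega>} \<subseteq> E"
    by auto
  then show ?thesis
    using E by (metis finite_measure_mono order_trans)
qed

section \<open>Error of the estimated direction\<close>

context regression_model
begin

definition udir :: "real mat \<Rightarrow> nat \<Rightarrow> real" where
  "udir W k = (\<Sum>j<p. \<xi> $ j * (entry W j k - entry \<Omega> j k))"

lemma udir_lin:
  assumes "W \<in> carrier_mat p p" "v \<in> carrier_vec p"
  shows "\<xi> \<bullet> (W *\<^sub>v v) - \<xi> \<bullet> (\<Omega> *\<^sub>v v) = lin_form p (udir W) v"
  using assms \<xi>(1) \<Omega>_carrier
  by (simp add: scalar_prod_mv[of _ p] lin_form_def udir_def sum_subtractf right_diff_distrib left_diff_distrib)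

text \<open>The l1 bound feeds the moments in (i). The two l2 bounds, by Schur's test and by the
  support of \<xi>, become the two arguments of the minimum in the rate.\<close>

lemma udir_bounds:
  assumes sym: "\<And>l k. l < p \<Longrightarrow> k < p \<Longrightarrow> entry W l k = entry W k l"
    and L: "\<And>k. k < p \<Longrightarrow> l1_sum p (\<lambda>j. entry W j k - entry \<Omega> j k) \<le> L"
    and Q: "\<And>k. k < p \<Longrightarrow> sq_sum p (\<lambda>j. entry W j k - entry \<Omega> j k) \<le> Q"
  shows "l1_sum p (udir W) \<le> L * l1_sum p (($) \<xi>)" "sq_sum p (udir W) \<le> L\<^sup>2 * N\<^sup>2"
    "sq_sum p (udir W) \<le> real (card {k. k < p \<and> \<xi> $ k \<noteq> 0}) * Q * N\<^sup>2"
proof -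
  let ?E = "\<lambda>j k. entry W j k - entry \<Omega> j k"
  have u: "udir W k = mat_app p ?E (($) \<xi>) k" if "k < p" for k
    unfolding udir_def mat_app_def using that by (intro sum.cong) (auto simp: sym \<Omega>_sym mult.commute)
  have l: "l1_sum p (udir W) = l1_sum p (mat_app p ?E (($) \<xi>))" and s: "sq_sum p (udir W) = sq_sum p (mat_app p ?E (($) \<xi>))"
    by (simp_all add: l1_sum_def sq_sum_def u)
  show "l1_sum p (udir W) \<le> L * l1_sum p (($) \<xi>)"
    unfolding l by (rule l1_mv_le[OF L])
  show "sq_sum p (udir W) \<le> L\<^sup>2 * N\<^sup>2"
    unfolding s N_sq by (rule sq_mv_le_schur[OF _ L]) (auto simp: sym \<Omega>_sym)
  show "sq_sum p (udir W) \<le> real (card {k. k < p \<and> \<xi> $ k \<noteq> 0}) * Q * N\<^sup>2"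
    unfolding s N_sq by (rule sq_mv_le_support[OF Q])
qed

subsection \<open>Cross-fitted sums\<close>

abbreviation data :: "nat set \<Rightarrow> 'a \<Rightarrow> nat \<Rightarrow> real vec \<times> real" where
  "data I \<omega> \<equiv> restrict (\<lambda>i. Z i \<omega>) I"

lemma data_Z: "(\<lambda>i\<in>I. (X i \<omega>, Y i \<omega>)) = data I \<omega>"
  by (simp add: Z_def)

lemma measurable_cross_lin:
  assumes f: "f \<in> PiM A (\<lambda>_. obs_space p) \<rightarrow>\<^sub>M mat_borel p" and i: "i \<in> B"
  shows "(\<lambda>x. lin_form p (udir (f (fst x))) (fst (snd x i)))
    \<in> borel_measurable (PiM A (\<lambda>_. obs_space p) \<Otimes>\<^sub>M PiM B (\<lambda>_. obs_space p))"
  unfolding lin_form_def udir_def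
proof (intro borel_measurable_sum borel_measurable_times borel_measurable_diff borel_measurable_const)
  fix k j assume "k \<in> {..<p}" "j \<in> {..<p}"
  then show "(\<lambda>x. entry (f (fst x)) j k) \<in> borel_measurable (PiM A (\<lambda>_. obs_space p) \<Otimes>\<^sub>M PiM B (\<lambda>_. obs_space p))"
    by (intro measurable_compose[OF measurable_compose[OF measurable_fst f] measurable_mat_entry]) auto
next
  fix k assume k: "k \<in> {..<p}"
  show "(\<lambda>x. fst (snd x i) $ k) \<in> borel_measurable (PiM A (\<lambda>_. obs_space p) \<Otimes>\<^sub>M PiM B (\<lambda>_. obs_space p))"
    using k measurable_compose[OF measurable_compose[OF measurable_snd measurable_component_singleton[OF i]]
        measurable_obs_component[of k]] by simp
qed

lemma measurable_cross_eps:
  assumes i: "i \<in> B"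
  shows "(\<lambda>x. eps (snd x i)) \<in> borel_measurable (PiM A (\<lambda>_. obs_space p) \<Otimes>\<^sub>M PiM B (\<lambda>_. obs_space p))"
  by (rule measurable_compose[OF measurable_compose[OF measurable_snd measurable_component_singleton[OF i]] eps_measurable])

lemma nn_integral_Zi:
  assumes "g \<in> borel_measurable (obs_space p)" "i \<in> {1..n}"
  shows "(\<integral>\<^sup>+\<omega>. g (Z i \<omega>) \<partial>M) = (\<integral>\<^sup>+z. g z \<partial>law)"
  unfolding law_Zi[OF assms(2), symmetric] using assms Zi by (subst nn_integral_distr) auto

text \<open>The moment bound stays inside the event as a premise: it is a property of the fold
  \<open>A\<close> alone, and it is verified later on another event. The function \<phi> covers the
  sums of a^2, a^2 e^2 and a^4.\<close>

lemma cross_sum: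
  assumes comp: "computed_from M p X Y A (mat_borel p) Oh" and AB: "A \<inter> B = {}" "A \<subseteq> {1..n}" "B \<subseteq> {1..n}"
    and \<phi>: "(\<lambda>x. \<phi> (fst x) (snd x)) \<in> borel_measurable (borel \<Otimes>\<^sub>M borel)" "\<And>a e. 0 \<le> \<phi> a e"
    and b: "0 \<le> b" and c: "0 < c"
  shows "whp M (real (card B) * b / c) (\<lambda>\<omega>.
    (\<integral>\<^sup>+z. ennreal (\<phi> (lin_form p (udir (Oh \<omega>)) (fst z)) (eps z)) \<partial>law) \<le> ennreal b \<longrightarrow>
    (\<Sum>i\<in>B. \<phi> (lin_form p (udir (Oh \<omega>)) (fst (Z i \<omega>))) (eps (Z i \<omega>))) \<le> c)"
proof -
  obtain f where f: "f \<in> PiM A (\<lambda>_. obs_space p) \<rightarrow>\<^sub>M mat_borel p"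
    and Oh: "\<And>\<omega>. \<omega> \<in> space M \<Longrightarrow> Oh \<omega> = f (data A \<omega>)"
    using comp unfolding computed_from_def data_Z by blast
  have \<phi>m: "(\<lambda>x. \<phi> (g x) (h x)) \<in> borel_measurable N'"
    if "g \<in> borel_measurable N'" "h \<in> borel_measurable N'" for g h and N' :: "'z measure"
    using measurable_compose[OF measurable_Pair[OF that] \<phi>(1)] by simp
  define F where "F x = (\<Sum>i\<in>B. \<phi> (lin_form p (udir (f (fst x))) (fst (snd x i))) (eps (snd x i)))"
    for x :: "(nat \<Rightarrow> real vec \<times> real) \<times> (nat \<Rightarrow> real vec \<times> real)"
  have Fm: "F \<in> borel_measurable (PiM A (\<lambda>_. obs_space p) \<Otimes>\<^sub>M PiM B (\<lambda>_. obs_space p))"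
    unfolding F_def[abs_def] by (intro borel_measurable_sum \<phi>m measurable_cross_lin[OF f] measurable_cross_eps)
  have F0: "0 \<le> F x" for x
    by (simp add: F_def \<phi>(2) sum_nonneg)
  have ind: "indep_var (PiM A (\<lambda>_. obs_space p)) (data A) (PiM B (\<lambda>_. obs_space p)) (data B)"
    using indep_var_restrict[OF indep_Z AB] by simp
  have le: "(\<integral>\<^sup>+\<omega>'. ennreal (F (data A \<omega>, data B \<omega>')) \<partial>M) \<le> ennreal (real (card B) * b)"
    if w: "\<omega> \<in> space M"
      and a: "(\<integral>\<^sup>+z. ennreal (\<phi> (lin_form p (udir (Oh \<omega>)) (fst z)) (eps z)) \<partial>law) \<le> ennreal b" for \<omega>
  proof -
    let ?g = "\<lambda>z. \<phi> (lin_form p (udir (Oh \<omega>)) (fst z)) (eps z)"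
    have gm: "?g \<in> borel_measurable (obs_space p)"
      by (intro \<phi>m measurable_lin eps_measurable)
    have gM: "i \<in> B \<Longrightarrow> (\<lambda>\<omega>'. ?g (Z i \<omega>')) \<in> borel_measurable M" for i
      using measurable_compose[OF Zi gm, of i] AB(3) by auto
    have "(\<integral>\<^sup>+\<omega>'. ennreal (F (data A \<omega>, data B \<omega>')) \<partial>M) = (\<integral>\<^sup>+\<omega>'. (\<Sum>i\<in>B. ennreal (?g (Z i \<omega>'))) \<partial>M)"
      using w by (intro nn_integral_cong) (simp add: F_def Oh sum_ennreal \<phi>(2))
    also have "\<dots> = (\<Sum>i\<in>B. \<integral>\<^sup>+\<omega>'. ennreal (?g (Z i \<omega>')) \<partial>M)"
      by (intro nn_integral_sum measurable_compose[OF gM measurable_ennreal])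
    also have "\<dots> = (\<Sum>i\<in>B. \<integral>\<^sup>+z. ennreal (?g z) \<partial>law)"
      using AB(3) by (intro sum.cong refl nn_integral_Zi measurable_compose[OF gm measurable_ennreal]) auto
    also have "\<dots> \<le> (\<Sum>i\<in>B. ennreal b)"
      by (intro sum_mono a)
    also have "\<dots> = ennreal (real (card B) * b)"
      using b by (simp add: ennreal_mult ennreal_of_nat_eq_real_of_nat)
    finally show ?thesis .
  qed
  have cb: "0 \<le> real (card B) * b"
    using b by simp
  note cm = conditional_markov[OF ind Fm F0 cb c]
  show ?thesis
  proof (rule whpI[OF cm(2,1)], rule impI)
    fix \<omega> assume w: "\<omega> \<in> space M"
      and nin: "\<omega> \<notin> {\<omega> \<in> space M. (\<integral>\<^sup>+\<omega>'. ennreal (F (data A \<omega>, data B \<omega>')) \<partial>M) \<le> ennreal (real (card B) * b)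
        \<and> c \<le> F (data A \<omega>, data B \<omega>)}"
      and a: "(\<integral>\<^sup>+z. ennreal (\<phi> (lin_form p (udir (Oh \<omega>)) (fst z)) (eps z)) \<partial>law) \<le> ennreal b"
    have "F (data A \<omega>, data B \<omega>) < c"
      using nin w le[OF w a] by auto
    then show "(\<Sum>i\<in>B. \<phi> (lin_form p (udir (Oh \<omega>)) (fst (Z i \<omega>))) (eps (Z i \<omega>))) \<le> c"
      using w by (simp add: F_def Oh)
  qed
qed

lemma integral_lin_eps:
  "integrable law (\<lambda>z. lin_form p u (fst z) * eps z)" "(\<integral>z. lin_form p u (fst z) * eps z \<partial>law) = 0"
proof -
  have e: "(\<lambda>z. lin_form p u (fst z) * eps z) = (\<lambda>z. \<Sum>k<p. u k * (fst z $ k * eps z))"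
    by (simp add: lin_form_def sum_distrib_right mult.assoc)
  show "integrable law (\<lambda>z. lin_form p u (fst z) * eps z)"
    unfolding e by (intro Bochner_Integration.integrable_sum integrable_mult_right integrable_X_eps) auto
  show "(\<integral>z. lin_form p u (fst z) * eps z \<partial>law) = 0"
    unfolding e by (subst Bochner_Integration.integral_sum)
      (auto intro!: integrable_mult_right integrable_X_eps simp: integral_X_eps)
qed

lemma second_moment_iid_sum:
  assumes B: "B \<subseteq> {1..n}" and g: "g \<in> borel_measurable (obs_space p)"
    and i2: "integrable law (\<lambda>z. (g z)\<^sup>2)" and z: "(\<integral>z. g z \<partial>law) = 0"
  shows "integrable M (\<lambda>\<omega>. (\<Sum>i\<in>B. g (Z i \<omega>))\<^sup>2)"
    "expectation (\<lambda>\<omega>. (\<Sum>i\<in>B. g (Z i \<omega>))\<^sup>2) = real (card B) * (\<integral>z. (g z)\<^sup>2 \<partial>law)"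
proof -
  have fB: "finite B"
    using B finite_subset by auto
  have ind: "indep_vars (\<lambda>_. borel) (\<lambda>i \<omega>. g (Z i \<omega>)) B"
    using indep_vars_compose2[OF indep_vars_subset[OF indep_Z B], of "\<lambda>_. g" "\<lambda>_. borel"] g by simp
  have I: "integral\<^sup>L law h = expectation (\<lambda>\<omega>. h (Z i \<omega>))" "integrable law h \<longleftrightarrow> integrable M (\<lambda>\<omega>. h (Z i \<omega>))"
    if "i \<in> B" "h \<in> borel_measurable (obs_space p)" for i and h :: "real vec \<times> real \<Rightarrow> real"
  proof -
    have i: "i \<in> {1..n}" using that B by auto
    show "integral\<^sup>L law h = expectation (\<lambda>\<omega>. h (Z i \<omega>))"
      unfolding law_Zi[OF i, symmetric] using Zi[OF i] that by (simp add: integral_distr)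
    show "integrable law h \<longleftrightarrow> integrable M (\<lambda>\<omega>. h (Z i \<omega>))"
      unfolding law_Zi[OF i, symmetric] using Zi[OF i] that by (simp add: integrable_distr_eq)
  qed
  have g2: "(\<lambda>z. (g z)\<^sup>2) \<in> borel_measurable (obs_space p)"
    using g by simp
  have r: "integrable M (\<lambda>\<omega>. (\<Sum>i\<in>B. g (Z i \<omega>))\<^sup>2) \<and>
    expectation (\<lambda>\<omega>. (\<Sum>i\<in>B. g (Z i \<omega>))\<^sup>2) = (\<Sum>i\<in>B. expectation (\<lambda>\<omega>. (g (Z i \<omega>))\<^sup>2))"
    using I(2)[OF _ g2] i2 I(1)[OF _ g] z by (intro second_moment_indep_sum[OF fB ind]) auto
  then show "integrable M (\<lambda>\<omega>. (\<Sum>i\<in>B. g (Z i \<omega>))\<^sup>2)"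
    by blast
  have "(\<Sum>i\<in>B. expectation (\<lambda>\<omega>. (g (Z i \<omega>))\<^sup>2)) = (\<Sum>i\<in>B. \<integral>z. (g z)\<^sup>2 \<partial>law)"
    by (intro sum.cong refl I(1)[OF _ g2, symmetric])
  then show "expectation (\<lambda>\<omega>. (\<Sum>i\<in>B. g (Z i \<omega>))\<^sup>2) = real (card B) * (\<integral>z. (g z)\<^sup>2 \<partial>law)"
    using r by simp
qed

text \<open>Given fold \<open>A\<close> the linear form is fixed, and the normal equations make its
  products with the errors independent and centred. The second moment of the sum therefore grows
  like \<open>card B\<close>, not like its square.\<close>

lemma cross_square:
  assumes comp: "computed_from M p X Y A (mat_borel p) Oh" and AB: "A \<inter> B = {}" "A \<subseteq> {1..n}" "B \<subseteq> {1..n}"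
    and b: "0 \<le> b" and c: "0 < c"
  shows "whp M (real (card B) * b / c) (\<lambda>\<omega>.
    (\<integral>\<^sup>+z. ennreal ((lin_form p (udir (Oh \<omega>)) (fst z))\<^sup>2 * (eps z)\<^sup>2) \<partial>law) \<le> ennreal b \<longrightarrow>
    (\<Sum>i\<in>B. lin_form p (udir (Oh \<omega>)) (fst (Z i \<omega>)) * eps (Z i \<omega>))\<^sup>2 \<le> c)"
proof -
  obtain f where f: "f \<in> PiM A (\<lambda>_. obs_space p) \<rightarrow>\<^sub>M mat_borel p"
    and Oh: "\<And>\<omega>. \<omega> \<in> space M \<Longrightarrow> Oh \<omega> = f (data A \<omega>)"
    using comp unfolding computed_from_def data_Z by blast
  define F where "F x = (\<Sum>i\<in>B. lin_form p (udir (f (fst x))) (fst (snd x i)) * eps (snd x i))\<^sup>2"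
    for x :: "(nat \<Rightarrow> real vec \<times> real) \<times> (nat \<Rightarrow> real vec \<times> real)"
  have Fm: "F \<in> borel_measurable (PiM A (\<lambda>_. obs_space p) \<Otimes>\<^sub>M PiM B (\<lambda>_. obs_space p))"
    unfolding F_def[abs_def]
    by (intro borel_measurable_power borel_measurable_sum borel_measurable_times measurable_cross_lin[OF f] measurable_cross_eps)
  have F0: "0 \<le> F x" for x
    by (simp add: F_def)
  have ind: "indep_var (PiM A (\<lambda>_. obs_space p)) (data A) (PiM B (\<lambda>_. obs_space p)) (data B)"
    using indep_var_restrict[OF indep_Z AB] by simp
  have le: "(\<integral>\<^sup>+\<omega>'. ennreal (F (data A \<omega>, data B \<omega>')) \<partial>M) \<le> ennreal (real (card B) * b)"
    if w: "\<omega> \<in> space M"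
      and a: "(\<integral>\<^sup>+z. ennreal ((lin_form p (udir (Oh \<omega>)) (fst z))\<^sup>2 * (eps z)\<^sup>2) \<partial>law) \<le> ennreal b" for \<omega>
  proof -
    let ?g = "\<lambda>z. lin_form p (udir (Oh \<omega>)) (fst z) * eps z"
    have gm: "?g \<in> borel_measurable (obs_space p)"
      by measurable
    have i: "integrable law (\<lambda>z. (?g z)\<^sup>2)" "(\<integral>z. (?g z)\<^sup>2 \<partial>law) \<le> b"
      using a b gm by (intro integrable_nn_bound[where B = b];
          simp add: power_mult_distrib sets_law[THEN measurable_cong_sets])+
    note sm = second_moment_iid_sum[OF AB(3) gm i(1) integral_lin_eps(2)]
    have "(\<integral>\<^sup>+\<omega>'. ennreal (F (data A \<omega>, data B \<omega>')) \<partial>M) = (\<integral>\<^sup>+\<omega>'. ennreal ((\<Sum>i\<in>B. ?g (Z i \<omega>'))\<^sup>2) \<partial>M)"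
      using w by (intro nn_integral_cong) (simp add: F_def Oh)
    also have "\<dots> \<le> ennreal (real (card B) * b)"
      using i(2) sm(2) by (intro nn_integral_le_of_integral[OF sm(1)]) (auto intro: mult_left_mono)
    finally show ?thesis .
  qed
  have cb: "0 \<le> real (card B) * b"
    using b by simp
  note cm = conditional_markov[OF ind Fm F0 cb c]
  show ?thesis
  proof (rule whpI[OF cm(2,1)], rule impI)
    fix \<omega> assume w: "\<omega> \<in> space M"
      and nin: "\<omega> \<notin> {\<omega> \<in> space M. (\<integral>\<^sup>+\<omega>'. ennreal (F (data A \<omega>, data B \<omega>')) \<partial>M) \<le> ennreal (real (card B) * b)
        \<and> c \<le> F (data A \<omega>, data B \<omega>)}"
      and a: "(\<integral>\<^sup>+z. ennreal ((lin_form p (udir (Oh \<omega>)) (fst z))\<^sup>2 * (eps z)\<^sup>2) \<partial>law) \<le> ennreal b"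
    have "F (data A \<omega>, data B \<omega>) < c"
      using nin w le[OF w a] by auto
    then show "(\<Sum>i\<in>B. lin_form p (udir (Oh \<omega>)) (fst (Z i \<omega>)) * eps (Z i \<omega>))\<^sup>2 \<le> c"
      using w by (simp add: F_def Oh)
  qed
qed

subsection \<open>Moments of linear forms\<close>

lemma lin_fourth_l1: "(\<integral>\<^sup>+z. ennreal ((lin_form p u (fst z)) ^ 4) \<partial>law) \<le> ennreal (4 * K ^ 4 * (l1_sum p u) ^ 4)"
proof (rule nn_integral_le_of_integral)
  have X4: "integrable law (\<lambda>z. (fst z $ k) ^ 4)" "(\<integral>z. (fst z $ k) ^ 4 \<partial>law) \<le> 4 * K ^ 4" if "k < p" for k
    using sg_even_moment[OF law_sg_X[OF that] K(1), of 2] that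
    by (simp_all add: sets_law[THEN measurable_cong_sets] eval_nat_numeral)
  let ?h = "\<lambda>z. (l1_sum p u) ^ 3 * (\<Sum>k<p. \<bar>u k\<bar> * (fst z $ k) ^ 4)"
  have ih: "integrable law ?h"
    by (intro integrable_mult_right Bochner_Integration.integrable_sum X4) auto
  have b: "(lin_form p u (fst z)) ^ 4 \<le> ?h z" for z :: "real vec \<times> real"
    by (rule lin_power4_le)
  show i: "integrable law (\<lambda>z. (lin_form p u (fst z)) ^ 4)"
    using b by (intro Bochner_Integration.integrable_bound[OF ih])
      (auto intro!: AE_I2 simp: sets_law[THEN measurable_cong_sets] intro: order_trans[OF _ abs_ge_self])
  have "(\<integral>z. (lin_form p u (fst z)) ^ 4 \<partial>law) \<le> integral\<^sup>L law ?h"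
    by (intro integral_mono i ih b)
  also have "\<dots> = (l1_sum p u) ^ 3 * (\<Sum>k<p. \<bar>u k\<bar> * (\<integral>z. (fst z $ k) ^ 4 \<partial>law))"
    by (simp, subst Bochner_Integration.integral_sum) (auto intro!: integrable_mult_right X4)
  also have "\<dots> \<le> (l1_sum p u) ^ 3 * (\<Sum>k<p. \<bar>u k\<bar> * (4 * K ^ 4))"
    using X4(2) by (intro mult_left_mono sum_mono) auto
  also have "\<dots> = 4 * K ^ 4 * (l1_sum p u) ^ 4"
    by (simp add: sum_distrib_right[symmetric] l1_sum_def[symmetric] eval_nat_numeral)
  finally show "(\<integral>z. (lin_form p u (fst z)) ^ 4 \<partial>law) \<le> 4 * K ^ 4 * (l1_sum p u) ^ 4" .
qed simp

lemma lin_fourth_l2: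
  assumes sg_vec: "\<And>u. 0 < sq_sum p u \<Longrightarrow> subgaussian law (\<lambda>z. lin_form p u (fst z)) (K * sqrt (sq_sum p u))"
  shows "(\<integral>\<^sup>+z. ennreal ((lin_form p u (fst z)) ^ 4) \<partial>law) \<le> ennreal (4 * K ^ 4 * (sqrt (sq_sum p u)) ^ 4)"
proof (cases "sq_sum p u = 0")
  case True
  then have "lin_form p u v = 0" for v
    by (simp add: lin_form_def sq_eq_0)
  then show ?thesis
    by simp
next
  case False
  then have pos: "0 < sq_sum p u"
    by (metis less_le sq_nonneg)
  then have "0 < K * sqrt (sq_sum p u)"
    using K by simp
  then show ?thesis
    using sg_moment[OF sg_vec[OF pos], of 2]
    by (simp add: sets_law[THEN measurable_cong_sets] eval_nat_numeral power_mult_distrib mult_ac)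
qed

lemma lin_second: "(\<integral>\<^sup>+z. ennreal ((lin_form p u (fst z))\<^sup>2) \<partial>law) \<le> ennreal (sq_sum p u / c3)"
  using S_upper[of u] by (intro nn_integral_le_of_integral integrable_lin_sq) (auto simp: integral_lin_sq)

lemma lin_eps_second:
  assumes "(\<integral>\<^sup>+z. ennreal ((lin_form p u (fst z)) ^ 4) \<partial>law) \<le> ennreal (B4 * b ^ 4)" "0 < b" "0 \<le> B4"
  shows "(\<integral>\<^sup>+z. ennreal ((lin_form p u (fst z))\<^sup>2 * (eps z)\<^sup>2) \<partial>law) \<le> ennreal ((B4 + 4 * K2 ^ 4) * b\<^sup>2)"
proof -
  have [measurable]: "(\<lambda>z. lin_form p u (fst z)) \<in> borel_measurable law" "eps \<in> borel_measurable law"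
    by (simp_all add: sets_law[THEN measurable_cong_sets])
  have pt: "(lin_form p u (fst z))\<^sup>2 * (eps z)\<^sup>2 \<le> 1 / b\<^sup>2 * (lin_form p u (fst z)) ^ 4 + b\<^sup>2 * eps z ^ 4" for z
  proof -
    \<comment> \<open>The weight b makes the fourth moment of the form and that of the error both
      contribute at order b^2.\<close>
    define x y where "x = (lin_form p u (fst z))\<^sup>2 / b" and "y = b * (eps z)\<^sup>2"
    have "0 \<le> x * y"
      using assms(2) by (simp add: x_def y_def)
    then have "x * y \<le> x\<^sup>2 + y\<^sup>2"
      using sum_squares_bound[of x y] by linarith
    moreover have "x * y = (lin_form p u (fst z))\<^sup>2 * (eps z)\<^sup>2"
      using assms(2) by (simp add: x_def y_def)
    moreover have "x\<^sup>2 = 1 / b\<^sup>2 * (lin_form p u (fst z)) ^ 4" "y\<^sup>2 = b\<^sup>2 * eps z ^ 4"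
      by (simp_all add: x_def y_def power_mult_distrib power_divide power_mult[symmetric])
    ultimately show ?thesis by simp
  qed
  have "(\<integral>\<^sup>+z. ennreal ((lin_form p u (fst z))\<^sup>2 * (eps z)\<^sup>2) \<partial>law)
      \<le> (\<integral>\<^sup>+z. ennreal (1 / b\<^sup>2) * ennreal ((lin_form p u (fst z)) ^ 4) + ennreal (b\<^sup>2) * ennreal (eps z ^ 4) \<partial>law)"
  proof (rule nn_integral_mono)
    fix z :: "real vec \<times> real"
    have "ennreal (1 / b\<^sup>2) * ennreal ((lin_form p u (fst z)) ^ 4) + ennreal (b\<^sup>2) * ennreal (eps z ^ 4)
        = ennreal (1 / b\<^sup>2 * (lin_form p u (fst z)) ^ 4 + b\<^sup>2 * eps z ^ 4)"
      by (subst (1 2) ennreal_mult'[symmetric]) (auto simp: ennreal_plus[symmetric] simp del: ennreal_plus)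
    then show "ennreal ((lin_form p u (fst z))\<^sup>2 * (eps z)\<^sup>2)
        \<le> ennreal (1 / b\<^sup>2) * ennreal ((lin_form p u (fst z)) ^ 4) + ennreal (b\<^sup>2) * ennreal (eps z ^ 4)"
      using pt[of z] by (simp only: ennreal_leI)
  qed
  also have "\<dots> = ennreal (1 / b\<^sup>2) * (\<integral>\<^sup>+z. ennreal ((lin_form p u (fst z)) ^ 4) \<partial>law)
      + ennreal (b\<^sup>2) * (\<integral>\<^sup>+z. ennreal (eps z ^ 4) \<partial>law)"
    by (subst nn_integral_add) (auto simp: nn_integral_cmult)
  also have "\<dots> \<le> ennreal (1 / b\<^sup>2) * ennreal (B4 * b ^ 4) + ennreal (b\<^sup>2) * ennreal (4 * K2 ^ 4)"
    by (intro add_mono mult_left_mono assms eps_fourth) auto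
  also have "\<dots> = ennreal (1 / b\<^sup>2 * (B4 * b ^ 4) + b\<^sup>2 * (4 * K2 ^ 4))"
    using assms by (subst (1 2) ennreal_mult'[symmetric]) (auto simp: ennreal_plus[symmetric] simp del: ennreal_plus)
  also have "1 / b\<^sup>2 * (B4 * b ^ 4) + b\<^sup>2 * (4 * K2 ^ 4) = (B4 + 4 * K2 ^ 4) * b\<^sup>2"
    using assms(2) by (simp add: field_simps eval_nat_numeral)
  finally show ?thesis .
qed

end

text \<open>Each factor (a + w) (e - d) is a e plus the remainder w e - (a + w) d. The squared
  remainders sum to at most \<rho> m V, and Cauchy-Schwarz against the leading sum of size (1 +
  \<eta>) m V yields the middle term.\<close>

lemma variance_perturbation:
  fixes a e d w :: "'i \<Rightarrow> real" and m V \<eta> \<rho> g A4 W4 d2 :: real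
  assumes fin: "finite I" and m: "0 < m" and V: "0 < V" and \<rho>: "0 \<le> \<rho>"
    and hA: "\<bar>(1 / m) * (\<Sum>i\<in>I. (a i)\<^sup>2 * (e i)\<^sup>2) - V\<bar> \<le> \<eta> * V"
    and hW: "(\<Sum>i\<in>I. (w i)\<^sup>2 * (e i)\<^sup>2) \<le> m * g"
    and h4: "(\<Sum>i\<in>I. a i ^ 4) \<le> A4" "(\<Sum>i\<in>I. w i ^ 4) \<le> W4"
    and hd: "(\<Sum>i\<in>I. (d i)\<^sup>2) \<le> m * d2"
    and h\<rho>: "2 * g + 4 * (sqrt A4 + sqrt W4) * d2 \<le> \<rho> * V"
  shows "\<bar>(1 / m) * (\<Sum>i\<in>I. (a i + w i)\<^sup>2 * (e i - d i)\<^sup>2) / V - 1\<bar> \<le> \<eta> + 2 * sqrt (1 + \<eta>) * sqrt \<rho> + \<rho>"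
proof -
  define f r where "f i = a i * e i" and "r i = w i * e i - (a i + w i) * d i" for i
  define F R T where "F = (\<Sum>i\<in>I. (f i)\<^sup>2)" and "R = (\<Sum>i\<in>I. (r i)\<^sup>2)"
    and "T = (\<Sum>i\<in>I. (a i + w i)\<^sup>2 * (e i - d i)\<^sup>2)"
  have T: "T = (\<Sum>i\<in>I. (f i + r i)\<^sup>2)"
    unfolding T_def by (intro sum.cong) (auto simp: f_def r_def algebra_simps power_mult_distrib[symmetric])
  have F: "F = (\<Sum>i\<in>I. (a i)\<^sup>2 * (e i)\<^sup>2)"
    by (simp add: F_def f_def power_mult_distrib)
  have d0: "0 \<le> (\<Sum>i\<in>I. (d i)\<^sup>2)"
    by (simp add: sum_nonneg)
  have r2: "(r i)\<^sup>2 \<le> 2 * ((w i)\<^sup>2 * (e i)\<^sup>2) + 4 * ((a i)\<^sup>2 * (d i)\<^sup>2) + 4 * ((w i)\<^sup>2 * (d i)\<^sup>2)" for i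
  proof -
    have s: "(x - y)\<^sup>2 \<le> 2 * x\<^sup>2 + 2 * y\<^sup>2" "(x + y)\<^sup>2 \<le> 2 * x\<^sup>2 + 2 * y\<^sup>2" for x y :: real
      using zero_le_power2[of "x + y"] zero_le_power2[of "x - y"] by (simp_all add: power2_diff power2_sum)
    have "(r i)\<^sup>2 \<le> 2 * (w i * e i)\<^sup>2 + 2 * ((a i + w i) * d i)\<^sup>2"
      unfolding r_def by (rule s)
    also have "((a i + w i) * d i)\<^sup>2 \<le> (2 * (a i)\<^sup>2 + 2 * (w i)\<^sup>2) * (d i)\<^sup>2"
      unfolding power_mult_distrib by (intro mult_right_mono s) auto
    finally show ?thesis
      by (simp add: power_mult_distrib algebra_simps)
  qed
  have "R \<le> (\<Sum>i\<in>I. 2 * ((w i)\<^sup>2 * (e i)\<^sup>2) + 4 * ((a i)\<^sup>2 * (d i)\<^sup>2) + 4 * ((w i)\<^sup>2 * (d i)\<^sup>2))"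
    unfolding R_def by (intro sum_mono r2)
  also have "\<dots> = 2 * (\<Sum>i\<in>I. (w i)\<^sup>2 * (e i)\<^sup>2) + 4 * (\<Sum>i\<in>I. (a i)\<^sup>2 * (d i)\<^sup>2) + 4 * (\<Sum>i\<in>I. (w i)\<^sup>2 * (d i)\<^sup>2)"
    by (simp add: sum.distrib sum_distrib_left)
  also have "(\<Sum>i\<in>I. (a i)\<^sup>2 * (d i)\<^sup>2) \<le> sqrt A4 * (m * d2)"
    by (rule order_trans[OF sum_square_product_le[OF fin]], rule mult_mono)
      (use h4 hd d0 in \<open>auto simp: sum_nonneg intro: order_trans[OF _ h4(1)]\<close>)
  also have "(\<Sum>i\<in>I. (w i)\<^sup>2 * (d i)\<^sup>2) \<le> sqrt W4 * (m * d2)"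
    by (rule order_trans[OF sum_square_product_le[OF fin]], rule mult_mono)
      (use h4 hd d0 in \<open>auto simp: sum_nonneg intro: order_trans[OF _ h4(2)]\<close>)
  finally have "R \<le> 2 * (m * g) + 4 * (sqrt A4 * (m * d2)) + 4 * (sqrt W4 * (m * d2))"
    using hW by linarith
  also have "\<dots> = m * (2 * g + 4 * (sqrt A4 + sqrt W4) * d2)"
    by (simp add: algebra_simps)
  also have "\<dots> \<le> m * (\<rho> * V)"
    using h\<rho> m by (intro mult_left_mono) auto
  finally have R: "R \<le> m * V * \<rho>"
    by (simp add: mult_ac)
  have "(1 / m) * F \<le> (1 + \<eta>) * V"
    using hA unfolding F[symmetric] by (simp add: algebra_simps abs_le_iff)
  then have Fle: "F \<le> m * V * (1 + \<eta>)"
    using m by (simp add: field_simps)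
  have "0 \<le> F" "0 \<le> R"
    by (simp_all add: F_def R_def sum_nonneg)
  have "\<bar>T - F\<bar> \<le> 2 * (sqrt F * sqrt R) + R"
    unfolding T F_def R_def by (rule sum_squares_perturbation)
  also have "sqrt F * sqrt R \<le> sqrt (m * V * (1 + \<eta>)) * sqrt (m * V * \<rho>)"
    using Fle R \<open>0 \<le> F\<close> \<open>0 \<le> R\<close> by (intro mult_mono) (auto intro: order_trans)
  also have "\<dots> = (sqrt (m * V) * sqrt (m * V)) * (sqrt (1 + \<eta>) * sqrt \<rho>)"
    unfolding real_sqrt_mult[of "m * V"] by (simp only: mult_ac)
  also have "\<dots> = m * V * (sqrt (1 + \<eta>) * sqrt \<rho>)"
    using m V by simp
  finally have TF: "\<bar>T - F\<bar> \<le> m * V * (2 * sqrt (1 + \<eta>) * sqrt \<rho> + \<rho>)"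
    using R by (simp add: algebra_simps)
  have "\<bar>(1 / m) * T - V\<bar> \<le> \<bar>(1 / m) * F - V\<bar> + \<bar>(1 / m) * (T - F)\<bar>"
    unfolding right_diff_distrib by linarith
  also have "\<bar>(1 / m) * (T - F)\<bar> \<le> V * (2 * sqrt (1 + \<eta>) * sqrt \<rho> + \<rho>)"
    using TF m by (simp add: abs_mult field_simps)
  finally have "\<bar>(1 / m) * T - V\<bar> \<le> V * (\<eta> + 2 * sqrt (1 + \<eta>) * sqrt \<rho> + \<rho>)"
    using hA unfolding F by (simp add: algebra_simps)
  moreover have "(1 / m) * T / V - 1 = ((1 / m) * T - V) / V"
    using V by (simp add: diff_divide_distrib)
  ultimately show ?thesis
    unfolding T_def[symmetric] using V by (simp add: abs_mult pos_divide_le_eq mult.commute)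
qed

section \<open>Bounds on a single event of high probability\<close>

context regression_model
begin

lemma computed_space:
  assumes "computed_from M p X Y I S Q" "I \<subseteq> {1..n}" "\<omega> \<in> space M"
  shows "Q \<omega> \<in> space S"
proof -
  obtain f where f: "f \<in> PiM I (\<lambda>_. obs_space p) \<rightarrow>\<^sub>M S" and Q: "Q \<omega> = f (data I \<omega>)"
    using assms(1,3) unfolding computed_from_def data_Z by blast
  have "data I \<omega> \<in> space (PiM I (\<lambda>_. obs_space p))"
    using measurable_space[OF Zi assms(3)] assms(2) by (auto simp: space_PiM)
  then show ?thesis
    unfolding Q by (rule measurable_space[OF f])
qed

lemma space_mat_borel: "space (mat_borel p) = carrier_mat p p"
  by (simp add: mat_borel_def)

text \<open>A two-stage estimator is constrained only at samples where the programs are solvable.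
  Off the Gram failure the residual of \<open>\<Omega>\<close> proves both programs solvable, so the
  estimator must return minimisers there and the deterministic error bounds apply.\<close>

lemma estimator_error:
  assumes est: "two_stage_estimator M p X Y I r Oh" and I: "I \<subseteq> {1..n}" "I \<noteq> {}"
    and t: "0 \<le> t" "t \<le> 8" "K\<^sup>2 * t \<le> r / 2"
    and re: "whp M q (\<lambda>\<omega>. \<forall>v. \<kappa> * sq_sum p v - \<gamma> * (l1_sum p v)\<^sup>2 \<le> bil_form p (entry (Shat I \<omega>)) v v)"
    and c: "0 < \<kappa>" "0 \<le> \<gamma>" "0 < r" "32 * \<gamma> * real s \<le> \<kappa>"
    and s: "\<And>k. k < p \<Longrightarrow> card {l. l < p \<and> entry \<Omega> l k \<noteq> 0} \<le> s"
  shows "whp M ((real p)\<^sup>2 * (2 * exp (- real (card I) * t\<^sup>2 / 32)) + q) (\<lambda>\<omega>.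
    l1_sum p (udir (Oh \<omega>)) \<le> 48 * r * real s / \<kappa> * l1_sum p (($) \<xi>) \<and>
    sq_sum p (udir (Oh \<omega>)) \<le> (48 * r * real s / \<kappa>)\<^sup>2 * N\<^sup>2 \<and>
    sq_sum p (udir (Oh \<omega>)) \<le> real (card {k. k < p \<and> \<xi> $ k \<noteq> 0}) * (144 * r\<^sup>2 * real s / \<kappa>\<^sup>2) * N\<^sup>2)"
proof -
  have g: "whp M ((real p)\<^sup>2 * (2 * exp (- real (card I) * t\<^sup>2 / 32))) (\<lambda>\<omega>. \<omega> \<notin> gram_fail I t)"
    by (rule whpI[OF gram_fail_prob[OF I(1) t(1,2)]])
  obtain Gh where Gh: "\<And>\<omega>. \<omega> \<in> space M \<Longrightarrow> \<exists>G. stage_one p r (Shat I \<omega>) G \<Longrightarrow>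
      stage_one p r (Shat I \<omega>) (Gh \<omega>) \<and>
      ((\<exists>G. stage_two p r (Shat I \<omega>) (Gh \<omega>) G) \<longrightarrow> stage_two p r (Shat I \<omega>) (Gh \<omega>) (Oh \<omega>))"
    using est unfolding two_stage_estimator_def Let_def Shat_def by blast
  show ?thesis
  proof (rule whp_mono[OF whp_conj[OF g re] order_refl])
    fix \<omega> assume w: "\<omega> \<in> space M"
      and ok: "\<omega> \<notin> gram_fail I t \<and> (\<forall>v. \<kappa> * sq_sum p v - \<gamma> * (l1_sum p v)\<^sup>2 \<le> bil_form p (entry (Shat I \<omega>)) v v)"
    have om: "\<bar>mat_app p (entry (Shat I \<omega>)) (\<lambda>j. entry \<Omega> j k) l - (if l = k then 1 else 0)\<bar> \<le> r / 2"
      if "l < p" "k < p" for l k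
      using gram_ok[OF I w _ that] ok t(3) by fastforce
    then have om': "\<bar>mat_app p (entry (Shat I \<omega>)) (\<lambda>j. entry \<Omega> j k) l - (if l = k then 1 else 0)\<bar> \<le> r"
      if "l < p" "k < p" for l k
      using that c(3) by fastforce
    have ex1: "\<exists>G. stage_one p r (Shat I \<omega>) G"
      by (rule stage_one_exists[OF Shat_carrier Shat_sym Shat_psd c(3) om])
    have G1: "stage_one p r (Shat I \<omega>) (Gh \<omega>)"
      using Gh[OF w ex1] by blast
    then have G1c: "Gh \<omega> \<in> carrier_mat p p"
      by (auto simp: stage_one_def is_arg_min_def)
    have "\<exists>G. stage_two p r (Shat I \<omega>) (Gh \<omega>) G"
      by (rule stage_two_exists[OF p_pos Shat_carrier G1c \<Omega>_carrier \<Omega>_sym om'])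
    then have G2: "stage_two p r (Shat I \<omega>) (Gh \<omega>) (Oh \<omega>)"
      using Gh[OF w ex1] by blast
    have re': "\<kappa> * sq_sum p v - \<gamma> * (l1_sum p v)\<^sup>2 \<le> bil_form p (entry (Shat I \<omega>)) v v" for v
      using ok by blast
    note err = two_stage_error[OF p_pos Shat_carrier Shat_sym Shat_psd re' c \<Omega>_carrier \<Omega>_sym om s G1 G2]
    show "l1_sum p (udir (Oh \<omega>)) \<le> 48 * r * real s / \<kappa> * l1_sum p (($) \<xi>) \<and>
      sq_sum p (udir (Oh \<omega>)) \<le> (48 * r * real s / \<kappa>)\<^sup>2 * N\<^sup>2 \<and>
      sq_sum p (udir (Oh \<omega>)) \<le> real (card {k. k < p \<and> \<xi> $ k \<noteq> 0}) * (144 * r\<^sup>2 * real s / \<kappa>\<^sup>2) * N\<^sup>2"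
    proof (intro conjI)
      show "l1_sum p (udir (Oh \<omega>)) \<le> 48 * r * real s / \<kappa> * l1_sum p (($) \<xi>)"
        by (rule udir_bounds(1)[OF err(2-4)])
      show "sq_sum p (udir (Oh \<omega>)) \<le> (48 * r * real s / \<kappa>)\<^sup>2 * N\<^sup>2"
        by (rule udir_bounds(2)[OF err(2-4)])
      show "sq_sum p (udir (Oh \<omega>)) \<le> real (card {k. k < p \<and> \<xi> $ k \<noteq> 0}) * (144 * r\<^sup>2 * real s / \<kappa>\<^sup>2) * N\<^sup>2"
        by (rule udir_bounds(3)[OF err(2-4)])
    qed
  qed
qed

text \<open>Four applications of Markov's inequality at level L. The hypotheses on second moments
  follow from the fourth-moment and l2 bounds on the direction, which are the two premises kept
  inside the event.\<close>

lemma cross_half: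
  assumes comp: "computed_from M p X Y A (mat_borel p) Oh"
    and AB: "A \<inter> B = {}" "A \<subseteq> {1..n}" "B \<subseteq> {1..n}" "B \<noteq> {}"
    and pos: "0 < b" "0 < q" "0 < B4" "0 < L"
  shows "whp M (4 / L) (\<lambda>\<omega>. (\<integral>\<^sup>+z. ennreal ((lin_form p (udir (Oh \<omega>)) (fst z)) ^ 4) \<partial>law) \<le> ennreal (B4 * b ^ 4)
      \<and> sq_sum p (udir (Oh \<omega>)) \<le> q \<longrightarrow>
    (\<Sum>i\<in>B. (lin_form p (udir (Oh \<omega>)) (fst (Z i \<omega>)))\<^sup>2) \<le> L * real (card B) * (q / c3) \<and>
    (\<Sum>i\<in>B. lin_form p (udir (Oh \<omega>)) (fst (Z i \<omega>)) * eps (Z i \<omega>))\<^sup>2 \<le> L * real (card B) * ((B4 + 4 * K2 ^ 4) * b\<^sup>2) \<and>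
    (\<Sum>i\<in>B. (lin_form p (udir (Oh \<omega>)) (fst (Z i \<omega>)))\<^sup>2 * (eps (Z i \<omega>))\<^sup>2) \<le> L * real (card B) * ((B4 + 4 * K2 ^ 4) * b\<^sup>2) \<and>
    (\<Sum>i\<in>B. (lin_form p (udir (Oh \<omega>)) (fst (Z i \<omega>))) ^ 4) \<le> L * real (card B) * (B4 * b ^ 4))"
proof -
  have cB: "0 < real (card B)"
    using AB finite_subset[OF AB(3)] by (simp add: card_gt_0_iff)
  have p4: "0 < B4 * b ^ 4" "0 < (B4 + 4 * K2 ^ 4) * b\<^sup>2" "0 < q / c3"
    using pos c K by (auto intro!: mult_pos_pos add_pos_pos divide_pos_pos)
  have quot: "real (card B) * x / (L * real (card B) * x) = 1 / L" if "0 < x" for x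
    using cB that pos by simp
  have c1: "whp M (1 / L) (\<lambda>\<omega>. (\<integral>\<^sup>+z. ennreal ((lin_form p (udir (Oh \<omega>)) (fst z))\<^sup>2) \<partial>law) \<le> ennreal (q / c3) \<longrightarrow>
    (\<Sum>i\<in>B. (lin_form p (udir (Oh \<omega>)) (fst (Z i \<omega>)))\<^sup>2) \<le> L * real (card B) * (q / c3))"
    by (subst quot[OF p4(3), symmetric], rule cross_sum[where \<phi> = "\<lambda>a e. a\<^sup>2",
          OF comp AB(1-3) _ _ less_imp_le[OF p4(3)] mult_pos_pos[OF mult_pos_pos[OF pos(4) cB] p4(3)]]) auto
  have c2: "whp M (1 / L) (\<lambda>\<omega>. (\<integral>\<^sup>+z. ennreal ((lin_form p (udir (Oh \<omega>)) (fst z))\<^sup>2 * (eps z)\<^sup>2) \<partial>law) \<le> ennreal ((B4 + 4 * K2 ^ 4) * b\<^sup>2) \<longrightarrow>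
    (\<Sum>i\<in>B. lin_form p (udir (Oh \<omega>)) (fst (Z i \<omega>)) * eps (Z i \<omega>))\<^sup>2 \<le> L * real (card B) * ((B4 + 4 * K2 ^ 4) * b\<^sup>2))"
    by (subst quot[OF p4(2), symmetric], intro cross_square[OF comp AB(1-3)] less_imp_le p4 mult_pos_pos cB pos)
  have c3: "whp M (1 / L) (\<lambda>\<omega>. (\<integral>\<^sup>+z. ennreal ((lin_form p (udir (Oh \<omega>)) (fst z))\<^sup>2 * (eps z)\<^sup>2) \<partial>law) \<le> ennreal ((B4 + 4 * K2 ^ 4) * b\<^sup>2) \<longrightarrow>
    (\<Sum>i\<in>B. (lin_form p (udir (Oh \<omega>)) (fst (Z i \<omega>)))\<^sup>2 * (eps (Z i \<omega>))\<^sup>2) \<le> L * real (card B) * ((B4 + 4 * K2 ^ 4) * b\<^sup>2))"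
    by (subst quot[OF p4(2), symmetric], rule cross_sum[where \<phi> = "\<lambda>a e. a\<^sup>2 * e\<^sup>2",
          OF comp AB(1-3) _ _ less_imp_le[OF p4(2)] mult_pos_pos[OF mult_pos_pos[OF pos(4) cB] p4(2)]]) auto
  have c4: "whp M (1 / L) (\<lambda>\<omega>. (\<integral>\<^sup>+z. ennreal ((lin_form p (udir (Oh \<omega>)) (fst z)) ^ 4) \<partial>law) \<le> ennreal (B4 * b ^ 4) \<longrightarrow>
    (\<Sum>i\<in>B. (lin_form p (udir (Oh \<omega>)) (fst (Z i \<omega>))) ^ 4) \<le> L * real (card B) * (B4 * b ^ 4))"
    by (subst quot[OF p4(1), symmetric], rule cross_sum[where \<phi> = "\<lambda>a e. a ^ 4",
          OF comp AB(1-3) _ _ less_imp_le[OF p4(1)] mult_pos_pos[OF mult_pos_pos[OF pos(4) cB] p4(1)]]) auto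
  show ?thesis
  proof (rule whp_mono[OF whp_conj[OF whp_conj[OF c1 c2] whp_conj[OF c3 c4]]], goal_cases)
    case 1
    then show ?case by simp
  next
    case (2 \<omega>)
    show ?case
    proof (intro impI, elim conjE)
      assume h4: "(\<integral>\<^sup>+z. ennreal ((lin_form p (udir (Oh \<omega>)) (fst z)) ^ 4) \<partial>law) \<le> ennreal (B4 * b ^ 4)"
        and hq: "sq_sum p (udir (Oh \<omega>)) \<le> q"
      have h2: "(\<integral>\<^sup>+z. ennreal ((lin_form p (udir (Oh \<omega>)) (fst z))\<^sup>2) \<partial>law) \<le> ennreal (q / c3)"
        using c(1) hq by (intro order_trans[OF lin_second] ennreal_leI divide_right_mono) auto
      have he: "(\<integral>\<^sup>+z. ennreal ((lin_form p (udir (Oh \<omega>)) (fst z))\<^sup>2 * (eps z)\<^sup>2) \<partial>law) \<le> ennreal ((B4 + 4 * K2 ^ 4) * b\<^sup>2)"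
        using pos by (intro lin_eps_second[OF h4]) auto
      show "(\<Sum>i\<in>B. (lin_form p (udir (Oh \<omega>)) (fst (Z i \<omega>)))\<^sup>2) \<le> L * real (card B) * (q / c3) \<and>
        (\<Sum>i\<in>B. lin_form p (udir (Oh \<omega>)) (fst (Z i \<omega>)) * eps (Z i \<omega>))\<^sup>2 \<le> L * real (card B) * ((B4 + 4 * K2 ^ 4) * b\<^sup>2) \<and>
        (\<Sum>i\<in>B. (lin_form p (udir (Oh \<omega>)) (fst (Z i \<omega>)))\<^sup>2 * (eps (Z i \<omega>))\<^sup>2) \<le> L * real (card B) * ((B4 + 4 * K2 ^ 4) * b\<^sup>2) \<and>
        (\<Sum>i\<in>B. (lin_form p (udir (Oh \<omega>)) (fst (Z i \<omega>))) ^ 4) \<le> L * real (card B) * (B4 * b ^ 4)"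
        using 2 h4 h2 he by blast
    qed
  qed
qed

lemma score_gram:
  assumes n: "0 < n" and t: "0 \<le> t" "t \<le> 8"
  shows "whp M (real p * (2 * exp (- real n * t\<^sup>2 / 32))) (\<lambda>\<omega>. \<forall>k<p.
    \<bar>\<xi> $ k - (1 / real n) * (\<Sum>i\<in>{1..n}. score (Z i \<omega>) * fst (Z i \<omega>) $ k)\<bar> \<le> K\<alpha> * K * t)"
proof -
  note b = bernstein_products[OF order_refl, where T = "{..<p}" and f = "\<lambda>_. score" and g = "\<lambda>k z. fst z $ k"
      and k = "\<lambda>_. K\<alpha>" and l = "\<lambda>_. K" and t = t]
  let ?E = "{\<omega> \<in> space M. \<exists>\<tau>\<in>{..<p}. K\<alpha> * K * real (card {1..n}) * t
      \<le> \<bar>(\<Sum>i\<in>{1..n}. score (Z i \<omega>) * fst (Z i \<omega>) $ \<tau>) - real (card {1..n}) * (\<integral>z. score z * fst z $ \<tau> \<partial>law)\<bar>}"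
  show ?thesis
  proof (rule whpI[of ?E])
    show "?E \<in> events"
      using K K\<alpha>_pos law_sg_X law_sg_score t by (intro b(1)) auto
    have "prob ?E \<le> real (card {..<p}) * (2 * exp (- real (card {1..n}) * t\<^sup>2 / 32))"
      using K K\<alpha>_pos law_sg_X law_sg_score t by (intro b(2)) auto
    then show "prob ?E \<le> real p * (2 * exp (- real n * t\<^sup>2 / 32))"
      by simp
    fix \<omega> assume w: "\<omega> \<in> space M" "\<omega> \<notin> ?E"
    show "\<forall>k<p. \<bar>\<xi> $ k - (1 / real n) * (\<Sum>i\<in>{1..n}. score (Z i \<omega>) * fst (Z i \<omega>) $ k)\<bar> \<le> K\<alpha> * K * t"
    proof (intro allI impI)
      fix k assume k: "k < p"
      define s where "s = (\<Sum>i\<in>{1..n}. score (Z i \<omega>) * fst (Z i \<omega>) $ k)"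
      have "\<bar>s - real (card {1..n}) * (\<integral>z. score z * fst z $ k \<partial>law)\<bar> < K\<alpha> * K * real (card {1..n}) * t"
        using w k unfolding s_def mem_Collect_eq by (meson lessThan_iff not_le)
      then have "\<bar>s - real n * \<xi> $ k\<bar> \<le> real n * (K\<alpha> * K * t)"
        unfolding integral_score_X[OF k] by (simp add: mult_ac)
      moreover have "s - real n * \<xi> $ k = - real n * (\<xi> $ k - (1 / real n) * s)"
        using n by (simp add: algebra_simps)
      ultimately show "\<bar>\<xi> $ k - (1 / real n) * (\<Sum>i\<in>{1..n}. score (Z i \<omega>) * fst (Z i \<omega>) $ k)\<bar> \<le> K\<alpha> * K * t"
        unfolding s_def[symmetric] using n by (simp add: abs_mult)
    qed
  qed
qed

lemma score_fourth_sum: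
  assumes n: "0 < n" and L: "0 < L"
  shows "whp M (1 / L) (\<lambda>\<omega>. (\<Sum>i\<in>{1..n}. score (Z i \<omega>) ^ 4) \<le> L * real n * (4 * K\<alpha> ^ 4))"
proof -
  have sm: "i \<in> {1..n} \<Longrightarrow> (\<lambda>\<omega>. score (Z i \<omega>)) \<in> borel_measurable M" for i
    by (rule measurable_compose[OF Zi score_measurable])
  have m: "(\<lambda>\<omega>. \<Sum>i\<in>{1..n}. score (Z i \<omega>) ^ 4) \<in> borel_measurable M"
    by (intro borel_measurable_sum borel_measurable_power sm)
  have K4: "0 < K\<alpha> ^ 4"
    using K\<alpha>_pos by simp
  have "(\<integral>\<^sup>+\<omega>. ennreal (\<Sum>i\<in>{1..n}. score (Z i \<omega>) ^ 4) \<partial>M) = (\<integral>\<^sup>+\<omega>. (\<Sum>i\<in>{1..n}. ennreal (score (Z i \<omega>) ^ 4)) \<partial>M)"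
    by (intro nn_integral_cong) (simp add: sum_ennreal)
  also have "\<dots> = (\<Sum>i\<in>{1..n}. \<integral>\<^sup>+\<omega>. ennreal (score (Z i \<omega>) ^ 4) \<partial>M)"
    by (intro nn_integral_sum measurable_compose[OF _ measurable_ennreal] borel_measurable_power sm)
  also have "\<dots> = (\<Sum>i\<in>{1..n}. \<integral>\<^sup>+z. ennreal (score z ^ 4) \<partial>law)"
    by (intro sum.cong refl nn_integral_Zi) auto
  also have "\<dots> \<le> (\<Sum>i\<in>{1..n}. ennreal (4 * K\<alpha> ^ 4))"
    by (intro sum_mono score_fourth)
  also have "\<dots> = ennreal (real n * (4 * K\<alpha> ^ 4))"
    using K4 by (simp add: ennreal_mult ennreal_of_nat_eq_real_of_nat)
  finally have le: "(\<integral>\<^sup>+\<omega>. ennreal (\<Sum>i\<in>{1..n}. score (Z i \<omega>) ^ 4) \<partial>M) \<le> ennreal (real n * (4 * K\<alpha> ^ 4))" .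
  let ?c = "L * real n * (4 * K\<alpha> ^ 4)"
  have "prob {\<omega> \<in> space M. ?c \<le> (\<Sum>i\<in>{1..n}. score (Z i \<omega>) ^ 4)} \<le> real n * (4 * K\<alpha> ^ 4) / ?c"
    using n L K4 by (intro prob_ge_le_nn_integral[OF m _ le]) (auto intro!: sum_nonneg mult_pos_pos)
  also have "\<dots> = 1 / L"
    using n K4 by simp
  finally show ?thesis
    using m by (intro whpI[of "{\<omega> \<in> space M. ?c \<le> (\<Sum>i\<in>{1..n}. score (Z i \<omega>) ^ 4)}"]) auto
qed

text \<open>Chebyshev's inequality: the products have variance of order N^4, so the deviation is of
  order N^2 / sqrt n, which is small relative to \<open>V\<close> by \<open>V_lower\<close>.\<close>

lemma variance_lln:
  assumes n: "0 < n" and L: "0 < L"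
  shows "whp M (1 / L) (\<lambda>\<omega>. \<bar>(1 / real n) * (\<Sum>i\<in>{1..n}. (score (Z i \<omega>))\<^sup>2 * (eps (Z i \<omega>))\<^sup>2) - V\<bar>
    \<le> sqrt (L * (24 * ((K * c4) ^ 8 + K2 ^ 8)) / real n) * N\<^sup>2)"
proof -
  define C where "C = 24 * ((K * c4) ^ 8 + K2 ^ 8)"
  have C: "0 < C"
    using K c by (simp add: C_def add_pos_pos)
  define g where "g z = (score z)\<^sup>2 * (eps z)\<^sup>2 - V" for z
  have gm: "g \<in> borel_measurable (obs_space p)"
    unfolding g_def[abs_def] by measurable
  have e: "(\<lambda>z. (g z)\<^sup>2) = (\<lambda>z. ((score z)\<^sup>2 * (eps z)\<^sup>2)\<^sup>2 - 2 * V * ((score z)\<^sup>2 * (eps z)\<^sup>2) + V\<^sup>2)"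
    by (auto simp: g_def power2_diff)
  have i: "integrable law (\<lambda>z. (g z)\<^sup>2)"
    unfolding e using score_eps_fourth(1) integrable_score_eps_sq by simp
  have z: "(\<integral>z. g z \<partial>law) = 0"
    unfolding g_def using integrable_score_eps_sq by (simp add: V_def L.prob_space)
  have "(\<integral>z. (g z)\<^sup>2 \<partial>law) = (\<integral>z. ((score z)\<^sup>2 * (eps z)\<^sup>2)\<^sup>2 \<partial>law) - 2 * V * V + V\<^sup>2"
    unfolding e using score_eps_fourth(1) integrable_score_eps_sq by (simp add: V_def L.prob_space)
  \<comment> \<open>The terms in V add up to - V^2, which is dropped: a variance is at most the
    second moment.\<close>
  also have "\<dots> \<le> C * N ^ 4"
    using score_eps_fourth(2) zero_le_power2[of V] unfolding C_def power2_eq_square[of V] by linarith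
  finally have g2: "(\<integral>z. (g z)\<^sup>2 \<partial>law) \<le> C * N ^ 4" .
  note sm = second_moment_iid_sum[OF order_refl gm i z]
  let ?c = "L * (real n * (C * N ^ 4))"
  have Zm: "(\<lambda>\<omega>. (\<Sum>i\<in>{1..n}. g (Z i \<omega>))\<^sup>2) \<in> borel_measurable M"
    using sm(1) by (rule borel_measurable_integrable)
  have "expectation (\<lambda>\<omega>. (\<Sum>i\<in>{1..n}. g (Z i \<omega>))\<^sup>2) \<le> real n * (C * N ^ 4)"
    unfolding sm(2) using g2 by (simp add: mult_left_mono)
  then have "(\<integral>\<^sup>+\<omega>. ennreal ((\<Sum>i\<in>{1..n}. g (Z i \<omega>))\<^sup>2) \<partial>M) \<le> ennreal (real n * (C * N ^ 4))"
    by (intro nn_integral_le_of_integral[OF sm(1)]) auto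
  then have "prob {\<omega> \<in> space M. ?c \<le> (\<Sum>i\<in>{1..n}. g (Z i \<omega>))\<^sup>2} \<le> real n * (C * N ^ 4) / ?c"
    using n C L N_pos by (intro prob_ge_le_nn_integral[OF Zm]) auto
  also have "\<dots> = 1 / L"
    using n C N_pos by simp
  finally show ?thesis
    unfolding C_def[symmetric]
  proof (intro whpI[of "{\<omega> \<in> space M. ?c \<le> (\<Sum>i\<in>{1..n}. g (Z i \<omega>))\<^sup>2}"])
    fix \<omega> assume w: "\<omega> \<in> space M" "\<omega> \<notin> {\<omega> \<in> space M. ?c \<le> (\<Sum>i\<in>{1..n}. g (Z i \<omega>))\<^sup>2}"
    define s where "s = (\<Sum>i\<in>{1..n}. g (Z i \<omega>))"
    have "(1 / real n) * (\<Sum>i\<in>{1..n}. (score (Z i \<omega>))\<^sup>2 * (eps (Z i \<omega>))\<^sup>2) - V = s / real n"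
      using n by (simp add: s_def g_def sum_subtractf diff_divide_distrib)
    moreover have "\<bar>s / real n\<bar> \<le> sqrt (L * C / real n * (N\<^sup>2)\<^sup>2)"
    proof (rule real_le_rsqrt)
      have "s\<^sup>2 \<le> ?c"
        using w by (simp add: s_def)
      then have "s\<^sup>2 / (real n)\<^sup>2 \<le> ?c / (real n)\<^sup>2"
        by (intro divide_right_mono) auto
      then show "\<bar>s / real n\<bar>\<^sup>2 \<le> L * C / real n * (N\<^sup>2)\<^sup>2"
        using n by (simp add: power_divide power2_eq_square[of "real n"] power_mult[symmetric])
    qed
    moreover have "sqrt (L * C / real n * (N\<^sup>2)\<^sup>2) = sqrt (L * C / real n) * N\<^sup>2"
      unfolding real_sqrt_mult[of "L * C / real n"] by (simp only: real_sqrt_abs abs_power2)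
    ultimately show "\<bar>(1 / real n) * (\<Sum>i\<in>{1..n}. (score (Z i \<omega>))\<^sup>2 * (eps (Z i \<omega>))\<^sup>2) - V\<bar> \<le> sqrt (L * C / real n) * N\<^sup>2"
      by simp
  qed (use Zm in auto)
qed

text \<open>The summands bound, in this order, the Gram residual, the Cauchy-Schwarz term and the
  conditionally centred sum over both folds. The denominator is the lower bound for sqrt V relative
  to \<open>N\<close>.\<close>

definition lin_bound :: "real \<Rightarrow> real \<Rightarrow> real \<Rightarrow> real \<Rightarrow> real \<Rightarrow> real \<Rightarrow> real \<Rightarrow> real" where
  "lin_bound L B4 t d1 d2 b q =
    (d1 * (K\<^sup>2 * c4 * t) + sqrt (L * q / c3) * sqrt d2 + 2 * sqrt (L * (B4 + 4 * K2 ^ 4) / real n) * b) / sqrt (c5 * c3)"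

definition var_eta :: "real \<Rightarrow> real" where
  "var_eta L = sqrt (L * (24 * ((K * c4) ^ 8 + K2 ^ 8)) / real n) / (c5 * c3)"

definition var_rho :: "real \<Rightarrow> real \<Rightarrow> real \<Rightarrow> real \<Rightarrow> real" where
  "var_rho L B4 d2 b = (2 * (L * ((B4 + 4 * K2 ^ 4) * b\<^sup>2))
    + 4 * (sqrt (L * real n * (4 * (K * c4) ^ 4)) + sqrt (L * real n * (B4 * b ^ 4))) * d2) / (c5 * c3)"

text \<open>The term 10 / L is 4 / L for each fold plus 1 / L each for the fourth powers of the
  score and for the oracle variance. The estimate of \<beta> enters the bounds through
  \<open>D\<close>.\<close>

lemma expansion_bound:
  assumes J: "J \<subseteq> {1..n}" "J \<noteq> {}" "{1..n} - J \<noteq> {}"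
    and compJ: "computed_from M p X Y J (mat_borel p) OJ"
    and compJc: "computed_from M p X Y ({1..n} - J) (mat_borel p) OJc"
    and compb: "computed_from M p X Y {1..n} (vec_borel p) \<beta>h"
    and EJ: "whp M qJ (\<lambda>\<omega>. (\<integral>\<^sup>+z. ennreal ((lin_form p (udir (OJ \<omega>)) (fst z)) ^ 4) \<partial>law) \<le> ennreal (B4 * (b * N) ^ 4)
      \<and> sq_sum p (udir (OJ \<omega>)) \<le> q * N\<^sup>2)"
    and EJc: "whp M qJc (\<lambda>\<omega>. (\<integral>\<^sup>+z. ennreal ((lin_form p (udir (OJc \<omega>)) (fst z)) ^ 4) \<partial>law) \<le> ennreal (B4 * (b * N) ^ 4)
      \<and> sq_sum p (udir (OJc \<omega>)) \<le> q * N\<^sup>2)"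
    and D: "whp M \<delta> (\<lambda>\<omega>. l1_norm (\<beta>h \<omega> - \<beta>) \<le> d1 \<and>
      (1 / real n) * (\<Sum>i\<in>{1..n}. (X i \<omega> \<bullet> \<beta>h \<omega> - X i \<omega> \<bullet> \<beta>)\<^sup>2) \<le> d2)"
    and pos: "0 < b" "0 < q" "0 < B4" "0 < L" and t: "0 \<le> t" "t \<le> 8" and d0: "0 \<le> d1" "0 \<le> d2"
  shows "whp M (qJ + qJc + \<delta> + 10 / L + real p * (2 * exp (- real n * t\<^sup>2 / 32))) (\<lambda>\<omega>.
    \<bar>(debiased_estimate p n J (\<lambda>i. X i \<omega>) (\<lambda>i. Y i \<omega>) \<xi> (\<beta>h \<omega>) (OJ \<omega>) (OJc \<omega>) - \<xi> \<bullet> \<beta>) / sqrt V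
      - (1 / real n) * (\<Sum>i\<in>{1..n}. (\<xi> \<bullet> (\<Omega> *\<^sub>v X i \<omega>)) * (Y i \<omega> - X i \<omega> \<bullet> \<beta>) / sqrt V)\<bar>
      \<le> lin_bound L B4 t d1 d2 b q \<and>
    \<bar>variance_estimate n J (\<lambda>i. X i \<omega>) (\<lambda>i. Y i \<omega>) \<xi> (\<beta>h \<omega>) (OJ \<omega>) (OJc \<omega>) / V - 1\<bar>
      \<le> var_eta L + 2 * sqrt (1 + var_eta L) * sqrt (var_rho L B4 d2 b) + var_rho L B4 d2 b)"
proof -
  let ?Jc = "{1..n} - J"
  have n: "0 < n"
    using J by (cases n) auto
  have bN: "0 < b * N" "0 < q * N\<^sup>2"
    using pos N_pos by auto
  have v: "0 < c5 * c3"
    using c by simp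
  then have V0: "0 < V"
    using V_lower N_pos by (intro less_le_trans[OF _ V_lower]) simp
  have dj: "({1..n} - J) \<inter> J = {}" "J \<inter> ({1..n} - J) = {}" "{1..n} - J \<subseteq> {1..n}"
    by auto
  note half1 = cross_half[OF compJc dj(1,3) J(1,2) bN pos(3,4)]
  note half2 = cross_half[OF compJ dj(2) J(1) dj(3) J(3) bN pos(3,4)]
  note all = whp_conj[OF whp_conj[OF whp_conj[OF EJ EJc] D] whp_conj[OF
        whp_conj[OF half1 half2] whp_conj[OF score_gram[OF n t]
        whp_conj[OF score_fourth_sum[OF n pos(4)] variance_lln[OF n pos(4)]]]]]
  show ?thesis
  proof (rule whp_mono[OF all], goal_cases)
    case 1
    then show ?case by simp
  next
    case (2 \<omega>)
    note w = 2(1)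
    define x where "x i = X i \<omega>" for i
    define e where "e i = Y i \<omega> - x i \<bullet> \<beta>" for i
    define a where "a i = \<xi> \<bullet> (\<Omega> *\<^sub>v x i)" for i
    define h where "h i = \<xi> \<bullet> ((if i \<in> J then OJc \<omega> else OJ \<omega>) *\<^sub>v x i)" for i
    define d where "d i = x i \<bullet> \<beta>h \<omega> - x i \<bullet> \<beta>" for i
    define u where "u i = udir (if i \<in> J then OJc \<omega> else OJ \<omega>)" for i
    define wt where "wt i = h i - a i" for i
    have Oc: "OJ \<omega> \<in> carrier_mat p p" "OJc \<omega> \<in> carrier_mat p p"
      using computed_space[OF compJ J(1) w] computed_space[OF compJc _ w] by (auto simp: space_mat_borel)
    have bc: "\<beta>h \<omega> \<in> carrier_vec p"
      using computed_space[OF compb order_refl w] by (simp add: space_vec_borel)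
    have xc: "x i \<in> carrier_vec p" if "i \<in> {1..n}" for i
      using X_carrier[OF w, of i] that by (auto simp: x_def)
    have score_a: "score (Z i \<omega>) = a i" and eps_e: "eps (Z i \<omega>) = e i" and fstZ: "fst (Z i \<omega>) = x i"
      if "i \<in> {1..n}" for i
      using score_eq[OF w, of i] eps_eq[OF w, of i] that by (auto simp: a_def e_def x_def Z_def)
    have wt: "wt i = lin_form p (u i) (x i)" if "i \<in> {1..n}" for i
      using udir_lin[OF _ xc[OF that]] Oc by (auto simp: wt_def h_def a_def u_def)
    have split: "(\<Sum>i\<in>{1..n}. f i) = (\<Sum>i\<in>J. f i) + (\<Sum>i\<in>?Jc. f i)" for f :: "nat \<Rightarrow> real"
      using sum.subset_diff[OF J(1), of f] by simp
    have cards: "real (card J) + real (card ?Jc) = real n"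
      using split[of "\<lambda>_. 1"] by simp
    have fJ: "(\<Sum>i\<in>J. F (lin_form p (udir (OJc \<omega>)) (fst (Z i \<omega>))) (eps (Z i \<omega>))) = (\<Sum>i\<in>J. F (wt i) (e i))"
      for F :: "real \<Rightarrow> real \<Rightarrow> real"
    proof (rule sum.cong)
      fix i assume i: "i \<in> J"
      then have "i \<in> {1..n}" using J(1) by blast
      then show "F (lin_form p (udir (OJc \<omega>)) (fst (Z i \<omega>))) (eps (Z i \<omega>)) = F (wt i) (e i)"
        using i by (simp add: wt fstZ eps_e u_def)
    qed simp
    have fJc: "(\<Sum>i\<in>?Jc. F (lin_form p (udir (OJ \<omega>)) (fst (Z i \<omega>))) (eps (Z i \<omega>))) = (\<Sum>i\<in>?Jc. F (wt i) (e i))"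
      for F :: "real \<Rightarrow> real \<Rightarrow> real"
    proof (rule sum.cong)
      fix i assume i: "i \<in> ?Jc"
      then show "F (lin_form p (udir (OJ \<omega>)) (fst (Z i \<omega>))) (eps (Z i \<omega>)) = F (wt i) (e i)"
        using wt[of i] fstZ[of i] eps_e[of i] by (auto simp: u_def)
    qed simp
    define Bs where "Bs = (B4 + 4 * K2 ^ 4) * (b * N)\<^sup>2"
    have Bs: "0 < Bs"
      unfolding Bs_def using pos K N_pos by (intro mult_pos_pos add_pos_pos zero_less_power) auto
    have H1: "(\<Sum>i\<in>J. (wt i)\<^sup>2) \<le> L * real (card J) * (q * N\<^sup>2 / c3)"
      "(\<Sum>i\<in>J. wt i * e i)\<^sup>2 \<le> L * real (card J) * Bs"
      "(\<Sum>i\<in>J. (wt i)\<^sup>2 * (e i)\<^sup>2) \<le> L * real (card J) * Bs"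
      "(\<Sum>i\<in>J. wt i ^ 4) \<le> L * real (card J) * (B4 * (b * N) ^ 4)"
      using 2(2) unfolding fJ[of "\<lambda>a e. a\<^sup>2"] fJ[of "\<lambda>a e. a * e"] fJ[of "\<lambda>a e. a\<^sup>2 * e\<^sup>2"] fJ[of "\<lambda>a e. a ^ 4"] Bs_def
      by blast+
    have H2: "(\<Sum>i\<in>?Jc. (wt i)\<^sup>2) \<le> L * real (card ?Jc) * (q * N\<^sup>2 / c3)"
      "(\<Sum>i\<in>?Jc. wt i * e i)\<^sup>2 \<le> L * real (card ?Jc) * Bs"
      "(\<Sum>i\<in>?Jc. (wt i)\<^sup>2 * (e i)\<^sup>2) \<le> L * real (card ?Jc) * Bs"
      "(\<Sum>i\<in>?Jc. wt i ^ 4) \<le> L * real (card ?Jc) * (B4 * (b * N) ^ 4)"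
      using 2(2) unfolding fJc[of "\<lambda>a e. a\<^sup>2"] fJc[of "\<lambda>a e. a * e"] fJc[of "\<lambda>a e. a\<^sup>2 * e\<^sup>2"] fJc[of "\<lambda>a e. a ^ 4"] Bs_def
      by blast+
    \<comment> \<open>The bounds on each fold are proportional to its size, so they add up to a
      bound with n.\<close>
    have add: "L * real (card J) * y + L * real (card ?Jc) * y = real n * (L * y)" for y
      unfolding cards[symmetric] by (simp add: algebra_simps)
    have S2: "(\<Sum>i\<in>{1..n}. (wt i)\<^sup>2) \<le> real n * (L * (q * N\<^sup>2 / c3))"
      unfolding split[of "\<lambda>i. (wt i)\<^sup>2"] add[symmetric] by (intro add_mono H1 H2)
    have S22: "(\<Sum>i\<in>{1..n}. (wt i)\<^sup>2 * (e i)\<^sup>2) \<le> real n * (L * Bs)"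
      unfolding split[of "\<lambda>i. (wt i)\<^sup>2 * (e i)\<^sup>2"] add[symmetric] by (intro add_mono H1 H2)
    have S4: "(\<Sum>i\<in>{1..n}. wt i ^ 4) \<le> L * real n * (B4 * (b * N) ^ 4)"
    proof -
      have "(\<Sum>i\<in>{1..n}. wt i ^ 4) \<le> real n * (L * (B4 * (b * N) ^ 4))"
        unfolding split[of "\<lambda>i. wt i ^ 4"] add[symmetric] by (intro add_mono H1 H2)
      then show ?thesis by (simp add: mult_ac)
    qed
    \<comment> \<open>The signed sum over each fold is bounded as if the fold had n elements, which
      is where the factor 2 in front of the third term comes from.\<close>
    have We: "\<bar>\<Sum>i\<in>I. wt i * e i\<bar> \<le> sqrt (real n * (L * Bs))"
      if "(\<Sum>i\<in>I. wt i * e i)\<^sup>2 \<le> L * real (card I) * Bs" "real (card I) \<le> real n" for I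
    proof (rule real_le_rsqrt)
      have "L * real (card I) * Bs \<le> L * real n * Bs"
        using that(2) pos Bs by (intro mult_left_mono mult_right_mono) auto
      then show "\<bar>\<Sum>i\<in>I. wt i * e i\<bar>\<^sup>2 \<le> real n * (L * Bs)"
        using that(1) by (simp add: mult_ac)
    qed
    have S1: "\<bar>\<Sum>i\<in>{1..n}. wt i * e i\<bar> \<le> 2 * sqrt (real n * (L * Bs))"
    proof -
      have c1: "real (card J) \<le> real n" and c2: "real (card ?Jc) \<le> real n"
        using cards by linarith+
      show ?thesis
        unfolding split[of "\<lambda>i. wt i * e i"] using We[OF H1(2) c1] We[OF H2(2) c2] by linarith
    qed
    have dl1: "l1_sum p (\<lambda>k. \<beta>h \<omega> $ k - \<beta> $ k) \<le> d1"
    proof -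
      have "l1_norm (\<beta>h \<omega> - \<beta>) = l1_sum p (\<lambda>k. \<beta>h \<omega> $ k - \<beta> $ k)"
        using bc \<beta>_carrier by (simp add: l1_norm_def l1_sum_def)
      then show ?thesis
        using 2(2) by simp
    qed
    have dd: "(\<Sum>i\<in>{1..n}. (d i)\<^sup>2) \<le> real n * d2"
    proof -
      have "(1 / real n) * (\<Sum>i\<in>{1..n}. (d i)\<^sup>2) \<le> d2"
        using 2(2) unfolding d_def x_def by blast
      then show ?thesis
        using n by (simp add: field_simps)
    qed
    have gram: "\<bar>\<xi> $ k - (1 / real n) * (\<Sum>i\<in>{1..n}. a i * x i $ k)\<bar> \<le> K\<alpha> * K * t" if "k < p" for k
    proof -
      have g1: "(\<Sum>i\<in>{1..n}. score (Z i \<omega>) * fst (Z i \<omega>) $ k) = (\<Sum>i\<in>{1..n}. a i * x i $ k)"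
        by (intro sum.cong refl) (simp only: score_a fstZ)
      have g2: "\<forall>k<p. \<bar>\<xi> $ k - (1 / real n) * (\<Sum>i\<in>{1..n}. score (Z i \<omega>) * fst (Z i \<omega>) $ k)\<bar> \<le> K\<alpha> * K * t"
        using 2(2) by blast
      show ?thesis
        using g2[rule_format, OF that] unfolding g1 .
    qed
    have A4: "(\<Sum>i\<in>{1..n}. a i ^ 4) \<le> L * real n * (4 * K\<alpha> ^ 4)"
    proof -
      have "(\<Sum>i\<in>{1..n}. score (Z i \<omega>) ^ 4) = (\<Sum>i\<in>{1..n}. a i ^ 4)"
        by (intro sum.cong refl) (simp only: score_a)
      moreover have "(\<Sum>i\<in>{1..n}. score (Z i \<omega>) ^ 4) \<le> L * real n * (4 * K\<alpha> ^ 4)"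
        using 2(2) by blast
      ultimately show ?thesis
        by simp
    qed
    have A2: "\<bar>(1 / real n) * (\<Sum>i\<in>{1..n}. (a i)\<^sup>2 * (e i)\<^sup>2) - V\<bar>
      \<le> sqrt (L * (24 * ((K * c4) ^ 8 + K2 ^ 8)) / real n) * N\<^sup>2"
    proof -
      have "(\<Sum>i\<in>{1..n}. (score (Z i \<omega>))\<^sup>2 * (eps (Z i \<omega>))\<^sup>2) = (\<Sum>i\<in>{1..n}. (a i)\<^sup>2 * (e i)\<^sup>2)"
        by (intro sum.cong refl) (simp only: score_a eps_e)
      moreover have "\<bar>(1 / real n) * (\<Sum>i\<in>{1..n}. (score (Z i \<omega>))\<^sup>2 * (eps (Z i \<omega>))\<^sup>2) - V\<bar>
        \<le> sqrt (L * (24 * ((K * c4) ^ 8 + K2 ^ 8)) / real n) * N\<^sup>2"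
        using 2(2) by blast
      ultimately show ?thesis
        by simp
    qed
    note dec = debiased_estimate_decomposition[where x = x and y = "\<lambda>i. Y i \<omega>",
        OF \<xi>(1) J(1) Oc \<Omega>_carrier xc bc \<beta>_carrier]
    define T where "T = debiased_estimate p n J x (\<lambda>i. Y i \<omega>) \<xi> (\<beta>h \<omega>) (OJ \<omega>) (OJc \<omega>) - \<xi> \<bullet> \<beta>
      - (1 / real n) * (\<Sum>i\<in>{1..n}. a i * e i)"
    have dec1: "T = (\<Sum>k<p. (\<beta>h \<omega> $ k - \<beta> $ k) * (\<xi> $ k - (1 / real n) * (\<Sum>i\<in>{1..n}. a i * x i $ k)))
      - (1 / real n) * (\<Sum>i\<in>{1..n}. wt i * d i) + (1 / real n) * (\<Sum>i\<in>{1..n}. wt i * e i)"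
      unfolding T_def wt_def h_def a_def d_def e_def by (rule dec(1))
    have dec2: "variance_estimate n J x (\<lambda>i. Y i \<omega>) \<xi> (\<beta>h \<omega>) (OJ \<omega>) (OJc \<omega>)
        = (1 / real n) * (\<Sum>i\<in>{1..n}. (h i)\<^sup>2 * (e i - d i)\<^sup>2)"
      unfolding h_def d_def e_def by (rule dec(2))
    have T1: "\<bar>\<Sum>k<p. (\<beta>h \<omega> $ k - \<beta> $ k) * (\<xi> $ k - (1 / real n) * (\<Sum>i\<in>{1..n}. a i * x i $ k))\<bar>
        \<le> N * (d1 * (K\<^sup>2 * c4 * t))"
    proof -
      have "\<bar>\<Sum>k<p. (\<beta>h \<omega> $ k - \<beta> $ k) * (\<xi> $ k - (1 / real n) * (\<Sum>i\<in>{1..n}. a i * x i $ k))\<bar>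
          \<le> K\<alpha> * K * t * l1_sum p (\<lambda>k. \<beta>h \<omega> $ k - \<beta> $ k)"
        by (intro sum_abs_mult_le_l1 gram)
      also have "\<dots> \<le> K\<alpha> * K * t * d1"
        using K K\<alpha>_pos t dl1 by (intro mult_left_mono) auto
      finally show ?thesis
        by (simp add: K\<alpha>_def power2_eq_square mult_ac)
    qed
    have T2: "\<bar>(1 / real n) * (\<Sum>i\<in>{1..n}. wt i * d i)\<bar> \<le> N * (sqrt (L * q / c3) * sqrt d2)"
    proof -
      have "\<bar>\<Sum>i\<in>{1..n}. wt i * d i\<bar> \<le> sqrt (\<Sum>i\<in>{1..n}. (wt i)\<^sup>2) * sqrt (\<Sum>i\<in>{1..n}. (d i)\<^sup>2)"
        by (rule cauchy_sum_sqrt)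
      also have "\<dots> \<le> sqrt (real n * (L * (q * N\<^sup>2 / c3))) * sqrt (real n * d2)"
      proof (intro mult_mono real_sqrt_le_mono S2 dd)
        have "0 \<le> real n * (L * (q * N\<^sup>2 / c3))"
          using pos c by (intro mult_nonneg_nonneg divide_nonneg_pos) auto
        then show "0 \<le> sqrt (real n * (L * (q * N\<^sup>2 / c3)))"
          by (simp only: real_sqrt_ge_zero)
      qed (simp add: sum_nonneg)
      also have "\<dots> = sqrt ((real n * N)\<^sup>2 * ((L * q / c3) * d2))"
        unfolding real_sqrt_mult[symmetric] by (simp add: power2_eq_square mult_ac)
      also have "\<dots> = real n * N * (sqrt (L * q / c3) * sqrt d2)"
        unfolding real_sqrt_mult[of "(real n * N)\<^sup>2"] real_sqrt_mult[of "L * q / c3"] real_sqrt_abs using N_pos by simp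
      finally show ?thesis
        using n by (simp add: abs_mult field_simps)
    qed
    have T3: "\<bar>(1 / real n) * (\<Sum>i\<in>{1..n}. wt i * e i)\<bar> \<le> N * (2 * sqrt (L * (B4 + 4 * K2 ^ 4) / real n) * b)"
    proof -
      have "real n * (L * Bs) = (real n * (b * N))\<^sup>2 * (L * (B4 + 4 * K2 ^ 4) / real n)"
        using n by (simp add: Bs_def power2_eq_square mult_ac)
      then have "sqrt (real n * (L * Bs)) = real n * (b * N) * sqrt (L * (B4 + 4 * K2 ^ 4) / real n)"
        using bN by (simp only: real_sqrt_mult[of "(real n * (b * N))\<^sup>2"] real_sqrt_abs) simp
      then show ?thesis
        using S1 n by (simp add: abs_mult field_simps)
    qed
    define lb where "lb = d1 * (K\<^sup>2 * c4 * t) + sqrt (L * q / c3) * sqrt d2 + 2 * sqrt (L * (B4 + 4 * K2 ^ 4) / real n) * b"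
    have Tle: "\<bar>T\<bar> \<le> N * lb"
      unfolding dec1 lb_def distrib_left[of N] using T1 T2 T3 by linarith
    have lb0: "0 \<le> lb"
      using d0 K c t pos unfolding lb_def by (intro add_nonneg_nonneg mult_nonneg_nonneg) auto
    have sV: "sqrt (c5 * c3) * N \<le> sqrt V"
    proof (rule real_le_rsqrt)
      show "(sqrt (c5 * c3) * N)\<^sup>2 \<le> V"
        using V_lower v by (simp add: power_mult_distrib)
    qed
    have "\<bar>T / sqrt V\<bar> \<le> lb / sqrt (c5 * c3)"
    proof -
      have sv0: "0 < sqrt (c5 * c3)"
        using v by simp
      have "\<bar>T\<bar> * sqrt (c5 * c3) \<le> N * lb * sqrt (c5 * c3)"
        using Tle sv0 by (intro mult_right_mono) auto
      also have "\<dots> = lb * (sqrt (c5 * c3) * N)"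
        by simp
      also have "\<dots> \<le> lb * sqrt V"
        using sV lb0 by (rule mult_left_mono)
      finally show ?thesis
        using V0 sv0 by (simp add: field_simps)
    qed
    moreover have "T / sqrt V = (debiased_estimate p n J x (\<lambda>i. Y i \<omega>) \<xi> (\<beta>h \<omega>) (OJ \<omega>) (OJc \<omega>) - \<xi> \<bullet> \<beta>) / sqrt V
      - (1 / real n) * (\<Sum>i\<in>{1..n}. a i * e i / sqrt V)"
      by (simp add: T_def diff_divide_distrib sum_divide_distrib mult.commute[of "sqrt V"])
    ultimately have lin_form: "\<bar>(debiased_estimate p n J x (\<lambda>i. Y i \<omega>) \<xi> (\<beta>h \<omega>) (OJ \<omega>) (OJc \<omega>) - \<xi> \<bullet> \<beta>) / sqrt V
      - (1 / real n) * (\<Sum>i\<in>{1..n}. a i * e i / sqrt V)\<bar> \<le> lin_bound L B4 t d1 d2 b q"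
      by (simp add: lin_bound_def lb_def)
    have var: "\<bar>(1 / real n) * (\<Sum>i\<in>{1..n}. (a i + wt i)\<^sup>2 * (e i - d i)\<^sup>2) / V - 1\<bar>
        \<le> var_eta L + 2 * sqrt (1 + var_eta L) * sqrt (var_rho L B4 d2 b) + var_rho L B4 d2 b"
    proof (rule variance_perturbation[OF _ _ V0 _ _ S22 A4 S4 dd])
      \<comment> \<open>The lower bound on \<open>V\<close> in the form that converts every bound
        proportional to N^2 into one proportional to \<open>V\<close>.\<close>
      have vV: "x * N\<^sup>2 \<le> x / (c5 * c3) * V" if "0 \<le> x" for x
      proof -
        have "x * N\<^sup>2 = x / (c5 * c3) * (c5 * c3 * N\<^sup>2)"
          using c by simp
        also have "\<dots> \<le> x / (c5 * c3) * V"
          using V_lower that v by (intro mult_left_mono divide_nonneg_pos) auto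
        finally show ?thesis .
      qed
      show "\<bar>(1 / real n) * (\<Sum>i\<in>{1..n}. (a i)\<^sup>2 * (e i)\<^sup>2) - V\<bar> \<le> var_eta L * V"
        unfolding var_eta_def using pos K c by (intro order_trans[OF A2 vV]) auto
      define y where "y = 2 * (L * ((B4 + 4 * K2 ^ 4) * b\<^sup>2))
        + 4 * (sqrt (L * real n * (4 * (K * c4) ^ 4)) + sqrt (L * real n * (B4 * b ^ 4))) * d2"
      have y0: "0 \<le> y"
        using pos d0 K c unfolding y_def by (intro add_nonneg_nonneg mult_nonneg_nonneg) auto
      then show "0 \<le> var_rho L B4 d2 b"
        using v unfolding var_rho_def y_def[symmetric] by simp
      have s4: "sqrt (L * real n * (y * N ^ 4)) = sqrt (L * real n * y) * N\<^sup>2" for y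
      proof -
        have "L * real n * (y * N ^ 4) = (N\<^sup>2)\<^sup>2 * (L * real n * y)"
          by (simp add: power_mult[symmetric] mult_ac)
        then show ?thesis
          by (simp only: real_sqrt_mult[of "(N\<^sup>2)\<^sup>2"] real_sqrt_abs) simp
      qed
      have "2 * (L * Bs) + 4 * (sqrt (L * real n * (4 * K\<alpha> ^ 4)) + sqrt (L * real n * (B4 * (b * N) ^ 4))) * d2 = y * N\<^sup>2"
        unfolding Bs_def K\<alpha>_def power_mult_distrib[of "K * c4" N] power_mult_distrib[of b N] y_def
          mult.assoc[symmetric, of 4 "(K * c4) ^ 4"] mult.assoc[symmetric, of B4 "b ^ 4"] s4
        by (simp add: algebra_simps)
      also have "\<dots> \<le> var_rho L B4 d2 b * V"
        unfolding var_rho_def y_def[symmetric] by (rule vV[OF y0])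
      finally show "2 * (L * Bs) + 4 * (sqrt (L * real n * (4 * K\<alpha> ^ 4)) + sqrt (L * real n * (B4 * (b * N) ^ 4))) * d2
        \<le> var_rho L B4 d2 b * V" .
    qed (use n in auto)
    moreover have "a i + wt i = h i" for i
      by (simp add: wt_def)
    ultimately have "\<bar>variance_estimate n J x (\<lambda>i. Y i \<omega>) \<xi> (\<beta>h \<omega>) (OJ \<omega>) (OJc \<omega>) / V - 1\<bar>
        \<le> var_eta L + 2 * sqrt (1 + var_eta L) * sqrt (var_rho L B4 d2 b) + var_rho L B4 d2 b"
      unfolding dec2 by simp
    then show ?case
      using lin_form unfolding x_def[abs_def] a_def[abs_def] e_def[abs_def] by blast
  qed
qed

end

subsection \<open>Rates\<close>

lemma rate_lambda_sq:
  assumes "0 < n"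
  shows "(rate_lambda p n)\<^sup>2 = ln (real (max p n)) / real n" "0 \<le> rate_lambda p n"
    "rate_tau p n = sqrt (real n) * (rate_lambda p n)\<^sup>2" "0 \<le> rate_tau p n"
proof -
  have m: "1 \<le> real (max p n)"
    using assms by simp
  then have l: "0 \<le> ln (real (max p n)) / real n"
    by simp
  show e: "(rate_lambda p n)\<^sup>2 = ln (real (max p n)) / real n"
    unfolding rate_lambda_def using l by simp
  show "0 \<le> rate_lambda p n"
    unfolding rate_lambda_def using l by simp
  show "rate_tau p n = sqrt (real n) * (rate_lambda p n)\<^sup>2"
    unfolding e rate_tau_def using assms by (simp add: field_simps)
  show "0 \<le> rate_tau p n"
    unfolding rate_tau_def using m by simp
qed

text \<open>The choice \<open>A\<^sup>2 \<rho> = 96\<close> makes the exponent at least \<open>3 ln (max p n)\<close>, which beats a union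
  bound over \<open>p\<^sup>2\<close> entries.\<close>

lemma exp_rate_bound:
  assumes n: "0 < n" and k: "\<rho> * real n \<le> k" and A: "A\<^sup>2 * \<rho> = 96"
  shows "(real p)\<^sup>2 * (2 * exp (- k * (A * rate_lambda p n)\<^sup>2 / 32)) \<le> 2 / real n"
    "real p * (2 * exp (- k * (A * rate_lambda p n)\<^sup>2 / 32)) \<le> 2 / real n"
proof -
  define m where "m = real (max p n)"
  have m: "1 \<le> m" "real p \<le> m" "real n \<le> m"
    using n by (auto simp: m_def)
  have "3 * ln m \<le> k * (A * rate_lambda p n)\<^sup>2 / 32"
  proof -
    have "3 * ln m = \<rho> * real n * (A\<^sup>2 * (ln m / real n)) / 32"
      using n A by (simp add: field_simps)
    also have "\<dots> \<le> k * (A\<^sup>2 * (ln m / real n)) / 32"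
      using k m by (intro divide_right_mono mult_right_mono) auto
    finally show ?thesis
      using rate_lambda_sq(1)[OF n] by (simp add: power_mult_distrib m_def)
  qed
  then have "exp (- k * (A * rate_lambda p n)\<^sup>2 / 32) \<le> exp (- (3 * ln m))"
    by simp
  also have "\<dots> = inverse (m ^ 3)"
    using m exp_of_nat_mult[of 3 "ln m"] by (simp add: exp_minus)
  finally have e: "exp (- k * (A * rate_lambda p n)\<^sup>2 / 32) \<le> inverse (m ^ 3)" .
  have "(real p)\<^sup>2 * (2 * exp (- k * (A * rate_lambda p n)\<^sup>2 / 32)) \<le> m\<^sup>2 * (2 * inverse (m ^ 3))"
    using e m by (intro mult_mono power_mono) auto
  also have "\<dots> = 2 / m"
    using m by (simp add: field_simps eval_nat_numeral)
  also have "\<dots> \<le> 2 / real n"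
    using m n by (simp add: frac_le)
  finally show 1: "(real p)\<^sup>2 * (2 * exp (- k * (A * rate_lambda p n)\<^sup>2 / 32)) \<le> 2 / real n" .
  have "real p \<le> (real p)\<^sup>2"
    by (cases p) (auto simp: power2_eq_square)
  then have "real p * (2 * exp (- k * (A * rate_lambda p n)\<^sup>2 / 32))
      \<le> (real p)\<^sup>2 * (2 * exp (- k * (A * rate_lambda p n)\<^sup>2 / 32))"
    by (intro mult_right_mono) auto
  then show "real p * (2 * exp (- k * (A * rate_lambda p n)\<^sup>2 / 32)) \<le> 2 / real n"
    using 1 by linarith
qed

section \<open>Sparsity levels, and the error bounds in terms of the rates\<close>

context regression_model
begin

lemma col_card: "k < p \<Longrightarrow> l0_norm (col \<Omega> k) = card {l. l < p \<and> entry \<Omega> l k \<noteq> 0}"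
  using \<Omega>_carrier by (auto simp: l0_norm_def supp_vec_def intro!: arg_cong[of _ _ card])

lemma col_nonzero: "k < p \<Longrightarrow> 1 \<le> l0_norm (col \<Omega> k)"
proof -
  assume k: "k < p"
  have "\<exists>l<p. entry \<Omega> l k \<noteq> 0"
  proof (rule ccontr)
    assume "\<not> ?thesis"
    then have "(\<Sum>l<p. Sig k l * entry \<Omega> l k) = 0"
      by simp
    then show False
      using Sig_\<Omega>[OF k k] by simp
  qed
  then have "card {l. l < p \<and> entry \<Omega> l k \<noteq> 0} \<noteq> 0"
    by (subst card_eq_0_iff) auto
  then show ?thesis
    unfolding col_card[OF k] by linarith
qed

lemma col_sparsity_le: "k < p \<Longrightarrow> l0_norm (col \<Omega> k) \<le> max_col_sparsity \<Omega>"
  unfolding max_col_sparsity_def using \<Omega>_carrier by (intro Max_ge) auto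

lemma max_col_sparsity_ge_1: "1 \<le> max_col_sparsity \<Omega>"
  using col_nonzero[OF p_pos] col_sparsity_le[OF p_pos] by linarith

text \<open>An invertible matrix has no zero column, so every index in the support of \<xi> has
  positive column sparsity and is counted.\<close>

lemma loading_sparsity_card: "loading_sparsity \<Omega> \<xi> = card {k. k < p \<and> \<xi> $ k \<noteq> 0}"
  unfolding loading_sparsity_def supp_vec_def using \<xi>(1) col_nonzero
  by (intro arg_cong[of _ _ card]) (auto simp: not_less_eq_eq[symmetric] dest: col_nonzero)

lemma loading_sparsity_ge_1: "1 \<le> loading_sparsity \<Omega> \<xi>"
proof -
  have "\<exists>k<p. \<xi> $ k \<noteq> 0"
  proof (rule ccontr)
    assume "\<not> ?thesis"
    then have "\<xi> = 0\<^sub>v p"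
      using \<xi>(1) by (intro eq_vecI) auto
    then show False
      using \<xi>(2) by simp
  qed
  then have "card {k. k < p \<and> \<xi> $ k \<noteq> 0} \<noteq> 0"
    by (subst card_eq_0_iff) auto
  then show ?thesis
    unfolding loading_sparsity_card by linarith
qed

lemma N_l2: "N = l2_norm \<xi>"
  using \<xi>(1) by (simp add: N_def l2_norm_sq)

lemma l1_\<xi>: "l1_sum p (($) \<xi>) = l1_norm \<xi>"
  using \<xi>(1) by (simp add: l1_sum_def l1_norm_def)

lemma N_le_l1: "N \<le> l1_sum p (($) \<xi>)"
proof -
  have "sq_sum p (($) \<xi>) \<le> (l1_sum p (($) \<xi>))\<^sup>2"
  proof -
    have "sq_sum p (($) \<xi>) = (\<Sum>k<p. \<xi> $ k * \<xi> $ k)"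
      by (simp add: sq_sum_def power2_eq_square)
    also have "\<dots> \<le> \<bar>\<Sum>k<p. \<xi> $ k * \<xi> $ k\<bar>"
      by simp
    also have "\<dots> \<le> l1_sum p (($) \<xi>) * l1_sum p (($) \<xi>)"
      by (intro sum_abs_mult_le_l1) (auto simp: l1_sum_def intro!: member_le_sum)
    finally show ?thesis
      by (simp add: power2_eq_square)
  qed
  then show ?thesis
    unfolding N_def by (intro real_le_lsqrt) auto
qed

definition mu :: real where
  "mu = min (sqrt (real (loading_sparsity \<Omega> \<xi>) * real (max_col_sparsity \<Omega>))) (real (max_col_sparsity \<Omega>))"

text \<open>Through this inequality the rate condition of (ii) also controls s1 \<lambda>^2, as the
  restricted eigenvalue bound of that part requires.\<close>

lemma mu_ge: "sqrt (real (max_col_sparsity \<Omega>)) \<le> mu"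
proof -
  have s: "1 \<le> real (max_col_sparsity \<Omega>)" "1 \<le> real (loading_sparsity \<Omega> \<xi>)"
    using max_col_sparsity_ge_1 loading_sparsity_ge_1 by simp_all
  have "sqrt (real (max_col_sparsity \<Omega>)) \<le> sqrt ((real (max_col_sparsity \<Omega>))\<^sup>2)"
    using s by (intro real_sqrt_le_mono) (simp add: power2_eq_square)
  then show ?thesis
    unfolding mu_def using s by (auto simp: mult_le_cancel_right1)
qed

lemma mu_ge_1: "1 \<le> mu"
proof -
  have "1 \<le> sqrt (real (max_col_sparsity \<Omega>))"
    using max_col_sparsity_ge_1 by simp
  then show ?thesis
    using mu_ge by linarith
qed

text \<open>Whichever argument attains the minimum, the matching l2 bound is taken. The constant 144
  of the support bound is raised to 2304 = 48^2 to give both cases one form.\<close>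

lemma sq_le_mu:
  assumes "y \<le> (48 * r * real (max_col_sparsity \<Omega>) / \<kappa>)\<^sup>2 * N\<^sup>2"
    and "y \<le> real (card {k. k < p \<and> \<xi> $ k \<noteq> 0}) * (144 * r\<^sup>2 * real (max_col_sparsity \<Omega>) / \<kappa>\<^sup>2) * N\<^sup>2"
  shows "y \<le> (48 * r * mu / \<kappa>)\<^sup>2 * N\<^sup>2"
proof (cases "sqrt (real (loading_sparsity \<Omega> \<xi>) * real (max_col_sparsity \<Omega>)) \<le> real (max_col_sparsity \<Omega>)")
  case True
  then have m: "mu\<^sup>2 = real (loading_sparsity \<Omega> \<xi>) * real (max_col_sparsity \<Omega>)"
    by (simp add: mu_def)
  have "real (loading_sparsity \<Omega> \<xi>) * (144 * r\<^sup>2 * real (max_col_sparsity \<Omega>) / \<kappa>\<^sup>2) * N\<^sup>2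
      = 144 * (r\<^sup>2 * mu\<^sup>2 / \<kappa>\<^sup>2 * N\<^sup>2)"
    unfolding m by simp
  also have "\<dots> \<le> 2304 * (r\<^sup>2 * mu\<^sup>2 / \<kappa>\<^sup>2 * N\<^sup>2)"
    by (intro mult_right_mono) auto
  finally show ?thesis
    using assms(2) unfolding loading_sparsity_card[symmetric] by (simp add: power_mult_distrib power_divide)
next
  case False
  then have "mu = real (max_col_sparsity \<Omega>)"
    by (simp add: mu_def)
  then show ?thesis
    using assms(1) by simp
qed

text \<open>The restricted eigenvalue bound \<open>RE\<close> and the moment bound
  \<open>mom\<close> are where (i) and (ii) diverge, so they are hypotheses here. The term 6 / n
  counts the Gram events of the two folds and that of the score, 2 / n each; powers of \<lambda> are
  rewritten by sqrt n \<lambda>^2 = \<tau>.\<close>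

lemma final_bound:
  assumes n: "0 < n" and J: "J \<subseteq> {1..n}" "\<rho> * real n < real (card J)" "\<rho> * real n < real (card ({1..n} - J))" "0 < \<rho>"
    and A: "0 < A" "A\<^sup>2 * \<rho> = 96" "K\<^sup>2 * A \<le> A0 / 2" and lam: "0 < rate_lambda p n" "A * rate_lambda p n \<le> 8"
    and est: "two_stage_estimator M p X Y J (A0 * rate_lambda p n) OJ"
      "two_stage_estimator M p X Y ({1..n} - J) (A0 * rate_lambda p n) OJc"
    and compb: "computed_from M p X Y {1..n} (vec_borel p) \<beta>h"
    and RE: "\<And>I. I = J \<or> I = {1..n} - J \<Longrightarrow>
      whp M qR (\<lambda>\<omega>. \<forall>v. \<kappa> * sq_sum p v - \<gamma> * (l1_sum p v)\<^sup>2 \<le> bil_form p (entry (Shat I \<omega>)) v v)"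
    and \<kappa>: "0 < \<kappa>" "0 \<le> \<gamma>" "32 * \<gamma> * real (max_col_sparsity \<Omega>) \<le> \<kappa>"
    and mom: "\<And>u. l1_sum p u \<le> 48 * A0 / \<kappa> * (rate_lambda p n * real (max_col_sparsity \<Omega>)) * l1_sum p (($) \<xi>) \<Longrightarrow>
        sq_sum p u \<le> (48 * A0 / \<kappa> * rate_lambda p n * mu)\<^sup>2 * N\<^sup>2 \<Longrightarrow>
        (\<integral>\<^sup>+z. ennreal ((lin_form p u (fst z)) ^ 4) \<partial>law) \<le> ennreal (B4 * (b * N) ^ 4)"
    and D: "whp M \<delta> (\<lambda>\<omega>. l1_norm (\<beta>h \<omega> - \<beta>) \<le> C1 * s0 * rate_lambda p n \<and>
      (1 / real n) * (\<Sum>i\<in>{1..n}. (X i \<omega> \<bullet> \<beta>h \<omega> - X i \<omega> \<bullet> \<beta>)\<^sup>2) \<le> C1 * s0 * (rate_lambda p n)\<^sup>2)"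
    and pos: "0 < b" "0 < B4" "0 < L" "0 < C1" "0 \<le> s0"
  shows "whp M (6 / real n + 2 * qR + \<delta> + 10 / L) (\<lambda>\<omega>.
    \<bar>(debiased_estimate p n J (\<lambda>i. X i \<omega>) (\<lambda>i. Y i \<omega>) \<xi> (\<beta>h \<omega>) (OJ \<omega>) (OJc \<omega>) - \<xi> \<bullet> \<beta>) / sqrt V
      - (1 / real n) * (\<Sum>i\<in>{1..n}. (\<xi> \<bullet> (\<Omega> *\<^sub>v X i \<omega>)) * (Y i \<omega> - X i \<omega> \<bullet> \<beta>) / sqrt V)\<bar>
      \<le> (C1 * K\<^sup>2 * c4 * A * (s0 * rate_tau p n) + sqrt (L * C1 / c3) * (48 * A0 / \<kappa>) * (mu * sqrt s0 * rate_tau p n)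
        + 2 * sqrt (L * (B4 + 4 * K2 ^ 4)) * b) / sqrt (c5 * c3) * (1 / sqrt (real n)) \<and>
    \<bar>variance_estimate n J (\<lambda>i. X i \<omega>) (\<lambda>i. Y i \<omega>) \<xi> (\<beta>h \<omega>) (OJ \<omega>) (OJc \<omega>) / V - 1\<bar>
      \<le> var_eta L + 2 * sqrt (1 + var_eta L) * sqrt ((2 * (L * ((B4 + 4 * K2 ^ 4) * b\<^sup>2))
          + 4 * (sqrt (L * (4 * (K * c4) ^ 4)) + sqrt (L * (B4 * b ^ 4))) * (C1 * (s0 * rate_tau p n))) / (c5 * c3))
        + (2 * (L * ((B4 + 4 * K2 ^ 4) * b\<^sup>2))
          + 4 * (sqrt (L * (4 * (K * c4) ^ 4)) + sqrt (L * (B4 * b ^ 4))) * (C1 * (s0 * rate_tau p n))) / (c5 * c3))"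
proof -
  define lm where "lm = rate_lambda p n"
  define cq where "cq = 48 * A0 / \<kappa>"
  define sn where "sn = sqrt (real n)"
  have sn: "0 < sn" "real n = sn * sn"
    using n by (auto simp: sn_def)
  have tau: "rate_tau p n = sn * lm\<^sup>2"
    using rate_lambda_sq(3)[OF n] by (simp add: sn_def lm_def)
  have l0: "0 < lm"
    using lam by (simp add: lm_def)
  have A0: "0 < A0"
    using A K by (smt (verit) divide_nonpos_pos mult_pos_pos zero_less_power)
  have cq: "0 < cq"
    using A0 \<kappa> by (simp add: cq_def)
  have rn: "0 < \<rho> * real n"
    using J n by simp
  have ne: "J \<noteq> {}" "{1..n} - J \<noteq> {}"
    using J(2,3) rn by (metis card.empty less_asym of_nat_0)+
  have half: "whp M (2 / real n + qR) (\<lambda>\<omega>.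
      (\<integral>\<^sup>+z. ennreal ((lin_form p (udir (Oh \<omega>)) (fst z)) ^ 4) \<partial>law) \<le> ennreal (B4 * (b * N) ^ 4)
      \<and> sq_sum p (udir (Oh \<omega>)) \<le> (cq * lm * mu)\<^sup>2 * N\<^sup>2)"
    if I: "I = J \<or> I = {1..n} - J" and e: "two_stage_estimator M p X Y I (A0 * rate_lambda p n) Oh" for I Oh
  proof -
    have I': "I \<subseteq> {1..n}" "I \<noteq> {}" "\<rho> * real n \<le> real (card I)"
      using I J ne by auto
    have t: "0 \<le> A * rate_lambda p n" "K\<^sup>2 * (A * rate_lambda p n) \<le> A0 * rate_lambda p n / 2" "0 < A0 * rate_lambda p n"
      using A A0 lam mult_right_mono[OF A(3), of "rate_lambda p n"] by (auto simp: mult.assoc)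
    have cs: "card {l. l < p \<and> entry \<Omega> l k \<noteq> 0} \<le> max_col_sparsity \<Omega>" if "k < p" for k
      using col_sparsity_le[OF that] by (simp add: col_card[OF that])
    note ee = estimator_error[OF e I'(1,2) t(1) lam(2) t(2) RE[OF I] \<kappa>(1,2) t(3) \<kappa>(3),
        OF cs]
    show ?thesis
    proof (rule whp_mono[OF ee], goal_cases)
      case 1
      then show ?case by simp
    next
      case 2
      then show ?case
        using exp_rate_bound(1)[OF n I'(3) A(2), of p] by simp
    next
      case (3 \<omega>)
      have e1: "48 * (A0 * rate_lambda p n) * mu / \<kappa> = cq * lm * mu"
        by (simp add: cq_def lm_def)
      have s: "sq_sum p (udir (Oh \<omega>)) \<le> (cq * lm * mu)\<^sup>2 * N\<^sup>2"
        using 3 unfolding e1[symmetric] by (intro sq_le_mu) auto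
      have l: "l1_sum p (udir (Oh \<omega>)) \<le> 48 * A0 / \<kappa> * (rate_lambda p n * real (max_col_sparsity \<Omega>)) * l1_sum p (($) \<xi>)"
        using 3 by (simp add: mult_ac)
      show ?case
        using mom[OF l] s unfolding cq_def lm_def by blast
    qed
  qed
  have q: "0 < (cq * lm * mu)\<^sup>2"
    using cq l0 mu_ge_1 by (intro zero_less_power mult_pos_pos) auto
  have d0: "0 \<le> C1 * s0 * lm" "0 \<le> C1 * s0 * lm\<^sup>2"
    using pos l0 by auto
  have t0: "0 \<le> A * lm" "A * lm \<le> 8"
    using A l0 lam by (auto simp: lm_def)
  have comp: "computed_from M p X Y J (mat_borel p) OJ" "computed_from M p X Y ({1..n} - J) (mat_borel p) OJc"
    using est by (auto simp: two_stage_estimator_def)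
  note eb = expansion_bound[OF J(1) ne comp compb half[OF disjI1[OF refl] est(1)] half[OF disjI2[OF refl] est(2)]
      D[folded lm_def] pos(1) q pos(2,3) t0 d0]
  have "lin_bound L B4 (A * lm) (C1 * s0 * lm) (C1 * s0 * lm\<^sup>2) b ((cq * lm * mu)\<^sup>2)
    = (C1 * K\<^sup>2 * c4 * A * (s0 * rate_tau p n) + sqrt (L * C1 / c3) * cq * (mu * sqrt s0 * rate_tau p n)
        + 2 * sqrt (L * (B4 + 4 * K2 ^ 4)) * b) / sqrt (c5 * c3) * (1 / sn)"
  proof -
    have e1: "C1 * s0 * lm * (K\<^sup>2 * c4 * (A * lm)) = C1 * K\<^sup>2 * c4 * A * (s0 * rate_tau p n) * (1 / sn)"
      using sn by (simp add: tau power2_eq_square)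
    have e2: "sqrt (L * (cq * lm * mu)\<^sup>2 / c3) * sqrt (C1 * s0 * lm\<^sup>2)
        = sqrt (L * C1 / c3) * cq * (mu * sqrt s0 * rate_tau p n) * (1 / sn)"
    proof -
      have "sqrt (L * (cq * lm * mu)\<^sup>2 / c3) * sqrt (C1 * s0 * lm\<^sup>2)
          = sqrt ((cq * lm * mu * lm)\<^sup>2 * ((L * C1 / c3) * s0))"
        unfolding real_sqrt_mult[symmetric] by (simp add: power_mult_distrib mult_ac)
      also have "\<dots> = cq * lm * mu * lm * (sqrt (L * C1 / c3) * sqrt s0)"
        unfolding real_sqrt_mult[of "(cq * lm * mu * lm)\<^sup>2"] real_sqrt_mult[of "L * C1 / c3"] real_sqrt_abs
        using cq l0 mu_ge_1 by simp
      finally show ?thesis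
        using sn by (simp add: tau power2_eq_square mult_ac)
    qed
    have e3: "2 * sqrt (L * (B4 + 4 * K2 ^ 4) / real n) * b = 2 * sqrt (L * (B4 + 4 * K2 ^ 4)) * b * (1 / sn)"
      by (simp add: real_sqrt_divide sn_def)
    show ?thesis
      unfolding lin_bound_def e1 e2 e3 by (simp add: algebra_simps add_divide_distrib)
  qed
  moreover have "var_rho L B4 (C1 * s0 * lm\<^sup>2) b = (2 * (L * ((B4 + 4 * K2 ^ 4) * b\<^sup>2))
      + 4 * (sqrt (L * (4 * (K * c4) ^ 4)) + sqrt (L * (B4 * b ^ 4))) * (C1 * (s0 * rate_tau p n))) / (c5 * c3)"
  proof -
    \<comment> \<open>The factor sqrt n from the sums of fourth powers meets \<lambda>^2 from
      \<open>D\<close>, and together they are \<open>rate_tau\<close>.\<close>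
    have sn_out: "sqrt (L * real n * y) = sn * sqrt (L * y)" for y
      by (simp add: sn_def real_sqrt_mult)
    show ?thesis
      unfolding var_rho_def tau sn_out by (simp add: algebra_simps)
  qed
  moreover have "2 / real n + qR + (2 / real n + qR) + \<delta> + 10 / L + real p * (2 * exp (- real n * (A * lm)\<^sup>2 / 32))
      \<le> 6 / real n + 2 * qR + \<delta> + 10 / L"
  proof -
    \<comment> \<open>The score is averaged over all n observations rather than one fold, so the
      exponent bound is needed with sample size n.\<close>
    have "\<rho> * real n \<le> real n"
    proof -
      have "card J \<le> n"
        using card_mono[OF _ J(1)] by simp
      then show ?thesis
        using J(2) by linarith
    qed
    from exp_rate_bound(2)[OF n this A(2), of p] show ?thesis
      by (simp add: lm_def)
  qed
  ultimately show ?thesis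
    by (intro whp_mono[OF eb]) (auto simp: cq_def sn_def)
qed

end

text \<open>Since 3 exceeds e, the logarithm is at least 1 and so at least its own square
  root.\<close>

lemma rate_lambda_le_tau:
  assumes "3 \<le> n"
  shows "0 < rate_lambda p n" "rate_lambda p n \<le> rate_tau p n"
proof -
  define l where "l = ln (real (max p n))"
  have "exp 1 \<le> real (max p n)"
    using exp_le assms by linarith
  then have l: "1 \<le> l"
    unfolding l_def by (subst ln_ge_iff) (use assms in auto)
  have e: "rate_lambda p n = sqrt l / sqrt (real n)" "rate_tau p n = l / sqrt (real n)"
    by (simp_all add: rate_lambda_def rate_tau_def l_def real_sqrt_divide)
  have "sqrt l \<le> l"
    using l by (intro real_le_lsqrt) (auto simp: power2_eq_square mult_le_cancel_left1)
  then show "0 < rate_lambda p n" "rate_lambda p n \<le> rate_tau p n"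
    unfolding e using l assms by (auto intro!: divide_pos_pos divide_right_mono)
qed

section \<open>Restricted eigenvalues and moments at the rates\<close>

context regression_model
begin

lemma RE_max_norm:
  assumes n: "0 < n" and I: "I \<subseteq> {1..n}" "\<rho> * real n < real (card I)" "0 < \<rho>"
    and A: "0 < A" "A\<^sup>2 * \<rho> = 96" and lam: "A * rate_lambda p n \<le> 8"
  shows "whp M (2 / real n) (\<lambda>\<omega>. \<forall>v. 1 / (2 * c4) * sq_sum p v - K\<^sup>2 * (A * rate_lambda p n) * (l1_sum p v)\<^sup>2
    \<le> bil_form p (entry (Shat I \<omega>)) v v)"
proof -
  have ne: "I \<noteq> {}"
    using I n by (metis card.empty less_asym mult_pos_pos of_nat_0 of_nat_0_less_iff)
  have t: "0 \<le> A * rate_lambda p n"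
    using A rate_lambda_sq(2)[OF n] by simp
  note cf = cov_fail_prob[OF I(1) t lam]
  show ?thesis
  proof (rule whpI[OF cf(1)])
    show "prob (cov_fail I (A * rate_lambda p n)) \<le> 2 / real n"
      using cf(2) exp_rate_bound(1)[OF n less_imp_le[OF I(2)] A(2), of p] by linarith
  qed (intro allI restricted_eigenvalue_max_norm[OF I(1) ne])
qed

text \<open>Sums of \<open>c' / \<lambda>\<^sup>2\<close> signed unit vectors number at most \<open>exp (2 c' n)\<close>, and \<open>2 c'\<close> is half of the
  Bernstein exponent \<open>\<rho> t\<^sup>2 / 32\<close>.\<close>

lemma RE_subgaussian:
  assumes sg_vec: "\<And>u. 0 < sq_sum p u \<Longrightarrow> subgaussian law (\<lambda>z. lin_form p u (fst z)) (K * sqrt (sq_sum p u))"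
    and n: "2 \<le> n" and I: "I \<subseteq> {1..n}" "\<rho> * real n < real (card I)" "0 < \<rho>"
    and lam: "0 < rate_lambda p n"
    and t: "0 < t" "t \<le> 8" "K\<^sup>2 * t \<le> 1 / (2 * c4)" and c': "c' = \<rho> * t\<^sup>2 / 128"
    and small: "(rate_lambda p n)\<^sup>2 \<le> \<rho> / 128" "(rate_lambda p n)\<^sup>2 \<le> c' / 4"
  shows "whp M (2 * exp (- (\<rho> * t\<^sup>2 / 64) * real n) + 2 * exp (- (\<rho> / 64) * real n)) (\<lambda>\<omega>. \<forall>v.
    1 / (2 * c4) * sq_sum p v - (1 / c3 + K\<^sup>2) * (2 * (rate_lambda p n)\<^sup>2 / c') * (l1_sum p v)\<^sup>2
    \<le> bil_form p (entry (Shat I \<omega>)) v v)"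
proof -
  define \<Lambda> where "\<Lambda> = (rate_lambda p n)\<^sup>2"
  \<comment> \<open>The length of the lattice sums. It is as large as the entropy of the union bound
    permits, since the curvature error decays like 1 / (k - 1).\<close>
  define k where "k = nat \<lfloor>c' / \<Lambda>\<rfloor>"
  define m where "m = real (max p n)"
  have n0: "0 < n" using n by simp
  have m: "2 \<le> m" "real p \<le> m" "1 \<le> real p"
    using n p_pos by (auto simp: m_def)
  have \<Lambda>: "0 < \<Lambda>" "\<Lambda> = ln m / real n"
    using zero_less_power[OF lam, of 2] rate_lambda_sq(1)[OF n0, of p] by (simp_all add: \<Lambda>_def m_def)
  have c'0: "0 < c'"
    using I t by (simp add: c')
  have ne: "I \<noteq> {}"
    using I n0 by (metis card.empty less_asym mult_pos_pos of_nat_0 of_nat_0_less_iff)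
  have k: "real k \<le> c' / \<Lambda>" "c' / \<Lambda> - 1 \<le> real k"
    using c'0 \<Lambda>(1) unfolding k_def by (simp_all add: floor_le_iff)
  \<comment> \<open>A quotient of at least 4 pays both for the rounding in \<open>k\<close> and for
    k - 1 in place of k: two units lost leave at least half.\<close>
  have four: "4 \<le> c' / \<Lambda>"
    using small(2) \<Lambda>(1) by (simp add: \<Lambda>_def[symmetric] field_simps)
  then have k2: "2 \<le> k" and k1: "c' / (2 * \<Lambda>) \<le> real k - 1"
    using k(2) by (auto simp: field_simps)
  have P1: "prob (lattice_fail I k t) \<le> 2 * exp (- (\<rho> * t\<^sup>2 / 64) * real n)"
  proof -
    \<comment> \<open>As 2 and p are both at most m, the alphabet of 2p signed vectors costs at most
      2 ln m per term of the sum.\<close>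
    have "(2 * real p) ^ k \<le> (m * m) ^ k"
      using m by (intro power_mono mult_mono) auto
    also have "\<dots> = exp (real k * (2 * ln m))"
      using m by (simp add: exp_of_nat_mult power_mult_distrib exp_double power2_eq_square)
    also have "\<dots> \<le> exp ((c' / \<Lambda>) * (2 * ln m))"
      using k m by (intro iffD2[OF exp_le_cancel_iff] mult_right_mono) auto
    also have "(c' / \<Lambda>) * (2 * ln m) = 2 * c' * real n"
    proof -
      have "ln m = \<Lambda> * real n"
        using \<Lambda>(2) n0 by simp
      then show ?thesis
        using \<Lambda>(1) by simp
    qed
    finally have a: "(2 * real p) ^ k \<le> exp (2 * c' * real n)" .
    have "\<rho> * real n * t\<^sup>2 \<le> real (card I) * t\<^sup>2"
      using I by (intro mult_right_mono) auto
    then have b: "exp (- real (card I) * t\<^sup>2 / 32) \<le> exp (- (\<rho> * real n * t\<^sup>2) / 32)"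
      by simp
    have "prob (lattice_fail I k t) \<le> (2 * real p) ^ k * (2 * exp (- real (card I) * t\<^sup>2 / 32))"
      using t by (intro lattice_fail_prob(2)[OF sg_vec I(1)]) auto
    also have "\<dots> \<le> exp (2 * c' * real n) * (2 * exp (- (\<rho> * real n * t\<^sup>2) / 32))"
      using a b by (intro mult_mono) auto
    also have "\<dots> = 2 * exp (- (\<rho> * t\<^sup>2 / 64) * real n)"
      by (simp add: mult_exp_exp c')
    finally show ?thesis .
  qed
  have P2: "prob (cov_fail I 1) \<le> 2 * exp (- (\<rho> / 64) * real n)"
  proof -
    have "prob (cov_fail I 1) \<le> (real p)\<^sup>2 * (2 * exp (- real (card I) * 1\<^sup>2 / 32))"
      by (rule cov_fail_prob(2)[OF I(1)]) auto
    also have "\<dots> \<le> m\<^sup>2 * (2 * exp (- (\<rho> * real n) / 32))"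
      using m I by (intro mult_mono power_mono) auto
    also have "m\<^sup>2 = exp (2 * ln m)"
      using m by (simp add: exp_double power2_eq_square)
    also have "exp (2 * ln m) * (2 * exp (- (\<rho> * real n) / 32)) = 2 * exp (2 * ln m - \<rho> * real n / 32)"
      by (simp add: mult_exp_exp)
    also have "\<dots> \<le> 2 * exp (- (\<rho> / 64) * real n)"
    proof -
      \<comment> \<open>The union over p^2 entries costs exp (2 ln m), which then uses only half of
        the exponent \<rho> n / 32.\<close>
      have "ln m \<le> \<rho> / 128 * real n"
        using small(1) n0 unfolding \<Lambda>_def[symmetric] \<Lambda>(2) by (simp add: field_simps)
      then show ?thesis by simp
    qed
    finally show ?thesis .
  qed
  have ev: "lattice_fail I k t \<in> events" "cov_fail I 1 \<in> events"
    using t lattice_fail_prob(1)[OF sg_vec I(1), of t k] cov_fail_prob(1)[OF I(1), of 1] by auto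
  show ?thesis
  proof (rule whpI[of "lattice_fail I k t \<union> cov_fail I 1"])
    show "prob (lattice_fail I k t \<union> cov_fail I 1)
        \<le> 2 * exp (- (\<rho> * t\<^sup>2 / 64) * real n) + 2 * exp (- (\<rho> / 64) * real n)"
      using measure_Un_le[OF ev] P1 P2 by linarith
    fix \<omega> assume w: "\<omega> \<in> space M" "\<omega> \<notin> lattice_fail I k t \<union> cov_fail I 1"
    show "\<forall>v. 1 / (2 * c4) * sq_sum p v - (1 / c3 + K\<^sup>2) * (2 * (rate_lambda p n)\<^sup>2 / c') * (l1_sum p v)\<^sup>2
      \<le> bil_form p (entry (Shat I \<omega>)) v v"
    proof
      fix v
      have "1 / (2 * c4) * sq_sum p v - (1 / c3 + K\<^sup>2) / (real k - 1) * (l1_sum p v)\<^sup>2 \<le> bil_form p (entry (Shat I \<omega>)) v v"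
        using w by (intro restricted_eigenvalue_subgaussian[OF I(1) ne w(1) _ _ t(3) k2]) auto
      moreover have "(1 / c3 + K\<^sup>2) / (real k - 1) * (l1_sum p v)\<^sup>2 \<le> (1 / c3 + K\<^sup>2) * (2 * (rate_lambda p n)\<^sup>2 / c') * (l1_sum p v)\<^sup>2"
      proof (rule mult_right_mono)
        have "(1 / c3 + K\<^sup>2) / (real k - 1) \<le> (1 / c3 + K\<^sup>2) / (c' / (2 * \<Lambda>))"
          using k1 k2 c'0 \<Lambda>(1) c K by (intro divide_left_mono mult_pos_pos add_nonneg_nonneg) auto
        also have "\<dots> = (1 / c3 + K\<^sup>2) * (2 * (rate_lambda p n)\<^sup>2 / c')"
          by (simp add: \<Lambda>_def)
        finally show "(1 / c3 + K\<^sup>2) / (real k - 1) \<le> (1 / c3 + K\<^sup>2) * (2 * (rate_lambda p n)\<^sup>2 / c')" .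
      qed simp
      ultimately show "1 / (2 * c4) * sq_sum p v - (1 / c3 + K\<^sup>2) * (2 * (rate_lambda p n)\<^sup>2 / c') * (l1_sum p v)\<^sup>2
        \<le> bil_form p (entry (Shat I \<omega>)) v v"
        by linarith
    qed
  qed (use ev in auto)
qed

lemma moment_l1:
  assumes "l1_sum p u \<le> a * l1_sum p (($) \<xi>)"
  shows "(\<integral>\<^sup>+z. ennreal ((lin_form p u (fst z)) ^ 4) \<partial>law) \<le> ennreal (4 * K ^ 4 * (a * (l1_norm \<xi> / l2_norm \<xi>) * N) ^ 4)"
proof -
  have "a * (l1_norm \<xi> / l2_norm \<xi>) * N = a * l1_sum p (($) \<xi>)"
    using N_pos by (simp add: N_l2[symmetric] l1_\<xi>)
  then have "(l1_sum p u) ^ 4 \<le> (a * (l1_norm \<xi> / l2_norm \<xi>) * N) ^ 4"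
    using assms by (intro power_mono) auto
  then show ?thesis
    using K by (intro order_trans[OF lin_fourth_l1] ennreal_leI mult_left_mono) auto
qed

lemma moment_l2:
  assumes sg_vec: "\<And>u. 0 < sq_sum p u \<Longrightarrow> subgaussian law (\<lambda>z. lin_form p u (fst z)) (K * sqrt (sq_sum p u))"
    and u: "sq_sum p u \<le> a\<^sup>2 * N\<^sup>2" "0 \<le> a"
  shows "(\<integral>\<^sup>+z. ennreal ((lin_form p u (fst z)) ^ 4) \<partial>law) \<le> ennreal (4 * K ^ 4 * (a * N) ^ 4)"
proof -
  have "sqrt (sq_sum p u) \<le> a * N"
    using u N_pos by (intro real_le_lsqrt) (auto simp: power_mult_distrib)
  then have "(sqrt (sq_sum p u)) ^ 4 \<le> (a * N) ^ 4"
    by (intro power_mono) auto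
  then show ?thesis
    using K by (intro order_trans[OF lin_fourth_l2[OF sg_vec]] ennreal_leI mult_left_mono) auto
qed

end

text \<open>No measurability is assumed: non-measurable sets have measure 0, so a positive measure forces the
  event to be measurable.\<close>

lemma whp_of_measure_ge:
  assumes "prob_space M" "1 - \<delta> \<le> measure M {\<omega> \<in> space M. P \<omega>}" "\<delta> < 1"
  shows "whp M \<delta> P"
proof -
  interpret prob_space M by fact
  have pos: "0 < prob {\<omega> \<in> space M. P \<omega>}"
    using assms(2,3) by linarith
  then have ev: "{\<omega> \<in> space M. P \<omega>} \<in> events"
    using measure_notin_sets by fastforce
  show ?thesis
  proof (rule whpI[of "space M - {\<omega> \<in> space M. P \<omega>}"])
    show "prob (space M - {\<omega> \<in> space M. P \<omega>}) \<le> \<delta>"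
      using prob_compl[OF ev] assms(2) by linarith
  qed (use ev in auto)
qed

text \<open>The rates vanish for each fixed \<open>L\<close>, with no uniformity in
  \<open>L\<close>. Given the target probability \<eta>, the level is chosen with 10 / L = \<eta> /
  4 before n grows.\<close>

lemma little_o_prob_of_whp:
  assumes prob: "\<forall>\<^sub>F n in sequentially. prob_space (M n)" and r: "r \<longlonglongrightarrow> 0"
    and w: "\<And>L. 0 < L \<Longrightarrow> \<forall>\<^sub>F n in sequentially. whp (M n) (r n + 10 / L) (\<lambda>\<omega>. \<bar>Q n \<omega>\<bar> \<le> f L n * \<bar>a n\<bar>)"
    and f: "\<And>L. 0 < L \<Longrightarrow> f L \<longlonglongrightarrow> 0"
  shows "little_o_prob M Q a"
  unfolding little_o_prob_def
proof (intro allI impI)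
  fix \<epsilon> :: real assume \<epsilon>: "0 < \<epsilon>"
  show "(\<lambda>n. measure (M n) {\<omega> \<in> space (M n). \<epsilon> * \<bar>a n\<bar> < \<bar>Q n \<omega>\<bar>}) \<longlonglongrightarrow> 0"
  proof (rule LIMSEQ_I)
    fix \<eta> :: real assume \<eta>: "0 < \<eta>"
    define L where "L = 40 / \<eta>"
    have L: "0 < L" "10 / L = \<eta> / 4"
      using \<eta> by (auto simp: L_def)
    have "\<forall>\<^sub>F n in sequentially. r n < \<eta> / 4"
      using r \<eta> by (intro order_tendstoD) auto
    moreover have "\<forall>\<^sub>F n in sequentially. f L n < \<epsilon>"
      using f[OF L(1)] \<epsilon> by (intro order_tendstoD) auto
    ultimately have "\<forall>\<^sub>F n in sequentially. measure (M n) {\<omega> \<in> space (M n). \<epsilon> * \<bar>a n\<bar> < \<bar>Q n \<omega>\<bar>} < \<eta>"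
      using w[OF L(1)] prob
    proof eventually_elim
      case (elim n)
      interpret prob_space "M n" by fact
      have "whp (M n) (r n + 10 / L) (\<lambda>\<omega>. \<not> \<epsilon> * \<bar>a n\<bar> < \<bar>Q n \<omega>\<bar>)"
      proof (rule whp_mono[OF elim(3) order_refl])
        fix \<omega> assume "\<bar>Q n \<omega>\<bar> \<le> f L n * \<bar>a n\<bar>"
        also have "\<dots> \<le> \<epsilon> * \<bar>a n\<bar>"
          using elim(2) by (intro mult_right_mono) auto
        finally show "\<not> \<epsilon> * \<bar>a n\<bar> < \<bar>Q n \<omega>\<bar>"
          by simp
      qed
      from whp_failure[OF this] have "measure (M n) {\<omega> \<in> space (M n). \<epsilon> * \<bar>a n\<bar> < \<bar>Q n \<omega>\<bar>} \<le> r n + 10 / L"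
        by simp
      then show ?case
        using elim(1) L(2) \<eta> by linarith
    qed
    then show "\<exists>no. \<forall>n\<ge>no. norm (measure (M n) {\<omega> \<in> space (M n). \<epsilon> * \<bar>a n\<bar> < \<bar>Q n \<omega>\<bar>} - 0) < \<eta>"
      unfolding eventually_sequentially by simp
  qed
qed

lemma l2_norm_pos:
  assumes "s \<in> carrier_vec p" "s \<noteq> 0\<^sub>v p"
  shows "0 < l2_norm s"
proof -
  have "sq_sum p (($) s) \<noteq> 0"
  proof
    assume "sq_sum p (($) s) = 0"
    then have "s = 0\<^sub>v p"
      using assms(1) sq_eq_0 by (intro eq_vecI) auto
    then show False using assms(2) by simp
  qed
  then have "0 < sq_sum p (($) s)"
    by (metis less_le sq_nonneg)
  then show ?thesis
    using assms(1) by (simp add: l2_norm_sq)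
qed

lemma psi2_norm_vec_scalar_prod:
  assumes v: "psi2_norm_vec M p Z \<le> ennreal \<sigma>" and \<sigma>: "0 < \<sigma>" and s: "s \<in> carrier_vec p" "s \<noteq> 0\<^sub>v p"
  shows "subgaussian M (\<lambda>\<omega>. s \<bullet> Z \<omega>) (2 * \<sigma> * l2_norm s)"
proof -
  have "psi2_norm M (\<lambda>\<omega>. (s \<bullet> Z \<omega>) / l2_norm s) \<le> psi2_norm_vec M p Z"
    unfolding psi2_norm_vec_def using s by (intro SUP_upper) auto
  then have "subgaussian M (\<lambda>\<omega>. (s \<bullet> Z \<omega>) / l2_norm s) (2 * \<sigma>)"
    using v \<sigma> by (intro sg_of_psi2_norm) auto
  moreover have "0 < l2_norm s"
    by (rule l2_norm_pos[OF s])
  ultimately show ?thesis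
    using sg_scale[of M "\<lambda>\<omega>. s \<bullet> Z \<omega>" "l2_norm s" "2 * \<sigma>"] by (simp add: mult.commute)
qed

lemma sg_cong:
  assumes "\<And>\<omega>. \<omega> \<in> space M \<Longrightarrow> f \<omega> = g \<omega>"
  shows "subgaussian M f k \<longleftrightarrow> subgaussian M g k"
  unfolding subgaussian_def using assms by (simp cong: nn_integral_cong)

subsection \<open>Asymptotics\<close>

definition expansion_error ::
  "'a measure \<Rightarrow> nat \<Rightarrow> nat \<Rightarrow> (nat \<Rightarrow> 'a \<Rightarrow> real vec) \<Rightarrow> (nat \<Rightarrow> 'a \<Rightarrow> real) \<Rightarrow> nat set \<Rightarrow> real vec \<Rightarrow>
   real vec \<Rightarrow> real mat \<Rightarrow> ('a \<Rightarrow> real vec) \<Rightarrow> ('a \<Rightarrow> real mat) \<Rightarrow> ('a \<Rightarrow> real mat) \<Rightarrow> 'a \<Rightarrow> real" where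
  "expansion_error M p n X Y J \<xi> \<beta> \<Omega> \<beta>h OJ OJc \<omega> =
    (debiased_estimate p n J (\<lambda>i. X i \<omega>) (\<lambda>i. Y i \<omega>) \<xi> (\<beta>h \<omega>) (OJ \<omega>) (OJc \<omega>) - \<xi> \<bullet> \<beta>)
      / sqrt (oracle_variance M (X 0) (Y 0) \<xi> \<beta> \<Omega>)
    - (1 / real n) * (\<Sum>i\<in>{1..n}. (\<xi> \<bullet> (\<Omega> *\<^sub>v X i \<omega>)) * (Y i \<omega> - X i \<omega> \<bullet> \<beta>)
      / sqrt (oracle_variance M (X 0) (Y 0) \<xi> \<beta> \<Omega>))"

definition variance_error ::
  "'a measure \<Rightarrow> nat \<Rightarrow> (nat \<Rightarrow> 'a \<Rightarrow> real vec) \<Rightarrow> (nat \<Rightarrow> 'a \<Rightarrow> real) \<Rightarrow> nat set \<Rightarrow> real vec \<Rightarrow>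
   real vec \<Rightarrow> real mat \<Rightarrow> ('a \<Rightarrow> real vec) \<Rightarrow> ('a \<Rightarrow> real mat) \<Rightarrow> ('a \<Rightarrow> real mat) \<Rightarrow> 'a \<Rightarrow> real" where
  "variance_error M n X Y J \<xi> \<beta> \<Omega> \<beta>h OJ OJc \<omega> =
    variance_estimate n J (\<lambda>i. X i \<omega>) (\<lambda>i. Y i \<omega>) \<xi> (\<beta>h \<omega>) (OJ \<omega>) (OJc \<omega>)
      / oracle_variance M (X 0) (Y 0) \<xi> \<beta> \<Omega> - 1"

text \<open>The factor \<open>96 * A0 * c4\<close> is \<open>48 * A0 / \<kappa>\<close> for the restricted eigenvalue \<open>\<kappa> = 1 / (2 * c4)\<close>.\<close>

definition lin_rate :: "real \<Rightarrow> real \<Rightarrow> real \<Rightarrow> real \<Rightarrow> real \<Rightarrow> real \<Rightarrow> real \<Rightarrow> real \<Rightarrow> real \<Rightarrow> real \<Rightarrow> real \<Rightarrow> real \<Rightarrow> real" where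
  "lin_rate c3 c4 c5 K K2 A A0 C1 L e1 e2 b =
    (C1 * K\<^sup>2 * c4 * A * e1 + sqrt (L * C1 / c3) * (96 * A0 * c4) * e2
      + 2 * sqrt (L * (4 * K ^ 4 + 4 * K2 ^ 4)) * b) / sqrt (c5 * c3)"

definition rho_rate :: "real \<Rightarrow> real \<Rightarrow> real \<Rightarrow> real \<Rightarrow> real \<Rightarrow> real \<Rightarrow> real \<Rightarrow> real \<Rightarrow> real \<Rightarrow> real" where
  "rho_rate c3 c4 c5 K K2 C1 L e1 b = (2 * (L * ((4 * K ^ 4 + 4 * K2 ^ 4) * b\<^sup>2))
    + 4 * (sqrt (L * (4 * (K * c4) ^ 4)) + sqrt (L * (4 * K ^ 4 * b ^ 4))) * (C1 * e1)) / (c5 * c3)"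

definition eta_rate :: "real \<Rightarrow> real \<Rightarrow> real \<Rightarrow> real \<Rightarrow> real \<Rightarrow> real \<Rightarrow> nat \<Rightarrow> real" where
  "eta_rate c3 c4 c5 K K2 L n = sqrt (L * (24 * ((K * c4) ^ 8 + K2 ^ 8)) / real n) / (c5 * c3)"

definition var_rate :: "real \<Rightarrow> real \<Rightarrow> real \<Rightarrow> real \<Rightarrow> real \<Rightarrow> real \<Rightarrow> real \<Rightarrow> nat \<Rightarrow> real \<Rightarrow> real \<Rightarrow> real" where
  "var_rate c3 c4 c5 K K2 C1 L n e1 b = eta_rate c3 c4 c5 K K2 L n
    + 2 * sqrt (1 + eta_rate c3 c4 c5 K K2 L n) * sqrt (rho_rate c3 c4 c5 K K2 C1 L e1 b)
    + rho_rate c3 c4 c5 K K2 C1 L e1 b"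

lemma lin_rate_tendsto:
  assumes "e1 \<longlonglongrightarrow> 0" "e2 \<longlonglongrightarrow> 0" "b \<longlonglongrightarrow> 0"
  shows "(\<lambda>n. lin_rate c3 c4 c5 K K2 A A0 C1 L (e1 n) (e2 n) (b n)) \<longlonglongrightarrow> 0"
proof -
  have "(\<lambda>n. lin_rate c3 c4 c5 K K2 A A0 C1 L (e1 n) (e2 n) (b n)) \<longlonglongrightarrow>
    (C1 * K\<^sup>2 * c4 * A * 0 + sqrt (L * C1 / c3) * (96 * A0 * c4) * 0
      + 2 * sqrt (L * (4 * K ^ 4 + 4 * K2 ^ 4)) * 0) * inverse (sqrt (c5 * c3))"
    unfolding lin_rate_def divide_inverse[of _ "sqrt (c5 * c3)"] by (intro tendsto_intros assms)
  then show ?thesis by simp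
qed

lemma var_rate_tendsto:
  assumes "e1 \<longlonglongrightarrow> 0" "b \<longlonglongrightarrow> 0"
  shows "(\<lambda>n. var_rate c3 c4 c5 K K2 C1 L n (e1 n) (b n)) \<longlonglongrightarrow> 0"
proof -
  have r: "(\<lambda>n. rho_rate c3 c4 c5 K K2 C1 L (e1 n) (b n)) \<longlonglongrightarrow>
    (2 * (L * ((4 * K ^ 4 + 4 * K2 ^ 4) * 0\<^sup>2))
    + 4 * (sqrt (L * (4 * (K * c4) ^ 4)) + sqrt (L * (4 * K ^ 4 * 0 ^ 4))) * (C1 * 0)) * inverse (c5 * c3)"
    unfolding rho_rate_def divide_inverse[of _ "c5 * c3"] by (intro tendsto_intros assms)
  have e: "(\<lambda>n. eta_rate c3 c4 c5 K K2 L n) \<longlonglongrightarrow> sqrt 0 * inverse (c5 * c3)"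
    unfolding eta_rate_def divide_inverse[of _ "c5 * c3"] by (intro tendsto_intros lim_const_over_n)
  have "(\<lambda>n. var_rate c3 c4 c5 K K2 C1 L n (e1 n) (b n)) \<longlonglongrightarrow> 0 + 2 * sqrt (1 + 0) * sqrt 0 + 0"
    unfolding var_rate_def using r e by (intro tendsto_intros) auto
  then show ?thesis by simp
qed

text \<open>Here e1 will be s0 \<tau> and e2 will be \<mu> sqrt s0 \<tau>, with \<mu> the minimum in
  the rate condition. The sequence b is the relative size of the direction error in the norm that
  controls its fourth moment, l1 in (i) and l2 in (ii).\<close>

lemma expansion_and_consistency_of_rates:
  assumes prob: "\<forall>\<^sub>F n in sequentially. prob_space (M n)" and r: "r \<longlonglongrightarrow> 0"
    and lim: "e1 \<longlonglongrightarrow> 0" "e2 \<longlonglongrightarrow> 0" "b \<longlonglongrightarrow> 0"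
    and w: "\<And>L. 0 < L \<Longrightarrow> \<forall>\<^sub>F n in sequentially. whp (M n) (r n + 10 / L) (\<lambda>\<omega>.
      \<bar>expansion_error (M n) (p n) n (X n) (Y n) (J n) (\<xi> n) (\<beta> n) (\<Omega> n) (\<beta>h n) (\<Omega>J n) (\<Omega>Jc n) \<omega>\<bar>
        \<le> lin_rate c3 c4 c5 K K2 A A0 C1 L (e1 n) (e2 n) (b n) * (1 / sqrt (real n)) \<and>
      \<bar>variance_error (M n) n (X n) (Y n) (J n) (\<xi> n) (\<beta> n) (\<Omega> n) (\<beta>h n) (\<Omega>J n) (\<Omega>Jc n) \<omega>\<bar>
        \<le> var_rate c3 c4 c5 K K2 C1 L n (e1 n) (b n))"
  shows "expansion_and_consistency M p X Y J \<xi> \<beta> \<Omega> \<beta>h \<Omega>J \<Omega>Jc"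
proof -
  have 1: "little_o_prob M (\<lambda>n \<omega>. expansion_error (M n) (p n) n (X n) (Y n) (J n) (\<xi> n) (\<beta> n) (\<Omega> n) (\<beta>h n) (\<Omega>J n) (\<Omega>Jc n) \<omega>)
      (\<lambda>n. 1 / sqrt (real n))"
  proof (rule little_o_prob_of_whp[OF prob r _ lin_rate_tendsto[OF lim]])
    fix L :: real assume "0 < L"
    from w[OF this] show "\<forall>\<^sub>F n in sequentially. whp (M n) (r n + 10 / L) (\<lambda>\<omega>.
      \<bar>expansion_error (M n) (p n) n (X n) (Y n) (J n) (\<xi> n) (\<beta> n) (\<Omega> n) (\<beta>h n) (\<Omega>J n) (\<Omega>Jc n) \<omega>\<bar>
        \<le> lin_rate c3 c4 c5 K K2 A A0 C1 L (e1 n) (e2 n) (b n) * \<bar>1 / sqrt (real n)\<bar>)"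
      by (rule eventually_mono) (erule whp_mono, auto)
  qed
  have 2: "little_o_prob M (\<lambda>n \<omega>. variance_error (M n) n (X n) (Y n) (J n) (\<xi> n) (\<beta> n) (\<Omega> n) (\<beta>h n) (\<Omega>J n) (\<Omega>Jc n) \<omega>)
      (\<lambda>n. 1)"
  proof (rule little_o_prob_of_whp[OF prob r _ var_rate_tendsto[OF lim(1,3)]])
    fix L :: real assume "0 < L"
    from w[OF this] show "\<forall>\<^sub>F n in sequentially. whp (M n) (r n + 10 / L) (\<lambda>\<omega>.
      \<bar>variance_error (M n) n (X n) (Y n) (J n) (\<xi> n) (\<beta> n) (\<Omega> n) (\<beta>h n) (\<Omega>J n) (\<Omega>Jc n) \<omega>\<bar>
        \<le> var_rate c3 c4 c5 K K2 C1 L n (e1 n) (b n) * \<bar>1\<bar>)"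
      by (rule eventually_mono) (erule whp_mono, auto)
  qed
  show ?thesis
    unfolding expansion_and_consistency_def Let_def
    using 1 2 unfolding expansion_error_def variance_error_def by blast
qed

section \<open>Specialisation to the two design assumptions\<close>

context regression_model
begin

text \<open>The direction error is measured in l1, hence the ratio of norms of \<xi>. Here \<gamma>
  is of order \<lambda>, so \<open>small\<close> asks for small s1 \<lambda>; the curvature events
  of the two folds raise 6 / n to 10 / n.\<close>

lemma final_bound_max_norm:
  assumes n: "0 < n" and J: "J \<subseteq> {1..n}" "\<rho> * real n < real (card J)" "\<rho> * real n < real (card ({1..n} - J))" "0 < \<rho>"
    and A: "0 < A" "A\<^sup>2 * \<rho> = 96" "K\<^sup>2 * A \<le> A0 / 2" and lam: "0 < rate_lambda p n" "A * rate_lambda p n \<le> 8"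
    and est: "two_stage_estimator M p X Y J (A0 * rate_lambda p n) OJ"
      "two_stage_estimator M p X Y ({1..n} - J) (A0 * rate_lambda p n) OJc"
    and compb: "computed_from M p X Y {1..n} (vec_borel p) \<beta>h"
    and small: "32 * (K\<^sup>2 * (A * rate_lambda p n)) * real (max_col_sparsity \<Omega>) \<le> 1 / (2 * c4)"
    and D: "whp M \<delta> (\<lambda>\<omega>. l1_norm (\<beta>h \<omega> - \<beta>) \<le> C1 * s0 * rate_lambda p n \<and>
      (1 / real n) * (\<Sum>i\<in>{1..n}. (X i \<omega> \<bullet> \<beta>h \<omega> - X i \<omega> \<bullet> \<beta>)\<^sup>2) \<le> C1 * s0 * (rate_lambda p n)\<^sup>2)"
    and pos: "0 < L" "0 < C1" "0 \<le> s0"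
  shows "whp M (10 / real n + \<delta> + 10 / L) (\<lambda>\<omega>.
    \<bar>expansion_error M p n X Y J \<xi> \<beta> \<Omega> \<beta>h OJ OJc \<omega>\<bar>
      \<le> lin_rate c3 c4 c5 K K2 A A0 C1 L (s0 * rate_tau p n) (mu * sqrt s0 * rate_tau p n)
          (96 * A0 * c4 * (rate_lambda p n * real (max_col_sparsity \<Omega>)) * (l1_norm \<xi> / l2_norm \<xi>)) * (1 / sqrt (real n)) \<and>
    \<bar>variance_error M n X Y J \<xi> \<beta> \<Omega> \<beta>h OJ OJc \<omega>\<bar>
      \<le> var_rate c3 c4 c5 K K2 C1 L n (s0 * rate_tau p n)
          (96 * A0 * c4 * (rate_lambda p n * real (max_col_sparsity \<Omega>)) * (l1_norm \<xi> / l2_norm \<xi>)))"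
proof -
  let ?b = "96 * A0 * c4 * (rate_lambda p n * real (max_col_sparsity \<Omega>)) * (l1_norm \<xi> / l2_norm \<xi>)"
  have A0: "0 < A0"
    using A K by (smt (verit) divide_nonpos_pos mult_pos_pos zero_less_power)
  have b: "0 < ?b"
    using A0 c lam max_col_sparsity_ge_1 N_pos N_le_l1 unfolding N_l2[symmetric] l1_\<xi>[symmetric]
    by (intro mult_pos_pos divide_pos_pos) auto
  have k: "48 * A0 / (1 / (2 * c4)) = 96 * A0 * c4"
    by simp
  have "whp M (6 / real n + 2 * (2 / real n) + \<delta> + 10 / L) (\<lambda>\<omega>.
    \<bar>expansion_error M p n X Y J \<xi> \<beta> \<Omega> \<beta>h OJ OJc \<omega>\<bar>
      \<le> lin_rate c3 c4 c5 K K2 A A0 C1 L (s0 * rate_tau p n) (mu * sqrt s0 * rate_tau p n) ?b * (1 / sqrt (real n)) \<and>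
    \<bar>variance_error M n X Y J \<xi> \<beta> \<Omega> \<beta>h OJ OJc \<omega>\<bar>
      \<le> var_rate c3 c4 c5 K K2 C1 L n (s0 * rate_tau p n) ?b)"
    unfolding expansion_error_def variance_error_def lin_rate_def var_rate_def rho_rate_def eta_rate_def
      V_oracle[symmetric] var_eta_def[symmetric] k[symmetric]
  proof (rule final_bound[OF n J A lam est compb, where \<gamma> = "K\<^sup>2 * (A * rate_lambda p n)"])
    fix I assume "I = J \<or> I = {1..n} - J"
    then show "whp M (2 / real n) (\<lambda>\<omega>. \<forall>v. 1 / (2 * c4) * sq_sum p v - K\<^sup>2 * (A * rate_lambda p n) * (l1_sum p v)\<^sup>2
      \<le> bil_form p (entry (Shat I \<omega>)) v v)"
      using J by (intro RE_max_norm[OF n _ _ J(4) A(1,2) lam(2)]) auto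
  next
    fix u assume "l1_sum p u \<le> 48 * A0 / (1 / (2 * c4)) * (rate_lambda p n * real (max_col_sparsity \<Omega>)) * l1_sum p (($) \<xi>)"
    then show "(\<integral>\<^sup>+z. ennreal ((lin_form p u (fst z)) ^ 4) \<partial>law) \<le> ennreal (4 * K ^ 4 *
      (48 * A0 / (1 / (2 * c4)) * (rate_lambda p n * real (max_col_sparsity \<Omega>)) * (l1_norm \<xi> / l2_norm \<xi>) * N) ^ 4)"
      by (rule moment_l1)
  next
    show "0 < 48 * A0 / (1 / (2 * c4)) * (rate_lambda p n * real (max_col_sparsity \<Omega>)) * (l1_norm \<xi> / l2_norm \<xi>)"
      unfolding k by (rule b)
  qed (use c K A lam small D pos in auto)
  then show ?thesis
    by (rule whp_mono) auto
qed

text \<open>The fourth moment is controlled by the l2 error, which is already bounded by \<lambda>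
  times \<open>mu\<close>, and \<gamma> is of order \<lambda>^2, so the last condition in
  \<open>small\<close> concerns s1 \<lambda>^2.\<close>

lemma final_bound_subgaussian:
  assumes sg_vec: "\<And>u. 0 < sq_sum p u \<Longrightarrow> subgaussian law (\<lambda>z. lin_form p u (fst z)) (K * sqrt (sq_sum p u))"
    and n: "2 \<le> n" and J: "J \<subseteq> {1..n}" "\<rho> * real n < real (card J)" "\<rho> * real n < real (card ({1..n} - J))" "0 < \<rho>"
    and A: "0 < A" "A\<^sup>2 * \<rho> = 96" "K\<^sup>2 * A \<le> A0 / 2" and lam: "0 < rate_lambda p n" "A * rate_lambda p n \<le> 8"
    and est: "two_stage_estimator M p X Y J (A0 * rate_lambda p n) OJ"
      "two_stage_estimator M p X Y ({1..n} - J) (A0 * rate_lambda p n) OJc"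
    and compb: "computed_from M p X Y {1..n} (vec_borel p) \<beta>h"
    and t: "0 < t" "t \<le> 8" "K\<^sup>2 * t \<le> 1 / (2 * c4)" and c': "c' = \<rho> * t\<^sup>2 / 128"
    and small: "(rate_lambda p n)\<^sup>2 \<le> \<rho> / 128" "(rate_lambda p n)\<^sup>2 \<le> c' / 4"
      "32 * ((1 / c3 + K\<^sup>2) * (2 * (rate_lambda p n)\<^sup>2 / c')) * real (max_col_sparsity \<Omega>) \<le> 1 / (2 * c4)"
    and D: "whp M \<delta> (\<lambda>\<omega>. l1_norm (\<beta>h \<omega> - \<beta>) \<le> C1 * s0 * rate_lambda p n \<and>
      (1 / real n) * (\<Sum>i\<in>{1..n}. (X i \<omega> \<bullet> \<beta>h \<omega> - X i \<omega> \<bullet> \<beta>)\<^sup>2) \<le> C1 * s0 * (rate_lambda p n)\<^sup>2)"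
    and pos: "0 < L" "0 < C1" "0 \<le> s0"
  shows "whp M (6 / real n + 2 * (2 * exp (- (\<rho> * t\<^sup>2 / 64) * real n) + 2 * exp (- (\<rho> / 64) * real n)) + \<delta> + 10 / L) (\<lambda>\<omega>.
    \<bar>expansion_error M p n X Y J \<xi> \<beta> \<Omega> \<beta>h OJ OJc \<omega>\<bar>
      \<le> lin_rate c3 c4 c5 K K2 A A0 C1 L (s0 * rate_tau p n) (mu * sqrt s0 * rate_tau p n)
          (96 * A0 * c4 * rate_lambda p n * mu) * (1 / sqrt (real n)) \<and>
    \<bar>variance_error M n X Y J \<xi> \<beta> \<Omega> \<beta>h OJ OJc \<omega>\<bar>
      \<le> var_rate c3 c4 c5 K K2 C1 L n (s0 * rate_tau p n) (96 * A0 * c4 * rate_lambda p n * mu))"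
proof -
  have n0: "0 < n" using n by simp
  have A0: "0 < A0"
    using A K by (smt (verit) divide_nonpos_pos mult_pos_pos zero_less_power)
  have b: "0 < 96 * A0 * c4 * rate_lambda p n * mu"
    using A0 c lam mu_ge_1 by (intro mult_pos_pos) auto
  have c'0: "0 < c'"
    using J t by (simp add: c')
  have k: "48 * A0 / (1 / (2 * c4)) = 96 * A0 * c4"
    by simp
  show ?thesis
    unfolding expansion_error_def variance_error_def lin_rate_def var_rate_def rho_rate_def eta_rate_def
      V_oracle[symmetric] var_eta_def[symmetric] k[symmetric]
  proof (rule final_bound[OF n0 J A lam est compb, where \<gamma> = "(1 / c3 + K\<^sup>2) * (2 * (rate_lambda p n)\<^sup>2 / c')"])
    fix I assume "I = J \<or> I = {1..n} - J"
    then show "whp M (2 * exp (- (\<rho> * t\<^sup>2 / 64) * real n) + 2 * exp (- (\<rho> / 64) * real n)) (\<lambda>\<omega>. \<forall>v.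
      1 / (2 * c4) * sq_sum p v - (1 / c3 + K\<^sup>2) * (2 * (rate_lambda p n)\<^sup>2 / c') * (l1_sum p v)\<^sup>2
      \<le> bil_form p (entry (Shat I \<omega>)) v v)"
      using J by (intro RE_subgaussian[OF sg_vec n _ _ J(4) lam(1) t c' small(1,2)]) auto
  next
    fix u assume "sq_sum p u \<le> (48 * A0 / (1 / (2 * c4)) * rate_lambda p n * mu)\<^sup>2 * N\<^sup>2"
    then show "(\<integral>\<^sup>+z. ennreal ((lin_form p u (fst z)) ^ 4) \<partial>law) \<le> ennreal (4 * K ^ 4 *
      (48 * A0 / (1 / (2 * c4)) * rate_lambda p n * mu * N) ^ 4)"
      using b by (intro moment_l2[OF sg_vec]) auto
  next
    show "0 < 48 * A0 / (1 / (2 * c4)) * rate_lambda p n * mu"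
      unfolding k by (rule b)
    show "0 \<le> (1 / c3 + K\<^sup>2) * (2 * (rate_lambda p n)\<^sup>2 / c')"
      using c c'0 by (intro mult_nonneg_nonneg add_nonneg_nonneg divide_nonneg_pos) auto
  qed (use c K small D pos in auto)
qed

end

section \<open>Consequences of sub-gaussianity of the whole covariate vector\<close>

lemma precision_mult_nonzero:
  assumes "is_precision_matrix M p X0 \<Omega>" "\<xi> \<in> carrier_vec p" "\<xi> \<noteq> 0\<^sub>v p"
  shows "\<Omega> *\<^sub>v \<xi> \<in> carrier_vec p" "\<Omega> *\<^sub>v \<xi> \<noteq> 0\<^sub>v p"
proof -
  define S where "S = second_moment M p X0"
  have S: "S \<in> carrier_mat p p"
    unfolding S_def second_moment_def by auto
  have \<Omega>: "\<Omega> \<in> carrier_mat p p" "S * \<Omega> = 1\<^sub>m p"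
    using assms(1) S by (auto simp: is_precision_matrix_def S_def inverts_mat_def)
  show "\<Omega> *\<^sub>v \<xi> \<in> carrier_vec p"
    using \<Omega>(1) assms(2) by auto
  show "\<Omega> *\<^sub>v \<xi> \<noteq> 0\<^sub>v p"
  proof
    assume z: "\<Omega> *\<^sub>v \<xi> = 0\<^sub>v p"
    have "\<xi> = (S * \<Omega>) *\<^sub>v \<xi>"
      using \<Omega>(2) assms(2) by simp
    also have "\<dots> = S *\<^sub>v (\<Omega> *\<^sub>v \<xi>)"
      by (rule assoc_mult_mat_vec[OF S \<Omega>(1) assms(2)])
    also have "\<dots> = 0\<^sub>v p"
      unfolding z using S by (intro eq_vecI) auto
    finally show False
      using assms(3) by simp
  qed
qed

text \<open>Testing the vector bound in the directions e_j and \<Omega> \<xi> recovers what the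
  common model asks for; symmetry of \<Omega> moves it across the scalar product.\<close>

lemma subgaussian_vec_consequences:
  assumes v: "psi2_norm_vec M p (X 0) \<le> ennreal \<sigma>" and \<sigma>: "0 < \<sigma>" and iid: "iid_copies M p n X Y"
    and prec: "is_precision_matrix M p (X 0) \<Omega>" and \<xi>: "\<xi> \<in> carrier_vec p" "\<xi> \<noteq> 0\<^sub>v p"
  shows "\<And>j. j < p \<Longrightarrow> subgaussian M (\<lambda>\<omega>. X 0 \<omega> $ j) (2 * \<sigma>)"
    and "subgaussian M (\<lambda>\<omega>. \<xi> \<bullet> (\<Omega> *\<^sub>v X 0 \<omega>)) (2 * \<sigma> * l2_norm (\<Omega> *\<^sub>v \<xi>))"
proof -
  have X0: "X 0 \<omega> \<in> carrier_vec p" if "\<omega> \<in> space M" for \<omega>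
    using iid that unfolding iid_copies_def
    by (auto simp: space_obs_space dest!: measurable_space)
  show "subgaussian M (\<lambda>\<omega>. X 0 \<omega> $ j) (2 * \<sigma>)" if j: "j < p" for j
  proof -
    have u: "unit_vec p j \<in> carrier_vec p" "unit_vec p j \<noteq> (0\<^sub>v p :: real vec)"
      using j by (auto dest!: arg_cong[of _ _ "\<lambda>v. v $ j"])
    have "l2_norm (unit_vec p j :: real vec) = 1"
      using j by (simp add: l2_norm_def)
    then have "subgaussian M (\<lambda>\<omega>. unit_vec p j \<bullet> X 0 \<omega>) (2 * \<sigma>)"
      using psi2_norm_vec_scalar_prod[OF v \<sigma> u] by simp
    then show ?thesis
      by (subst (asm) sg_cong[of _ _ "\<lambda>\<omega>. X 0 \<omega> $ j"]) (use X0 j in auto)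
  qed
  have "subgaussian M (\<lambda>\<omega>. (\<Omega> *\<^sub>v \<xi>) \<bullet> X 0 \<omega>) (2 * \<sigma> * l2_norm (\<Omega> *\<^sub>v \<xi>))"
    by (rule psi2_norm_vec_scalar_prod[OF v \<sigma> precision_mult_nonzero[OF prec \<xi>]])
  moreover have "(\<Omega> *\<^sub>v \<xi>) \<bullet> X 0 \<omega> = \<xi> \<bullet> (\<Omega> *\<^sub>v X 0 \<omega>)" if "\<omega> \<in> space M" for \<omega>
  proof -
    have "\<Omega> \<in> carrier_mat p p"
      using prec by (simp add: is_precision_matrix_def)
    from transpose_vec_mult_scalar[OF this X0[OF that] \<xi>(1)]
    show ?thesis
      using precision_matrix_symmetric[OF prec] by simp
  qed
  ultimately show "subgaussian M (\<lambda>\<omega>. \<xi> \<bullet> (\<Omega> *\<^sub>v X 0 \<omega>)) (2 * \<sigma> * l2_norm (\<Omega> *\<^sub>v \<xi>))"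
    by (subst (asm) sg_cong) auto
qed

lemma (in regression_model) subgaussian_lin:
  assumes v: "psi2_norm_vec M p (X 0) \<le> ennreal (K / 2)" and u: "0 < sq_sum p u"
  shows "subgaussian law (\<lambda>z. lin_form p u (fst z)) (K * sqrt (sq_sum p u))"
proof (rule sg_law)
  have "vec p u \<noteq> 0\<^sub>v p"
  proof
    assume "vec p u = 0\<^sub>v p"
    then have "u j = 0" if "j < p" for j
      using that by (metis index_vec index_zero_vec(1))
    then show False
      using u by (simp add: sq_sum_def)
  qed
  then have "subgaussian M (\<lambda>\<omega>. vec p u \<bullet> X 0 \<omega>) (2 * (K / 2) * l2_norm (vec p u))"
    using K by (intro psi2_norm_vec_scalar_prod[OF v]) auto
  moreover have "l2_norm (vec p u) = sqrt (sq_sum p u)"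
    using l2_norm_sq[of "vec p u" p] by (simp add: sq_sum_def)
  ultimately show "subgaussian M (\<lambda>\<omega>. vec p u \<bullet> X 0 \<omega>) (K * sqrt (sq_sum p u))"
    by simp
  show "lin_form p u (fst (Z 0 \<omega>)) = vec p u \<bullet> X 0 \<omega>" if "\<omega> \<in> space M" for \<omega>
    using scalar_prod_lin(2)[of "vec p u" p "X 0 \<omega>"] X_carrier[OF that] by (simp add: Z_def lin_form_def)
qed simp

lemma null_dominated:
  fixes f g :: "nat \<Rightarrow> real"
  assumes "g \<longlonglongrightarrow> 0" "\<forall>\<^sub>F n in sequentially. 0 \<le> f n \<and> f n \<le> c * g n"
  shows "f \<longlonglongrightarrow> 0"
proof (rule tendsto_sandwich[OF _ _ tendsto_const])
  show "(\<lambda>n. c * g n) \<longlonglongrightarrow> 0"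
    using tendsto_mult_left[OF assms(1), of c] by simp
qed (use assms(2) in \<open>auto elim: eventually_mono\<close>)

lemma exp_neg_linear_tendsto:
  assumes "0 < (c :: real)"
  shows "(\<lambda>n. exp (- c * real n)) \<longlonglongrightarrow> 0"
proof -
  have "filterlim (\<lambda>n. - c * real n) at_bot sequentially"
    using assms by (intro filterlim_tendsto_neg_mult_at_bot[OF tendsto_const _ filterlim_real_sequentially]) auto
  then show ?thesis
    by (rule filterlim_compose[OF exp_at_bot])
qed

theorem theorem3:
  fixes C1 C3 C4 C5 \<sigma>1 \<sigma>2 \<rho> :: real
  assumes "0 < C1" "0 < C3" "0 < C4" "0 < C5" "0 < \<sigma>1" "0 < \<sigma>2" "0 < \<rho>" "\<rho> < 1"
  shows "\<exists>Athr. \<forall>A0 > Athr.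
    \<forall>(M :: nat \<Rightarrow> 'a measure) (p :: nat \<Rightarrow> nat)
      (X :: nat \<Rightarrow> nat \<Rightarrow> 'a \<Rightarrow> real vec) (Y :: nat \<Rightarrow> nat \<Rightarrow> 'a \<Rightarrow> real)
      (\<xi> :: nat \<Rightarrow> real vec) (J :: nat \<Rightarrow> nat set)
      (\<beta> :: nat \<Rightarrow> real vec) (\<Omega> :: nat \<Rightarrow> real mat) (\<delta>1 :: nat \<Rightarrow> real)
      (\<beta>h :: nat \<Rightarrow> 'a \<Rightarrow> real vec) (\<Omega>J :: nat \<Rightarrow> 'a \<Rightarrow> real mat) (\<Omega>Jc :: nat \<Rightarrow> 'a \<Rightarrow> real mat).
    (\<forall>\<^sub>F n in sequentially.
       prob_space (M n) \<and> iid_copies (M n) (p n) n (X n) (Y n) \<and>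
       square_integrable_obs (M n) (p n) (X n 0) (Y n 0) \<and>
       is_regression_target (M n) (p n) (X n 0) (Y n 0) (\<beta> n) \<and>
       is_precision_matrix (M n) (p n) (X n 0) (\<Omega> n) \<and>
       \<xi> n \<in> carrier_vec (p n) \<and> \<xi> n \<noteq> 0\<^sub>v (p n) \<and>
       J n \<subseteq> {1..n} \<and> real (card (J n)) > \<rho> * real n \<and> real (card ({1..n} - J n)) > \<rho> * real n \<and>
       computed_from (M n) (p n) (X n) (Y n) {1..n} (vec_borel (p n)) (\<beta>h n)) \<longrightarrow>
    \<comment> \<open>(a)\<close>
    (\<forall>\<^sub>F n in sequentially. C3 \<le> lambda_min (\<Omega> n) \<and> lambda_max (\<Omega> n) \<le> C4) \<longrightarrow>
    \<comment> \<open>(b)\<close>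
    (\<forall>\<^sub>F n in sequentially.
       psi2_norm (M n) (\<lambda>\<omega>. Y n 0 \<omega> - X n 0 \<omega> \<bullet> \<beta> n) \<le> ennreal \<sigma>2 \<and>
       (AE \<omega> in M n. real_cond_exp (M n) (vimage_algebra (space (M n)) (X n 0) (vec_borel (p n)))
                        (\<lambda>\<omega>. (Y n 0 \<omega> - X n 0 \<omega> \<bullet> \<beta> n)\<^sup>2) \<omega> \<ge> C5)) \<longrightarrow>
    \<comment> \<open>(c)\<close>
    (\<forall>\<^sub>F n in sequentially. \<forall>j<p n. psi2_norm (M n) (\<lambda>\<omega>. (\<Omega> n *\<^sub>v X n 0 \<omega>) $ j) \<le> ennreal \<sigma>1) \<longrightarrow>
    \<comment> \<open>(d)\<close>
    \<delta>1 \<longlonglongrightarrow> 0 \<longrightarrow>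
    (\<forall>\<^sub>F n in sequentially.
       measure (M n) {\<omega> \<in> space (M n).
         l1_norm (\<beta>h n \<omega> - \<beta> n) \<le> C1 * real (l0_norm (\<beta> n)) * sqrt (ln (real (max (p n) n)) / real n) \<and>
         (1 / real n) * (\<Sum>i\<in>{1..n}. (X n i \<omega> \<bullet> \<beta>h n \<omega> - X n i \<omega> \<bullet> \<beta> n)\<^sup>2)
           \<le> C1 * real (l0_norm (\<beta> n)) * ln (real (max (p n) n)) / real n}
       \<ge> 1 - \<delta>1 n) \<longrightarrow>
    \<comment> \<open>(e)\<close>
    (\<forall>\<^sub>F n in sequentially.
       two_stage_estimator (M n) (p n) (X n) (Y n) (J n) (A0 * rate_lambda (p n) n) (\<Omega>J n) \<and>
       two_stage_estimator (M n) (p n) (X n) (Y n) ({1..n} - J n) (A0 * rate_lambda (p n) n) (\<Omega>Jc n)) \<longrightarrow>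
    \<comment> \<open>(i)\<close>
    ((\<forall>\<^sub>F n in sequentially.
        (\<forall>j<p n. psi2_norm (M n) (\<lambda>\<omega>. X n 0 \<omega> $ j) \<le> ennreal \<sigma>1) \<and>
        psi2_norm (M n) (\<lambda>\<omega>. \<xi> n \<bullet> (\<Omega> n *\<^sub>v X n 0 \<omega>)) \<le> ennreal (\<sigma>1 * l2_norm (\<Omega> n *\<^sub>v \<xi> n))) \<and>
     (\<lambda>n. Max {real (l0_norm (\<beta> n)),
               real (max_col_sparsity (\<Omega> n)) * (l1_norm (\<xi> n) / l2_norm (\<xi> n)),
               min (sqrt (real (loading_sparsity (\<Omega> n) (\<xi> n)) * real (max_col_sparsity (\<Omega> n))))
                   (real (max_col_sparsity (\<Omega> n))) * sqrt (real (l0_norm (\<beta> n)))}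
          * rate_tau (p n) n) \<in> o(\<lambda>_. 1)
     \<longrightarrow> expansion_and_consistency M p X Y J \<xi> \<beta> \<Omega> \<beta>h \<Omega>J \<Omega>Jc) \<and>
    \<comment> \<open>(ii)\<close>
    ((\<forall>\<^sub>F n in sequentially.
        1 \<le> l0_norm (\<beta> n) \<and> psi2_norm_vec (M n) (p n) (X n 0) \<le> ennreal \<sigma>1) \<and>
     (\<lambda>n. Max {real (l0_norm (\<beta> n)),
               min (sqrt (real (loading_sparsity (\<Omega> n) (\<xi> n)) * real (max_col_sparsity (\<Omega> n))))
                   (real (max_col_sparsity (\<Omega> n))) * sqrt (real (l0_norm (\<beta> n)))}
          * rate_tau (p n) n) \<in> o(\<lambda>_. 1)
     \<longrightarrow> expansion_and_consistency M p X Y J \<xi> \<beta> \<Omega> \<beta>h \<Omega>J \<Omega>Jc)"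
proof -
  \<comment> \<open>The factors 2 come from \<open>sg_of_psi2_norm\<close>. \<open>A\<close> is the
    deviation multiplier for which folds of size at least \<rho> n beat the union bound in
    \<open>exp_rate_bound\<close>.\<close>
  define K K2 A where "K = 2 * \<sigma>1" and "K2 = 2 * \<sigma>2" and "A = sqrt (96 / \<rho>)"
  have K: "0 < K" "0 < K2" and A: "0 < A" "A\<^sup>2 * \<rho> = 96"
    using assms by (auto simp: K_def K2_def A_def)
  show ?thesis
  \<comment> \<open>The threshold, depending only on \<sigma>1 and \<rho>, ensures that the Gram
    error K^2 A \<lambda> is at most half of the tuning parameter A0 \<lambda>.\<close>
  proof (intro exI[of _ "2 * (K\<^sup>2 * A)"] allI impI, goal_cases)
    case (1 A0 M p X Y \<xi> J \<beta> \<Omega> \<delta>1 \<beta>h \<Omega>J \<Omega>Jc)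
    note base = 1(2) and ha = 1(3) and hb = 1(4) and hc = 1(5) and h\<delta> = 1(6) and hd = 1(7) and he = 1(8)
    have "0 < K\<^sup>2 * A"
      using K A by simp
    then have A0: "K\<^sup>2 * A \<le> A0 / 2" "0 < A0"
      using 1(1) by linarith+
    define s0 where "s0 n = real (l0_norm (\<beta> n))" for n
    define s1 where "s1 n = real (max_col_sparsity (\<Omega> n))" for n
    define rat where "rat n = l1_norm (\<xi> n) / l2_norm (\<xi> n)" for n
    define mn where "mn n = min (sqrt (real (loading_sparsity (\<Omega> n) (\<xi> n)) * real (max_col_sparsity (\<Omega> n))))
                   (real (max_col_sparsity (\<Omega> n)))" for n
    define \<tau> where "\<tau> n = rate_tau (p n) n" for n
    define lm where "lm n = rate_lambda (p n) n" for n
    have prob: "\<forall>\<^sub>F n in sequentially. prob_space (M n)"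
      using base by (rule eventually_mono) blast
    have large: "\<forall>\<^sub>F n in sequentially. (3::nat) \<le> n"
      by (rule eventually_ge_at_top)
    have rates: "\<forall>\<^sub>F n in sequentially. 0 < lm n \<and> lm n \<le> \<tau> n"
      using large by eventually_elim (simp add: lm_def \<tau>_def rate_lambda_le_tau)
    have D: "\<forall>\<^sub>F n in sequentially. whp (M n) (\<delta>1 n) (\<lambda>\<omega>. l1_norm (\<beta>h n \<omega> - \<beta> n) \<le> C1 * s0 n * rate_lambda (p n) n \<and>
      (1 / real n) * (\<Sum>i\<in>{1..n}. (X n i \<omega> \<bullet> \<beta>h n \<omega> - X n i \<omega> \<bullet> \<beta> n)\<^sup>2) \<le> C1 * s0 n * (rate_lambda (p n) n)\<^sup>2)"
    proof -
      have "\<forall>\<^sub>F n in sequentially. \<delta>1 n < 1"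
        using h\<delta> by (intro order_tendstoD) auto
      \<comment> \<open>Once \<delta>1 is below 1 the success set in (d) has positive measure, which
        is what makes it an event.\<close>
      with hd prob large show ?thesis
      proof eventually_elim
        case (elim n)
        have "C1 * s0 n * (rate_lambda (p n) n)\<^sup>2 = C1 * real (l0_norm (\<beta> n)) * ln (real (max (p n) n)) / real n"
          using elim(3) by (simp add: rate_lambda_sq(1) s0_def)
        then show ?case
          unfolding rate_lambda_def[of "p n" n, symmetric] s0_def
          using whp_of_measure_ge[OF elim(2,1,4)] unfolding rate_lambda_def[of "p n" n, symmetric] s0_def by simp
      qed
    qed
    have model: "\<forall>\<^sub>F n in sequentially. regression_model (M n) (p n) n (X n) (Y n) (\<beta> n) (\<xi> n) (\<Omega> n) C3 C4 C5 K K2"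
      if "\<forall>\<^sub>F n in sequentially. (\<forall>j<p n. subgaussian (M n) (\<lambda>\<omega>. X n 0 \<omega> $ j) K) \<and>
        subgaussian (M n) (\<lambda>\<omega>. \<xi> n \<bullet> (\<Omega> n *\<^sub>v X n 0 \<omega>)) (K * l2_norm (\<Omega> n *\<^sub>v \<xi> n))"
      using that base ha hb hc
    proof eventually_elim
      case (elim n)
      have eps: "subgaussian (M n) (\<lambda>\<omega>. Y n 0 \<omega> - X n 0 \<omega> \<bullet> \<beta> n) K2"
        unfolding K2_def using elim(4) assms by (intro sg_of_psi2_norm) auto
      have OX: "subgaussian (M n) (\<lambda>\<omega>. (\<Omega> n *\<^sub>v X n 0 \<omega>) $ j) K" if "j < p n" for j
        unfolding K_def using elim(5) that assms by (intro sg_of_psi2_norm) auto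
      show ?case
        by (intro regression_model.intro regression_model_axioms.intro)
          (use elim eps OX assms K in auto)
    qed
    show ?case
    proof (intro conjI impI, goal_cases)
      case 1
      then have ass: "\<forall>\<^sub>F n in sequentially.
          (\<forall>j<p n. psi2_norm (M n) (\<lambda>\<omega>. X n 0 \<omega> $ j) \<le> ennreal \<sigma>1) \<and>
          psi2_norm (M n) (\<lambda>\<omega>. \<xi> n \<bullet> (\<Omega> n *\<^sub>v X n 0 \<omega>)) \<le> ennreal (\<sigma>1 * l2_norm (\<Omega> n *\<^sub>v \<xi> n))"
        and o: "(\<lambda>n. Max {s0 n, s1 n * rat n, mn n * sqrt (s0 n)} * \<tau> n) \<in> o(\<lambda>_. 1)"
        unfolding s0_def s1_def rat_def mn_def \<tau>_def by blast+
      have model: "\<forall>\<^sub>F n in sequentially. regression_model (M n) (p n) n (X n) (Y n) (\<beta> n) (\<xi> n) (\<Omega> n) C3 C4 C5 K K2"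
      proof (rule model)
        show "\<forall>\<^sub>F n in sequentially. (\<forall>j<p n. subgaussian (M n) (\<lambda>\<omega>. X n 0 \<omega> $ j) K) \<and>
          subgaussian (M n) (\<lambda>\<omega>. \<xi> n \<bullet> (\<Omega> n *\<^sub>v X n 0 \<omega>)) (K * l2_norm (\<Omega> n *\<^sub>v \<xi> n))"
          using ass base
        proof eventually_elim
          case (elim n)
          have "0 < l2_norm (\<Omega> n *\<^sub>v \<xi> n)"
            using elim(2) precision_mult_nonzero[of "M n" "p n" "X n 0" "\<Omega> n" "\<xi> n"] by (intro l2_norm_pos) auto
          then have "subgaussian (M n) (\<lambda>\<omega>. \<xi> n \<bullet> (\<Omega> n *\<^sub>v X n 0 \<omega>)) (2 * (\<sigma>1 * l2_norm (\<Omega> n *\<^sub>v \<xi> n)))"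
            using elim(1) assms by (intro sg_of_psi2_norm) auto
          then show ?case
            unfolding K_def using elim(1) assms by (auto intro!: sg_of_psi2_norm simp: mult.assoc)
        qed
      qed
      define G where "G n = Max {s0 n, s1 n * rat n, mn n * sqrt (s0 n)} * \<tau> n" for n
      have G: "G \<longlonglongrightarrow> 0"
        using smalloD_tendsto[OF o] by (simp add: G_def[abs_def])
      have facts: "\<forall>\<^sub>F n in sequentially. 1 \<le> s1 n \<and> 1 \<le> rat n \<and> 1 \<le> mn n \<and> 0 \<le> s0 n"
        using model
      proof eventually_elim
        case (elim n)
        interpret R: regression_model "M n" "p n" n "X n" "Y n" "\<beta> n" "\<xi> n" "\<Omega> n" C3 C4 C5 K K2 by fact
        have "1 \<le> rat n"
          using R.N_le_l1 R.N_pos unfolding rat_def R.N_l2[symmetric] R.l1_\<xi>[symmetric] by simp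
        then show ?case
          using R.max_col_sparsity_ge_1 R.mu_ge_1 unfolding R.mu_def by (simp add: s1_def mn_def s0_def)
      qed
      have dom: "\<forall>\<^sub>F n in sequentially. s0 n * \<tau> n \<le> G n \<and> s1 n * rat n * \<tau> n \<le> G n \<and> mn n * sqrt (s0 n) * \<tau> n \<le> G n"
        using rates
      proof eventually_elim
        case (elim n)
        then have "0 \<le> \<tau> n" by linarith
        then show ?case
          unfolding G_def by (auto intro!: mult_right_mono Max_ge)
      qed
      have e1: "(\<lambda>n. s0 n * \<tau> n) \<longlonglongrightarrow> 0"
        by (rule null_dominated[OF G, of _ 1]) (use dom rates facts in \<open>eventually_elim, auto\<close>)
      have e2: "(\<lambda>n. mn n * sqrt (s0 n) * \<tau> n) \<longlonglongrightarrow> 0"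
        by (rule null_dominated[OF G, of _ 1]) (use dom rates facts in \<open>eventually_elim, auto\<close>)
      have e3: "(\<lambda>n. s1 n * rat n * \<tau> n) \<longlonglongrightarrow> 0"
        by (rule null_dominated[OF G, of _ 1]) (use dom rates facts in \<open>eventually_elim, auto\<close>)
      \<comment> \<open>Because \<lambda> is at most \<tau>, the relative l1 error of the direction
        is dominated by the middle term of the rate condition.\<close>
      have e4: "(\<lambda>n. 96 * A0 * C4 * (lm n * s1 n) * rat n) \<longlonglongrightarrow> 0"
      proof (rule null_dominated[OF e3, of _ "96 * A0 * C4"])
        show "\<forall>\<^sub>F n in sequentially. 0 \<le> 96 * A0 * C4 * (lm n * s1 n) * rat n \<and>
          96 * A0 * C4 * (lm n * s1 n) * rat n \<le> 96 * A0 * C4 * (s1 n * rat n * \<tau> n)"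
          using rates facts
        proof eventually_elim
          case (elim n)
          have "lm n * (s1 n * rat n) \<le> \<tau> n * (s1 n * rat n)"
            using elim by (intro mult_right_mono) auto
          then have "96 * A0 * C4 * (lm n * (s1 n * rat n)) \<le> 96 * A0 * C4 * (\<tau> n * (s1 n * rat n))"
            using A0 assms by (intro mult_left_mono) auto
          then show ?case
            using elim A0 assms by (auto simp: mult_ac)
        qed
      qed
      \<comment> \<open>The first threshold keeps A \<lambda> within the Bernstein range; the second
        is 32 \<gamma> s1 \<le> \<kappa> solved for s1 \<lambda>, with \<gamma> = K^2 A \<lambda>
        and \<kappa> = 1 / (2 C4).\<close>
      have "0 < min (8 / A) (1 / (64 * C4 * K\<^sup>2 * A))"
        using A K assms by simp
      then have small: "\<forall>\<^sub>F n in sequentially. s1 n * rat n * \<tau> n < min (8 / A) (1 / (64 * C4 * K\<^sup>2 * A))"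
        using e3 by (intro order_tendstoD(2)) auto
      have r: "(\<lambda>n. 10 / real n + \<delta>1 n) \<longlonglongrightarrow> 0"
        using tendsto_add[OF lim_const_over_n[of 10] h\<delta>] by simp
      show ?case
      proof (rule expansion_and_consistency_of_rates[OF prob r e1 e2 e4])
        fix L :: real assume L: "0 < L"
        show "\<forall>\<^sub>F n in sequentially. whp (M n) (10 / real n + \<delta>1 n + 10 / L) (\<lambda>\<omega>.
          \<bar>expansion_error (M n) (p n) n (X n) (Y n) (J n) (\<xi> n) (\<beta> n) (\<Omega> n) (\<beta>h n) (\<Omega>J n) (\<Omega>Jc n) \<omega>\<bar>
            \<le> lin_rate C3 C4 C5 K K2 A A0 C1 L (s0 n * \<tau> n) (mn n * sqrt (s0 n) * \<tau> n)
              (96 * A0 * C4 * (lm n * s1 n) * rat n) * (1 / sqrt (real n)) \<and>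
          \<bar>variance_error (M n) n (X n) (Y n) (J n) (\<xi> n) (\<beta> n) (\<Omega> n) (\<beta>h n) (\<Omega>J n) (\<Omega>Jc n) \<omega>\<bar>
            \<le> var_rate C3 C4 C5 K K2 C1 L n (s0 n * \<tau> n) (96 * A0 * C4 * (lm n * s1 n) * rat n))"
          using model base he D large rates facts small
        proof eventually_elim
          case (elim n)
          interpret R: regression_model "M n" "p n" n "X n" "Y n" "\<beta> n" "\<xi> n" "\<Omega> n" C3 C4 C5 K K2 by fact
          \<comment> \<open>Both s1 and the ratio of norms are at least 1, so one smallness
            condition controls \<tau> as well as s1 \<tau>.\<close>
          have "1 \<le> s1 n * rat n" "s1 n \<le> s1 n * rat n"
            using elim(7) mult_mono[of 1 "s1 n" 1 "rat n"] by (auto simp: mult_le_cancel_left1)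
          then have "1 * \<tau> n \<le> s1 n * rat n * \<tau> n" "s1 n * \<tau> n \<le> s1 n * rat n * \<tau> n"
            using elim(6) by (intro mult_right_mono; linarith)+
          then have \<tau>: "\<tau> n < 8 / A" "s1 n * \<tau> n < 1 / (64 * C4 * K\<^sup>2 * A)"
            using elim(8) by auto
          have lam: "A * rate_lambda (p n) n \<le> 8"
          proof -
            have "lm n \<le> 8 / A"
              using \<tau>(1) elim(6) by linarith
            then show ?thesis
              using A by (simp add: lm_def field_simps)
          qed
          have sm: "32 * (K\<^sup>2 * (A * rate_lambda (p n) n)) * real (max_col_sparsity (\<Omega> n)) \<le> 1 / (2 * C4)"
          proof -
            have "s1 n * lm n \<le> s1 n * \<tau> n"
              using elim(6,7) by (intro mult_left_mono) auto
            then have "s1 n * lm n \<le> 1 / (64 * C4 * K\<^sup>2 * A)"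
              using \<tau>(2) by linarith
            then have "32 * K\<^sup>2 * A * (s1 n * lm n) \<le> 32 * K\<^sup>2 * A * (1 / (64 * C4 * K\<^sup>2 * A))"
              using A K by (intro mult_left_mono) auto
            also have "\<dots> = 1 / (2 * C4)"
              using A K assms by (simp add: field_simps)
            finally show ?thesis
              by (simp add: s1_def lm_def mult_ac)
          qed
          have Jn: "J n \<subseteq> {1..n}" "\<rho> * real n < real (card (J n))" "\<rho> * real n < real (card ({1..n} - J n))"
            and comp: "computed_from (M n) (p n) (X n) (Y n) {1..n} (vec_borel (p n)) (\<beta>h n)"
            using elim(2) by blast+
          have lpos: "0 < rate_lambda (p n) n"
            using elim(6) by (simp add: lm_def)
          have s0: "0 \<le> s0 n"
            by (simp add: s0_def)
          have n: "0 < n"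
            using elim(5) by simp
          show ?case
            unfolding \<tau>_def lm_def s1_def rat_def mn_def R.mu_def[symmetric]
            by (rule R.final_bound_max_norm[OF n Jn assms(7) A A0(1) lpos lam conjunct1[OF elim(3)]
                  conjunct2[OF elim(3)] comp sm elim(4) L assms(1) s0])
        qed
      qed
    next
      case 2
      then have ass: "\<forall>\<^sub>F n in sequentially. 1 \<le> l0_norm (\<beta> n) \<and> psi2_norm_vec (M n) (p n) (X n 0) \<le> ennreal \<sigma>1"
        and o: "(\<lambda>n. Max {s0 n, mn n * sqrt (s0 n)} * \<tau> n) \<in> o(\<lambda>_. 1)"
        unfolding s0_def mn_def \<tau>_def by blast+
      have model: "\<forall>\<^sub>F n in sequentially. regression_model (M n) (p n) n (X n) (Y n) (\<beta> n) (\<xi> n) (\<Omega> n) C3 C4 C5 K K2"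
      proof (rule model)
        show "\<forall>\<^sub>F n in sequentially. (\<forall>j<p n. subgaussian (M n) (\<lambda>\<omega>. X n 0 \<omega> $ j) K) \<and>
          subgaussian (M n) (\<lambda>\<omega>. \<xi> n \<bullet> (\<Omega> n *\<^sub>v X n 0 \<omega>)) (K * l2_norm (\<Omega> n *\<^sub>v \<xi> n))"
          using ass base
        proof eventually_elim
          case (elim n)
          show ?case
            unfolding K_def using elim assms
              subgaussian_vec_consequences[of "M n" "p n" "X n" \<sigma>1 n "Y n" "\<Omega> n" "\<xi> n"] by auto
        qed
      qed
      define G where "G n = Max {s0 n, mn n * sqrt (s0 n)} * \<tau> n" for n
      have G: "G \<longlonglongrightarrow> 0"
        using smalloD_tendsto[OF o] by (simp add: G_def[abs_def])
      have facts: "\<forall>\<^sub>F n in sequentially. 1 \<le> s1 n \<and> sqrt (s1 n) \<le> mn n \<and> 1 \<le> mn n \<and> 1 \<le> s0 n"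
        using model ass
      proof eventually_elim
        case (elim n)
        interpret R: regression_model "M n" "p n" n "X n" "Y n" "\<beta> n" "\<xi> n" "\<Omega> n" C3 C4 C5 K K2 by fact
        show ?case
          using elim(2) R.max_col_sparsity_ge_1 R.mu_ge_1 R.mu_ge unfolding R.mu_def by (simp add: s1_def mn_def s0_def)
      qed
      have dom: "\<forall>\<^sub>F n in sequentially. s0 n * \<tau> n \<le> G n \<and> mn n * sqrt (s0 n) * \<tau> n \<le> G n"
        using rates
      proof eventually_elim
        case (elim n)
        then have "0 \<le> \<tau> n" by linarith
        then show ?case
          unfolding G_def by (auto intro!: mult_right_mono Max_ge)
      qed
      have e1: "(\<lambda>n. s0 n * \<tau> n) \<longlonglongrightarrow> 0"
        by (rule null_dominated[OF G, of _ 1]) (use dom rates facts in \<open>eventually_elim, auto\<close>)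
      have e2: "(\<lambda>n. mn n * sqrt (s0 n) * \<tau> n) \<longlonglongrightarrow> 0"
        by (rule null_dominated[OF G, of _ 1]) (use dom rates facts in \<open>eventually_elim, auto\<close>)
      \<comment> \<open>With s0 at least 1, the rate condition bounds \<lambda> and \<mu> \<lambda>
        themselves; for s0 = 0 it would say nothing about the sparsity of \<Omega>.\<close>
      have lm_le: "\<forall>\<^sub>F n in sequentially. lm n \<le> s0 n * \<tau> n \<and> lm n * mn n \<le> mn n * sqrt (s0 n) * \<tau> n"
        using rates facts
      proof eventually_elim
        case (elim n)
        have "1 * \<tau> n \<le> s0 n * \<tau> n" "mn n * 1 * \<tau> n \<le> mn n * sqrt (s0 n) * \<tau> n" "mn n * lm n \<le> mn n * \<tau> n"
          using elim by (auto intro!: mult_right_mono mult_left_mono)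
        then show ?case
          using elim(1) unfolding mult_1 mult_1_right mult.commute[of "lm n"] by linarith
      qed
      have e4: "(\<lambda>n. 96 * A0 * C4 * lm n * mn n) \<longlonglongrightarrow> 0"
      proof (rule null_dominated[OF e2, of _ "96 * A0 * C4"])
        show "\<forall>\<^sub>F n in sequentially. 0 \<le> 96 * A0 * C4 * lm n * mn n \<and>
          96 * A0 * C4 * lm n * mn n \<le> 96 * A0 * C4 * (mn n * sqrt (s0 n) * \<tau> n)"
          using rates facts lm_le
        proof eventually_elim
          case (elim n)
          have "96 * A0 * C4 * (lm n * mn n) \<le> 96 * A0 * C4 * (mn n * sqrt (s0 n) * \<tau> n)"
            using A0 assms elim by (intro mult_left_mono) auto
          then show ?case
            using elim A0 assms by (auto simp: mult_ac)
        qed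
      qed
      \<comment> \<open>The relative deviation allowed on lattice sums: K^2 t must not exceed half
        of the least population curvature 1 / C4, and t must stay in the Bernstein range.\<close>
      define t where "t = min 8 (1 / (2 * C4 * K\<^sup>2))"
      have t: "0 < t" "t \<le> 8" "K\<^sup>2 * t \<le> 1 / (2 * C4)"
      proof -
        show "0 < t" "t \<le> 8"
          using K assms by (auto simp: t_def)
        have "K\<^sup>2 * t \<le> K\<^sup>2 * (1 / (2 * C4 * K\<^sup>2))"
          unfolding t_def by (intro mult_left_mono) auto
        then show "K\<^sup>2 * t \<le> 1 / (2 * C4)"
          using K by simp
      qed
      define c' where "c' = \<rho> * t\<^sup>2 / 128"
      have c': "0 < c'"
        using assms t by (simp add: c'_def)
      \<comment> \<open>This solves 32 \<gamma> s1 = \<kappa> for s1 \<lambda>^2, where \<gamma> =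
        (1 / C3 + K^2) * 2 \<lambda>^2 / c' and \<kappa> = 1 / (2 C4).\<close>
      define d where "d = c' / (128 * C4 * (1 / C3 + K\<^sup>2))"
      have CK: "0 < 1 / C3 + K\<^sup>2"
        using assms K by (auto intro!: add_pos_pos)
      then have d: "0 < d"
        using c' assms by (simp add: d_def)
      have sq1: "(\<lambda>n. (s0 n * \<tau> n)\<^sup>2) \<longlonglongrightarrow> 0" and sq2: "(\<lambda>n. (mn n * sqrt (s0 n) * \<tau> n)\<^sup>2) \<longlonglongrightarrow> 0"
        using tendsto_power[OF e1, of 2] tendsto_power[OF e2, of 2] by simp_all
      \<comment> \<open>The three bounds serve the Bernstein range of A \<lambda>, the two
        conditions on \<lambda>^2 that make the lattice union bound work, and the sparsity condition
        through \<open>d\<close>.\<close>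
      have small: "\<forall>\<^sub>F n in sequentially. s0 n * \<tau> n < 8 / A \<and> (s0 n * \<tau> n)\<^sup>2 < min (\<rho> / 128) (c' / 4)
          \<and> (mn n * sqrt (s0 n) * \<tau> n)\<^sup>2 < d"
        using A assms c' d
        by (intro eventually_conj order_tendstoD(2)[OF e1] order_tendstoD(2)[OF sq1] order_tendstoD(2)[OF sq2]) auto
      have r: "(\<lambda>n. 6 / real n + 2 * (2 * exp (- (\<rho> * t\<^sup>2 / 64) * real n) + 2 * exp (- (\<rho> / 64) * real n)) + \<delta>1 n) \<longlonglongrightarrow> 0"
      proof -
        have "(\<lambda>n. 6 / real n + 2 * (2 * exp (- (\<rho> * t\<^sup>2 / 64) * real n) + 2 * exp (- (\<rho> / 64) * real n)) + \<delta>1 n)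
            \<longlonglongrightarrow> 0 + 2 * (2 * 0 + 2 * 0) + 0"
          using assms t by (intro tendsto_intros lim_const_over_n exp_neg_linear_tendsto h\<delta>) auto
        then show ?thesis by simp
      qed
      show ?case
      proof (rule expansion_and_consistency_of_rates[OF prob r e1 e2 e4])
        fix L :: real assume L: "0 < L"
        show "\<forall>\<^sub>F n in sequentially. whp (M n) (6 / real n + 2 * (2 * exp (- (\<rho> * t\<^sup>2 / 64) * real n) + 2 * exp (- (\<rho> / 64) * real n))
            + \<delta>1 n + 10 / L) (\<lambda>\<omega>.
          \<bar>expansion_error (M n) (p n) n (X n) (Y n) (J n) (\<xi> n) (\<beta> n) (\<Omega> n) (\<beta>h n) (\<Omega>J n) (\<Omega>Jc n) \<omega>\<bar>
            \<le> lin_rate C3 C4 C5 K K2 A A0 C1 L (s0 n * \<tau> n) (mn n * sqrt (s0 n) * \<tau> n)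
              (96 * A0 * C4 * lm n * mn n) * (1 / sqrt (real n)) \<and>
          \<bar>variance_error (M n) n (X n) (Y n) (J n) (\<xi> n) (\<beta> n) (\<Omega> n) (\<beta>h n) (\<Omega>J n) (\<Omega>Jc n) \<omega>\<bar>
            \<le> var_rate C3 C4 C5 K K2 C1 L n (s0 n * \<tau> n) (96 * A0 * C4 * lm n * mn n))"
          using model base he D large rates facts small lm_le ass
        proof eventually_elim
          case (elim n)
          interpret R: regression_model "M n" "p n" n "X n" "Y n" "\<beta> n" "\<xi> n" "\<Omega> n" C3 C4 C5 K K2 by fact
          have lam: "A * rate_lambda (p n) n \<le> 8"
          proof -
            have "lm n \<le> 8 / A"
              using elim(8,9) by linarith
            then show ?thesis
              using A by (simp add: lm_def field_simps)
          qed
          have l2: "(lm n)\<^sup>2 \<le> (s0 n * \<tau> n)\<^sup>2"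
            using elim(6,9) by (intro power_mono) auto
          \<comment> \<open>Here sqrt s1 \<le> \<mu> is used: the square of the second term of the
            rate condition dominates s1 \<lambda>^2.\<close>
          have "(lm n)\<^sup>2 * s1 n \<le> (mn n * sqrt (s0 n) * \<tau> n)\<^sup>2"
          proof -
            have "sqrt (s1 n) * lm n \<le> mn n * lm n"
              using elim(6,7) by (intro mult_right_mono) auto
            then have "sqrt (s1 n) * lm n \<le> mn n * sqrt (s0 n) * \<tau> n"
              using elim(9) by (simp add: mult.commute)
            then have "(sqrt (s1 n) * lm n)\<^sup>2 \<le> (mn n * sqrt (s0 n) * \<tau> n)\<^sup>2"
              using elim(6,7) by (intro power_mono) auto
            then show ?thesis
              using elim(7) by (simp add: power_mult_distrib mult.commute)
          qed
          then have "(lm n)\<^sup>2 * s1 n \<le> d"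
            using elim(8) by linarith
          then have "64 * (1 / C3 + K\<^sup>2) / c' * ((lm n)\<^sup>2 * s1 n) \<le> 64 * (1 / C3 + K\<^sup>2) / c' * d"
            using c' CK by (intro mult_left_mono divide_nonneg_pos) auto
          also have "\<dots> = 1 / (2 * C4)"
          proof -
            have "64 * q / c' * (c' / (128 * C4 * q)) = 1 / (2 * C4)" if "0 < q" for q
              using that c' assms by simp
            then show ?thesis
              unfolding d_def using CK by blast
          qed
          finally have "64 * (1 / C3 + K\<^sup>2) / c' * ((lm n)\<^sup>2 * s1 n) \<le> 1 / (2 * C4)" .
          have sm: "32 * ((1 / C3 + K\<^sup>2) * (2 * (rate_lambda (p n) n)\<^sup>2 / c')) * real (max_col_sparsity (\<Omega> n)) \<le> 1 / (2 * C4)"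
          proof -
            have "32 * (q * (2 * x / c')) * y = 64 * q / c' * (x * y)" for q x y
              by simp
            then show ?thesis
              using \<open>64 * (1 / C3 + K\<^sup>2) / c' * ((lm n)\<^sup>2 * s1 n) \<le> 1 / (2 * C4)\<close>
              unfolding lm_def s1_def by (simp only:)
          qed
          have subgaussian: "subgaussian R.law (\<lambda>z. lin_form (p n) u (fst z)) (K * sqrt (sq_sum (p n) u))" if "0 < sq_sum (p n) u" for u
            using R.subgaussian_lin[OF _ that] elim(10) by (simp add: K_def)
          have Jn: "J n \<subseteq> {1..n}" "\<rho> * real n < real (card (J n))" "\<rho> * real n < real (card ({1..n} - J n))"
            and comp: "computed_from (M n) (p n) (X n) (Y n) {1..n} (vec_borel (p n)) (\<beta>h n)"
            using elim(2) by blast+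
          have lpos: "0 < rate_lambda (p n) n"
            using elim(6) by (simp add: lm_def)
          have s0: "0 \<le> s0 n"
            by (simp add: s0_def)
          have n: "2 \<le> n"
            using elim(5) by simp
          have l2': "(rate_lambda (p n) n)\<^sup>2 \<le> \<rho> / 128" "(rate_lambda (p n) n)\<^sup>2 \<le> c' / 4"
            using l2 elim(8) unfolding lm_def by linarith+
          show ?case
            unfolding \<tau>_def lm_def mn_def R.mu_def[symmetric]
            by (rule R.final_bound_subgaussian[OF subgaussian n Jn assms(7) A A0(1) lpos lam conjunct1[OF elim(3)]
                  conjunct2[OF elim(3)] comp t c'_def l2' sm elim(4) L assms(1) s0])
        qed
      qed
    qed
  qed
qed

end
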